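(* There exists a deterministic, combinatorial, polynomial-time algorithm that achieves an approximation ratio of $6-\frac{2}{m}$ for the flow-level coflow scheduling problem in identical parallel networks with (arbitrary) release times, where $m$ is the number of network cores.
   Context: Identical parallel network: $m$ identical network cores, each an $N\times N$ non-blocking switch; the $i$-th input port of every core is connected to source server $i\in\mathcal{I}=\{1,\dots,N\}$ and the $j$-th output port of every core to destination server $j\in\mathcal{J}=\{1,\dots,N\}$. All links have unit capacity, so on each core, at any time, each input port and each output port transmits data of at most one flow, at rate at most 1; transmission may be preempted. A set $\mathcal{K}$ of $n$ coflows is given; coflow $k$ has a demand matrix $D^{(k)}=(d_{i,j,k})_{i,j=1}^N$ of nonnegative integers, where $d_{i,j,k}$ is the size (equivalently, transmission time) of flow $(i,j,k)$ from source $i$ to destination $j$, a release time $r_k\ge 0$ before which none of its flows may be transmitted, and a positive weight $w_k$. The completion time $C_k$ of coflow $k$ is the time at which the last of its flows finishes. In the flow-level scheduling problem, each flow must be transmitted entirely on a single core, but different flows of the same coflow may use different cores. The objective is to minimize $\sum_{k\in\mathcal{K}} w_k C_k$. An algorithm has approximation ratio $\rho$ if on every instance its schedule has objective at most $\rho$ times the optimum. *)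

theory Defs
  imports
    "HOL-Analysis.Analysis"
    "HOL-Computational_Algebra.Polynomial"
    "HOL-Library.Log_Nat"
begin

section \<open>Flow-level coflow scheduling in identical parallel networks\<close>

text \<open>
  Cores, ports and coflows are numbered from 0. Release times and weights are rational, so that an
  instance is a finite object which can be handed to an algorithm.
\<close>

record coflow_instance =
  cores :: nat
  ports :: nat
  coflows :: nat
  demand :: "nat \<Rightarrow> nat \<Rightarrow> nat \<Rightarrow> nat"
  release :: "nat \<Rightarrow> rat"
  weight :: "nat \<Rightarrow> rat"

definition valid_instance :: "coflow_instance \<Rightarrow> bool" where
  "valid_instance I \<longleftrightarrow> cores I \<ge> 1 \<and> ports I \<ge> 1 \<and>
     (\<forall>k<coflows I. release I k \<ge> 0 \<and> weight I k > 0)"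

type_synonym flow = "nat \<times> nat \<times> nat"  \<comment> \<open>(source, destination, coflow)\<close>

fun source :: "flow \<Rightarrow> nat" where "source (i, j, k) = i"
fun destination :: "flow \<Rightarrow> nat" where "destination (i, j, k) = j"
fun coflow_of :: "flow \<Rightarrow> nat" where "coflow_of (i, j, k) = k"

definition flows :: "coflow_instance \<Rightarrow> flow set" where
  "flows I = {..<ports I} \<times> {..<ports I} \<times> {..<coflows I}"

definition flow_size :: "coflow_instance \<Rightarrow> flow \<Rightarrow> real" where
  "flow_size I f = real (demand I (source f) (destination f) (coflow_of f))"

definition flow_release :: "coflow_instance \<Rightarrow> flow \<Rightarrow> real" where
  "flow_release I f = real_of_rat (release I (coflow_of f))"

text \<open>
  A schedule gives, for each core and flow, the transmission rate as a function of time.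
\<close>

type_synonym schedule = "nat \<Rightarrow> flow \<Rightarrow> real \<Rightarrow> real"

definition transmitted :: "coflow_instance \<Rightarrow> schedule \<Rightarrow> flow \<Rightarrow> real \<Rightarrow> real" where
  "transmitted I x f T = (\<Sum>h<cores I. integral {0..T} (x h f))"

definition feasible :: "coflow_instance \<Rightarrow> schedule \<Rightarrow> bool" where
  "feasible I x \<longleftrightarrow>
     (\<forall>h<cores I. \<forall>f\<in>flows I.
        (\<forall>t. 0 \<le> x h f t \<and> x h f t \<le> 1) \<and>
        (\<forall>t<flow_release I f. x h f t = 0) \<and>
        (\<forall>T. x h f integrable_on {0..T})) \<and>
     (\<forall>h<cores I. \<forall>t. \<forall>f\<in>flows I. \<forall>g\<in>flows I.
        x h f t > 0 \<and> x h g t > 0 \<and> (source f = source g \<or> destination f = destination g)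
        \<longrightarrow> f = g) \<and>
     (\<forall>f\<in>flows I. \<exists>h<cores I. \<forall>h'<cores I. h' \<noteq> h \<longrightarrow> (\<forall>t. x h' f t = 0)) \<and>
     (\<forall>f\<in>flows I. (\<forall>T. transmitted I x f T \<le> flow_size I f) \<and>
        (\<exists>T. transmitted I x f T = flow_size I f))"

text \<open>
  The bound by the release time only matters for flows of size 0, which count as finished as soon
  as they are released; a coflow without any data is thus completed at its release time.
\<close>

definition flow_finish :: "coflow_instance \<Rightarrow> schedule \<Rightarrow> flow \<Rightarrow> real" where
  "flow_finish I x f = Inf {T. flow_release I f \<le> T \<and> transmitted I x f T = flow_size I f}"

definition completion_time :: "coflow_instance \<Rightarrow> schedule \<Rightarrow> nat \<Rightarrow> real" where
  "completion_time I x k = Max (flow_finish I x ` {f \<in> flows I. coflow_of f = k})"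

definition objective :: "coflow_instance \<Rightarrow> schedule \<Rightarrow> real" where
  "objective I x = (\<Sum>k<coflows I. real_of_rat (weight I k) * completion_time I x k)"

definition optimum :: "coflow_instance \<Rightarrow> real" where
  "optimum I = Inf (objective I ` {x. feasible I x})"


section \<open>Random access machines with logarithmic cost\<close>

text \<open>
  The deterministic RAM in structured form: memory cells holding natural numbers of
  arbitrary size with indirect addressing, a read-only input tape, a write-only output tape. Every
  operation is charged the bit lengths of the addresses and values it handles, so that
  polynomial time coincides with polynomial time on Turing machines. Subtraction is truncated;
  a condition holds iff its value is nonzero.
\<close>

datatype aexp =
    Const nat
  | Cell aexp  \<comment> \<open>content of the cell with the given address\<close>
  | Plus aexp aexp
  | Minus aexp aexp
  | Times aexp aexp
  | Quot aexp aexp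

datatype com =
    Skip
  | Assign aexp aexp  \<comment> \<open>address of the target cell, value\<close>
  | Read aexp
  | Write aexp
  | Seq com com
  | Cond aexp com com
  | While aexp com

type_synonym memory = "nat \<Rightarrow> nat"

type_synonym config = "memory \<times> nat list \<times> nat list"  \<comment> \<open>memory, remaining input, output so far\<close>

definition bits :: "nat \<Rightarrow> nat" where
  "bits v = max 1 (floorlog 2 v)"

fun aval :: "memory \<Rightarrow> aexp \<Rightarrow> nat" where
  "aval s (Const c) = c"
| "aval s (Cell a) = s (aval s a)"
| "aval s (Plus a b) = aval s a + aval s b"
| "aval s (Minus a b) = aval s a - aval s b"
| "aval s (Times a b) = aval s a * aval s b"
| "aval s (Quot a b) = aval s a div aval s b"

fun acost :: "memory \<Rightarrow> aexp \<Rightarrow> nat" where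
  "acost s (Const c) = bits c"
| "acost s (Cell a) = acost s a + bits (aval s a) + bits (s (aval s a))"
| "acost s (Plus a b) = acost s a + acost s b + bits (aval s a) + bits (aval s b)"
| "acost s (Minus a b) = acost s a + acost s b + bits (aval s a) + bits (aval s b)"
| "acost s (Times a b) = acost s a + acost s b + bits (aval s a) + bits (aval s b)"
| "acost s (Quot a b) = acost s a + acost s b + bits (aval s a) + bits (aval s b)"

text \<open>\<open>exec c \<sigma> t \<tau>\<close>: started in \<open>\<sigma>\<close>, the program \<open>c\<close> halts in \<open>\<tau>\<close> with total cost \<open>t\<close>.\<close>

inductive exec :: "com \<Rightarrow> config \<Rightarrow> nat \<Rightarrow> config \<Rightarrow> bool" where
  Skip: "exec Skip \<sigma> 1 \<sigma>"
| Assign: "exec (Assign a e) (s, inp, out)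
     (acost s a + acost s e + bits (aval s a) + bits (aval s e))
     (s(aval s a := aval s e), inp, out)"
| Read: "exec (Read a) (s, v # inp, out)
     (acost s a + bits (aval s a) + bits v) (s(aval s a := v), inp, out)"
| Write: "exec (Write e) (s, inp, out)
     (acost s e + bits (aval s e)) (s, inp, out @ [aval s e])"
| Seq: "exec c \<sigma> t \<sigma>' \<Longrightarrow> exec d \<sigma>' u \<tau> \<Longrightarrow> exec (Seq c d) \<sigma> (t + u) \<tau>"
| CondTrue: "aval s b \<noteq> 0 \<Longrightarrow> exec c (s, inp, out) t \<tau> \<Longrightarrow>
     exec (Cond b c d) (s, inp, out) (acost s b + bits (aval s b) + t) \<tau>"
| CondFalse: "aval s b = 0 \<Longrightarrow> exec d (s, inp, out) t \<tau> \<Longrightarrow>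
     exec (Cond b c d) (s, inp, out) (acost s b + bits (aval s b) + t) \<tau>"
| WhileFalse: "aval s b = 0 \<Longrightarrow>
     exec (While b c) (s, inp, out) (acost s b + bits (aval s b)) (s, inp, out)"
| WhileTrue: "aval s b \<noteq> 0 \<Longrightarrow> exec c (s, inp, out) t \<sigma>' \<Longrightarrow> exec (While b c) \<sigma>' u \<tau> \<Longrightarrow>
     exec (While b c) (s, inp, out) (acost s b + bits (aval s b) + t + u) \<tau>"

inductive_cases exec_SkipE: "exec Skip \<sigma> t \<tau>"
inductive_cases exec_AssignE: "exec (Assign a e) \<sigma> t \<tau>"
inductive_cases exec_ReadE: "exec (Read a) \<sigma> t \<tau>"
inductive_cases exec_WriteE: "exec (Write e) \<sigma> t \<tau>"
inductive_cases exec_SeqE: "exec (Seq c d) \<sigma> t \<tau>"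
inductive_cases exec_CondE: "exec (Cond b c d) \<sigma> t \<tau>"
inductive_cases exec_WhileE: "exec (While b c) \<sigma> t \<tau>"

lemma exec_deterministic:
  "exec c \<sigma> t \<tau> \<Longrightarrow> exec c \<sigma> t' \<tau>' \<Longrightarrow> t = t' \<and> \<tau> = \<tau>'"
proof (induction arbitrary: t' \<tau>' rule: exec.induct)
  case Skip
  then show ?case by - (erule exec_SkipE, simp_all)
next
  case Assign
  then show ?case by - (erule exec_AssignE, simp_all)
next
  case Read
  then show ?case by - (erule exec_ReadE, simp_all)
next
  case Write
  then show ?case by - (erule exec_WriteE, simp_all)
next
  case (Seq c \<sigma> t \<sigma>' d u \<tau>)
  from Seq.prems obtain t2 \<sigma>2 u2 where
    t': "t' = t2 + u2" and c: "exec c \<sigma> t2 \<sigma>2" and d: "exec d \<sigma>2 u2 \<tau>'"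
    by (rule exec_SeqE)
  have 1: "t = t2 \<and> \<sigma>' = \<sigma>2" by (rule Seq.IH(1)[OF c])
  with d have "exec d \<sigma>' u2 \<tau>'" by simp
  then have "u = u2 \<and> \<tau> = \<tau>'" by (rule Seq.IH(2))
  with 1 t' show ?case by simp
next
  case (CondTrue s b c inp out t \<tau> d)
  from CondTrue.prems CondTrue.hyps obtain t2 where
    t': "t' = acost s b + bits (aval s b) + t2" and c: "exec c (s, inp, out) t2 \<tau>'"
    by - (erule exec_CondE, simp_all)
  from CondTrue.IH[OF c] t' show ?case by simp
next
  case (CondFalse s b d inp out t \<tau> c)
  from CondFalse.prems CondFalse.hyps obtain t2 where
    t': "t' = acost s b + bits (aval s b) + t2" and d: "exec d (s, inp, out) t2 \<tau>'"
    by - (erule exec_CondE, simp_all)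
  from CondFalse.IH[OF d] t' show ?case by simp
next
  case (WhileFalse s b c inp out)
  from WhileFalse.prems show ?case
    by (rule exec_WhileE) (use WhileFalse.hyps in simp_all)
next
  case (WhileTrue s b c inp out t \<sigma>' u \<tau>)
  from WhileTrue.prems WhileTrue.hyps obtain t2 \<sigma>2 u2 where
    t': "t' = acost s b + bits (aval s b) + t2 + u2" and
    c: "exec c (s, inp, out) t2 \<sigma>2" and w: "exec (While b c) \<sigma>2 u2 \<tau>'"
    by - (erule exec_WhileE, simp_all)
  have 1: "t = t2 \<and> \<sigma>' = \<sigma>2" by (rule WhileTrue.IH(1)[OF c])
  with w have "exec (While b c) \<sigma>' u2 \<tau>'" by simp
  then have "u = u2 \<and> \<tau> = \<tau>'" by (rule WhileTrue.IH(2))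
  with 1 t' show ?case by simp
qed


section \<open>Approximation algorithms for the scheduling problem\<close>

definition encode_rat :: "rat \<Rightarrow> nat list" where
  "encode_rat q = (case quotient_of q of (a, b) \<Rightarrow> [nat a, nat b])"

definition encode_coflow :: "coflow_instance \<Rightarrow> nat \<Rightarrow> nat list" where
  "encode_coflow I k =
     [demand I i j k. i \<leftarrow> [0..<ports I], j \<leftarrow> [0..<ports I]]
     @ encode_rat (release I k) @ encode_rat (weight I k)"

definition encode_instance :: "coflow_instance \<Rightarrow> nat list" where
  "encode_instance I =
     [cores I, ports I, coflows I] @ concat (map (encode_coflow I) [0..<coflows I])"

definition input_size :: "coflow_instance \<Rightarrow> nat" where
  "input_size I = sum_list (map bits (encode_instance I))"

text \<open>
  The output lists periods of transmission, each given by the core, the flow, and the start and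
  end times as fractions. During such a period the flow is transmitted at full rate.
\<close>

type_synonym period = "nat \<times> flow \<times> real \<times> real"

fun decode_periods :: "nat list \<Rightarrow> period list" where
  "decode_periods (h # i # j # k # a # b # c # d # xs) =
     (h, (i, j, k), real a / real b, real c / real d) # decode_periods xs"
| "decode_periods _ = []"

definition schedule_of :: "period list \<Rightarrow> schedule" where
  "schedule_of ps h f t = of_bool (\<exists>a b. (h, f, a, b) \<in> set ps \<and> a \<le> t \<and> t < b)"

definition start :: "coflow_instance \<Rightarrow> config" where
  "start I = (\<lambda>_. 0, encode_instance I, [])"

definition polynomial_time :: "com \<Rightarrow> bool" where
  "polynomial_time c \<longleftrightarrow> (\<exists>p :: nat poly. \<forall>I. valid_instance I \<longrightarrow>
     (\<exists>t \<tau>. exec c (start I) t \<tau> \<and> t \<le> poly p (input_size I)))"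

definition computes_schedule :: "com \<Rightarrow> coflow_instance \<Rightarrow> schedule \<Rightarrow> bool" where
  "computes_schedule c I x \<longleftrightarrow>
     (\<exists>t s inp out. exec c (start I) t (s, inp, out) \<and> x = schedule_of (decode_periods out))"

definition has_approximation_ratio :: "com \<Rightarrow> (coflow_instance \<Rightarrow> real) \<Rightarrow> bool" where
  "has_approximation_ratio c \<rho> \<longleftrightarrow> (\<forall>I. valid_instance I \<longrightarrow>
     (\<exists>x. computes_schedule c I x \<and> feasible I x \<and> objective I x \<le> \<rho> I * optimum I))"

end

theory Submission
  imports Defs
begin

text \<open>
  After clearing denominators all release times, sizes and weights are integers. Two lower bounds on
  the completion times of a feasible schedule are used: the coflows completed by time \<open>t\<close> load each
  port by at most \<open>m * t\<close>, and a flow needs its size after its release.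

  For \<open>m \<ge> 2\<close> the coflows are ordered by a local ratio argument, which loses a factor 2 against the
  first bound. Every flow in turn is assigned to the core on which its two ports are least loaded and
  transmitted there as early as possible. It waits at most for the load of both ports, so the ratio
  is \<open>1 + 2 * 2 = 5 \<le> 6 - 2 / m\<close>.

  For \<open>m = 1\<close> the ratio 4 is needed. A linear program relaxes the first bound to fractional completion
  on a geometric time grid. It is solved approximately by a drift-plus-penalty iteration; the
  data sent in each grid interval form a bipartite multigraph of bounded degree, and an edge
  colouring with alternating chains turns it into matchings that are transmitted one after another.

  Both algorithms are written in a small array language, whose programs are compiled to
  the random access machine with a polynomial bound on the cost.
\<close>

section \<open>A structured array language on the random access machine\<close>

text \<open>The guarantee is strictest for one core, where it equals 4. List scheduling pays 1 for
  release plus size and twice 2 for the two ports, hence 5. The linear relaxation is not handed to a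
  solver: the drift iteration runs for a fixed number of rounds on natural numbers of bounded size,
  so its cost can be read off its loops. The constants fit together as follows. The iteration leaves
  a relative violation of 1/10, so a port may carry 11/10 of the grid time. A grid interval lasts
  only 1/10 of its starting time, so it can serve a share 1/11 of that load, and 1/12 once every
  flow is rounded up to whole slots. A coflow therefore has to collect twelve units of fractional
  completion, which puts its finish 12 grid points after the mean of its chosen points, and one more
  for rounding. Rounding to the grid and the optimality gap cost 11/10 + 1/20 = 23/20, and
  (11/10)^13 * 23/20 < 4. A further obstacle is that the number of cores is given in binary and may
  be exponential in the input length, so list scheduling must not loop over all of them.\<close>

text \<open>
  A store maps an array name, a row and a column to a number. Scalars live in position (0, 0).
\<close>

type_synonym store = "nat => nat => nat => nat"

datatype ex =
    Cn nat
  | Arr nat ex ex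
  | Add ex ex  (infixl ".+" 65)
  | Sub ex ex  (infixl ".-" 65)
  | Mul ex ex  (infixl ".*" 70)
  | Div ex ex  (infixl "\<oslash>" 70)

abbreviation V :: "nat => ex" where "V r == Arr r (Cn 0) (Cn 0)"

text \<open>Loops are counted, so every program terminates and its cost can be bounded by recursion
  on the syntax. \<open>Len\<close> is a primitive because its number of rounds is the binary length
  of a value and not a scalar known beforehand.\<close>

datatype pr =
    Skp
  | Put nat ex ex ex  \<comment> \<open>array, row, column, value\<close>
  | Sq pr pr  (infixr ";;" 60)
  | Test ex pr pr
  | Loop nat nat pr  \<comment> \<open>counter, scalar holding the number of rounds, body\<close>
  | Len nat nat ex  \<comment> \<open>target, scratch scalar, number whose binary length is computed\<close>

abbreviation Let_be :: "nat => ex => pr"  (infix ":=:" 61) where "r :=: e == Put r (Cn 0) (Cn 0) e"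

primrec ev :: "store => ex => nat" where
  "ev S (Cn c) = c"
| "ev S (Arr r a b) = S r (ev S a) (ev S b)"
| "ev S (a .+ b) = ev S a + ev S b"
| "ev S (a .- b) = ev S a - ev S b"
| "ev S (a .* b) = ev S a * ev S b"
| "ev S (a \<oslash> b) = ev S a div ev S b"

definition upd :: "store => nat => nat => nat => nat => store" where
  "upd S r i j x = (%r' i' j'. if r' = r & i' = i & j' = j then x else S r' i' j')"

lemma upd_apply: "upd S r i j x r' i' j' = (if r' = r & i' = i & j' = j then x else S r' i' j')"
  by (simp add: upd_def)

lemma upd_other [simp]: "r' ~= r ==> upd S r i j x r' = S r'"
  by (simp add: upd_def)

lemma upd_same [simp]: "upd S r i j x r i' j' = (if i' = i & j' = j then x else S r i' j')"
  by (simp add: upd_def)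

text \<open>The number of rounds is read once, before the body runs. \<open>Len\<close> resets its
  scratch scalar because the compiled halving loop leaves it at 0.\<close>

primrec sem :: "pr => store => store" where
  "sem Skp = (%S. S)"
| "sem (Put r i j e) = (%S. upd S r (ev S i) (ev S j) (ev S e))"
| "sem (p ;; q) = (%S. sem q (sem p S))"
| "sem (Test c p q) = (%S. if ev S c ~= 0 then sem p S else sem q S)"
| "sem (Loop v l p) = (%S. ((%S. let S' = sem p S in upd S' v 0 0 (S' v 0 0 + 1)) ^^ S l 0 0) (upd S v 0 0 0))"
| "sem (Len r t e) = (%S. upd (upd S t 0 0 0) r 0 0 (floorlog 2 (ev S e)))"

primrec mods :: "pr => nat set" where
  "mods Skp = {}"
| "mods (Put r i j e) = {r}"
| "mods (p ;; q) = mods p \<union> mods q"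
| "mods (Test c p q) = mods p \<union> mods q"
| "mods (Loop v l p) = insert v (mods p)"
| "mods (Len r t e) = {r, t}"

lemma sem_frame: "r ~: mods p ==> sem p S r = S r"
proof (induction p arbitrary: S)
  case (Loop v l p)
  have "((%S. let S' = sem p S in upd S' v 0 0 (S' v 0 0 + 1)) ^^ i) (upd S v 0 0 0) r = S r" for i
    using Loop by (induction i) (simp_all add: Let_def)
  then show ?case by simp
qed (simp_all add: upd_def)

definition loop_state :: "nat => pr => store => nat => store" where
  "loop_state v p S i = ((%S. let S' = sem p S in upd S' v 0 0 (S' v 0 0 + 1)) ^^ i) (upd S v 0 0 0)"

lemma loop_state_0: "loop_state v p S 0 = upd S v 0 0 0"
  by (simp add: loop_state_def)

lemma loop_state_Suc:
  "loop_state v p S (Suc i) =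
     (let S' = sem p (loop_state v p S i) in upd S' v 0 0 (S' v 0 0 + 1))"
  by (simp add: loop_state_def)

lemma sem_Loop: "sem (Loop v l p) S = loop_state v p S (S l 0 0)"
  by (simp add: loop_state_def)

lemma loop_state_counter: "v ~: mods p ==> loop_state v p S i v 0 0 = i"
  by (induction i) (simp_all add: loop_state_0 loop_state_Suc Let_def sem_frame)

lemma loop_state_frame: "r ~= v ==> r ~: mods p ==> loop_state v p S i r = S r"
  by (induction i) (simp_all add: loop_state_0 loop_state_Suc Let_def sem_frame)

text \<open>Array \<open>r\<close> occupies the addresses congruent to \<open>r\<close> modulo this
  number. It only has to exceed every array name of the programs, the largest of which is
  327.\<close>

definition names :: nat where "names = 400"

primrec wfe :: "ex => bool" where
  "wfe (Cn c) = True"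
| "wfe (Arr r a b) = (r < names & wfe a & wfe b)"
| "wfe (a .+ b) = (wfe a & wfe b)"
| "wfe (a .- b) = (wfe a & wfe b)"
| "wfe (a .* b) = (wfe a & wfe b)"
| "wfe (a \<oslash> b) = (wfe a & wfe b)"

text \<open>The conditions on \<open>Loop\<close> keep counter and bound out of reach of the body.
  Hence the compiled loop, which evaluates \<open>l - v\<close> before each round, makes exactly the
  rounds that the semantics fixes at entry.\<close>

primrec wfp :: "pr => bool" where
  "wfp Skp = True"
| "wfp (Put r i j e) = (r < names & wfe i & wfe j & wfe e)"
| "wfp (p ;; q) = (wfp p & wfp q)"
| "wfp (Test c p q) = (wfe c & wfp p & wfp q)"
| "wfp (Loop v l p) = (v < names & l < names & v ~= l & v ~: mods p & l ~: mods p & wfp p)"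
| "wfp (Len r t e) = (r < names & t < names & r ~= t & wfe e)"

subsection \<open>Weakest preconditions with bounded values and loops\<close>

text \<open>\<open>M\<close> bounds every stored value and \<open>Lim\<close> every number of
  rounds. Counters are stored too, whence \<open>Lim <= M\<close>.\<close>

locale ram =
  fixes M Lim :: nat
  assumes Lim_le_M: "Lim <= M" and Lim_pos: "1 <= Lim"
begin

text \<open>Only stored values are bounded. Intermediate values of an expression may exceed
  \<open>M\<close>, but its fixed syntax keeps their bit length within a constant multiple of that
  of \<open>M\<close>.\<close>

primrec safe :: "pr => store => bool" where
  "safe Skp = (%S. True)"
| "safe (Put r i j e) = (%S. ev S e <= M)"
| "safe (p ;; q) = (%S. safe p S & safe q (sem p S))"
| "safe (Test c p q) = (%S. if ev S c ~= 0 then safe p S else safe q S)"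
| "safe (Loop v l p) = (%S. S l 0 0 <= Lim & (ALL i<S l 0 0. safe p (loop_state v p S i)))"
| "safe (Len r t e) = (%S. ev S e <= M & floorlog 2 (ev S e) <= Lim)"

text \<open>Safety and correctness are proved in one pass, since the bounds on stored values usually
  follow from what these values mean.\<close>

definition wp :: "pr => (store => bool) => store => bool" where
  "wp p Q S \<longleftrightarrow> safe p S & Q (sem p S)"

lemma wp_Skp [simp]: "wp Skp Q S = Q S"
  by (simp add: wp_def)

lemma wp_Put [simp]: "wp (Put r i j e) Q S \<longleftrightarrow> ev S e <= M & Q (upd S r (ev S i) (ev S j) (ev S e))"
  by (simp add: wp_def)

lemma wp_Sq [simp]: "wp (p ;; q) Q S \<longleftrightarrow> wp p (wp q Q) S"
  by (auto simp: wp_def)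

lemma wp_Test [simp]: "wp (Test c p q) Q S \<longleftrightarrow> (if ev S c ~= 0 then wp p Q S else wp q Q S)"
  by (simp add: wp_def)

lemma wp_Len [simp]: "wp (Len r t e) Q S \<longleftrightarrow> ev S e <= M & floorlog 2 (ev S e) <= Lim &
   Q (upd (upd S t 0 0 0) r 0 0 (floorlog 2 (ev S e)))"
  by (simp add: wp_def)

text \<open>The frame is handed to the consequence step, so a postcondition only has to mention what
  the program changes.\<close>

lemma wp_mono:
  assumes "wp p Q S" and "!!S'. Q S' ==> (!!r. r ~: mods p ==> S' r = S r) ==> Q' S'"
  shows "wp p Q' S"
  using assms sem_frame by (auto simp: wp_def)

text \<open>The invariant need not speak of the counter or of untouched arrays: the rule supplies
  both, relative to the store before the loop, in the step and at the end.\<close>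

lemma wp_Loop:
  assumes wf: "v ~= l" "v ~: mods p" "l ~: mods p"
    and lim: "S l 0 0 <= Lim"
    and init: "I 0 (upd S v 0 0 0)"
    and step: "!!i S'. i < S l 0 0 ==> I i S' ==> S' v 0 0 = i ==>
       (!!r. r ~= v ==> r ~: mods p ==> S' r = S r) ==>
       wp p (%S''. I (Suc i) (upd S'' v 0 0 (Suc i))) S'"
    and final: "!!S'. I (S l 0 0) S' ==> S' v 0 0 = S l 0 0 ==>
       (!!r. r ~= v ==> r ~: mods p ==> S' r = S r) ==> Q S'"
  shows "wp (Loop v l p) Q S"
proof -
  have *: "i <= S l 0 0 ==> I i (loop_state v p S i)" for i
  proof (induction i)
    case 0
    then show ?case using init by (simp add: loop_state_0)
  next
    case (Suc i)
    then have "wp p (%S''. I (Suc i) (upd S'' v 0 0 (Suc i))) (loop_state v p S i)"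
      by (intro step) (use wf in \<open>auto simp: loop_state_counter loop_state_frame\<close>)
    then show ?case
      using wf by (simp add: loop_state_Suc wp_def Let_def sem_frame loop_state_counter)
  qed
  have "safe p (loop_state v p S i)" if "i < S l 0 0" for i
    using step[OF that *, OF less_imp_le[OF that]] wf
    by (auto simp: loop_state_counter loop_state_frame wp_def)
  moreover have "Q (loop_state v p S (S l 0 0))"
    by (rule final) (use * wf in \<open>auto simp: loop_state_counter loop_state_frame\<close>)
  ultimately show ?thesis
    using lim unfolding wp_def sem_Loop by simp
qed

end

section \<open>Expressions unaffected by an update, and summation loops\<close>

primrec reads :: "ex => nat set" where
  "reads (Cn c) = {}"
| "reads (Arr r a b) = insert r (reads a \<union> reads b)"
| "reads (a .+ b) = reads a \<union> reads b"
| "reads (a .- b) = reads a \<union> reads b"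
| "reads (a .* b) = reads a \<union> reads b"
| "reads (a \<oslash> b) = reads a \<union> reads b"

lemma ev_cong: "(!!r. r \<in> reads e ==> S r = S' r) ==> ev S e = ev S' e"
  by (induction e) auto

definition SumTo :: "nat => nat => nat => ex => pr" where
  "SumTo a v l e = (a :=: Cn 0 ;; Loop v l (a :=: V a .+ e))"

lemma mods_SumTo [simp]: "mods (SumTo a v l e) = {a, v}"
  by (auto simp: SumTo_def)

lemma wfp_SumTo [simp]: "wfp (SumTo a v l e) \<longleftrightarrow>
   a < names & v < names & l < names & v ~= l & v ~= a & l ~= a & wfe e"
  by (auto simp: SumTo_def)

text \<open>The store after each round is known exactly, so the invariant is an equation of stores.
  A bound on the full sum suffices, because partial sums of natural numbers are smaller.\<close>

lemma (in ram) wp_SumTo: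
  assumes "v ~= l" "v ~= a" "l ~= a" "a ~: reads e"
    and lim: "S l 0 0 <= Lim"
    and bd: "(\<Sum>i<S l 0 0. ev (upd S v 0 0 i) e) <= M"
    and Q: "Q (upd (upd S v 0 0 (S l 0 0)) a 0 0 (\<Sum>i<S l 0 0. ev (upd S v 0 0 i) e))"
  shows "wp (SumTo a v l e) Q S"
proof -
  let ?f = "%i. ev (upd S v 0 0 i) e"
  show ?thesis
    unfolding SumTo_def wp_Sq wp_Put
  proof (simp only: ev.simps, rule conjI, simp, rule wp_Loop[where I = "%i S'. S' = upd (upd S v 0 0 i) a 0 0 (\<Sum>j<i. ?f j)"])
    fix i S'
    assume i: "i < upd S a 0 0 0 l 0 0" and S': "S' = upd (upd S v 0 0 i) a 0 0 (\<Sum>j<i. ?f j)"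
    have e: "ev S' e = ?f i"
      using assms(4) by (intro ev_cong ext) (auto simp: S' upd_def)
    have "(\<Sum>j<i. ?f j) + ?f i = (\<Sum>j<Suc i. ?f j)" by simp
    also have "... <= (\<Sum>j<S l 0 0. ?f j)"
      using i assms by (intro sum_mono2) auto
    also note bd
    finally show "wp (a :=: V a .+ e) (%S''. upd S'' v 0 0 (Suc i) = upd (upd S v 0 0 (Suc i)) a 0 0 (\<Sum>j<Suc i. ?f j)) S'"
      using assms(1-3) by (auto simp: e) (auto simp: S' fun_eq_iff upd_def)
  next
    show "upd (upd S a 0 0 0) v 0 0 0 = upd (upd S v 0 0 0) a 0 0 (\<Sum>j<0. ?f j)"
      by (auto simp: fun_eq_iff upd_def)
  qed (use assms in auto)
qed

subsection \<open>Compilation\<close>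

text \<open>The map \<open>(i, j) \<mapsto> (i + j)\<^sup>2 + i\<close> is injective, as \<open>i \<le> i + j\<close>.\<close>

definition cell_pair :: "nat => nat => nat" where
  "cell_pair i j = (i + j) * (i + j) + i"

lemma cell_pair_inj: "cell_pair i j = cell_pair i' j' \<longleftrightarrow> i = i' & j = j'"
proof
  assume eq: "cell_pair i j = cell_pair i' j'"
  have lt: "cell_pair a b < cell_pair c d" if "a + b < c + d" for a b c d
  proof -
    have "cell_pair a b < (a + b + 1) * (a + b + 1)"
      by (simp add: cell_pair_def algebra_simps)
    also have "... <= (c + d) * (c + d)"
      using that by (intro mult_mono) auto
    also have "... <= cell_pair c d"
      by (simp add: cell_pair_def)
    finally show ?thesis .
  qed
  have "i + j = i' + j'"
    using lt[of i j i' j'] lt[of i' j' i j] eq by (metis less_irrefl linorder_neqE_nat)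
  then show "i = i' & j = j'"
    using eq by (auto simp: cell_pair_def)
qed auto

definition uncell :: "nat => nat \<times> nat" where
  "uncell q = (SOME ij. q = cell_pair (fst ij) (snd ij))"

lemma uncell_cell_pair: "uncell (cell_pair i j) = (i, j)"
  unfolding uncell_def by (rule some_equality) (auto simp: cell_pair_inj)

text \<open>Addresses outside the image of the pairing hold 0. Thus the all-zero store is encoded by
  the all-zero memory in which the machine starts.\<close>

definition enc :: "store => memory" where
  "enc S a = (if EX i j. a div names = cell_pair i j
     then S (a mod names) (fst (uncell (a div names))) (snd (uncell (a div names))) else 0)"

lemma enc_cell: "r < names ==> enc S (r + names * cell_pair i j) = S r i j"
  by (auto simp: enc_def uncell_cell_pair)

text \<open>Reduction modulo \<open>names\<close> recovers the array and division by it the pair of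
  indices, so distinct cells never collide.\<close>

lemma enc_upd: "r < names ==> (enc S)(r + names * cell_pair i j := x) = enc (upd S r i j x)"
proof
  fix a
  assume r: "r < names"
  show "((enc S)(r + names * cell_pair i j := x)) a = enc (upd S r i j x) a"
  proof (cases "EX i' j'. a div names = cell_pair i' j'")
    case True
    then obtain i' j' where q: "a div names = cell_pair i' j'" by blast
    have "a = a mod names + names * cell_pair i' j'" using q by (metis mod_mult_div_eq)
    moreover define r' where "r' = a mod names"
    ultimately have a: "a = r' + names * cell_pair i' j'" and r': "r' < names"
      by (simp_all add: names_def)
    have "r + names * cell_pair i j = r' + names * cell_pair i' j' \<longleftrightarrow> r = r' & i = i' & j = j'"
    proof
      assume "r + names * cell_pair i j = r' + names * cell_pair i' j'"
      then have "(r + names * cell_pair i j) mod names = (r' + names * cell_pair i' j') mod names"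
        and "(r + names * cell_pair i j) div names = (r' + names * cell_pair i' j') div names" by simp_all
      then show "r = r' & i = i' & j = j'"
        using r r' by (simp add: cell_pair_inj)
    qed simp
    then show ?thesis
      using r r' by (auto simp: a enc_cell upd_apply)
  next
    case False
    have "a ~= r + names * cell_pair i j"
    proof
      assume "a = r + names * cell_pair i j"
      then have "a div names = cell_pair i j" using r by simp
      with False show False by blast
    qed
    with False show ?thesis by (simp add: enc_def)
  qed
qed

lemma enc_zero: "enc (%_ _ _. 0) = (%_. 0)"
  by (simp add: enc_def fun_eq_iff)

definition addr :: "nat => aexp => aexp => aexp" where
  "addr r a b = Plus (Const r) (Times (Const names) (Plus (Times (Plus a b) (Plus a b)) a))"

primrec cex :: "ex => aexp" where
  "cex (Cn c) = Const c"
| "cex (Arr r a b) = Cell (addr r (cex a) (cex b))"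
| "cex (a .+ b) = Plus (cex a) (cex b)"
| "cex (a .- b) = Minus (cex a) (cex b)"
| "cex (a .* b) = Times (cex a) (cex b)"
| "cex (a \<oslash> b) = Quot (cex a) (cex b)"

lemma aval_addr: "aval s (addr r a b) = r + names * cell_pair (aval s a) (aval s b)"
  by (simp add: addr_def cell_pair_def)

lemma aval_cex: "wfe e ==> aval (enc S) (cex e) = ev S e"
  by (induction e) (simp_all add: aval_addr enc_cell)

abbreviation scalar_addr :: "nat => aexp" where
  "scalar_addr r == addr r (Const 0) (Const 0)"

primrec comp :: "pr => com" where
  "comp Skp = Skip"
| "comp (Put r i j e) = Assign (addr r (cex i) (cex j)) (cex e)"
| "comp (p ;; q) = Seq (comp p) (comp q)"
| "comp (Test c p q) = Cond (cex c) (comp p) (comp q)"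
| "comp (Loop v l p) = Seq (Assign (scalar_addr v) (Const 0))
     (While (cex (V l .- V v)) (Seq (comp p) (Assign (scalar_addr v) (cex (V v .+ Cn 1)))))"
| "comp (Len r t e) = Seq (Assign (scalar_addr t) (cex e)) (Seq (Assign (scalar_addr r) (Const 0))
     (While (cex (V t)) (Seq (Assign (scalar_addr t) (cex (V t \<oslash> Cn 2)))
       (Assign (scalar_addr r) (cex (V r .+ Cn 1))))))"

section \<open>Bit lengths of values and costs of expressions\<close>

lemma bits_pos: "1 <= bits v"
  by (simp add: bits_def)

lemma bits_le_iff: "1 <= b ==> bits v <= b \<longleftrightarrow> v < 2 ^ b"
  by (auto simp: bits_def floorlog_le_iff)

lemma less_two_power_bits: "v < 2 ^ bits v"
  using bits_le_iff[OF bits_pos, of v v] by simp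

lemma bits_mono: "u <= v ==> bits u <= bits v"
  using less_two_power_bits[of v] by (simp add: bits_le_iff[OF bits_pos])

text \<open>The additive bound, weaker than a maximum plus one, lets sums be treated like products.
  It rests on \<open>a + b <= a * b\<close> for numbers that are at least 2.\<close>

lemma bits_add: "bits (u + v) <= bits u + bits v"
proof -
  have "u + v + 1 <= 2 ^ bits u * 2 ^ bits v"
  proof -
    have "(u + 1) + (v + 1) <= 2 ^ bits u + 2 ^ bits v"
      using less_two_power_bits[of u] less_two_power_bits[of v] by simp
    also have "... <= 2 ^ bits u * 2 ^ bits v"
    proof -
      have "a + b <= a * b" if "2 <= a" "2 <= b" for a b :: nat
        using that by (metis add.commute add_mono_thms_linordered_semiring(1) le_trans mult.commute mult_2 mult_le_mono1 nat_le_linear)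
      moreover have "(2::nat) <= 2 ^ bits u" "(2::nat) <= 2 ^ bits v"
        using power_increasing[OF bits_pos, of "2::nat"] by (metis one_le_numeral power_one_right)+
      ultimately show ?thesis by blast
    qed
    finally show ?thesis by simp
  qed
  then show ?thesis
    using bits_pos[of u] by (subst bits_le_iff) (auto simp: power_add)
qed

lemma bits_mult: "bits (u * v) <= bits u + bits v"
proof -
  have "u * v < 2 ^ bits u * 2 ^ bits v"
    using less_two_power_bits[of u] less_two_power_bits[of v] by (intro mult_strict_mono) auto
  then show ?thesis
    using bits_pos[of u] by (subst bits_le_iff) (auto simp: power_add)
qed

text \<open>The factor by which the bit length of a value can exceed that of the largest memory
  entry. A cell returns such an entry, hence 1; products add bit lengths; differences and quotients
  are at most their first operand.\<close>

primrec vfac :: "aexp => nat" where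
  "vfac (Const c) = bits c"
| "vfac (Cell a) = 1"
| "vfac (Plus a b) = vfac a + vfac b"
| "vfac (Minus a b) = vfac a + vfac b"
| "vfac (Times a b) = vfac a + vfac b"
| "vfac (Quot a b) = vfac a + vfac b"

primrec cfac :: "aexp => nat" where
  "cfac (Const c) = bits c"
| "cfac (Cell a) = cfac a + vfac a + 1"
| "cfac (Plus a b) = cfac a + cfac b + vfac a + vfac b"
| "cfac (Minus a b) = cfac a + cfac b + vfac a + vfac b"
| "cfac (Times a b) = cfac a + cfac b + vfac a + vfac b"
| "cfac (Quot a b) = cfac a + cfac b + vfac a + vfac b"

lemma bits_aval:
  assumes "!!a. s a <= M"
  shows "bits (aval s e) <= vfac e * bits M"
proof (induction e)
  case (Const c)
  then show ?case using bits_pos[of M] by simp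
next
  case (Cell a)
  then show ?case using assms bits_mono by simp
next
  case (Plus a b)
  then show ?case using bits_add[of "aval s a" "aval s b"] by (simp add: algebra_simps)
next
  case (Minus a b)
  then show ?case using bits_mono[of "aval s a - aval s b" "aval s a"] by (simp add: algebra_simps)
next
  case (Times a b)
  then show ?case using bits_mult[of "aval s a" "aval s b"] by (simp add: algebra_simps)
next
  case (Quot a b)
  then show ?case using bits_mono[of "aval s a div aval s b" "aval s a"] by (simp add: algebra_simps)
qed

lemma acost_le:
  assumes "!!a. s a <= M"
  shows "acost s e <= cfac e * bits M"
proof (induction e)
  case (Const c)
  then show ?case using bits_pos[of M] by simp
next
  case (Cell a)
  then show ?case
    using bits_aval[of s M a, OF assms] bits_mono[OF assms, of "aval s a"] by (simp add: algebra_simps)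
next
  case (Plus a b)
  then show ?case
    using bits_aval[of s M a, OF assms] bits_aval[of s M b, OF assms] by (simp add: algebra_simps)
next
  case (Minus a b)
  then show ?case
    using bits_aval[of s M a, OF assms] bits_aval[of s M b, OF assms] by (simp add: algebra_simps)
next
  case (Times a b)
  then show ?case
    using bits_aval[of s M a, OF assms] bits_aval[of s M b, OF assms] by (simp add: algebra_simps)
next
  case (Quot a b)
  then show ?case
    using bits_aval[of s M a, OF assms] bits_aval[of s M b, OF assms] by (simp add: algebra_simps)
qed

definition fac :: "aexp => nat" where "fac e = cfac e + vfac e"

lemma acost_bits_le:
  assumes "!!a. s a <= M"
  shows "acost s e + bits (aval s e) <= fac e * bits M"
  using acost_le[of s M e, OF assms] bits_aval[of s M e, OF assms] by (simp add: fac_def algebra_simps)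

lemma exec_Assign:
  assumes "!!a. s a <= M"
  obtains t where "exec (Assign a e) (s, inp, out) t (s(aval s a := aval s e), inp, out)"
    "t <= (fac a + fac e) * bits M"
proof -
  have "acost s a + acost s e + bits (aval s a) + bits (aval s e) <= (fac a + fac e) * bits M"
    using acost_bits_le[of s M a, OF assms] acost_bits_le[of s M e, OF assms] by (simp add: algebra_simps)
  with exec.Assign[of a e s inp out] show ?thesis by (rule that)
qed

text \<open>The running time in units of the bit length of \<open>M\<close>, as a polynomial in the loop bound.\<close>

primrec time_poly :: "pr => nat poly" where
  "time_poly Skp = [:1:]"
| "time_poly (Put r i j e) = [:fac (addr r (cex i) (cex j)) + fac (cex e):]"
| "time_poly (p ;; q) = time_poly p + time_poly q"
| "time_poly (Test c p q) = [:fac (cex c):] + time_poly p + time_poly q"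
| "time_poly (Loop v l p) = [:fac (scalar_addr v) + fac (Const 0) + fac (cex (V l .- V v)):] +
     [:0, 1:] * ([:fac (cex (V l .- V v)) + (fac (scalar_addr v) + fac (cex (V v .+ Cn 1))):] + time_poly p)"
| "time_poly (Len r t e) = [:fac (scalar_addr t) + fac (cex e) + (fac (scalar_addr r) + fac (Const 0))
      + fac (cex (V t)):] +
     [:0, 1:] * [:fac (cex (V t)) + (fac (scalar_addr t) + fac (cex (V t \<oslash> Cn 2)))
       + (fac (scalar_addr r) + fac (cex (V r .+ Cn 1))):]"

definition bounded_store :: "nat => store => bool" where
  "bounded_store M S \<longleftrightarrow> (ALL r i j. S r i j <= M)"

lemma bounded_storeD: "bounded_store M S ==> enc S a <= M"
  by (simp add: bounded_store_def enc_def)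

lemma bounded_store_upd: "bounded_store M S ==> x <= M ==> bounded_store M (upd S r i j x)"
  by (auto simp: bounded_store_def upd_def)

lemma exec_Put:
  assumes "bounded_store M S" "wfp (Put r i j e)" "ev S e <= M"
  obtains t where "exec (Assign (addr r (cex i) (cex j)) (cex e)) (enc S, inp, out) t
      (enc (upd S r (ev S i) (ev S j) (ev S e)), inp, out)"
    "t <= (fac (addr r (cex i) (cex j)) + fac (cex e)) * bits M"
    "bounded_store M (upd S r (ev S i) (ev S j) (ev S e))"
  by (rule exec_Assign[of "enc S" M "addr r (cex i) (cex j)" "cex e" inp out])
    (use assms in \<open>auto simp: bounded_storeD aval_addr aval_cex enc_upd bounded_store_upd\<close>)

lemma exec_set:
  assumes "bounded_store M S" "r < names" "wfe e" "ev S e <= M"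
  obtains t where "exec (Assign (scalar_addr r) (cex e)) (enc S, inp, out) t (enc (upd S r 0 0 (ev S e)), inp, out)"
    "t <= (fac (scalar_addr r) + fac (cex e)) * bits M" "bounded_store M (upd S r 0 0 (ev S e))"
  by (rule exec_Put[of M S r "Cn 0" "Cn 0" e inp out]) (use assms in auto)

text \<open>All stores \<open>f i\<close> at the head of the loop are known beforehand. The
  induction is on the number of remaining rounds, since the big-step rules unroll a loop from its
  first round.\<close>

lemma exec_while_rounds:
  assumes test: "wfe c"
    and bd: "!!i. i <= k ==> bounded_store M (f i)"
    and true: "!!i. i < k ==> ev (f i) c ~= 0" and false: "ev (f k) c = 0"
    and body: "!!i. i < k ==> EX t. exec p (enc (f i), inp, out) t (enc (f (Suc i)), inp, out) & t <= T"
  shows "EX t. exec (While (cex c) p) (enc (f 0), inp, out) t (enc (f k), inp, out) &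
     t <= fac (cex c) * bits M + k * (fac (cex c) * bits M + T)"
proof -
  have "EX t. exec (While (cex c) p) (enc (f (k - d)), inp, out) t (enc (f k), inp, out) &
     t <= fac (cex c) * bits M + d * (fac (cex c) * bits M + T)" if "d <= k" for d
    using that
  proof (induction d)
    case 0
    have "acost (enc (f k)) (cex c) + bits (aval (enc (f k)) (cex c)) <= fac (cex c) * bits M"
      using bd by (intro acost_bits_le) (auto intro: bounded_storeD)
    then show ?case
      using exec.WhileFalse[of "enc (f k)" "cex c" p inp out] false test by (auto simp: aval_cex)
  next
    case (Suc d)
    define i where "i = k - Suc d"
    have i: "i < k" "k - d = Suc i" using Suc.prems by (auto simp: i_def)
    obtain t where t: "exec p (enc (f i), inp, out) t (enc (f (Suc i)), inp, out)" "t <= T"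
      using body i by blast
    obtain u where u: "exec (While (cex c) p) (enc (f (Suc i)), inp, out) u (enc (f k), inp, out)"
       "u <= fac (cex c) * bits M + d * (fac (cex c) * bits M + T)"
      using Suc i by auto
    have w: "acost (enc (f i)) (cex c) + bits (aval (enc (f i)) (cex c)) <= fac (cex c) * bits M"
      using bd i by (intro acost_bits_le) (auto intro: bounded_storeD)
    have "exec (While (cex c) p) (enc (f i), inp, out)
       (acost (enc (f i)) (cex c) + bits (aval (enc (f i)) (cex c)) + t + u) (enc (f k), inp, out)"
      using true[OF i(1)] test by (intro exec.WhileTrue[OF _ t(1) u(1)]) (simp add: aval_cex)
    moreover have "acost (enc (f i)) (cex c) + bits (aval (enc (f i)) (cex c)) + t + u
      <= fac (cex c) * bits M + Suc d * (fac (cex c) * bits M + T)"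
      using w t(2) u(2) by (simp add: algebra_simps)
    ultimately show ?case unfolding i_def by blast
  qed
  from this[of k] show ?thesis by simp
qed

text \<open>Safety keeps every store along the way bounded by \<open>M\<close>, so each evaluation
  costs a constant times \<open>bits M\<close>. A loop multiplies the cost of its body by at most
  \<open>Lim\<close>; boundedness of the result is part of the claim so that the induction can pass
  it on.\<close>

lemma (in ram) comp_exec:
  assumes "wfp p" "safe p S" "bounded_store M S"
  shows "(EX t. exec (comp p) (enc S, inp, out) t (enc (sem p S), inp, out) &
     t <= poly (time_poly p) Lim * bits M) & bounded_store M (sem p S)"
  using assms
proof (induction p arbitrary: S)
  case Skp
  have "exec Skip (enc S, inp, out) 1 (enc S, inp, out)" by (rule exec.Skip)
  then show ?case using bits_pos[of M] Skp by (auto intro!: exI[of _ 1])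
next
  case (Put r i j e)
  then obtain t where "exec (Assign (addr r (cex i) (cex j)) (cex e)) (enc S, inp, out) t
      (enc (upd S r (ev S i) (ev S j) (ev S e)), inp, out)"
    "t <= (fac (addr r (cex i) (cex j)) + fac (cex e)) * bits M"
    "bounded_store M (upd S r (ev S i) (ev S j) (ev S e))"
    using exec_Put[of M S r i j e inp out] by auto
  then show ?case by auto
next
  case (Sq p q)
  obtain t where t: "exec (comp p) (enc S, inp, out) t (enc (sem p S), inp, out)"
     "t <= poly (time_poly p) Lim * bits M" and b: "bounded_store M (sem p S)"
    using Sq.IH(1)[of S] Sq.prems by auto
  obtain u where u: "exec (comp q) (enc (sem p S), inp, out) u (enc (sem q (sem p S)), inp, out)"
     "u <= poly (time_poly q) Lim * bits M" and b': "bounded_store M (sem q (sem p S))"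
    using Sq.IH(2)[of "sem p S"] Sq.prems b by auto
  show ?case
    using exec.Seq[OF t(1) u(1)] t(2) u(2) b' by (auto simp: algebra_simps intro!: exI[of _ "t + u"])
next
  case (Test c p q)
  have w: "acost (enc S) (cex c) + bits (aval (enc S) (cex c)) <= fac (cex c) * bits M"
    using Test.prems by (intro acost_bits_le) (auto intro: bounded_storeD)
  show ?case
  proof (cases "ev S c = 0")
    case False
    obtain t where t: "exec (comp p) (enc S, inp, out) t (enc (sem p S), inp, out)"
      "t <= poly (time_poly p) Lim * bits M" and b: "bounded_store M (sem p S)"
      using Test.IH(1)[of S] Test.prems False by auto
    have "exec (Cond (cex c) (comp p) (comp q)) (enc S, inp, out)
      (acost (enc S) (cex c) + bits (aval (enc S) (cex c)) + t) (enc (sem p S), inp, out)"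
      using False Test.prems by (intro exec.CondTrue[OF _ t(1)]) (simp add: aval_cex)
    then show ?thesis
      using w t(2) b False
      by (auto simp: algebra_simps intro!: exI[of _ "acost (enc S) (cex c) + bits (aval (enc S) (cex c)) + t"])
  next
    case True
    obtain t where t: "exec (comp q) (enc S, inp, out) t (enc (sem q S), inp, out)"
      "t <= poly (time_poly q) Lim * bits M" and b: "bounded_store M (sem q S)"
      using Test.IH(2)[of S] Test.prems True by auto
    have "exec (Cond (cex c) (comp p) (comp q)) (enc S, inp, out)
      (acost (enc S) (cex c) + bits (aval (enc S) (cex c)) + t) (enc (sem q S), inp, out)"
      using True Test.prems by (intro exec.CondFalse[OF _ t(1)]) (simp add: aval_cex)
    then show ?thesis
      using w t(2) b True
      by (auto simp: algebra_simps intro!: exI[of _ "acost (enc S) (cex c) + bits (aval (enc S) (cex c)) + t"])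
  qed
next
  case (Loop v l p)
  let ?k = "S l 0 0" and ?f = "loop_state v p S" and ?c = "V l .- V v"
  have k: "?k <= Lim" and sp: "!!i. i < ?k ==> safe p (?f i)"
    and wf: "v ~= l" "v ~: mods p" "l ~: mods p" "wfp p" "v < names" "l < names"
    using Loop.prems by auto
  obtain t0 where t0: "exec (Assign (scalar_addr v) (cex (Cn 0))) (enc S, inp, out) t0 (enc (?f 0), inp, out)"
    "t0 <= (fac (scalar_addr v) + fac (cex (Cn 0))) * bits M" and b0: "bounded_store M (?f 0)"
    using exec_set[of M S v "Cn 0" inp out] wf Loop.prems by (auto simp: loop_state_0)
  have bd: "bounded_store M (?f i)" if "i <= ?k" for i
    using that
  proof (induction i)
    case (Suc i)
    then have "bounded_store M (sem p (?f i))" using Loop.IH[of "?f i"] sp wf by auto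
    then show ?case
      using Suc.prems k Lim_le_M wf
      by (auto simp: loop_state_Suc Let_def sem_frame loop_state_counter intro!: bounded_store_upd)
  qed (rule b0)
  define T where "T = poly (time_poly p) Lim * bits M + (fac (scalar_addr v) + fac (cex (V v .+ Cn 1))) * bits M"
  have body: "EX t. exec (Seq (comp p) (Assign (scalar_addr v) (cex (V v .+ Cn 1)))) (enc (?f i), inp, out) t
      (enc (?f (Suc i)), inp, out) & t <= T" if i: "i < ?k" for i
  proof -
    obtain t where t: "exec (comp p) (enc (?f i), inp, out) t (enc (sem p (?f i)), inp, out)"
      "t <= poly (time_poly p) Lim * bits M" and b: "bounded_store M (sem p (?f i))"
      using Loop.IH[of "?f i"] sp wf bd i by auto
    have v: "sem p (?f i) v 0 0 = i" using wf by (simp add: sem_frame loop_state_counter)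
    obtain u where u: "exec (Assign (scalar_addr v) (cex (V v .+ Cn 1))) (enc (sem p (?f i)), inp, out) u
        (enc (?f (Suc i)), inp, out)" "u <= (fac (scalar_addr v) + fac (cex (V v .+ Cn 1))) * bits M"
      using exec_set[OF b wf(5), of "V v .+ Cn 1" inp out] v i k Lim_le_M wf
      by (auto simp: loop_state_Suc Let_def)
    show ?thesis
      using exec.Seq[OF t(1) u(1)] t(2) u(2) unfolding T_def by (meson add_mono)
  qed
  have fr: "?f i l = S l" "?f i v 0 0 = i" for i
    using wf by (auto simp: loop_state_frame loop_state_counter)
  obtain t1 where t1: "exec (While (cex ?c) (Seq (comp p) (Assign (scalar_addr v) (cex (V v .+ Cn 1)))))
      (enc (?f 0), inp, out) t1 (enc (?f ?k), inp, out)"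
    "t1 <= fac (cex ?c) * bits M + ?k * (fac (cex ?c) * bits M + T)"
    using exec_while_rounds[where f = ?f and k = ?k and c = ?c and M = M and T = T and inp = inp and out = out, OF _ bd _ _ body]
      wf by (auto simp: fr)
  have "t0 + t1 <= (fac (scalar_addr v) + fac (Const 0)) * bits M + (fac (cex ?c) * bits M + Lim * (fac (cex ?c) * bits M + T))"
    using t0(2) t1(2) k by (intro add_mono order_trans[OF t1(2)] mult_mono) auto
  also have "... = poly (time_poly (Loop v l p)) Lim * bits M"
    by (simp add: T_def algebra_simps)
  finally show ?case
    using exec.Seq[OF t0(1) t1(1)] bd[of ?k]
    by (intro conjI exI[of _ "t0 + t1"]) (simp_all only: sem_Loop comp.simps cex.simps order_refl)
next
  case (Len r t e)
  let ?x = "ev S e"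
  have wf: "r ~= t" "r < names" "t < names" "wfe e" and x: "?x <= M" and k: "floorlog 2 ?x <= Lim"
    using Len.prems by auto
  \<comment> \<open>The store after \<open>i\<close> halvings. The value \<open>?x div 2 ^ i\<close>
    becomes 0 exactly when \<open>i\<close> reaches \<open>floorlog 2 ?x\<close>.\<close>
  define f where "f i = upd (upd S t 0 0 (?x div 2 ^ i)) r 0 0 i" for i
  obtain t0 where t0: "exec (Assign (scalar_addr t) (cex e)) (enc S, inp, out) t0 (enc (upd S t 0 0 ?x), inp, out)"
    "t0 <= (fac (scalar_addr t) + fac (cex e)) * bits M" and b0: "bounded_store M (upd S t 0 0 ?x)"
    using exec_set[of M S t e inp out] wf Len.prems by auto
  obtain t1 where t1: "exec (Assign (scalar_addr r) (cex (Cn 0))) (enc (upd S t 0 0 ?x), inp, out) t1 (enc (f 0), inp, out)"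
    "t1 <= (fac (scalar_addr r) + fac (cex (Cn 0))) * bits M"
    using exec_set[OF b0 wf(2), of "Cn 0" inp out] by (auto simp: f_def)
  have iM: "i <= M" if "i <= floorlog 2 ?x" for i using that k Lim_le_M by linarith
  have xi: "?x div 2 ^ i <= M" for i using x div_le_dividend order_trans by blast
  have bd: "bounded_store M (f i)" if "i <= floorlog 2 ?x" for i
    unfolding f_def using Len.prems iM[OF that] xi by (intro bounded_store_upd) auto
  define T where "T = (fac (scalar_addr t) + fac (cex (V t \<oslash> Cn 2))) * bits M + (fac (scalar_addr r) + fac (cex (V r .+ Cn 1))) * bits M"
  have body: "EX u. exec (Seq (Assign (scalar_addr t) (cex (V t \<oslash> Cn 2))) (Assign (scalar_addr r) (cex (V r .+ Cn 1))))
      (enc (f i), inp, out) u (enc (f (Suc i)), inp, out) & u <= T" if i: "i < floorlog 2 ?x" for i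
  proof -
    have e1: "ev (f i) (V t \<oslash> Cn 2) = ?x div 2 ^ Suc i"
      using wf by (simp add: f_def mult.commute flip: div_mult2_eq)
    obtain u1 where u1: "exec (Assign (scalar_addr t) (cex (V t \<oslash> Cn 2))) (enc (f i), inp, out) u1
        (enc (upd (f i) t 0 0 (?x div 2 ^ Suc i)), inp, out)"
        "u1 <= (fac (scalar_addr t) + fac (cex (V t \<oslash> Cn 2))) * bits M"
      and b1: "bounded_store M (upd (f i) t 0 0 (?x div 2 ^ Suc i))"
      using exec_set[OF bd wf(3), of i "V t \<oslash> Cn 2" inp out] i wf xi[of "Suc i"] unfolding e1 by auto
    have e2: "ev (upd (f i) t 0 0 (?x div 2 ^ Suc i)) (V r .+ Cn 1) = Suc i"
      using wf by (simp add: f_def)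
    have e3: "upd (upd (f i) t 0 0 (?x div 2 ^ Suc i)) r 0 0 (Suc i) = f (Suc i)"
      by (auto simp: f_def upd_def fun_eq_iff)
    obtain u2 where u2: "exec (Assign (scalar_addr r) (cex (V r .+ Cn 1)))
        (enc (upd (f i) t 0 0 (?x div 2 ^ Suc i)), inp, out) u2 (enc (f (Suc i)), inp, out)"
        "u2 <= (fac (scalar_addr r) + fac (cex (V r .+ Cn 1))) * bits M"
      using exec_set[OF b1 wf(2), of "V r .+ Cn 1" inp out] iM[of "Suc i"] i wf unfolding e2 e3 by auto
    show ?thesis
      using exec.Seq[OF u1(1) u2(1)] u1(2) u2(2) unfolding T_def by (meson add_mono)
  qed
  have nz: "?x div 2 ^ i ~= 0 \<longleftrightarrow> i < floorlog 2 ?x" for i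
    using floorlog_le_iff[of 2 ?x i] by (auto simp: div_eq_0_iff not_le)
  have ft: "f i t 0 0 = ?x div 2 ^ i" for i using wf by (simp add: f_def)
  obtain t2 where t2: "exec (While (cex (V t)) (Seq (Assign (scalar_addr t) (cex (V t \<oslash> Cn 2))) (Assign (scalar_addr r) (cex (V r .+ Cn 1)))))
      (enc (f 0), inp, out) t2 (enc (f (floorlog 2 ?x)), inp, out)"
    "t2 <= fac (cex (V t)) * bits M + floorlog 2 ?x * (fac (cex (V t)) * bits M + T)"
    using exec_while_rounds[where f = f and k = "floorlog 2 ?x" and c = "V t" and M = M and T = T and inp = inp and out = out, OF _ bd _ _ body]
      wf nz by (auto simp: ft)
  have fin: "f (floorlog 2 ?x) = sem (Len r t e) S"
    using nz[of "floorlog 2 ?x"] by (simp add: f_def)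
  have "t0 + (t1 + t2) <= (fac (scalar_addr t) + fac (cex e)) * bits M + ((fac (scalar_addr r) + fac (Const 0)) * bits M
     + (fac (cex (V t)) * bits M + Lim * (fac (cex (V t)) * bits M + T)))"
    using t0(2) t1(2) k by (intro add_mono order_trans[OF t2(2)] mult_mono) auto
  also have "... = poly (time_poly (Len r t e)) Lim * bits M"
    by (simp add: T_def algebra_simps)
  finally show ?case
    using exec.Seq[OF t0(1) exec.Seq[OF t1(1)[simplified] t2(1)]] bd[of "floorlog 2 ?x"] fin by auto
qed

section \<open>What feasibility means for the completion times\<close>

definition share_port :: "flow => flow => bool" where
  "share_port f g \<longleftrightarrow> source f = source g \<or> destination f = destination g"

lemma finite_flows [simp]: "finite (flows I)"
  by (simp add: flows_def)

lemma feasible_rate: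
  assumes "feasible I x" "h < cores I" "f \<in> flows I"
  shows "0 <= x h f t" "x h f t <= 1" "x h f integrable_on {0..T}"
    "t < flow_release I f ==> x h f t = 0"
  using assms by (auto simp: feasible_def)

lemma transmitted_mono:
  assumes "feasible I x" "f \<in> flows I" "T <= T'"
  shows "transmitted I x f T <= transmitted I x f T'"
  unfolding transmitted_def
  using assms by (intro sum_mono integral_subset_le) (auto intro: feasible_rate)

text \<open>The infimum in \<open>flow_finish\<close> is not known to be attained, so only strictly
  later times are treated: an earlier witness exists, and monotonicity together with the upper bound
  carries equality forward.\<close>

lemma transmitted_after_finish:
  assumes x: "feasible I x" and f: "f \<in> flows I" and T: "flow_finish I x f < T"
  shows "transmitted I x f T = flow_size I f"
proof -
  let ?A = "{T. flow_release I f <= T & transmitted I x f T = flow_size I f}"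
  have le: "transmitted I x f T <= flow_size I f" for T
    using x f by (auto simp: feasible_def)
  obtain T0 where T0: "transmitted I x f T0 = flow_size I f"
    using x f by (auto simp: feasible_def)
  \<comment> \<open>\<open>T0\<close> may lie before the release, as for a flow of size 0, while the
    set defining the finish time only admits times from the release on.\<close>
  have "transmitted I x f (max T0 (flow_release I f)) = flow_size I f"
    using transmitted_mono[OF x f, of T0 "max T0 (flow_release I f)"] le T0 by (simp add: antisym)
  then have "?A ~= {}" by (metis (mono_tags, lifting) empty_iff max.cobounded2 mem_Collect_eq)
  then obtain T1 where "T1 \<in> ?A" "T1 < T"
    using T unfolding flow_finish_def by (meson cInf_lessD)
  then show ?thesis
    using transmitted_mono[OF x f, of T1 T] le[of T] by auto
qed

text \<open>Flows that pairwise share a port are never served simultaneously by one core, so their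
  rates on a core add up to at most 1. Integration over time and summation over the cores give the
  bound, up to an arbitrarily small delay because finish times are infima.\<close>

lemma conflicting_flows_load:
  assumes x: "feasible I x" and F: "F \<subseteq> flows I" and t: "0 <= t"
    and conflict: "!!f g. f \<in> F ==> g \<in> F ==> share_port f g"
    and fin: "!!f. f \<in> F ==> flow_finish I x f <= t"
  shows "(\<Sum>f\<in>F. flow_size I f) <= real (cores I) * t"
proof (rule field_le_epsilon)
  fix e :: real
  assume e: "0 < e"
  \<comment> \<open>The delay is chosen such that \<open>cores I\<close> times it stays below
    \<open>e\<close>, also if there are no cores.\<close>
  define T where "T = t + e / (real (cores I) + 1)"
  have T: "t < T" using e by (simp add: T_def)
  have finF: "finite F" using F finite_flows finite_subset by blast
  have "(\<Sum>f\<in>F. flow_size I f) = (\<Sum>f\<in>F. transmitted I x f T)"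
    using T fin F by (intro sum.cong refl transmitted_after_finish[symmetric, OF x]) force+
  also have "... = (\<Sum>h<cores I. \<Sum>f\<in>F. integral {0..T} (x h f))"
    unfolding transmitted_def by (rule sum.swap)
  also have "... = (\<Sum>h<cores I. integral {0..T} (%\<tau>. \<Sum>f\<in>F. x h f \<tau>))"
    using F finF by (intro sum.cong refl integral_sum[symmetric]) (auto intro: feasible_rate[OF x])
  also have "... <= (\<Sum>h<cores I. integral {0..T} (%\<tau>. 1))"
  proof (intro sum_mono integral_le)
    fix h \<tau>
    assume h: "h \<in> {..<cores I}"
    show "(%\<tau>. \<Sum>f\<in>F. x h f \<tau>) integrable_on {0..T}"
      using h F finF by (intro integrable_sum) (auto intro: feasible_rate[OF x])
    show "(\<Sum>f\<in>F. x h f \<tau>) <= 1"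
    proof (cases "\<exists>f\<in>F. x h f \<tau> > 0")
      case True
      then obtain f where f: "f \<in> F" "x h f \<tau> > 0" by blast
      have "x h g \<tau> = 0" if "g \<in> F - {f}" for g
      proof (rule ccontr)
        assume "x h g \<tau> ~= 0"
        then have "x h g \<tau> > 0"
          using feasible_rate(1)[OF x, of h g \<tau>] that F h by (auto simp: less_le)
        then have "f = g"
          using x f that h conflict[of f g] F unfolding feasible_def share_port_def by blast
        with that show False by simp
      qed
      then have "(\<Sum>f\<in>F. x h f \<tau>) = x h f \<tau>"
        using f finF by (simp add: sum.remove)
      then show ?thesis using feasible_rate(2)[OF x, of h f \<tau>] f F h by auto
    next
      case False
      then have "(\<Sum>f\<in>F. x h f \<tau>) <= 0" by (intro sum_nonpos) force
      then show ?thesis by linarith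
    qed
  qed auto
  also have "... = real (cores I) * T"
    using t T by simp
  also have "... <= real (cores I) * t + e"
    using e by (simp add: T_def field_simps)
  finally show "(\<Sum>f\<in>F. flow_size I f) <= real (cores I) * t + e" .
qed

text \<open>Here it matters that a flow stays on a single core: its total rate is then at most 1
  after the release and 0 before it.\<close>

lemma flow_finish_ge:
  assumes I: "valid_instance I" and x: "feasible I x" and f: "f \<in> flows I"
  shows "flow_release I f + flow_size I f <= flow_finish I x f"
proof -
  let ?A = "{T. flow_release I f <= T & transmitted I x f T = flow_size I f}"
  have r: "0 <= flow_release I f"
    using I f by (auto simp: valid_instance_def flow_release_def flows_def)
  have "transmitted I x f (flow_finish I x f + 1 + \<bar>flow_release I f\<bar> + \<bar>flow_finish I x f\<bar>) = flow_size I f"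
    by (rule transmitted_after_finish[OF x f]) linarith
  then have "?A ~= {}"
    by (auto intro!: exI[of _ "flow_finish I x f + 1 + \<bar>flow_release I f\<bar> + \<bar>flow_finish I x f\<bar>"])
  moreover have "flow_release I f + flow_size I f <= T" if T: "T \<in> ?A" for T
  proof -
    obtain h where h: "h < cores I" "!!h' t. h' < cores I ==> h' ~= h ==> x h' f t = 0"
      using x f unfolding feasible_def by meson
    have "transmitted I x f T = (\<Sum>h'\<in>{h}. integral {0..T} (x h' f))"
      unfolding transmitted_def
    proof (rule sum.mono_neutral_right)
      show "\<forall>i\<in>{..<cores I} - {h}. integral {0..T} (x i f) = 0"
      proof
        fix i assume "i \<in> {..<cores I} - {h}"
        then have "x i f = (%t. 0)" using h(2) by auto
        then show "integral {0..T} (x i f) = 0" by simp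
      qed
    qed (use h in auto)
    then have "transmitted I x f T = integral {0..T} (x h f)" by simp
    also have "... <= T - flow_release I f"
    proof (rule has_integral_le)
      show "(x h f has_integral integral {0..T} (x h f)) {0..T}"
        using feasible_rate(3)[OF x h(1) f] by (rule integrable_integral)
      show "((%t. if t \<in> {flow_release I f..T} then 1 else 0) has_integral T - flow_release I f) {0..T}"
        using r T has_integral_const_real[of "1::real" "flow_release I f" T] by (subst has_integral_restrict) auto
    qed (use feasible_rate[OF x h(1) f] in \<open>auto simp: not_le\<close>)
    finally show ?thesis using T by simp
  qed
  ultimately show ?thesis
    unfolding flow_finish_def by (rule cInf_greatest)
qed

lemma flow_finish_le_completion:
  assumes "f \<in> flows I"
  shows "flow_finish I x f <= completion_time I x (coflow_of f)"
  unfolding completion_time_def using assms by (intro Max_ge) auto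

text \<open>The maximum ranges over a nonempty set, since a valid instance has a port and therefore
  the flow \<open>(0, 0, k)\<close>.\<close>

lemma completion_le_iff:
  assumes "valid_instance I" "k < coflows I"
  shows "completion_time I x k <= t \<longleftrightarrow> (\<forall>f\<in>flows I. coflow_of f = k --> flow_finish I x f <= t)"
proof -
  have "(0, 0, k) \<in> {f \<in> flows I. coflow_of f = k}"
    using assms by (auto simp: flows_def valid_instance_def)
  then show ?thesis unfolding completion_time_def by (subst Max_le_iff) auto
qed

section \<open>Schedules given by disjoint periods\<close>

text \<open>The difference of minima covers at once the cases that \<open>T\<close> lies before,
  within or after the period. The half-open end differs from the closed interval at one point
  only.\<close>

lemma has_integral_period:
  fixes a b T :: real
  assumes "0 <= a" "a <= b" "0 <= T"
  shows "((%t. of_bool (a <= t & t < b)) has_integral (min b T - min a T)) {0..T}"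
proof (cases "a <= T")
  case True
  have "((%t. if t \<in> {a..min b T} then 1 else 0) has_integral (min b T - a)) {0..T}"
    using assms True has_integral_const_real[of "1::real" a "min b T"] by (subst has_integral_restrict) auto
  then have "((%t. of_bool (a <= t & t < b)) has_integral (min b T - a)) {0..T}"
    by (rule has_integral_spike_finite[of "{b}", rotated 2]) auto
  then show ?thesis using True by simp
next
  case False
  have "((%t. of_bool (a <= t & t < b)) has_integral 0) {0..T}"
    by (rule has_integral_is_0) (use False in auto)
  then show ?thesis using False assms by (simp add: min_def)
qed

text \<open>Endpoints are natural numbers in units of \<open>1 / X\<close>. Disjointness concerns
  periods on the same core with a common port, which includes different periods of one flow.\<close>

locale periods =
  fixes I :: coflow_instance and X :: nat and cnt :: nat
    and c :: "nat => nat" and fl :: "nat => flow" and a b :: "nat => nat"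
  assumes valid: "valid_instance I" and X: "0 < X"
    and dom: "!!q. q < cnt ==> c q < cores I & fl q \<in> flows I & a q <= b q"
    and rel: "!!q. q < cnt ==> flow_release I (fl q) * X <= a q"
    and disj: "!!q q'. q < q' ==> q' < cnt ==> c q = c q' ==> share_port (fl q) (fl q') ==>
        b q <= a q' \<or> b q' <= a q"
    and core: "!!q q'. q < cnt ==> q' < cnt ==> fl q = fl q' ==> c q = c q'"
    and total: "!!f. f \<in> flows I ==> (\<Sum>q | q < cnt & fl q = f. real (b q) - real (a q)) = X * flow_size I f"
begin

definition x where "x = schedule_of (map (%q. (c q, fl q, real (a q) / real X, real (b q) / real X)) [0..<cnt])"

lemma x_iff: "x h f t = of_bool (EX q<cnt. c q = h & fl q = f & a q / X <= t & t < b q / X)"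
proof -
  have "(h, f, u, v) \<in> set (map (%q. (c q, fl q, real (a q) / real X, real (b q) / real X)) [0..<cnt]) \<longleftrightarrow>
      (EX q<cnt. c q = h & fl q = f & a q / X = u & b q / X = v)" for u v
    by auto
  then show ?thesis
    unfolding x_def schedule_of_def by (intro arg_cong[of _ _ of_bool]) (simp, blast)
qed

lemma at_most_one:
  assumes "q < cnt" "q' < cnt" "c q = c q'" "share_port (fl q) (fl q')"
    "a q / X <= t" "t < b q / X" "a q' / X <= t" "t < b q' / X"
  shows "q = q'"
proof (rule ccontr)
  assume "q ~= q'"
  then have "b q <= a q' \<or> b q' <= a q"
    using disj[of q q'] disj[of q' q] assms(1-4) by (auto simp: share_port_def nat_neq_iff)
  then have "b q / X <= a q' / X \<or> b q' / X <= a q / X"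
    by (auto intro!: divide_right_mono)
  then show False using assms(5-8) by linarith
qed

text \<open>As at most one period is active at a time, the indicator of their union equals the sum
  of their indicators, which can be integrated term by term.\<close>

lemma x_sum: "x h f t = (\<Sum>q | q < cnt & c q = h & fl q = f. of_bool (a q / X <= t & t < b q / X))"
proof (cases "EX q<cnt. c q = h & fl q = f & a q / X <= t & t < b q / X")
  case True
  then obtain q where q: "q < cnt" "c q = h" "fl q = f" "a q / X <= t" "t < b q / X" by blast
  have "(\<Sum>q | q < cnt & c q = h & fl q = f. of_bool (a q / X <= t & t < b q / X) :: real)
     = (\<Sum>q\<in>{q}. of_bool (a q / X <= t & t < b q / X))"
    by (rule sum.mono_neutral_right)
      (use q in \<open>auto dest: at_most_one[of q, rotated 4] simp: share_port_def\<close>)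
  also have "... = 1" using q by simp
  finally show ?thesis using True unfolding x_iff by simp
next
  case False
  then have "(\<Sum>q | q < cnt & c q = h & fl q = f. of_bool (a q / X <= t & t < b q / X) :: real) = 0"
    by (intro sum.neutral) auto
  then show ?thesis using False unfolding x_iff by simp
qed

lemma x_has_integral:
  assumes "0 <= T"
  shows "(x h f has_integral
    (\<Sum>q | q < cnt & c q = h & fl q = f. min (b q / X) T - min (a q / X) T)) {0..T}"
  unfolding x_sum[abs_def]
  using assms dom by (intro has_integral_sum has_integral_period) (auto intro!: divide_right_mono)

lemma x_transmitted:
  assumes "0 <= T" "f \<in> flows I"
  shows "transmitted I x f T = (\<Sum>q | q < cnt & fl q = f. min (b q / X) T - min (a q / X) T)"
proof -
  have "transmitted I x f T = (\<Sum>h<cores I. \<Sum>q | q < cnt & c q = h & fl q = f. min (b q / X) T - min (a q / X) T)"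
    unfolding transmitted_def by (intro sum.cong refl integral_unique x_has_integral[OF assms(1)])
  also have "... = (\<Sum>h<cores I. \<Sum>q\<in>{q \<in> {q. q < cnt & fl q = f}. c q = h}. min (b q / X) T - min (a q / X) T)"
    by (intro sum.cong refl) auto
  also have "... = (\<Sum>q | q < cnt & fl q = f. min (b q / X) T - min (a q / X) T)"
    by (rule sum.group) (use dom in auto)
  finally show ?thesis .
qed

lemma size_eq: "f \<in> flows I ==> flow_size I f = (\<Sum>q | q < cnt & fl q = f. b q / X - a q / X)"
  using total[of f] X by (simp add: field_simps flip: sum_divide_distrib diff_divide_distrib)

lemma transmitted_done:
  assumes "f \<in> flows I" "0 <= T" "!!q. q < cnt ==> fl q = f ==> b q / X <= T"
  shows "transmitted I x f T = flow_size I f"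
proof -
  have "min (b q / X) T - min (a q / X) T = b q / X - a q / X" if "q < cnt" "fl q = f" for q
  proof -
    have "a q / X <= b q / X" using dom[OF that(1)] by (intro divide_right_mono) auto
    then show ?thesis using assms(3)[OF that] by simp
  qed
  then show ?thesis
    using x_transmitted[OF assms(2,1)] size_eq[OF assms(1)] by simp
qed

lemma release_nonneg: "f \<in> flows I ==> 0 <= flow_release I f"
  using valid by (auto simp: valid_instance_def flow_release_def flows_def)

lemma feasible_x: "feasible I x"
  unfolding feasible_def
proof (intro conjI allI impI ballI)
  fix h f t
  assume h: "h < cores I" and f: "f \<in> flows I"
  show "0 <= x h f t" "x h f t <= 1" by (simp_all add: x_iff)
  show "x h f integrable_on {0..T}" for T
  proof (cases "0 <= T")
    case True
    then show ?thesis using x_has_integral by blast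
  next
    case False
    then have "{0..T} = {}" by auto
    then show ?thesis using integrable_on_empty by metis
  qed
  show "x h f t = 0" if "t < flow_release I f"
  proof -
    have "flow_release I f <= a q / X" if "q < cnt" "fl q = f" for q
      using rel[OF that(1)] that(2) X by (simp add: field_simps)
    then show ?thesis using that by (force simp: x_iff)
  qed
next
  fix h t f g
  assume "0 < x h f t & 0 < x h g t & (source f = source g \<or> destination f = destination g)"
  then obtain q q' where "q < cnt" "q' < cnt" "c q = h" "c q' = h" "fl q = f" "fl q' = g"
    "a q / X <= t" "t < b q / X" "a q' / X <= t" "t < b q' / X" "share_port f g"
    by (auto simp: x_iff share_port_def)
  then show "f = g" using at_most_one[of q q' t] by auto
next
  fix f
  assume f: "f \<in> flows I"
  show "EX h<cores I. ALL h'<cores I. h' ~= h --> (ALL t. x h' f t = 0)"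
  proof (cases "EX q<cnt. fl q = f")
    case True
    then obtain q where q: "q < cnt" "fl q = f" by blast
    have "x h' f t = 0" if "h' ~= c q" for h' t
      using that core[OF _ q(1)] q(2) unfolding x_iff by auto
    then show ?thesis using dom[OF q(1)] by blast
  next
    case False
    then show ?thesis using valid by (intro exI[of _ 0]) (auto simp: x_iff valid_instance_def)
  qed
  show "transmitted I x f T <= flow_size I f" for T
  proof (cases "0 <= T")
    case True
    have "min (b q / X) T - min (a q / X) T <= b q / X - a q / X" if "q < cnt" for q
    proof -
      have "a q / X <= b q / X" using dom[OF that(1)] by (intro divide_right_mono) auto
      then show ?thesis by (simp add: min_def)
    qed
    then show ?thesis
      unfolding x_transmitted[OF True f] size_eq[OF f] by (intro sum_mono) auto
  next
    case False
    then have "{0..T} = {}" by auto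
    then show ?thesis by (simp add: transmitted_def flow_size_def)
  qed
  \<comment> \<open>A crude time by which all periods are over: the sum of all end times.\<close>
  define T where "T = (\<Sum>q<cnt. b q / X)"
  have "b q / X <= T" if "q < cnt" for q
    unfolding T_def using that by (intro member_le_sum) auto
  then have "transmitted I x f T = flow_size I f"
    using f by (intro transmitted_done) (auto simp: T_def intro: sum_nonneg)
  then show "EX T. transmitted I x f T = flow_size I f" ..
qed

lemma flow_finish_x_le:
  assumes f: "f \<in> flows I" and T: "flow_release I f <= T"
    and le: "!!q. q < cnt ==> fl q = f ==> b q / X <= T"
  shows "flow_finish I x f <= T"
proof -
  have "0 <= T" using release_nonneg[OF f] T by linarith
  then have "transmitted I x f T = flow_size I f"
    using f le by (intro transmitted_done)
  then show ?thesis
    unfolding flow_finish_def using T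
    by (intro cInf_lower) (auto intro!: bdd_belowI[of _ "flow_release I f"])
qed

end

lemma decode_periods_map:
  "decode_periods (concat (map (%q. case fl q of (i, j, k) => [c q, i, j, k, a q, X, b q, X]) qs)) =
     map (%q. (c q, fl q, real (a q) / real X, real (b q) / real X)) qs"
  by (induction qs) (auto split: prod.split)

section \<open>Ordering coflows by local ratios\<close>

locale port_loads =
  fixes L :: "nat => nat => nat" and P n m :: nat
begin

definition total_load :: "nat set => nat => nat" where
  "total_load A p = (\<Sum>k\<in>A. L p k)"

definition max_load :: "nat set => nat" where
  "max_load A = Max (insert 0 (total_load A ` {..<P}))"

lemma total_load_le_max: "p < P ==> total_load A p <= max_load A"
  unfolding max_load_def by (intro Max_ge) auto

lemma max_load_le_iff: "max_load A <= x \<longleftrightarrow> (ALL p<P. total_load A p <= x)"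
  unfolding max_load_def by (subst Max_le_iff) auto

lemma max_load_mono: "finite B ==> A \<subseteq> B ==> max_load A <= max_load B"
proof -
  assume "finite B" "A \<subseteq> B"
  then have "total_load A p <= total_load B p" for p
    unfolding total_load_def by (intro sum_mono2) auto
  then show ?thesis unfolding max_load_le_iff using total_load_le_max order_trans by blast
qed

text \<open>
  The list is built from its head, which is the coflow to be scheduled last. The weights are
  multiplied by the load of the chosen coflow in each round so that they remain integers.
\<close>

inductive local_ratio_order :: "(nat => nat) => nat list => bool" where
  Nil: "local_ratio_order W []"
| Zero: "local_ratio_order W xs ==> max_load (set (k # xs)) = 0 ==> local_ratio_order W (k # xs)"
| Step: "\<mu> < P ==> total_load (set (k # xs)) \<mu> = max_load (set (k # xs)) ==> 0 < L \<mu> k ==>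
    (!!l. l \<in> set xs ==> W k * L \<mu> l <= W l * L \<mu> k) ==>
    (!!l. l \<in> set xs ==> W' l = W l * L \<mu> k - W k * L \<mu> l) ==>
    local_ratio_order W' xs ==> local_ratio_order W (k # xs)"

text \<open>The head is scheduled last, so \<open>set (k # xs)\<close> consists of \<open>k\<close>
  and the coflows scheduled before it. Each coflow pays the largest port load accumulated up to and
  including itself.\<close>

fun order_cost :: "(nat => nat) => nat list => nat" where
  "order_cost W [] = 0"
| "order_cost W (k # xs) = W k * max_load (set (k # xs)) + order_cost W xs"

text \<open>The split of the weights on which the local ratio argument rests: the part proportional
  to \<open>c\<close> is charged with the largest maximal load, that of the whole list.\<close>

lemma order_cost_bound:
  assumes "!!k. k \<in> set xs ==> U * W k <= W' k + W0 * c k"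
  shows "U * order_cost W xs <= order_cost W' xs + W0 * ((\<Sum>k\<leftarrow>xs. c k) * max_load (set xs))"
  using assms
proof (induction xs)
  case (Cons k xs)
  have "U * order_cost W (k # xs) = (U * W k) * max_load (set (k # xs)) + U * order_cost W xs"
    by (simp add: algebra_simps)
  also have "... <= (W' k + W0 * c k) * max_load (set (k # xs)) +
      (order_cost W' xs + W0 * ((\<Sum>k\<leftarrow>xs. c k) * max_load (set xs)))"
    using Cons by (intro add_mono mult_right_mono) auto
  also have "... <= (W' k + W0 * c k) * max_load (set (k # xs)) +
      (order_cost W' xs + W0 * ((\<Sum>k\<leftarrow>xs. c k) * max_load (set (k # xs))))"
    by (intro add_mono mult_left_mono max_load_mono) auto
  finally show ?case by (simp add: algebra_simps)
qed simp

text \<open>The square is a sum over pairs, and each pair is charged to the coflow completed later.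
  For fixed \<open>k\<close> the partners completed no later have total load at most
  \<open>m * C k\<close>; counting pairs both ways gives the factor 2.\<close>

lemma load_squared_le:
  fixes C :: "nat => real"
  assumes fin: "finite A" and C: "!!k. k \<in> A ==> real (\<Sum>l | l \<in> A & C l <= C k. L p l) <= m * C k"
  shows "(real (total_load A p))\<^sup>2 <= 2 * real m * (\<Sum>k\<in>A. L p k * C k)"
proof -
  let ?L = "%k. real (L p k)"
  have "(real (total_load A p))\<^sup>2 = (\<Sum>k\<in>A. \<Sum>l\<in>A. ?L k * ?L l)"
    by (simp add: total_load_def power2_eq_square sum_product)
  also have "... <= (\<Sum>k\<in>A. \<Sum>l\<in>A. ?L k * ?L l * of_bool (C l <= C k) + ?L k * ?L l * of_bool (C k <= C l))"
    by (intro sum_mono) auto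
  also have "... = (\<Sum>k\<in>A. \<Sum>l\<in>A. ?L k * ?L l * of_bool (C l <= C k)) + (\<Sum>k\<in>A. \<Sum>l\<in>A. ?L k * ?L l * of_bool (C k <= C l))"
    by (simp add: sum.distrib)
  also have "(\<Sum>k\<in>A. \<Sum>l\<in>A. ?L k * ?L l * of_bool (C k <= C l)) = (\<Sum>k\<in>A. \<Sum>l\<in>A. ?L k * ?L l * of_bool (C l <= C k))"
    by (subst sum.swap) (simp add: mult.commute)
  also have "(\<Sum>k\<in>A. \<Sum>l\<in>A. ?L k * ?L l * of_bool (C l <= C k)) <= (\<Sum>k\<in>A. ?L k * (m * C k))"
  proof (intro sum_mono)
    fix k assume k: "k \<in> A"
    have "(\<Sum>l\<in>A. ?L k * ?L l * of_bool (C l <= C k)) = ?L k * (\<Sum>l\<in>A. ?L l * of_bool (C l <= C k))"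
      by (simp add: sum_distrib_left mult.assoc)
    also have "(\<Sum>l\<in>A. ?L l * of_bool (C l <= C k)) = real (\<Sum>l | l \<in> A & C l <= C k. L p l)"
      using fin by (simp add: of_bool_def if_distrib sum.If_cases Int_def cong: if_cong)
    also have "?L k * ... <= ?L k * (m * C k)"
      using C[OF k] by (intro mult_left_mono) auto
    finally show "(\<Sum>l\<in>A. ?L k * ?L l * of_bool (C l <= C k)) <= ?L k * (m * C k)" .
  qed
  finally show ?thesis by (simp add: sum_distrib_left mult_ac)
qed

text \<open>Scaled by \<open>L \<mu> k\<close>, the weights split into the reduced weights
  \<open>W'\<close>, handled by induction, and a multiple of the loads on the port
  \<open>\<mu>\<close>. The second part costs the total load of \<open>\<mu>\<close> times the
  maximal load. These agree by the choice of \<open>\<mu>\<close>, so the product is a square and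
  the pair argument applies.\<close>

theorem local_ratio_order_cost:
  fixes C :: "nat => real"
  assumes "local_ratio_order W xs" "distinct xs" "set xs \<subseteq> {..<n}"
    and C: "!!(t::real) p. 0 <= t ==> p < P ==> real (\<Sum>k | k < n & C k <= t. L p k) <= m * t"
    and C0: "!!k. k < n ==> 0 <= C k"
  shows "real (order_cost W xs) <= 2 * real m * (\<Sum>k\<in>set xs. W k * C k)"
  using assms(1-3)
proof (induction rule: local_ratio_order.induct)
  case (Nil W)
  then show ?case by simp
next
  case (Zero W xs k)
  have "0 <= real m * (W k * C k)" using C0 Zero.prems by (intro mult_nonneg_nonneg) auto
  then show ?case using Zero by (auto simp: algebra_simps)
next
  case (Step \<mu> k xs W W')
  let ?S = "set (k # xs)" and ?U = "L \<mu> k"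
  have "?U * order_cost W (k # xs) = W k * ?U * max_load ?S + ?U * order_cost W xs"
    by (simp add: algebra_simps)
  also have "?U * order_cost W xs <= order_cost W' xs + W k * ((\<Sum>l\<leftarrow>xs. L \<mu> l) * max_load (set xs))"
    using Step.hyps(4,5) by (intro order_cost_bound) (auto simp: mult.commute)
  also have "W k * ((\<Sum>l\<leftarrow>xs. L \<mu> l) * max_load (set xs)) <= W k * ((\<Sum>l\<leftarrow>xs. L \<mu> l) * max_load ?S)"
    by (intro mult_left_mono max_load_mono) auto
  also have "W k * ?U * max_load ?S + (order_cost W' xs + W k * ((\<Sum>l\<leftarrow>xs. L \<mu> l) * max_load ?S))
     = order_cost W' xs + W k * ((\<Sum>l\<leftarrow>k # xs. L \<mu> l) * max_load ?S)"
    by (simp add: algebra_simps)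
  also have "(\<Sum>l\<leftarrow>k # xs. L \<mu> l) = total_load ?S \<mu>"
    unfolding total_load_def using Step.prems by (metis sum_list_distinct_conv_sum_set)
  also have "total_load ?S \<mu> * max_load ?S = (total_load ?S \<mu>)\<^sup>2"
    using Step.hyps(2) by (simp add: power2_eq_square)
  finally have "real (?U * order_cost W (k # xs)) <= real (order_cost W' xs + W k * (total_load ?S \<mu>)\<^sup>2)"
    by (simp only: of_nat_le_iff)
  also have "... = real (order_cost W' xs) + W k * (real (total_load ?S \<mu>))\<^sup>2" by simp
  also have "... <= 2 * real m * (\<Sum>l\<in>set xs. W' l * C l) + W k * (2 * real m * (\<Sum>l\<in>?S. L \<mu> l * C l))"
  proof (intro add_mono mult_left_mono load_squared_le)
    show "real (order_cost W' xs) <= 2 * real m * (\<Sum>l\<in>set xs. W' l * C l)"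
      using Step by auto
    fix l assume l: "l \<in> ?S"
    have "real (\<Sum>l' | l' \<in> ?S & C l' <= C l. L \<mu> l') <= real (\<Sum>k | k < n & C k <= C l. L \<mu> k)"
      unfolding of_nat_le_iff using Step.prems by (intro sum_mono2) auto
    also have "... <= m * C l" using l Step.prems Step.hyps(1) C0[of l] C[of "C l" \<mu>] by auto
    finally show "real (\<Sum>l' | l' \<in> ?S & C l' <= C l. L \<mu> l') <= m * C l" .
  qed auto
  also have "(\<Sum>l\<in>set xs. real (W' l) * C l) = (\<Sum>l\<in>set xs. (W l * ?U - real (W k * L \<mu> l)) * C l)"
    using Step.hyps(4,5) by (intro sum.cong) (auto simp: of_nat_diff simp flip: of_nat_mult)
  also have "2 * real m * ... + W k * (2 * real m * (\<Sum>l\<in>?S. L \<mu> l * C l)) =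
     2 * real m * ((\<Sum>l\<in>set xs. (W l * ?U - real (W k * L \<mu> l)) * C l) + (\<Sum>l\<in>set xs. W k * (L \<mu> l * C l)) + W k * (L \<mu> k * C k))"
    using Step.prems by (simp add: algebra_simps sum_distrib_left)
  also have "(\<Sum>l\<in>set xs. (W l * ?U - real (W k * L \<mu> l)) * C l) + (\<Sum>l\<in>set xs. W k * (L \<mu> l * C l)) = ?U * (\<Sum>l\<in>set xs. W l * C l)"
    unfolding sum.distrib[symmetric] sum_distrib_left by (intro sum.cong) (auto simp: algebra_simps)
  also have "2 * real m * (?U * (\<Sum>l\<in>set xs. W l * C l) + W k * (L \<mu> k * C k)) = ?U * (2 * real m * (\<Sum>l\<in>?S. W l * C l))"
    using Step.prems by (simp add: algebra_simps)
  finally show ?case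
    using Step.hyps(3) by simp
qed

end

section \<open>Fractional completion on a geometric time grid\<close>

text \<open>
  A coflow that is completed at time \<open>C\<close> occupies the grid points from \<open>C\<close> on; a port cannot have
  more than \<open>t\<close> units of data completed at time \<open>t\<close>. The resulting linear program is solved
  approximately by a drift-plus-penalty iteration: a queue for each port and grid point
  accumulates the violation of its constraint, and in each round every coflow chooses the grid point
  that minimises its weighted completion time plus the queue lengths it would see.
\<close>

locale drift =
  fixes N n H :: nat and L :: "nat => nat => nat" and B W :: "nat => nat"
  assumes N: "1 <= N" and n: "1 <= n" and H: "12 <= H"
    and L_le: "!!p k. p < 2 * N ==> k < n ==> L p k <= B k"
    and top: "!!k. k < n ==> n * B k * 10 ^ (H - 12) <= 11 ^ (H - 12)"
    and WB: "!!k. k < n ==> 0 < W k ==> 0 < B k"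
begin

text \<open>The grid point \<open>(11 / 10) ^ g\<close>, multiplied by \<open>10 ^ H\<close> to make
  it integral for all \<open>g <= H\<close>.\<close>

definition T :: "nat => nat" where "T g = 11 ^ g * 10 ^ (H - g)"

definition load :: "(nat => nat) => nat => nat => nat" where
  "load G p g = (\<Sum>k<n. L p k * of_bool (G k <= g))"

text \<open>Truncated subtraction is the reflection of the queue at 0. Divided by
  \<open>T g\<close>, as in \<open>Q\<close> below, it is the usual recursion in terms of the
  relative violation.\<close>

primrec queue :: "(nat => nat => nat) => nat => nat => nat => nat" where
  "queue Gs 0 = (%p g. 0)"
| "queue Gs (Suc s) = (%p g. queue Gs s p g + 10 ^ H * load (Gs s) p g - T g)"

text \<open>The second-order term of the drift: half of the bound \<open>n * n\<close> on a squared
  violation, summed over \<open>2 * N\<close> ports and \<open>H\<close> grid points.\<close>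

definition Bc :: nat where "Bc = N * H * n * n"

text \<open>The sum is a lower bound for the objective and normalises the penalty. The added 1 keeps
  the divisor positive if all weights vanish.\<close>

definition lam :: nat where "lam = (\<Sum>k<n. W k * B k) * 10 ^ H + 1"

text \<open>The real-valued \<open>rcost\<close>, cleared of denominators by the factor
  \<open>lam * 110 ^ H * 110 ^ H\<close>. One power of 110 removes the division of the queue by
  \<open>T\<close>, the other that of the load.\<close>

definition cost :: "(nat => nat => nat) => nat => nat => nat" where
  "cost q k g = 40 * Bc * 110 ^ H * 110 ^ H * W k * T g + lam * 10 ^ H *
     (\<Sum>g'\<in>{g..<H}. (\<Sum>p<2*N. q p g' * L p k) * (110 ^ H div T g') * (110 ^ H div T g'))"

text \<open>The last 12 grid points are reserved for the shift in \<open>finish_index\<close>. The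
  second condition keeps a coflow from being completed before its own lower bound and limits its
  share of any later grid point.\<close>

definition allowed :: "nat => nat => bool" where
  "allowed k g \<longleftrightarrow> g <= H - 12 & 10 ^ H * B k <= T g"

definition best :: "(nat => nat => nat) => nat => nat => bool" where
  "best q k g \<longleftrightarrow> allowed k g & (ALL g'. allowed k g' --> cost q k g <= cost q k g')"

text \<open>Equal to \<open>9000 * Bc * n\<close>. This is the number of rounds for which the
  potential bound \<open>Sx * (45 * n * Bc)\<close> becomes \<open>(Sx / 10) ^ 2 / 2\<close>, so
  that every queue ends below \<open>Sx / 10\<close>.\<close>

definition Sx :: nat where "Sx = 9000 * N * H * n * n * n"

text \<open>The fractional solution is the average of the integral choices:
  \<open>y Gs k g / Sx\<close> is the part of coflow \<open>k\<close> completed by grid point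
  \<open>g\<close>.\<close>

definition y :: "(nat => nat => nat) => nat => nat => nat" where
  "y Gs k g = (\<Sum>s<Sx. of_bool (Gs s k <= g))"

definition \<tau> :: "nat => real" where "\<tau> g = (11 / 10) ^ g"

section \<open>Arithmetic of the time grid\<close>

lemma T_eq: "g <= H ==> real (T g) = 10 ^ H * \<tau> g"
proof -
  assume "g <= H"
  then have "(10::real) ^ H = 10 ^ (H - g) * 10 ^ g" by (simp flip: power_add)
  then show ?thesis by (simp add: T_def \<tau>_def power_divide)
qed

lemma T_pos: "0 < T g"
  by (simp add: T_def)

lemma \<tau>_pos: "0 < \<tau> g"
  by (simp add: \<tau>_def)

lemma \<tau>_mono: "g <= g' ==> \<tau> g <= \<tau> g'"
  unfolding \<tau>_def by (intro power_increasing) auto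

text \<open>Since \<open>T g\<close> times \<open>11 ^ (H - g) * 10 ^ g\<close> is
  \<open>110 ^ H\<close>, the integer divisions in \<open>cost\<close> are exact.\<close>

lemma T_div: "g <= H ==> real (110 ^ H div T g) = 110 ^ H / T g"
proof -
  assume g: "g <= H"
  have "T g * (11 ^ (H - g) * 10 ^ g) = 11 ^ (g + (H - g)) * 10 ^ ((H - g) + g)"
    unfolding T_def power_add by (simp add: algebra_simps)
  also have "... = 110 ^ H"
    using g by (simp flip: power_mult_distrib)
  finally have "T g dvd 110 ^ H" by (metis dvd_triv_left)
  then show ?thesis by (simp add: real_of_nat_div)
qed

lemma top_real: "k < n ==> real n * B k <= \<tau> (H - 12)"
proof -
  assume "k < n"
  then have "real (n * B k * 10 ^ (H - 12)) <= real (11 ^ (H - 12))"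
    using top of_nat_le_iff by blast
  then show ?thesis by (simp add: \<tau>_def power_divide field_simps)
qed

lemma B_le_top: "k < n ==> real (B k) <= \<tau> (H - 12)"
  using top_real[of k] n mult_right_mono[of 1 "real n" "real (B k)"] by auto

lemma allowed_iff: "allowed k g \<longleftrightarrow> g <= H - 12 & real (B k) <= \<tau> g"
proof (cases "g <= H - 12")
  case True
  then have g: "g <= H" by simp
  have "10 ^ H * B k <= T g \<longleftrightarrow> real (10 ^ H * B k) <= real (T g)" by (simp only: of_nat_le_iff)
  also have "... \<longleftrightarrow> real (B k) <= \<tau> g" by (simp add: T_eq[OF g])
  finally show ?thesis by (simp add: allowed_def)
qed (simp add: allowed_def)

lemma lam_pos: "0 < real lam"
  unfolding of_nat_0_less_iff by (simp add: lam_def)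

section \<open>Analysis of the drift-plus-penalty iteration\<close>

context
  fixes Gs :: "nat => nat => nat"
  assumes best: "!!s k. s < Sx ==> k < n ==> best (queue Gs s) k (Gs s k)"
begin

definition Q :: "nat => nat => nat => real" where
  "Q s p g = queue Gs s p g / T g"

definition viol :: "(nat => nat) => nat => nat => real" where
  "viol G p g = load G p g / \<tau> g - 1"

text \<open>The weight of the penalty. With the factor 40 the optimality gap \<open>Bc / Vw\<close>
  is at most 1/20 of the weighted lower bounds whenever their sum is at least 1.\<close>

definition Vw :: real where "Vw = 40 * Bc * 10 ^ H / lam"

definition rcost :: "nat => nat => nat => real" where
  "rcost s k g = Vw * W k * \<tau> g + (\<Sum>g'\<in>{g..<H}. \<Sum>p<2*N. Q s p g' * L p k / \<tau> g')"

definition obj :: "(nat => nat) => real" where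
  "obj G = (\<Sum>k<n. W k * \<tau> (G k))"

definition potential :: "nat => real" where
  "potential s = (\<Sum>g<H. \<Sum>p<2*N. (Q s p g)\<^sup>2) / 2"

lemma Q_nonneg: "0 <= Q s p g"
  by (simp add: Q_def)

lemma Q_Suc: "g < H ==> Q (Suc s) p g = max 0 (Q s p g + viol (Gs s) p g)"
proof -
  assume g: "g < H"
  let ?a = "queue Gs s p g + 10 ^ H * load (Gs s) p g"
  have "real (a - b) = max 0 (real a - real b)" for a b :: nat
    by (cases "b <= a") (auto simp: of_nat_diff max_def)
  then have "Q (Suc s) p g = max 0 (real ?a - real (T g)) / T g"
    unfolding Q_def queue.simps by metis
  also have "... = max 0 ((real ?a - real (T g)) / T g)"
    by (simp add: max_divide_distrib_right)
  also have "(real ?a - real (T g)) / T g = Q s p g + viol (Gs s) p g"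
    using g T_pos[of g] \<tau>_pos[of g] by (simp add: Q_def viol_def T_eq field_simps)
  finally show ?thesis .
qed

lemma cost_eq: "g <= H ==> real (cost (queue Gs s) k g) = real lam * 110 ^ H * 110 ^ H * rcost s k g"
proof -
  assume g: "g <= H"
  have "real (40 * Bc * 110 ^ H * 110 ^ H * W k * T g) = real lam * 110 ^ H * 110 ^ H * (Vw * W k * \<tau> g)"
    using lam_pos by (simp add: Vw_def T_eq[OF g])
  moreover have "real (lam * 10 ^ H * (\<Sum>g'\<in>{g..<H}. (\<Sum>p<2*N. queue Gs s p g' * L p k) * (110 ^ H div T g') * (110 ^ H div T g')))
     = real lam * 110 ^ H * 110 ^ H * (\<Sum>g'\<in>{g..<H}. \<Sum>p<2*N. Q s p g' * L p k / \<tau> g')"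
  proof -
    have "10 ^ H * (real (\<Sum>p<2*N. queue Gs s p g' * L p k) * (110 ^ H div T g') * (110 ^ H div T g'))
        = 110 ^ H * 110 ^ H * (\<Sum>p<2*N. Q s p g' * L p k / \<tau> g')" if "g' \<in> {g..<H}" for g'
      using that T_pos[of g'] \<tau>_pos[of g']
      by (simp add: T_div Q_def sum_distrib_left sum_distrib_right sum_divide_distrib T_eq field_simps)
    moreover define f where "f g' = (\<Sum>p<2*N. queue Gs s p g' * L p k) * (110 ^ H div T g') * (110 ^ H div T g')" for g'
    moreover define h where "h g' = (\<Sum>p<2*N. Q s p g' * L p k / \<tau> g')" for g'
    ultimately have eq: "10 ^ H * real (f g') = 110 ^ H * 110 ^ H * h g'" if "g' \<in> {g..<H}" for g'
      using that by simp
    have "real (lam * 10 ^ H * (\<Sum>g'\<in>{g..<H}. f g')) = real lam * (\<Sum>g'\<in>{g..<H}. 10 ^ H * real (f g'))"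
      by (simp add: sum_distrib_left mult.assoc)
    also have "... = real lam * (\<Sum>g'\<in>{g..<H}. 110 ^ H * 110 ^ H * h g')"
      using eq by simp
    also have "... = real lam * 110 ^ H * 110 ^ H * (\<Sum>g'\<in>{g..<H}. h g')"
      by (simp add: sum_distrib_left mult.assoc)
    finally show ?thesis by (simp only: f_def h_def)
  qed
  ultimately show ?thesis
    unfolding cost_def rcost_def by (simp only: of_nat_add distrib_left)
qed

lemma rcost_best:
  assumes "s < Sx" "k < n" "allowed k g"
  shows "rcost s k (Gs s k) <= rcost s k g"
proof -
  have "cost (queue Gs s) k (Gs s k) <= cost (queue Gs s) k g" "Gs s k <= H" "g <= H"
    using best[OF assms(1,2)] assms(3) by (auto simp: best_def allowed_def)
  then have "real lam * 110 ^ H * 110 ^ H * rcost s k (Gs s k) <= real lam * 110 ^ H * 110 ^ H * rcost s k g"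
    by (metis cost_eq of_nat_le_iff)
  moreover have "0 < real lam * 110 ^ H * 110 ^ H" using lam_pos by simp
  ultimately show ?thesis using mult_le_cancel_left_pos by blast
qed

text \<open>A coflow with chosen point \<open>G k\<close> loads all later grid points, so the
  queue-weighted load splits into one term per coflow. This is why minimising for each coflow
  separately minimises the whole drift bound.\<close>

lemma queue_load:
  assumes "!!k. k < n ==> G k <= H"
  shows "(\<Sum>g<H. \<Sum>p<2*N. Q s p g * (load G p g / \<tau> g)) = (\<Sum>k<n. rcost s k (G k)) - Vw * obj G"
proof -
  have "(\<Sum>g<H. \<Sum>p<2*N. Q s p g * (load G p g / \<tau> g))
     = (\<Sum>g<H. \<Sum>p<2*N. \<Sum>k<n. Q s p g * L p k / \<tau> g * of_bool (G k <= g))"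
    by (simp add: load_def sum_distrib_left sum_divide_distrib mult_ac
        del: sum_mult_of_bool_eq sum_of_bool_mult_eq)
  also have "... = (\<Sum>k<n. \<Sum>g<H. \<Sum>p<2*N. Q s p g * L p k / \<tau> g * of_bool (G k <= g))"
    by (subst (2) sum.swap, subst sum.swap) simp
  also have "... = (\<Sum>k<n. \<Sum>g\<in>{G k..<H}. \<Sum>p<2*N. Q s p g * L p k / \<tau> g)"
  proof (rule sum.cong[OF refl])
    fix k
    have "(\<Sum>g<H. \<Sum>p<2*N. Q s p g * L p k / \<tau> g * of_bool (G k <= g)) =
       (\<Sum>g\<in>{G k..<H}. \<Sum>p<2*N. Q s p g * L p k / \<tau> g * of_bool (G k <= g))"
      by (rule sum.mono_neutral_right) auto
    then show "(\<Sum>g<H. \<Sum>p<2*N. Q s p g * L p k / \<tau> g * of_bool (G k <= g)) =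
       (\<Sum>g\<in>{G k..<H}. \<Sum>p<2*N. Q s p g * L p k / \<tau> g)" by simp
  qed
  also have "... = (\<Sum>k<n. rcost s k (G k)) - Vw * obj G"
    by (simp add: rcost_def obj_def sum.distrib sum_distrib_left mult.assoc)
  finally show ?thesis .
qed

text \<open>A chosen point is allowed, so every coflow counted at \<open>g\<close> contributes at
  most \<open>B k <= \<tau> g\<close>. The relative load is thus between 0 and
  \<open>n\<close>.\<close>

lemma viol_bound:
  assumes "s < Sx" "g < H" "p < 2 * N"
  shows "(viol (Gs s) p g)\<^sup>2 <= real n * n"
proof -
  have "real (load (Gs s) p g) <= (\<Sum>k<n. \<tau> g)"
    unfolding load_def of_nat_sum
  proof (intro sum_mono)
    fix k assume "k \<in> {..<n}"
    then have k: "k < n" by simp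
    have "real (B k) <= \<tau> (Gs s k)"
      using best[OF assms(1) k] by (simp add: best_def allowed_iff)
    then show "real (L p k * of_bool (Gs s k <= g)) <= \<tau> g"
      using L_le[OF assms(3) k] \<tau>_mono[of "Gs s k" g] \<tau>_pos[of g]
      by (cases "Gs s k <= g") (simp_all add: order_trans)
  qed
  then have "real (load (Gs s) p g) / \<tau> g <= n"
    using \<tau>_pos[of g] by (simp add: field_simps)
  moreover have "0 <= real (load (Gs s) p g) / \<tau> g" using \<tau>_pos[of g] by simp
  moreover have "1 <= real n" using n by simp
  ultimately have "\<bar>viol (Gs s) p g\<bar> <= n" unfolding viol_def by linarith
  then have "\<bar>viol (Gs s) p g\<bar>\<^sup>2 <= (real n)\<^sup>2" by (intro power_mono) auto
  then show ?thesis by (simp add: power2_eq_square)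
qed

text \<open>Squaring the queue recursion bounds the drift by the queue-weighted violation plus
  \<open>Bc\<close>. As the chosen points minimise penalty plus queue-weighted load, they can be
  replaced by the feasible choice \<open>G\<close>, whose violation is nowhere positive.\<close>

lemma potential_step:
  assumes s: "s < Sx"
    and G: "!!k. k < n ==> allowed k (G k)"
    and feas: "!!p g. p < 2 * N ==> g < H ==> load G p g <= \<tau> g"
  shows "potential (Suc s) + Vw * obj (Gs s) <= potential s + Bc + Vw * obj G"
proof -
  let ?v = "viol (Gs s)"
  have "(Q (Suc s) p g)\<^sup>2 <= (Q s p g)\<^sup>2 + 2 * (Q s p g * ?v p g) + real n * n" if "g < H" "p < 2 * N" for p g
  proof -
    have "(Q (Suc s) p g)\<^sup>2 <= (Q s p g + ?v p g)\<^sup>2"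
      unfolding Q_Suc[OF that(1)] by (simp add: max_def power2_le_iff_abs_le)
    then show ?thesis using viol_bound[OF s that] by (simp add: power2_sum)
  qed
  then have "2 * potential (Suc s) <= (\<Sum>g<H. \<Sum>p<2*N. (Q s p g)\<^sup>2 + 2 * (Q s p g * ?v p g) + real n * n)"
    unfolding potential_def by (simp, intro sum_mono) auto
  also have "... = 2 * potential s + 2 * (\<Sum>g<H. \<Sum>p<2*N. Q s p g * ?v p g) + 2 * Bc"
    by (simp add: potential_def Bc_def sum.distrib flip: sum_distrib_left)
  also have "(\<Sum>g<H. \<Sum>p<2*N. Q s p g * ?v p g) =
     (\<Sum>g<H. \<Sum>p<2*N. Q s p g * (load (Gs s) p g / \<tau> g)) - (\<Sum>g<H. \<Sum>p<2*N. Q s p g)"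
    by (simp add: viol_def algebra_simps sum_subtractf)
  also have "(\<Sum>g<H. \<Sum>p<2*N. Q s p g * (load (Gs s) p g / \<tau> g)) = (\<Sum>k<n. rcost s k (Gs s k)) - Vw * obj (Gs s)"
  proof (rule queue_load)
    show "Gs s k <= H" if "k < n" for k using best[OF s that] by (auto simp: best_def allowed_def intro: order_trans)
  qed
  finally have 1: "2 * potential (Suc s) <= 2 * potential s +
      2 * ((\<Sum>k<n. rcost s k (Gs s k)) - Vw * obj (Gs s) - (\<Sum>g<H. \<Sum>p<2*N. Q s p g)) + 2 * Bc" .
  have 2: "(\<Sum>k<n. rcost s k (Gs s k)) <= (\<Sum>k<n. rcost s k (G k))"
    using G by (intro sum_mono rcost_best[OF s]) auto
  have 3: "(\<Sum>g<H. \<Sum>p<2*N. Q s p g * (load G p g / \<tau> g)) = (\<Sum>k<n. rcost s k (G k)) - Vw * obj G"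
  proof (rule queue_load)
    show "G k <= H" if "k < n" for k using G[OF that] by (auto simp: allowed_def)
  qed
  have "Q s p g * (load G p g / \<tau> g) <= Q s p g * 1" if "g < H" "p < 2 * N" for p g
    using feas[OF that(2,1)] \<tau>_pos[of g] Q_nonneg by (intro mult_left_mono) auto
  then have 4: "(\<Sum>g<H. \<Sum>p<2*N. Q s p g * (load G p g / \<tau> g)) <= (\<Sum>g<H. \<Sum>p<2*N. Q s p g)"
    by (intro sum_mono) force
  from 1 2 3 4 show ?thesis by (simp add: algebra_simps)
qed

lemma potential_total:
  assumes "!!k. k < n ==> allowed k (G k)"
    and "!!p g. p < 2 * N ==> g < H ==> load G p g <= \<tau> g"
  shows "potential Sx + Vw * (\<Sum>s<Sx. obj (Gs s)) <= Sx * (Bc + Vw * obj G)"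
proof -
  have "potential s + Vw * (\<Sum>s<s. obj (Gs s)) <= s * (Bc + Vw * obj G)" if "s <= Sx" for s
    using that
  proof (induction s)
    case 0
    then show ?case by (simp add: potential_def Q_def)
  next
    case (Suc s)
    then show ?case
      using potential_step[of s G, OF _ assms] by (simp add: algebra_simps)
  qed
  then show ?thesis by blast
qed

lemma Bc_pos: "0 < Bc"
  using N n H by (simp add: Bc_def)

lemma Vw_pos: "0 < Vw"
  using Bc_pos lam_pos by (simp add: Vw_def)

lemma Sx_eq: "Sx = 9000 * Bc * n"
  by (simp add: Sx_def Bc_def)

lemma Sx_pos: "0 < Sx"
  using Bc_pos n by (simp add: Sx_eq)

lemma obj_nonneg: "0 <= obj G"
  unfolding obj_def using \<tau>_pos by (intro sum_nonneg mult_nonneg_nonneg) (auto intro: less_imp_le)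

text \<open>Rounding up to the grid loses at most its ratio, because the preceding point is still
  below \<open>c\<close>. At the first point this holds because \<open>c\<close> is at least
  1.\<close>

lemma first_grid_point:
  assumes "1 <= c" "!!g'. g' < g ==> \<tau> g' < c"
  shows "g = 0 \<or> \<tau> g <= 11 / 10 * c" "g = 0 ==> \<tau> g <= 11 / 10 * c"
proof -
  show "g = 0 \<or> \<tau> g <= 11 / 10 * c"
    using assms(2)[of "g - 1"] by (cases g) (auto simp: \<tau>_def)
  show "g = 0 ==> \<tau> g <= 11 / 10 * c"
    using assms(1) by (simp add: \<tau>_def)
qed

text \<open>The final potential is compared with a crude feasible choice. Its objective may be a
  factor \<open>n\<close> too large, which the number of rounds absorbs; only the penalised average
  has to be nearly optimal, and that is shown separately.\<close>

lemma queue_bound: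
  assumes "p < 2 * N" "g < H"
  shows "Q Sx p g <= Sx / 10"
proof -
  \<comment> \<open>A choice that is feasible for trivial reasons: at every grid point each coflow
    takes at most an \<open>n\<close>-th of the capacity.\<close>
  define G where "G k = (LEAST g. real n * B k <= \<tau> g)" for k
  have G: "real n * B k <= \<tau> (G k)" "G k <= H - 12" if "k < n" for k
    unfolding G_def using top_real[OF that] by (auto intro: LeastI Least_le)
  have G_less: "g < G k ==> \<tau> g < real n * B k" for g k
    unfolding G_def using not_less_Least not_le by blast
  have "allowed k (G k)" if "k < n" for k
    using G[OF that] n mult_right_mono[of 1 "real n" "real (B k)"] by (auto simp: allowed_iff)
  moreover have "real (load G p g) <= \<tau> g" if "p < 2 * N" "g < H" for p g
  proof -
    have "real (L p k * of_bool (G k <= g)) <= \<tau> g / n" if k: "k < n" for k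
    proof (cases "G k <= g")
      case True
      have "real n * L p k <= real n * B k" using L_le[OF \<open>p < 2 * N\<close> k] by (intro mult_left_mono) auto
      also have "... <= \<tau> g" using G(1)[OF k] \<tau>_mono[OF True] by linarith
      finally show ?thesis using True n by (simp add: field_simps)
    qed (use \<tau>_pos[of g] in simp)
    then have "real (load G p g) <= (\<Sum>k<n. \<tau> g / n)"
      unfolding load_def of_nat_sum by (intro sum_mono) auto
    then show ?thesis using n by simp
  qed
  ultimately have "potential Sx + Vw * (\<Sum>s<Sx. obj (Gs s)) <= Sx * (Bc + Vw * obj G)"
    by (rule potential_total)
  moreover have "0 <= Vw * (\<Sum>s<Sx. obj (Gs s))"
    using Vw_pos obj_nonneg by (intro mult_nonneg_nonneg sum_nonneg) auto
  ultimately have "potential Sx <= Sx * (Bc + Vw * obj G)" by linarith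
  \<comment> \<open>The 44 is the 40 of \<open>Vw\<close> times 11/10 for rounding up to the grid;
    the remaining quotient by \<open>lam\<close> is at most 1.\<close>
  also have "Vw * obj G <= 44 * n * Bc"
  proof -
    have "obj G <= (\<Sum>k<n. 11 / 10 * n * (real (W k) * B k))"
      unfolding obj_def
    proof (intro sum_mono)
      fix k assume "k \<in> {..<n}"
      then have k: "k < n" by simp
      show "W k * \<tau> (G k) <= 11 / 10 * n * (real (W k) * B k)"
      proof (cases "W k = 0")
        case False
        then have "1 <= n * B k" using WB[OF k] n by (simp add: Suc_leI)
        then have "1 <= real n * B k" by (metis of_nat_1 of_nat_le_iff of_nat_mult)
        then have "\<tau> (G k) <= 11 / 10 * (real n * B k)"
          using first_grid_point[of "real n * B k" "G k", OF _ G_less] by blast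
        then have "W k * \<tau> (G k) <= W k * (11 / 10 * (real n * B k))" by (intro mult_left_mono) auto
        then show ?thesis by (simp add: mult_ac)
      qed simp
    qed
    also have "... = 11 / 10 * n * real (\<Sum>k<n. W k * B k)"
      by (simp add: sum_distrib_left)
    finally have "Vw * obj G <= Vw * (11 / 10 * n * real (\<Sum>k<n. W k * B k))"
      using Vw_pos by (intro mult_left_mono) auto
    also have "... = 44 * n * Bc * (10 ^ H * real (\<Sum>k<n. W k * B k) / lam)"
      by (simp add: Vw_def)
    also have "... <= real (44 * n * Bc) * 1"
    proof (intro mult_left_mono)
      define z where "z = (\<Sum>k<n. W k * B k)"
      show "10 ^ H * real (\<Sum>k<n. W k * B k) / lam <= 1"
        using lam_pos unfolding lam_def z_def[symmetric] by simp
    qed simp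
    finally show ?thesis by simp
  qed
  finally have "potential Sx <= Sx * (Bc + 44 * n * Bc)" by (simp add: mult_left_mono)
  also have "... <= Sx * (45 * n * Bc)"
    unfolding of_nat_le_iff using mult_le_mono1[OF n, of Bc] by (intro mult_le_mono2) simp
  also have "... = (Sx / 10)\<^sup>2 / 2"
    by (simp add: Sx_eq power2_eq_square)
  finally have "potential Sx <= (Sx / 10)\<^sup>2 / 2" .
  moreover have "(Q Sx p g)\<^sup>2 <= 2 * potential Sx"
  proof -
    have "(Q Sx p g)\<^sup>2 <= (\<Sum>p<2*N. (Q Sx p g)\<^sup>2)" using assms by (intro member_le_sum) auto
    also have "... <= (\<Sum>g<H. \<Sum>p<2*N. (Q Sx p g)\<^sup>2)"
      using assms by (intro member_le_sum[of g "{..<H}" "%g. \<Sum>p<2*N. (Q Sx p g)\<^sup>2"] sum_nonneg) auto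
    finally show ?thesis by (simp add: potential_def)
  qed
  ultimately have "(Q Sx p g)\<^sup>2 <= (Sx / 10)\<^sup>2" by linarith
  then show ?thesis by (rule power2_le_imp_le) simp
qed

text \<open>Reflection at 0 only raises a queue, so it dominates the accumulated violation.\<close>

lemma sum_viol_le: "g < H ==> (\<Sum>s<s'. viol (Gs s) p g) <= Q s' p g"
  by (induction s') (auto simp: Q_Suc, simp add: Q_def)

text \<open>The average violation is at most the final queue divided by the number of rounds, hence
  at most 1/10.\<close>

theorem fractional_load:
  assumes "p < 2 * N" "g < H"
  shows "10 * 10 ^ H * (\<Sum>k<n. L p k * y Gs k g) <= 11 * Sx * T g"
proof -
  have "(\<Sum>k<n. L p k * y Gs k g) = (\<Sum>s<Sx. load (Gs s) p g)"
    unfolding y_def load_def sum_distrib_left by (rule sum.swap)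
  then have "real (\<Sum>k<n. L p k * y Gs k g) / \<tau> g - Sx = (\<Sum>s<Sx. viol (Gs s) p g)"
    by (simp add: viol_def sum_subtractf sum_divide_distrib)
  also have "... <= Sx / 10"
    using sum_viol_le[OF assms(2)] queue_bound[OF assms] by (rule order_trans)
  finally have "10 * real (\<Sum>k<n. L p k * y Gs k g) <= 11 * Sx * \<tau> g"
    using \<tau>_pos[of g] by (simp add: field_simps)
  then have "10 ^ H * (10 * real (\<Sum>k<n. L p k * y Gs k g)) <= 10 ^ H * (11 * Sx * \<tau> g)"
    by (intro mult_left_mono) auto
  then have "real (10 * 10 ^ H * (\<Sum>k<n. L p k * y Gs k g)) <= real (11 * Sx * T g)"
    using assms by (simp add: T_eq mult_ac)
  then show ?thesis by (simp only: of_nat_le_iff)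
qed

text \<open>The mean of the chosen grid points, rounded up by means of \<open>Sx - 1\<close>, plus
  12.\<close>

definition finish_index :: "nat => nat" where
  "finish_index k = 12 + ((\<Sum>s<Sx. Gs s k) + (Sx - 1)) div Sx"

lemma finish_index_le: "k < n ==> finish_index k <= H"
proof -
  assume k: "k < n"
  have "(\<Sum>s<Sx. Gs s k) <= (\<Sum>s<Sx. H - 12)"
    using best k by (intro sum_mono) (auto simp: best_def allowed_def)
  then have "(\<Sum>s<Sx. Gs s k) + (Sx - 1) <= Sx * (H - 12) + (Sx - 1)" by simp
  then have "((\<Sum>s<Sx. Gs s k) + (Sx - 1)) div Sx <= (Sx * (H - 12) + (Sx - 1)) div Sx"
    by (rule div_le_mono)
  also have "... = ((Sx - 1) + Sx * (H - 12)) div Sx" by (simp only: add.commute)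
  also have "... = H - 12" using Sx_pos by (subst div_mult_self2) auto
  finally show ?thesis using H by (simp add: finish_index_def)
qed

lemma sum_G_le: "(\<Sum>s<Sx. Gs s k) <= Sx * (finish_index k - 12)"
proof -
  have "(\<Sum>s<Sx. Gs s k) + (Sx - 1) = Sx * (((\<Sum>s<Sx. Gs s k) + (Sx - 1)) div Sx) + ((\<Sum>s<Sx. Gs s k) + (Sx - 1)) mod Sx"
    by simp
  also have "... <= Sx * (((\<Sum>s<Sx. Gs s k) + (Sx - 1)) div Sx) + (Sx - 1)"
    using mod_less_divisor[OF Sx_pos, of "(\<Sum>s<Sx. Gs s k) + (Sx - 1)"] by linarith
  finally show ?thesis by (simp add: finish_index_def)
qed

text \<open>A round with choice \<open>G\<close> counts for at least \<open>e - G\<close> of the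
  first \<open>e\<close> grid points. Summed over the rounds this is at least \<open>Sx\<close>
  times the distance of \<open>e\<close> from the mean, which is 12 or more.\<close>

theorem finish_index_enough: "12 * Sx <= (\<Sum>g<finish_index k. y Gs k g)"
proof -
  let ?e = "finish_index k"
  have "Sx * ?e = (\<Sum>s<Sx. ?e)" by simp
  also have "... <= (\<Sum>s<Sx. Gs s k + (\<Sum>g<?e. of_bool (Gs s k <= g)))"
  proof (intro sum_mono)
    fix s
    have "(\<Sum>g<?e. of_bool (Gs s k <= g)) = card {g. g < ?e & Gs s k <= g}"
      by (simp add: of_bool_def sum.If_cases Int_def)
    also have "{g. g < ?e & Gs s k <= g} = {Gs s k..<?e}" by auto
    finally show "?e <= Gs s k + (\<Sum>g<?e. of_bool (Gs s k <= g))" by simp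
  qed
  also have "... = (\<Sum>s<Sx. Gs s k) + (\<Sum>g<?e. y Gs k g)"
    unfolding y_def sum.distrib by (subst (2) sum.swap) simp
  also have "... <= Sx * (?e - 12) + (\<Sum>g<?e. y Gs k g)"
    using sum_G_le by simp
  finally have "Sx * ?e <= Sx * (?e - 12) + (\<Sum>g<?e. y Gs k g)" .
  moreover have "Sx * ?e = Sx * (?e - 12) + 12 * Sx"
    by (simp add: finish_index_def algebra_simps)
  ultimately show ?thesis by linarith
qed

text \<open>The geometric mean of the chosen grid points is at most their arithmetic mean.\<close>

lemma finish_time_le: "\<tau> (finish_index k) * Sx <= (11 / 10) ^ 13 * (\<Sum>s<Sx. \<tau> (Gs s k))"
proof -
  define a where "a = (\<Sum>s<Sx. real (Gs s k)) / Sx"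
  \<comment> \<open>The tangent of the exponential at the mean \<open>a\<close>; the linear terms
    cancel when summed over the rounds.\<close>
  have ge: "(11 / 10) powr a * (1 + (real (Gs s k) - a) * ln (11 / 10)) <= \<tau> (Gs s k)" for s
  proof -
    have "1 + (real (Gs s k) - a) * ln (11 / 10) <= exp ((real (Gs s k) - a) * ln (11 / 10))"
      by (rule exp_ge_add_one_self)
    also have "... = (11 / 10) powr (real (Gs s k) - a)"
      by (simp add: powr_def)
    finally have "(11 / 10) powr a * (1 + (real (Gs s k) - a) * ln (11 / 10)) <= (11 / 10) powr a * (11 / 10) powr (real (Gs s k) - a)"
      by (intro mult_left_mono) auto
    also have "... = \<tau> (Gs s k)"
      by (simp add: \<tau>_def powr_realpow flip: powr_add)
    finally show ?thesis .
  qed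
  have "(11 / 10) powr a * Sx = (\<Sum>s<Sx. (11 / 10) powr a * (1 + (real (Gs s k) - a) * ln (11 / 10)))"
  proof -
    have "(\<Sum>s<Sx. (real (Gs s k) - a)) = 0"
      using Sx_pos by (simp add: sum_subtractf a_def)
    then have "(\<Sum>s<Sx. (real (Gs s k) - a) * ln (11 / 10)) = 0"
      by (simp flip: sum_distrib_right)
    then show ?thesis by (simp add: sum.distrib flip: sum_distrib_left)
  qed
  also have "... <= (\<Sum>s<Sx. \<tau> (Gs s k))" using ge by (intro sum_mono)
  finally have 1: "(11 / 10) powr a * Sx <= (\<Sum>s<Sx. \<tau> (Gs s k))" .
  \<comment> \<open>12 by definition, and 1 for rounding the mean up.\<close>
  have "real (finish_index k) <= 13 + a"
  proof -
    have "Sx * (((\<Sum>s<Sx. Gs s k) + (Sx - 1)) div Sx) <= (\<Sum>s<Sx. Gs s k) + Sx"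
      using times_div_less_eq_dividend[of Sx "(\<Sum>s<Sx. Gs s k) + (Sx - 1)"] by linarith
    then have "real (Sx * (((\<Sum>s<Sx. Gs s k) + (Sx - 1)) div Sx)) <= real ((\<Sum>s<Sx. Gs s k) + Sx)"
      by (simp only: of_nat_le_iff)
    then have "real (((\<Sum>s<Sx. Gs s k) + (Sx - 1)) div Sx) <= a + 1"
      using Sx_pos by (simp add: a_def field_simps)
    then show ?thesis by (simp add: finish_index_def)
  qed
  then have "(11 / 10) powr real (finish_index k) <= (11 / 10) powr (13 + a)"
    by (intro powr_mono) auto
  also have "... = (11 / 10) ^ 13 * (11 / 10) powr a"
    by (simp add: powr_add powr_numeral)
  finally have "\<tau> (finish_index k) <= (11 / 10) ^ 13 * (11 / 10) powr a"
    by (simp add: \<tau>_def powr_realpow)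
  then have "\<tau> (finish_index k) * Sx <= (11 / 10) ^ 13 * (11 / 10) powr a * Sx"
    by (rule mult_right_mono) simp
  also have "... <= (11 / 10) ^ 13 * (\<Sum>s<Sx. \<tau> (Gs s k))"
    using 1 by (simp add: mult.assoc)
  finally show ?thesis .
qed

text \<open>The completion times \<open>C\<close>, rounded up to the grid, are a feasible choice, so
  the average objective of the rounds exceeds theirs by at most the gap \<open>Bc / Vw\<close>.
  Jensen's inequality then passes from the chosen points to the finish index.\<close>

theorem finish_cost:
  fixes C :: "nat => real"
  assumes CB: "!!k. k < n ==> B k <= C k"
    and C: "!!(t::real) p. 0 <= t ==> p < 2 * N ==> real (\<Sum>k | k < n & C k <= t. L p k) <= t"
  shows "(\<Sum>k<n. W k * \<tau> (finish_index k)) <= 4 * (\<Sum>k<n. W k * C k)"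
proof -
  \<comment> \<open>\<open>C k\<close> is unbounded, so the rounded times are capped at the last
    allowed point.\<close>
  define G where "G k = (LEAST g. C k <= \<tau> g \<or> g = H - 12)" for k
  have G: "C k <= \<tau> (G k) \<or> G k = H - 12" "G k <= H - 12" for k
    unfolding G_def by (rule LeastI[of _ "H - 12"], simp) (auto intro: Least_le)
  have G_less: "g < G k ==> \<tau> g < C k" for g k
    unfolding G_def using not_less_Least not_le by blast
  have "allowed k (G k)" if "k < n" for k
    using G[of k] CB[OF that] B_le_top[OF that] by (auto simp: allowed_iff)
  moreover have "real (load G p g) <= \<tau> g" if p: "p < 2 * N" and "g < H" for p g
  proof (cases "g < H - 12")
    case True
    have "load G p g = (\<Sum>k | k < n & G k <= g. L p k)"
      unfolding load_def by (simp add: of_bool_def if_distrib sum.If_cases Int_def cong: if_cong)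
    also have "... <= (\<Sum>k | k < n & C k <= \<tau> g. L p k)"
    proof (rule sum_mono2)
      show "{k. k < n & G k <= g} \<subseteq> {k. k < n & C k <= \<tau> g}"
        using G(1) True \<tau>_mono order_trans by fastforce
    qed auto
    finally have "real (load G p g) <= real (\<Sum>k | k < n & C k <= \<tau> g. L p k)"
      by (simp only: of_nat_le_iff)
    also have "... <= \<tau> g" using \<tau>_pos[of g] p by (intro C) auto
    finally show ?thesis .
  next
    case False
    \<comment> \<open>From the cap on all coflows fit together, since
      \<open>n * B k <= \<tau> (H - 12)\<close> for each of them.\<close>
    have "real (load G p g) <= (\<Sum>k<n. \<tau> (H - 12) / n)"
      unfolding load_def of_nat_sum
    proof (intro sum_mono)
      fix k assume "k \<in> {..<n}"
      then have k: "k < n" by simp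
      have "real (L p k * of_bool (G k <= g)) <= L p k" by simp
      also have "... <= B k" using L_le[OF p k] by simp
      also have "... <= \<tau> (H - 12) / n" using top_real[OF k] n by (simp add: field_simps)
      finally show "real (L p k * of_bool (G k <= g)) <= \<tau> (H - 12) / n" .
    qed
    also have "... = \<tau> (H - 12)" using n by simp
    also have "... <= \<tau> g" using False by (intro \<tau>_mono) auto
    finally show ?thesis .
  qed
  ultimately have "potential Sx + Vw * (\<Sum>s<Sx. obj (Gs s)) <= Sx * (Bc + Vw * obj G)"
    by (rule potential_total)
  moreover have "0 <= potential Sx" unfolding potential_def by (intro divide_nonneg_pos sum_nonneg) auto
  ultimately have "Vw * (\<Sum>s<Sx. obj (Gs s)) <= Vw * (Sx * (Bc / Vw + obj G))"
    using Vw_pos by (simp add: algebra_simps)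
  then have 1: "(\<Sum>s<Sx. obj (Gs s)) <= Sx * (Bc / Vw + obj G)"
    using Vw_pos by simp
  show ?thesis
  proof (cases "ALL k<n. W k = 0")
    case False
    define WBs where "WBs = (\<Sum>k<n. W k * B k)"
    from False obtain k where k: "k < n" "0 < W k" by auto
    have "W k * B k <= WBs" unfolding WBs_def using k by (intro member_le_sum) auto
    moreover have "0 < W k * B k" using k WB by simp
    ultimately have WBs: "1 <= WBs" by linarith
    \<comment> \<open>The gap of the iteration. The sum of the weighted bounds is a positive integer
      here, which absorbs the 1 in \<open>lam\<close>.\<close>
    have "Bc / Vw = lam / (40 * 10 ^ H)"
      using Bc_pos by (simp add: Vw_def)
    also have "... = (real WBs + 1 / 10 ^ H) / 40"
      by (simp add: lam_def WBs_def field_simps)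
    also have "... <= WBs / 20"
    proof -
      have "1 / 10 ^ H <= (1::real)" "1 <= real WBs" using WBs by simp_all
      moreover have "(w + u) / 40 <= w / 20" if "u <= 1" "1 <= w" for u w :: real
        using that by simp
      ultimately show ?thesis by blast
    qed
    also have "real WBs <= (\<Sum>k<n. W k * C k)"
      unfolding WBs_def of_nat_sum of_nat_mult using CB by (intro sum_mono mult_left_mono) auto
    finally have 2: "Bc / Vw <= (\<Sum>k<n. W k * C k) / 20" by simp
    have "obj G <= (\<Sum>k<n. 11 / 10 * (W k * C k))"
      unfolding obj_def
    proof (intro sum_mono)
      fix k assume "k \<in> {..<n}"
      then have k: "k < n" by simp
      show "W k * \<tau> (G k) <= 11 / 10 * (real (W k) * C k)"
      proof (cases "W k = 0")
        case False
        then have "1 <= B k" using WB[OF k] by (simp add: Suc_leI)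
        then have "1 <= C k" using CB[OF k] by linarith
        then have "\<tau> (G k) <= 11 / 10 * C k"
          using first_grid_point[of "C k" "G k", OF _ G_less] by blast
        then have "W k * \<tau> (G k) <= W k * (11 / 10 * C k)" by (intro mult_left_mono) auto
        then show ?thesis by (simp add: mult_ac)
      qed simp
    qed
    then have 3: "obj G <= 11 / 10 * (\<Sum>k<n. W k * C k)" by (simp add: sum_distrib_left)
    have "Sx * (\<Sum>k<n. W k * \<tau> (finish_index k)) = (\<Sum>k<n. W k * (\<tau> (finish_index k) * Sx))"
      by (simp add: sum_distrib_left mult_ac)
    also have "... <= (\<Sum>k<n. W k * ((11 / 10) ^ 13 * (\<Sum>s<Sx. \<tau> (Gs s k))))"
      by (intro sum_mono mult_left_mono finish_time_le) auto
    also have "... = (11 / 10) ^ 13 * (\<Sum>k<n. \<Sum>s<Sx. W k * \<tau> (Gs s k))"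
      unfolding sum_distrib_left by (intro sum.cong refl) (simp add: mult_ac)
    also have "(\<Sum>k<n. \<Sum>s<Sx. W k * \<tau> (Gs s k)) = (\<Sum>s<Sx. obj (Gs s))"
      unfolding obj_def by (rule sum.swap)
    also have "(11 / 10) ^ 13 * ... <= (11 / 10) ^ 13 * (Sx * ((\<Sum>k<n. W k * C k) / 20 + 11 / 10 * (\<Sum>k<n. W k * C k)))"
      using 1 2 3 by (intro mult_left_mono order_trans[OF 1] add_mono) auto
    also have "... = Sx * ((11 / 10) ^ 13 * (23 / 20) * (\<Sum>k<n. W k * C k))"
      by (simp add: algebra_simps)
    also have "... <= Sx * (4 * (\<Sum>k<n. W k * C k))"
    proof (intro mult_left_mono mult_right_mono sum_nonneg mult_nonneg_nonneg)
      \<comment> \<open>The left side is about 3.97; 23/20 combines the gap 1/20 with the rounding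
        factor 11/10.\<close>
      show "(11 / 10) ^ 13 * (23 / 20) <= (4::real)" by (simp add: power_divide)
      fix k assume "k \<in> {..<n}"
      then show "0 <= C k" using CB[of k] by (simp add: order_trans[rotated])
    qed auto
    finally show ?thesis using Sx_pos by simp
  qed simp
qed

end

end

section \<open>Instances with integral release times, sizes and weights\<close>

locale inst =
  fixes I :: coflow_instance
  assumes valid: "valid_instance I" and coflows_pos: "1 <= coflows I"
begin

abbreviation "N == ports I"
abbreviation "n == coflows I"
abbreviation "m == cores I"

definition "rn k = nat (fst (quotient_of (release I k)))"
definition "rd k = nat (snd (quotient_of (release I k)))"
definition "wn k = nat (fst (quotient_of (weight I k)))"
definition "wd k = nat (snd (quotient_of (weight I k)))"
text \<open>A product of denominators instead of their least common multiple: it takes no gcd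
  computation, and its bit length is at most the sum of theirs. Release times and weights are scaled
  independently.\<close>

definition "D = (\<Prod>k<n. rd k)"
definition "Dw = (\<Prod>k<n. wd k)"
definition "rho k = rn k * (D div rd k)"
definition "W k = wn k * (Dw div wd k)"
definition "dd i j k = D * demand I i j k"
text \<open>Sources are the ports below \<open>N\<close>, destinations those from \<open>N\<close>
  to \<open>2 * N - 1\<close>.\<close>

definition "L p k = (if p < N then \<Sum>j<N. dd p j k else \<Sum>i<N. dd i (p - N) k)"

lemma N_pos: "1 <= N" and m_pos: "1 <= m"
  using valid by (auto simp: valid_instance_def)

lemma rd_pos: "0 < rd k" and wd_pos: "0 < wd k"
  using quotient_of_denom_pos' by (auto simp: rd_def wd_def)

lemma D_pos: "0 < D" and Dw_pos: "0 < Dw"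
  using rd_pos wd_pos by (auto simp: D_def Dw_def)

lemma rat_of_nats:
  assumes "0 <= q"
  shows "real_of_rat q = real (nat (fst (quotient_of q))) / real (nat (snd (quotient_of q)))"
proof -
  obtain a b where ab: "quotient_of q = (a, b)" by (cases "quotient_of q")
  have b: "0 < b" using quotient_of_denom_pos[OF ab] .
  have q: "q = of_int a / of_int b" using quotient_of_div[OF ab] .
  then have "0 <= a" using assms b by (simp add: zero_le_divide_iff)
  then show ?thesis using b unfolding ab by (simp add: q of_rat_divide)
qed

lemma rho_eq: "k < n ==> real (rho k) = D * real_of_rat (release I k)"
proof -
  assume k: "k < n"
  have "rd k dvd D" unfolding D_def using k by (intro dvd_prodI) auto
  then have "real (D div rd k) = real D / rd k" by (simp add: real_of_nat_div)
  moreover have "0 <= release I k" using valid k by (simp add: valid_instance_def)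
  ultimately show ?thesis by (simp add: rat_of_nats rho_def rn_def rd_def)
qed

lemma W_eq: "k < n ==> real (W k) = Dw * real_of_rat (weight I k)"
proof -
  assume k: "k < n"
  have "wd k dvd Dw" unfolding Dw_def using k by (intro dvd_prodI) auto
  then have "real (Dw div wd k) = real Dw / wd k" by (simp add: real_of_nat_div)
  moreover have "0 <= weight I k" using valid k by (simp add: valid_instance_def less_imp_le)
  ultimately show ?thesis by (simp add: rat_of_nats W_def wn_def wd_def)
qed

text \<open>All that is ever used about a competing schedule. Both algorithms are compared with
  arbitrary numbers \<open>C\<close> that satisfy these conditions.\<close>

definition lower_bounds :: "(nat => real) => bool" where
  "lower_bounds C \<longleftrightarrow>
    (ALL t::real. 0 <= t --> (ALL p<2*N. real (\<Sum>k | k < n & C k <= t. L p k) <= m * t)) &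
    (ALL k<n. ALL i<N. ALL j<N. real (rho k + dd i j k) <= C k)"

lemma lower_bounds_feasible:
  assumes x: "feasible I x"
  shows "lower_bounds (%k. D * completion_time I x k)"
  unfolding lower_bounds_def
proof (intro conjI allI impI)
  fix t :: real and p
  assume t: "0 <= t" and p: "p < 2 * N"
  define A where "A = {k. k < n & D * completion_time I x k <= t}"
  \<comment> \<open>The flows through port \<open>p\<close> of the coflows completed by
    \<open>t\<close>; any two of them share this port.\<close>
  define F where "F = (if p < N then {p} \<times> {..<N} \<times> A else {..<N} \<times> {p - N} \<times> A)"
  have F: "F \<subseteq> flows I" using p by (auto simp: F_def A_def flows_def split: if_splits)
  have finA: "finite A" by (simp add: A_def)
  have "flow_finish I x f <= t / D" if "f \<in> F" for f
  proof -
    have "coflow_of f \<in> A" using that by (auto simp: F_def split: if_splits)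
    then have "completion_time I x (coflow_of f) <= t / D" using D_pos by (simp add: A_def field_simps)
    then show ?thesis using flow_finish_le_completion[of f I x] F that by auto
  qed
  then have "(\<Sum>f\<in>F. flow_size I f) <= m * (t / D)"
    using t F by (intro conflicting_flows_load[OF x]) (auto simp: F_def share_port_def split: if_splits)
  moreover have "real (\<Sum>k\<in>A. L p k) = D * (\<Sum>f\<in>F. flow_size I f)"
  proof (cases "p < N")
    case True
    have "(\<Sum>f\<in>F. flow_size I f) = (\<Sum>j<N. \<Sum>k\<in>A. real (demand I p j k))"
      using True by (simp add: F_def flow_size_def sum.cartesian_product')
    also have "... = (\<Sum>k\<in>A. \<Sum>j<N. real (demand I p j k))" by (rule sum.swap)
    finally show ?thesis using True by (simp add: L_def dd_def sum_distrib_left)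
  next
    case False
    have "(\<Sum>f\<in>F. flow_size I f) = (\<Sum>i<N. \<Sum>k\<in>A. real (demand I i (p - N) k))"
      using False by (simp add: F_def flow_size_def sum.cartesian_product')
    also have "... = (\<Sum>k\<in>A. \<Sum>i<N. real (demand I i (p - N) k))" by (rule sum.swap)
    finally show ?thesis using False by (simp add: L_def dd_def sum_distrib_left)
  qed
  ultimately show "real (\<Sum>k | k < n & D * completion_time I x k <= t. L p k) <= m * t"
    using D_pos unfolding A_def[symmetric] by (simp add: field_simps)
next
  fix k i j
  assume k: "k < n" and i: "i < N" and j: "j < N"
  let ?f = "(i, j, k)"
  have f: "?f \<in> flows I" using k i j by (simp add: flows_def)
  have "flow_release I ?f + flow_size I ?f <= completion_time I x k"
    using flow_finish_ge[OF valid x f] flow_finish_le_completion[OF f, of x] by simp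
  then have "D * (flow_release I ?f + flow_size I ?f) <= D * completion_time I x k"
    using D_pos by (intro mult_left_mono) auto
  then show "real (rho k + dd i j k) <= D * completion_time I x k"
    using k by (simp add: rho_eq dd_def flow_release_def flow_size_def algebra_simps)
qed

subsection \<open>Integral schedules\<close>

text \<open>Times are measured in units of \<open>1 / (D * X)\<close>.\<close>

definition partial_schedule ::
    "nat => nat => (nat => nat) => (nat => flow) => (nat => nat) => (nat => nat) => bool" where
  "partial_schedule X cnt c fl a b \<longleftrightarrow>
    (ALL q<cnt. c q < m & source (fl q) < N & destination (fl q) < N & coflow_of (fl q) < n &
       X * rho (coflow_of (fl q)) <= a q & a q < b q) &
    (ALL q'<cnt. ALL q<q'. c q = c q' & share_port (fl q) (fl q') --> b q <= a q' \<or> b q' <= a q) &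
    (ALL q<cnt. ALL q'<cnt. fl q = fl q' --> c q = c q')"

definition sent :: "nat => (nat => flow) => (nat => nat) => (nat => nat) => flow => nat" where
  "sent cnt fl a b f = (\<Sum>q | q < cnt & fl q = f. b q - a q)"

lemma partial_schedule_0: "partial_schedule X 0 c fl a b"
  by (simp add: partial_schedule_def)

lemma sent_0: "sent 0 fl a b f = 0"
  by (simp add: sent_def)

lemma partial_schedule_Suc:
  assumes "partial_schedule X cnt c fl a b"
    and "!!q. q < cnt ==> c' q = c q & fl' q = fl q & a' q = a q & b' q = b q"
    and "c' cnt < m" "source (fl' cnt) < N" "destination (fl' cnt) < N" "coflow_of (fl' cnt) < n"
    and "X * rho (coflow_of (fl' cnt)) <= a' cnt" "a' cnt < b' cnt"
    and "!!q. q < cnt ==> c q = c' cnt ==> share_port (fl q) (fl' cnt) ==> b q <= a' cnt \<or> b' cnt <= a q"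
    and "!!q. q < cnt ==> fl q = fl' cnt ==> c q = c' cnt"
  shows "partial_schedule X (Suc cnt) c' fl' a' b'"
  unfolding partial_schedule_def
proof (intro conjI allI impI)
  have ps: "c q < m & source (fl q) < N & destination (fl q) < N & coflow_of (fl q) < n &
       X * rho (coflow_of (fl q)) <= a q & a q < b q" if "q < cnt" for q
    using assms(1) that unfolding partial_schedule_def by blast
  fix q assume "q < Suc cnt"
  then have "q < cnt \<or> q = cnt" by linarith
  then show "c' q < m" "source (fl' q) < N" "destination (fl' q) < N" "coflow_of (fl' q) < n"
    "X * rho (coflow_of (fl' q)) <= a' q" "a' q < b' q"
    using ps[of q] assms(2)[of q] assms(3-8) by auto
next
  have ps: "b q <= a q' \<or> b q' <= a q" if "q' < cnt" "q < q'" "c q = c q'" "share_port (fl q) (fl q')" for q q'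
    using assms(1) that unfolding partial_schedule_def by blast
  fix q' q assume q: "q' < Suc cnt" "q < q'" "c' q = c' q' & share_port (fl' q) (fl' q')"
  show "b' q <= a' q' \<or> b' q' <= a' q"
  proof (cases "q' = cnt")
    case True
    then show ?thesis using q assms(2)[of q] assms(9)[of q] by simp
  next
    case False
    then show ?thesis using q assms(2)[of q] assms(2)[of q'] ps[of q' q] by simp
  qed
next
  have ps: "c q = c q'" if "q < cnt" "q' < cnt" "fl q = fl q'" for q q'
    using assms(1) that unfolding partial_schedule_def by blast
  fix q q' assume q: "q < Suc cnt" "q' < Suc cnt" "fl' q = fl' q'"
  show "c' q = c' q'"
    using q assms(2)[of q] assms(2)[of q'] assms(10)[of q] assms(10)[of q'] ps[of q q']
    by (cases "q = cnt"; cases "q' = cnt") simp_all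
qed

lemma sent_Suc:
  assumes "!!q. q < cnt ==> fl' q = fl q & a' q = a q & b' q = b q"
  shows "sent (Suc cnt) fl' a' b' f = sent cnt fl a b f + (if f = fl' cnt then b' cnt - a' cnt else 0)"
proof -
  have "{q. q < Suc cnt & fl' q = f} = {q. q < cnt & fl q = f} \<union> (if f = fl' cnt then {cnt} else {})"
    using assms by (auto simp: less_Suc_eq)
  then have "sent (Suc cnt) fl' a' b' f = (\<Sum>q\<in>{q. q < cnt & fl q = f} \<union> (if f = fl' cnt then {cnt} else {}). b' q - a' q)"
    by (simp add: sent_def)
  also have "... = (\<Sum>q | q < cnt & fl q = f. b' q - a' q) + (if f = fl' cnt then b' cnt - a' cnt else 0)"
    by (subst sum.union_disjoint) auto
  also have "(\<Sum>q | q < cnt & fl q = f. b' q - a' q) = sent cnt fl a b f"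
    unfolding sent_def using assms by (intro sum.cong) auto
  finally show ?thesis .
qed

text \<open>The interface between the discrete algorithms and the real objective. The bounds
  \<open>U\<close> on the completion times may depend on the competitor \<open>C\<close>. They must
  also exceed the release times, because a flow of size 0 has no period but is not finished before
  its release. The optimum is reached as an infimum over all competitors.\<close>

theorem complete_schedule:
  fixes \<rho> :: real
  assumes X: "0 < X" and ps: "partial_schedule X cnt c fl a b"
    and full: "!!i j k. i < N ==> j < N ==> k < n ==> sent cnt fl a b (i, j, k) = X * dd i j k"
    and bound: "!!C::nat => real. lower_bounds C ==> EX U::nat => real. (ALL k<n. rho k <= U k) &
        (ALL q<cnt. b q <= X * U (coflow_of (fl q))) & (\<Sum>k<n. W k * U k) <= \<rho> * (\<Sum>k<n. W k * C k)"
  defines x_sched: "x == schedule_of (map (%q. (c q, fl q, real (a q) / real (D * X), real (b q) / real (D * X))) [0..<cnt])"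
  shows "feasible I x" and "\<rho> \<ge> 0 ==> objective I x <= \<rho> * optimum I"
proof -
  have DX: "0 < D * X" using D_pos X by simp
  have ps1: "c q < m & source (fl q) < N & destination (fl q) < N & coflow_of (fl q) < n &
       X * rho (coflow_of (fl q)) <= a q & a q < b q" if "q < cnt" for q
    using ps that unfolding partial_schedule_def by blast
  interpret periods I "D * X" cnt c fl a b
  proof
    show "valid_instance I" by (rule valid)
    show "0 < D * X" by (rule DX)
    fix q assume q: "q < cnt"
    obtain i j k where f: "fl q = (i, j, k)" by (cases "fl q")
    show "c q < cores I & fl q \<in> flows I & a q <= b q"
      using ps1[OF q] f by (auto simp: flows_def)
    have "k < n" "X * rho k <= a q" using ps1[OF q] f by auto
    then have "real (X * rho k) <= a q" by (simp only: of_nat_le_iff)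
    then show "flow_release I (fl q) * real (D * X) <= real (a q)"
      using \<open>k < n\<close> by (simp add: f flow_release_def rho_eq mult_ac)
  next
    fix q q' assume "q < q'" "q' < cnt" "c q = c q'" "share_port (fl q) (fl q')"
    then show "b q <= a q' \<or> b q' <= a q" using ps unfolding partial_schedule_def by blast
  next
    fix q q' assume "q < cnt" "q' < cnt" "fl q = fl q'"
    then show "c q = c q'" using ps unfolding partial_schedule_def by blast
  next
    fix f assume "f \<in> flows I"
    then obtain i j k where f: "f = (i, j, k)" "i < N" "j < N" "k < n" by (auto simp: flows_def)
    have "(\<Sum>q | q < cnt & fl q = f. real (b q) - real (a q)) = real (sent cnt fl a b f)"
      unfolding sent_def of_nat_sum using ps1
      by (intro sum.cong) (auto simp: of_nat_diff less_imp_le)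
    also have "... = real (D * X) * flow_size I f"
      using full f by (simp add: dd_def flow_size_def)
    finally show "(\<Sum>q | q < cnt & fl q = f. real (b q) - real (a q)) = real (D * X) * flow_size I f" .
  qed
  have x: "x = periods.x (D * X) cnt c fl a b" unfolding x_sched x_def ..
  show fx: "feasible I x" unfolding x by (rule feasible_x)
  assume \<rho>: "\<rho> \<ge> 0"
  have le: "objective I x <= \<rho> * objective I x'" if x': "feasible I x'" for x'
  proof -
    define C where "C k = D * completion_time I x' k" for k
    have "lower_bounds C" using lower_bounds_feasible[OF x'] by (simp add: C_def[abs_def])
    from bound[OF this] obtain U where U0: "(ALL k<n. real (rho k) <= U k) &
        (ALL q<cnt. real (b q) <= real X * U (coflow_of (fl q))) & (\<Sum>k<n. real (W k) * U k) <= \<rho> * (\<Sum>k<n. real (W k) * C k)"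
      by (rule exE)
    have U: "!!k. k < n ==> rho k <= U k" "!!q. q < cnt ==> b q <= X * U (coflow_of (fl q))"
      "(\<Sum>k<n. W k * U k) <= \<rho> * (\<Sum>k<n. W k * C k)"
      using U0[THEN conjunct1] U0[THEN conjunct2, THEN conjunct1] U0[THEN conjunct2, THEN conjunct2] by simp_all
    have fin: "completion_time I x k <= U k / D" if k: "k < n" for k
      unfolding completion_le_iff[OF valid k]
    proof (intro ballI impI)
      fix f assume f: "f \<in> flows I" "coflow_of f = k"
      show "flow_finish I x f <= U k / D"
        unfolding x
      proof (rule flow_finish_x_le[OF f(1)])
        show "flow_release I f <= U k / D"
          using U(1)[OF k] D_pos k f(2) by (simp add: flow_release_def field_simps rho_eq)
        fix q assume q: "q < cnt" "fl q = f"
        then have "real (b q) <= X * U k" using U(2)[of q] f by simp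
        then show "real (b q) / real (D * X) <= U k / D"
          using D_pos X by (simp add: field_simps)
      qed
    qed
    have "objective I x <= (\<Sum>k<n. real_of_rat (weight I k) * (U k / D))"
      unfolding objective_def
    proof (intro sum_mono mult_left_mono)
      fix k assume "k \<in> {..<n}"
      then show "completion_time I x k <= U k / D" "0 <= real_of_rat (weight I k)"
        using fin valid by (auto simp: valid_instance_def less_imp_le)
    qed
    also have "... = (\<Sum>k<n. W k * U k) / (D * Dw)"
      unfolding sum_divide_distrib using Dw_pos D_pos by (intro sum.cong) (auto simp: W_eq)
    also have "... <= \<rho> * (\<Sum>k<n. W k * C k) / (D * Dw)"
      using U(3) by (intro divide_right_mono) auto
    also have "... = \<rho> * ((\<Sum>k<n. W k * C k) / (D * Dw))" by simp
    also have "(\<Sum>k<n. W k * C k) / (D * Dw) = objective I x'"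
      unfolding objective_def sum_divide_distrib using Dw_pos D_pos
      by (intro sum.cong) (auto simp: W_eq C_def)
    finally show ?thesis .
  qed
  show "objective I x <= \<rho> * optimum I"
  proof (cases "\<rho> = 0")
    case True
    then show ?thesis using le[OF fx] by simp
  next
    case False
    with \<rho> have "0 < \<rho>" by simp
    have "objective I x / \<rho> <= optimum I"
      unfolding optimum_def
    proof (rule cInf_greatest)
      show "objective I ` {x. feasible I x} ~= {}" using fx by blast
      fix v assume "v \<in> objective I ` {x. feasible I x}"
      then show "objective I x / \<rho> <= v" using le \<open>0 < \<rho>\<close> by (auto simp: field_simps)
    qed
    then show ?thesis using \<open>0 < \<rho>\<close> by (simp add: field_simps)
  qed
qed

end

section \<open>Edge colouring by alternating chains\<close>

text \<open>
  Colour \<open>c\<close> at input \<open>i\<close> is used by the edge with label \<open>l\<close> if \<open>A i c = Suc l\<close>; its output is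
  \<open>l mod N\<close>, and then \<open>R (l mod N) c = Suc i\<close>. The value 0 marks an unused colour.
\<close>

locale colouring =
  fixes N K :: nat
  assumes N_pos: "1 <= N"
begin

text \<open>The two tables hold the same coloured edges, indexed by input and by output. As an entry
  has room for one edge only, consistency in both directions makes every colour class a
  matching.\<close>

definition proper :: "(nat => nat => nat) => (nat => nat => nat) => bool" where
  "proper A R \<longleftrightarrow>
    (ALL i<N. ALL c<K. A i c ~= 0 --> R ((A i c - 1) mod N) c = Suc i) &
    (ALL j<N. ALL c<K. R j c ~= 0 --> R j c <= N & A (R j c - 1) c ~= 0 & (A (R j c - 1) c - 1) mod N = j)"

definition colours :: "(nat => nat => nat) => nat => nat => nat" where
  "colours A i l = card {c. c < K & A i c = Suc l}"

abbreviation set2 :: "(nat => nat => nat) => nat => nat => nat => nat => nat => nat" where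
  "set2 A i c v == A(i := (A i)(c := v))"

text \<open>The correction terms are added on both sides, which avoids truncated subtraction when
  several updates are composed.\<close>

lemma colours_set2:
  assumes "c < K"
  shows "colours (set2 A i c v) i' l + of_bool (i' = i & A i c = Suc l) =
    colours A i' l + of_bool (i' = i & v = Suc l)"
proof (cases "i' = i")
  case True
  have 1: "{c'. c' < K & ((A i)(c := v)) c' = Suc l} =
      {c'. c' < K & c' ~= c & A i c' = Suc l} \<union> (if v = Suc l then {c} else {})"
    using assms by auto
  have 2: "{c'. c' < K & A i c' = Suc l} =
      {c'. c' < K & c' ~= c & A i c' = Suc l} \<union> (if A i c = Suc l then {c} else {})"
    using assms by auto
  have "card {c'. c' < K & ((A i)(c := v)) c' = Suc l} =
      card {c'. c' < K & c' ~= c & A i c' = Suc l} + of_bool (v = Suc l)"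
    unfolding 1 by (subst card_Un_disjoint) auto
  moreover have "card {c'. c' < K & A i c' = Suc l} =
      card {c'. c' < K & c' ~= c & A i c' = Suc l} + of_bool (A i c = Suc l)"
    unfolding 2 by (subst card_Un_disjoint) auto
  ultimately show ?thesis using True by (simp add: colours_def)
qed (simp add: colours_def)

definition inserted where
  "inserted A0 i0 l0 A R \<longleftrightarrow> proper A R &
    (ALL i l. colours A i l = colours A0 i l + of_bool (i = i0 & l = l0))"

text \<open>
  The edge \<open>(i, l)\<close> is the only uncoloured one. The sets \<open>P\<close> and \<open>J\<close> collect the outputs and inputs
  passed so far; their colours \<open>a\<close> and \<open>b\<close> lead back into these sets, hence the chain never returns.
\<close>

definition chain where
  "chain a b A0 i0 l0 s A R i l \<longleftrightarrow> proper A R & i < N & A i a = 0 & R (l mod N) b = 0 &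
    (ALL i' l'. colours A i' l' + of_bool (i' = i & l' = l) = colours A0 i' l' + of_bool (i' = i0 & l' = l0)) &
    (EX P J. P \<subseteq> {..<N} & card P = s & l mod N ~: P & i \<in> J &
      (\<forall>j\<in>P. R j b ~= 0 & R j b - 1 \<in> J) &
      (\<forall>i'\<in>J. i' ~= i --> A i' a ~= 0 & (A i' a - 1) mod N \<in> P))"

lemma chain_start:
  assumes "proper A R" "i < N" "A i a = 0" "R (l mod N) b = 0"
  shows "chain a b A i l 0 A R i l"
proof -
  have "EX P J. P \<subseteq> {..<N} & card P = 0 & l mod N ~: P & i \<in> J &
      (\<forall>j\<in>P. R j b ~= 0 & R j b - 1 \<in> J) &
      (\<forall>i'\<in>J. i' ~= i --> A i' a ~= 0 & (A i' a - 1) mod N \<in> P)"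
    by (rule exI[of _ "{}"], rule exI[of _ "{i}"]) simp
  then show ?thesis unfolding chain_def using assms by blast
qed

text \<open>The \<open>s\<close> outputs in \<open>P\<close> are distinct and the current output is
  not among them. Hence a chain still active after \<open>s\<close> steps has \<open>s < N\<close>,
  and \<open>N\<close> rounds always suffice.\<close>

lemma chain_less:
  assumes "chain a b A0 i0 l0 s A R i l"
  shows "s < N"
proof -
  obtain P where P: "P \<subseteq> {..<N}" "card P = s" "l mod N ~: P"
    using assms unfolding chain_def by blast
  have "l mod N < N" using N_pos by simp
  then have "P \<subset> {..<N}" using P by blast
  then have "card P < card {..<N}" by (intro psubset_card_mono) auto
  then show ?thesis using P by simp
qed

text \<open>Colour \<open>a\<close> is free at both ends of the uncoloured edge, so the edge simply
  takes it.\<close>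

lemma chain_end_1:
  assumes ch: "chain a b A0 i0 l0 s A R i l" and a: "a < K" and b: "b < K"
    and R: "R (l mod N) a = 0"
  shows "inserted A0 i0 l0 (set2 A i a (Suc l)) (set2 R (l mod N) a (Suc i))"
proof -
  have pr: "proper A R" and i: "i < N" and A: "A i a = 0"
    and cnt: "!!i' l'. colours A i' l' + of_bool (i' = i & l' = l) = colours A0 i' l' + of_bool (i' = i0 & l' = l0)"
    using ch by (auto simp: chain_def)
  have j: "l mod N < N" using N_pos by simp
  have "proper (set2 A i a (Suc l)) (set2 R (l mod N) a (Suc i))"
    unfolding proper_def
  proof (intro conjI allI impI)
    fix x c assume x: "x < N" "c < K" "set2 A i a (Suc l) x c ~= 0"
    show "set2 R (l mod N) a (Suc i) ((set2 A i a (Suc l) x c - 1) mod N) c = Suc x"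
    proof (cases "x = i & c = a")
      case False
      then have "set2 A i a (Suc l) x c = A x c" by auto
      moreover from this have "R ((A x c - 1) mod N) c = Suc x" using pr x by (auto simp: proper_def)
      ultimately show ?thesis using R by auto
    qed simp
  next
    fix y c assume y: "y < N" "c < K" "set2 R (l mod N) a (Suc i) y c ~= 0"
    let ?r = "set2 R (l mod N) a (Suc i) y c"
    have "?r <= N & set2 A i a (Suc l) (?r - 1) c ~= 0 & (set2 A i a (Suc l) (?r - 1) c - 1) mod N = y"
    proof (cases "y = l mod N & c = a")
      case False
      then have r: "?r = R y c" by auto
      then have x: "R y c <= N" "A (R y c - 1) c ~= 0" "(A (R y c - 1) c - 1) mod N = y"
        using pr y by (auto simp: proper_def)
      then have "set2 A i a (Suc l) (R y c - 1) c = A (R y c - 1) c" using A by auto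
      then show ?thesis using x r by simp
    qed (use i in simp)
    then show "?r <= N" "set2 A i a (Suc l) (?r - 1) c ~= 0" "(set2 A i a (Suc l) (?r - 1) c - 1) mod N = y"
      by simp_all
  qed
  moreover have "colours (set2 A i a (Suc l)) i' l' = colours A0 i' l' + of_bool (i' = i0 & l' = l0)" for i' l'
    using colours_set2[OF a, of A i "Suc l" i' l'] cnt[of i' l'] A by (auto simp: of_bool_def split: if_splits)
  ultimately show ?thesis by (auto simp: inserted_def)
qed

lemma chain_step_facts:
  assumes ch: "chain a b A0 i0 l0 s A R i l" and a: "a < K" and b: "b < K"
    and R: "R (l mod N) a ~= 0"
  defines "i' == R (l mod N) a - 1"
  shows "a ~= b" "i' < N" "i' ~= i" "R (l mod N) a = Suc i'" "A i' a ~= 0" "(A i' a - 1) mod N = l mod N"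
proof -
  have j: "l mod N < N" using N_pos by simp
  have pr: "proper A R" and A: "A i a = 0" and Rb: "R (l mod N) b = 0"
    using ch by (auto simp: chain_def)
  show "a ~= b" using R Rb by auto
  show "i' < N" "A i' a ~= 0" "(A i' a - 1) mod N = l mod N" "R (l mod N) a = Suc i'"
    using pr j a R unfolding proper_def i'_def by fastforce+
  then show "i' ~= i" using A by auto
qed

text \<open>Colour \<open>a\<close> is free at \<open>i\<close> but used at the output by an edge
  from \<open>i'\<close>. The uncoloured edge takes \<open>a\<close>, and the displaced edge changes
  to \<open>b\<close>, which is free at this output. If \<open>i'\<close> already used
  \<open>b\<close>, that edge loses its colour and becomes the uncoloured one, with \<open>a\<close>
  free at its input and \<open>b\<close> at its output.\<close>

lemma chain_step:
  assumes ch: "chain a b A0 i0 l0 s A R i l" and a: "a < K" and b: "b < K"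
    and R: "R (l mod N) a ~= 0"
  defines "i' == R (l mod N) a - 1"
  defines "A' == set2 (set2 (set2 A i a (Suc l)) i' a 0) i' b (A i' a)"
    and "R' == set2 (set2 R (l mod N) a (Suc i)) (l mod N) b (Suc i')"
  shows chain_end_2: "A i' b = 0 ==> inserted A0 i0 l0 A' R'"
    and chain_next: "A i' b ~= 0 ==>
      chain a b A0 i0 l0 (Suc s) A' (set2 R' ((A i' b - 1) mod N) b 0) i' (A i' b - 1)"
proof -
  have j: "l mod N < N" using N_pos by simp
  have pr: "proper A R" and i: "i < N" and A: "A i a = 0" and Rb: "R (l mod N) b = 0"
    and cnt: "!!i' l'. colours A i' l' + of_bool (i' = i & l' = l) = colours A0 i' l' + of_bool (i' = i0 & l' = l0)"
    using ch by (auto simp: chain_def)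
  have ab: "a ~= b" and i': "i' < N" "i' ~= i" and Ra: "R (l mod N) a = Suc i'"
    and A'a: "A i' a ~= 0" "(A i' a - 1) mod N = l mod N"
    using chain_step_facts[OF ch a b R] unfolding i'_def by auto
  have pr1: "R ((A x c - 1) mod N) c = Suc x" if "x < N" "c < K" "A x c ~= 0" for x c
    using pr that by (auto simp: proper_def)
  have pr2: "R y c <= N" "A (R y c - 1) c ~= 0" "(A (R y c - 1) c - 1) mod N = y"
    if "y < N" "c < K" "R y c ~= 0" for y c
    using pr that by (auto simp: proper_def)
  \<comment> \<open>Net effect on the counts: \<open>(i, l)\<close> gains a colour, a former edge of
    colour \<open>b\<close> at \<open>i'\<close> loses one, and the edge moved from \<open>a\<close>
    to \<open>b\<close> keeps its count.\<close>
  have c1: "colours A' x z + of_bool (x = i' & A i' b = Suc z) = colours A x z + of_bool (x = i & z = l)" for x z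
  proof -
    define A1 where "A1 = set2 A i a (Suc l)"
    define A2 where "A2 = set2 A1 i' a 0"
    have "colours A1 x z + of_bool (x = i & A i a = Suc z) = colours A x z + of_bool (x = i & Suc l = Suc z)"
      unfolding A1_def by (rule colours_set2[OF a])
    moreover have "colours A2 x z + of_bool (x = i' & A1 i' a = Suc z) = colours A1 x z + of_bool (x = i' & 0 = Suc z)"
      unfolding A2_def by (rule colours_set2[OF a])
    moreover have "colours A' x z + of_bool (x = i' & A2 i' b = Suc z) = colours A2 x z + of_bool (x = i' & A i' a = Suc z)"
      unfolding A'_def A2_def A1_def by (rule colours_set2[OF b])
    moreover have "A1 i' a = A i' a" "A2 i' b = A i' b"
      using i' ab by (auto simp: A1_def A2_def)
    ultimately show ?thesis using A by (auto simp: of_bool_def split: if_splits)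
  qed
  have A'_eq: "A' x c = (if x = i' & c = b then A i' a else if x = i' & c = a then 0 else if x = i & c = a then Suc l else A x c)" for x c
    using ab i' by (auto simp: A'_def)
  have R'_eq: "R' y c = (if y = l mod N & c = b then Suc i' else if y = l mod N & c = a then Suc i else R y c)" for y c
    using ab by (auto simp: R'_def)
  {
    assume z: "A i' b = 0"
    have "proper A' R'"
      unfolding proper_def
    proof (intro conjI allI impI)
      fix x c assume x: "x < N" "c < K" "A' x c ~= 0"
      consider "x = i'" "c = b" | "x = i'" "c = a" | "x = i" "c = a" | "A' x c = A x c" "\<not> (x = i' & c = a)"
        by (cases "x = i' & c = b"; cases "x = i' & c = a"; cases "x = i & c = a") (auto simp: A'_eq)
      then show "R' ((A' x c - 1) mod N) c = Suc x"
      proof cases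
        case 4
        then have "R ((A' x c - 1) mod N) c = Suc x" using pr1 x by simp
        then show ?thesis using Rb Ra 4(2) unfolding R'_eq by auto
      qed (use x A'a i' ab in \<open>simp_all add: A'_eq R'_eq\<close>)
    next
      fix y c assume y: "y < N" "c < K" "R' y c ~= 0"
      have "R' y c <= N & A' (R' y c - 1) c ~= 0 & (A' (R' y c - 1) c - 1) mod N = y"
      proof (cases "y = l mod N & (c = a \<or> c = b)")
        case True
        then show ?thesis using i i' A'a ab by (auto simp: A'_eq R'_eq)
      next
        case False
        then have r: "R' y c = R y c" by (auto simp: R'_eq)
        have x: "R y c <= N" "A (R y c - 1) c ~= 0" "(A (R y c - 1) c - 1) mod N = y"
          using pr2 y r by simp_all
        then have "A' (R y c - 1) c = A (R y c - 1) c"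
          using z A A'a(2) False unfolding A'_eq by auto
        then show ?thesis using x r by simp
      qed
      then show "R' y c <= N" "A' (R' y c - 1) c ~= 0" "(A' (R' y c - 1) c - 1) mod N = y" by simp_all
    qed
    moreover have "colours A' x z = colours A0 x z + of_bool (x = i0 & z = l0)" for x z
      using c1[of x z] cnt[of x z] \<open>A i' b = 0\<close> by simp
    ultimately show "inserted A0 i0 l0 A' R'" by (auto simp: inserted_def)
  }
  {
    assume z: "A i' b ~= 0"
    define j' where "j' = (A i' b - 1) mod N"
    have j'N: "j' < N" using N_pos by (simp add: j'_def)
    have Rj': "R j' b = Suc i'" using pr1[OF i'(1) b z] by (simp add: j'_def)
    have jj': "j' ~= l mod N" using Rj' Rb by auto
    define R'' where "R'' = set2 R' j' b 0"
    have R''_eq: "R'' y c = (if y = j' & c = b then 0 else R' y c)" for y c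
      by (auto simp: R''_def)
    have "proper A' R''"
      unfolding proper_def
    proof (intro conjI allI impI)
      fix x c assume x: "x < N" "c < K" "A' x c ~= 0"
      consider "x = i'" "c = b" | "x = i'" "c = a" | "x = i" "c = a" | "A' x c = A x c" "\<not> (x = i' & c = a)" "\<not> (x = i' & c = b)"
        by (cases "x = i' & c = b"; cases "x = i' & c = a"; cases "x = i & c = a") (auto simp: A'_eq)
      then show "R'' ((A' x c - 1) mod N) c = Suc x"
      proof cases
        case 4
        then have "R ((A' x c - 1) mod N) c = Suc x" using pr1 x by simp
        then show ?thesis using Rb Ra Rj' 4(2,3) unfolding R''_eq R'_eq by auto
      qed (use x A'a i' ab jj' in \<open>simp_all add: A'_eq R''_eq R'_eq\<close>)
    next
      fix y c assume y: "y < N" "c < K" "R'' y c ~= 0"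
      have "R'' y c <= N & A' (R'' y c - 1) c ~= 0 & (A' (R'' y c - 1) c - 1) mod N = y"
      proof (cases "y = l mod N & (c = a \<or> c = b)")
        case True
        then have "y = l mod N" "c = a \<or> c = b" by simp_all
        then show ?thesis using i i' A'a ab jj' by (elim disjE) (simp_all add: A'_eq R''_eq R'_eq Suc_leI)
      next
        case False
        have nj: "\<not> (y = j' & c = b)" using y by (auto simp: R''_eq)
        then have r: "R'' y c = R y c" using False by (auto simp: R''_eq R'_eq)
        have x: "R y c <= N" "A (R y c - 1) c ~= 0" "(A (R y c - 1) c - 1) mod N = y"
          using pr2 y r by simp_all
        then have "A' (R y c - 1) c = A (R y c - 1) c"
        proof -
          have "\<not> (R y c - 1 = i' & c = b)" using x(3) nj by (auto simp: j'_def)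
          moreover have "\<not> (R y c - 1 = i' & c = a)" using x(3) A'a(2) False by auto
          moreover have "\<not> (R y c - 1 = i & c = a)" using x(2) A by auto
          ultimately show ?thesis unfolding A'_eq by (simp only: if_False)
        qed
        then show ?thesis using x r by simp
      qed
      then show "R'' y c <= N" "A' (R'' y c - 1) c ~= 0" "(A' (R'' y c - 1) c - 1) mod N = y" by simp_all
    qed
    moreover have "A' i' a = 0" using ab by (simp add: A'_eq)
    moreover have "R'' ((A i' b - 1) mod N) b = 0" by (simp add: R''_eq j'_def)
    moreover have "colours A' x w + of_bool (x = i' & w = A i' b - 1) = colours A0 x w + of_bool (x = i0 & w = l0)" for x w
    proof -
      have "A i' b = Suc w \<longleftrightarrow> w = A i' b - 1" using z by auto
      then show ?thesis using c1[of x w] cnt[of x w] by simp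
    qed
    moreover obtain P J where PJ: "P \<subseteq> {..<N} & card P = s & l mod N ~: P & i \<in> J &
      (\<forall>j\<in>P. R j b ~= 0 & R j b - 1 \<in> J) &
      (\<forall>i'\<in>J. i' ~= i --> A i' a ~= 0 & (A i' a - 1) mod N \<in> P)"
      using ch unfolding chain_def by (elim conjE exE) (rule that, intro conjI)
    then have P: "P \<subseteq> {..<N}" "card P = s" "l mod N ~: P" "i \<in> J"
      "!!j. j \<in> P ==> R j b ~= 0 & R j b - 1 \<in> J"
      "!!i'. i' \<in> J ==> i' ~= i ==> A i' a ~= 0 & (A i' a - 1) mod N \<in> P"
      by blast+
    \<comment> \<open>Otherwise colour \<open>a\<close> at \<open>i'\<close> would lead into
      \<open>P\<close>, but it leads to the current output.\<close>
    have i'J: "i' ~: J" using P(6)[of i'] i' A'a P(3) by auto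
    \<comment> \<open>Otherwise colour \<open>b\<close> at \<open>j'\<close> would lead into
      \<open>J\<close>, but it leads to the new input \<open>i'\<close>.\<close>
    have j'P: "j' ~: P" using P(5)[of j'] Rj' i'J by auto
    have "EX P J. P \<subseteq> {..<N} & card P = Suc s & (A i' b - 1) mod N ~: P & i' \<in> J &
      (\<forall>j\<in>P. R'' j b ~= 0 & R'' j b - 1 \<in> J) &
      (\<forall>x\<in>J. x ~= i' --> A' x a ~= 0 & (A' x a - 1) mod N \<in> P)"
    proof (rule exI[of _ "insert (l mod N) P"], rule exI[of _ "insert i' J"], intro conjI)
      show "insert (l mod N) P \<subseteq> {..<N}" using P j by auto
      show "card (insert (l mod N) P) = Suc s" using P finite_subset[OF P(1)] by simp
      show "(A i' b - 1) mod N ~: insert (l mod N) P" using j'P jj' by (auto simp: j'_def)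
      show "\<forall>j\<in>insert (l mod N) P. R'' j b ~= 0 & R'' j b - 1 \<in> insert i' J"
        using P(3,5) j'P jj' by (auto simp: R''_eq R'_eq)
      show "\<forall>x\<in>insert i' J. x ~= i' --> A' x a ~= 0 & (A' x a - 1) mod N \<in> insert (l mod N) P"
        using P(6) ab by (auto simp: A'_eq)
    qed simp
    ultimately show "chain a b A0 i0 l0 (Suc s) A' (set2 R' ((A i' b - 1) mod N) b 0) i' (A i' b - 1)"
      unfolding chain_def R''_def[symmetric] j'_def[symmetric] using i' by blast
  }
qed

text \<open>The number of used colours is the coloured degree, so an input of smaller degree than
  \<open>K\<close> has a free colour. Labels are bounded by \<open>LL\<close>, which makes the sum
  finite.\<close>

lemma used_at_input:
  assumes "!!l. LL <= l ==> colours A i l = 0"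
  shows "card {c. c < K & A i c ~= 0} = (\<Sum>l<LL. colours A i l)"
proof -
  have "l < LL" if "c < K" "A i c = Suc l" for c l
  proof (rule ccontr)
    assume "\<not> ?thesis"
    then have "colours A i l = 0" using assms by simp
    then show False using that by (auto simp: colours_def)
  qed
  then have "{c. c < K & A i c ~= 0} = (\<Union>l<LL. {c. c < K & A i c = Suc l})"
    by (auto simp: gr0_conv_Suc)
  also have "card ... = (\<Sum>l<LL. colours A i l)"
    unfolding colours_def by (rule card_UN_disjoint) auto
  finally show ?thesis .
qed

lemma used_at_output:
  assumes pr: "proper A R" and j: "j < N"
    and "!!i l. i < N ==> LL <= l ==> colours A i l = 0"
  shows "card {c. c < K & R j c ~= 0} <= (\<Sum>i<N. \<Sum>l | l < LL & l mod N = j. colours A i l)"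
proof -
  have "{c. c < K & R j c ~= 0} \<subseteq> (\<Union>i<N. \<Union>l\<in>{l. l < LL & l mod N = j}. {c. c < K & A i c = Suc l})"
  proof
    fix c assume "c \<in> {c. c < K & R j c ~= 0}"
    then have c: "c < K" "R j c ~= 0" by auto
    define i l where "i = R j c - 1" and "l = A i c - 1"
    have i: "i < N" and A: "A i c = Suc l" and l: "l mod N = j"
      using pr j c unfolding proper_def i_def l_def by fastforce+
    have "l < LL"
    proof (rule ccontr)
      assume "\<not> ?thesis"
      then have "colours A i l = 0" using assms(3) i by simp
      then show False using A c by (auto simp: colours_def)
    qed
    then show "c \<in> (\<Union>i<N. \<Union>l\<in>{l. l < LL & l mod N = j}. {c. c < K & A i c = Suc l})"
      using i A l c by auto
  qed
  then have "card {c. c < K & R j c ~= 0} <= card (\<Union>i<N. \<Union>l\<in>{l. l < LL & l mod N = j}. {c. c < K & A i c = Suc l})"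
    by (intro card_mono) auto
  also have "... <= (\<Sum>i<N. card (\<Union>l\<in>{l. l < LL & l mod N = j}. {c. c < K & A i c = Suc l}))"
    by (rule card_UN_le) simp
  also have "... <= (\<Sum>i<N. \<Sum>l | l < LL & l mod N = j. colours A i l)"
    unfolding colours_def by (intro sum_mono card_UN_le) simp
  finally show ?thesis .
qed

end

section \<open>The program: preparing the instance\<close>

abbreviation "vm == 200::nat"
abbreviation "vN == 201::nat"
abbreviation "vn == 202::nat"
abbreviation "vNN == 203::nat"
abbreviation "vRow == 204::nat"
abbreviation "raw == 205::nat"
abbreviation "vD == 206::nat"
abbreviation "vDw == 207::nat"
abbreviation "aRho == 208::nat"
abbreviation "aW == 209::nat"
abbreviation "aD == 210::nat"
abbreviation "aL == 211::nat"
abbreviation "v2N == 212::nat"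
abbreviation "vF == 213::nat"
abbreviation "cnt == 214::nat"
abbreviation "pC == 215::nat"
abbreviation "pI == 216::nat"
abbreviation "pJ == 217::nat"
abbreviation "pK == 218::nat"
abbreviation "pA == 219::nat"
abbreviation "pB == 220::nat"
abbreviation "vDen == 221::nat"
abbreviation "i1 == 230::nat"
abbreviation "i2 == 231::nat"
abbreviation "i3 == 232::nat"
abbreviation "i4 == 233::nat"
abbreviation "i5 == 234::nat"
abbreviation "t1 == 240::nat"
abbreviation "aX == 250::nat"
abbreviation "vmu == 251::nat"
abbreviation "vbest == 252::nat"
abbreviation "vcur == 253::nat"
abbreviation "vfl == 254::nat"
abbreviation "aOrd == 255::nat"

text \<open>An entry in the input row of coflow \<open>i1\<close>. A row holds \<open>N * N\<close>
  demands, followed by numerator and denominator of the release time and of the weight.\<close>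

abbreviation Rw :: "ex => ex" where
  "Rw e == Arr raw (V i1 .* V vRow .+ e) (Cn 0)"

definition setup_scale :: pr where
  "setup_scale =
    vD :=: Cn 1 ;; vDw :=: Cn 1 ;;
    Loop i1 vn (vD :=: V vD .* Rw (V vNN .+ Cn 1) ;; vDw :=: V vDw .* Rw (V vNN .+ Cn 3))"

definition setup_copy :: pr where
  "setup_copy =
    Loop i1 vn (
      Put aRho (V i1) (Cn 0) (Rw (V vNN) .* (V vD \<oslash> Rw (V vNN .+ Cn 1))) ;;
      Put aW (V i1) (Cn 0) (Rw (V vNN .+ Cn 2) .* (V vDw \<oslash> Rw (V vNN .+ Cn 3))) ;;
      Loop i2 vNN (Put aD (V i1) (V i2) (V vD .* Rw (V i2))))"

definition setup_loads :: pr where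
  "setup_loads =
    v2N :=: Cn 2 .* V vN ;; vF :=: V vNN .* V vn ;;
    Loop i1 vn (Loop i2 vN (
      SumTo t1 i3 vN (Arr aD (V i1) (V i2 .* V vN .+ V i3)) ;; Put aL (V i2) (V i1) (V t1) ;;
      SumTo t1 i3 vN (Arr aD (V i1) (V i3 .* V vN .+ V i2)) ;; Put aL (V vN .+ V i2) (V i1) (V t1)))"

text \<open>The limits stay abstract until polynomial values are supplied at the end. Four times the
  total load, added to a release time, covers all times produced by list scheduling. The last bound
  covers the weights, which each of the \<open>n\<close> rounds of the ordering may multiply by a
  load.\<close>

locale alg = inst I + ram M Lim for I M Lim +
  assumes lim_input: "n * (N * N + 4) <= Lim" and lim_2N: "2 * N <= Lim"
    and bd_scale: "D <= M" "Dw <= M"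
    and bd_rho: "!!k. k < n ==> rho k + 4 * (\<Sum>p<2*N. \<Sum>k<n. L p k) <= M"
    and bd_W: "(\<Sum>k<n. W k + 1) * (1 + (\<Sum>p<2*N. \<Sum>k<n. L p k)) ^ n <= M"
begin

definition "TL = (\<Sum>p<2*N. \<Sum>k<n. L p k)"

lemma lim_n: "n <= Lim" and lim_NN: "N * N <= Lim" and lim_N: "N <= Lim" and lim_F: "N * N * n <= Lim"
proof -
  have "n * 1 <= n * (N * N + 4)" by (rule mult_le_mono2) simp
  then show n: "n <= Lim" using lim_input by linarith
  have "n * (N * N) <= n * (N * N + 4)" by (rule mult_le_mono2) simp
  from order_trans[OF this lim_input] show F: "N * N * n <= Lim" by (simp only: mult.commute)
  have "N * N * 1 <= N * N * n" using coflows_pos by (rule mult_le_mono2)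
  then show "N * N <= Lim" using F by linarith
  show "N <= Lim" using lim_2N by simp
qed

lemma L_le_TL: "p < 2 * N ==> A \<subseteq> {..<n} ==> (\<Sum>k\<in>A. L p k) <= TL"
proof -
  assume p: "p < 2 * N" and A: "A \<subseteq> {..<n}"
  have "(\<Sum>k\<in>A. L p k) <= (\<Sum>k<n. L p k)" using A by (intro sum_mono2) auto
  also have "... <= TL" unfolding TL_def using p by (intro member_le_sum) auto
  finally show ?thesis .
qed

lemma L1_le_TL: "p < 2 * N ==> k < n ==> L p k <= TL"
  using L_le_TL[of p "{k}"] by simp

lemma rho_TL: "k < n ==> rho k + 4 * TL <= M"
  using bd_rho unfolding TL_def .

lemma TL_le_M: "4 * TL <= M"
  using rho_TL[of 0] coflows_pos by linarith

lemma dd_le_L: "i < N ==> j < N ==> dd i j k <= L i k" "i < N ==> j < N ==> dd i j k <= L (N + j) k"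
  by (auto simp: L_def intro!: member_le_sum[of j "{..<N}" "%j. dd i j k"] member_le_sum[of i "{..<N}" "%i. dd i j k"])

lemma dd_le_TL: "i < N ==> j < N ==> k < n ==> dd i j k <= TL"
  using dd_le_L(1)[of i j k] L1_le_TL[of i k] by simp

definition "raw_ok S \<longleftrightarrow> (ALL k<n. (ALL e<N*N. S raw (k * (N*N+4) + e) 0 = demand I (e div N) (e mod N) k) &
   S raw (k * (N*N+4) + N*N) 0 = rn k & S raw (k * (N*N+4) + (N*N+1)) 0 = rd k &
   S raw (k * (N*N+4) + (N*N+2)) 0 = wn k & S raw (k * (N*N+4) + (N*N+3)) 0 = wd k)"

definition "params S \<longleftrightarrow> S vm 0 0 = m & S vN 0 0 = N & S vn 0 0 = n & S vNN 0 0 = N*N & S vRow 0 0 = N*N+4"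

text \<open>A partial product of positive factors divides the full one, so bounding the final
  product is enough.\<close>

lemma prod_le_M:
  assumes "(\<Prod>k<n. f k) <= M" "!!k. 0 < f k" "i <= n"
  shows "(\<Prod>k<i. f k) <= (M::nat)"
proof -
  have "(\<Prod>k<i. f k) dvd (\<Prod>k<n. f k)" using assms by (intro prod_dvd_prod_subset) auto
  then have "(\<Prod>k<i. f k) <= (\<Prod>k<n. f k)" using assms by (intro dvd_imp_le) auto
  then show ?thesis using assms by simp
qed

lemma wp_setup_scale:
  assumes "params S" "raw_ok S"
  shows "wp setup_scale (%S'. S' vD 0 0 = D & S' vDw 0 0 = Dw) S"
  unfolding setup_scale_def wp_Sq
  apply simp
  apply (intro conjI)
    using Lim_le_M Lim_pos apply simp
   using Lim_le_M Lim_pos apply simp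
  apply (rule wp_Loop[where I = "%i S'. S' vD 0 0 = (\<Prod>k<i. rd k) & S' vDw 0 0 = (\<Prod>k<i. wd k)"])
        apply (simp_all)
  subgoal using assms lim_n by (simp add: params_def)
  subgoal for i S'
    using assms prod_le_M[OF bd_scale(1)[unfolded D_def] rd_pos, of "Suc i"]
      prod_le_M[OF bd_scale(2)[unfolded Dw_def] wd_pos, of "Suc i"]
    by (simp add: params_def raw_ok_def ac_simps)
  subgoal using assms by (simp add: params_def D_def Dw_def)
  done

lemma W_sum_le_M: "(\<Sum>k<n. W k + 1) <= M"
proof -
  have "(\<Sum>k<n. W k + 1) * 1 <= (\<Sum>k<n. W k + 1) * (1 + (\<Sum>p<2*N. \<Sum>k<n. L p k)) ^ n"
    by (intro mult_le_mono2) simp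
  from order_trans[OF this bd_W] show ?thesis by (simp only: mult_1_right)
qed

lemma W_le_M: "k < n ==> W k <= M"
proof -
  assume "k < n"
  then have "W k + 1 <= (\<Sum>k<n. W k + 1)" by (intro member_le_sum) auto
  then show ?thesis using W_sum_le_M by simp
qed

lemma rho_le_M: "k < n ==> rho k <= M"
  using rho_TL[of k] by simp

lemma dd_le_M: "i < N ==> j < N ==> k < n ==> dd i j k <= M"
  using dd_le_TL[of i j k] TL_le_M by simp

lemma div_mod_N: "e < N * N ==> e div N < N" "e mod N < N"
  using N_pos by (auto simp: less_mult_imp_div_less)

lemma wp_setup_copy:
  assumes "params S" "raw_ok S" "S vD 0 0 = D" "S vDw 0 0 = Dw"
  shows "wp setup_copy (%S'. ALL k<n. S' aRho k 0 = rho k & S' aW k 0 = W k &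
     (ALL e<N*N. S' aD k e = dd (e div N) (e mod N) k)) S"
  unfolding setup_copy_def
  apply (rule wp_Loop[where I = "%i S'. ALL k<i. S' aRho k 0 = rho k & S' aW k 0 = W k &
     (ALL e<N*N. S' aD k e = dd (e div N) (e mod N) k)"])
        apply simp_all
  subgoal using assms lim_n by (simp add: params_def)
  subgoal for k S1
    using assms
    apply (simp add: params_def raw_ok_def rho_def[symmetric] W_def[symmetric] rho_le_M W_le_M)
    apply (rule wp_Loop[where I = "%e S'. (ALL k'<k. (ALL e<N*N. S' aD k' e = dd (e div N) (e mod N) k')) &
       (ALL e'<e. S' aD k e' = dd (e' div N) (e' mod N) k)"])
          apply (simp_all add: lim_NN)
    subgoal for e S2
      using dd_le_M[of "e div N" "e mod N" k] div_mod_N[of e]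
      by (simp add: dd_def less_Suc_eq)
    done
  using assms apply (simp add: params_def)
  done

text \<open>The weights \<open>aW\<close> are left out because both algorithms overwrite
  them.\<close>

definition "inst_ok S \<longleftrightarrow> params S & S vD 0 0 = D & S v2N 0 0 = 2 * N & S vF 0 0 = N * N * n &
   (ALL k<n. S aRho k 0 = rho k & (ALL i<N. ALL j<N. S aD k (i * N + j) = dd i j k) & (ALL p<2*N. S aL p k = L p k))"

lemma wp_setup_loads:
  assumes "params S" "S vD 0 0 = D" and dem: "!!k. k < n ==> S aRho k 0 = rho k &
     (ALL e<N*N. S aD k e = dd (e div N) (e mod N) k)"
  shows "wp setup_loads inst_ok S"
proof -
  have ix: "i * N + j < N * N" if "i < N" "j < N" for i j
  proof -
    have "i * N + j < Suc i * N" using that by simp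
    also have "... <= N * N" using that by (intro mult_le_mono1) simp
    finally show ?thesis .
  qed
  have d: "S aD k (i * N + j) = dd i j k" if "k < n" "i < N" "j < N" for i j k
    using dem[OF that(1)] ix[OF that(2,3)] that by simp
  have L1: "L i k <= M" "L (N + i) k <= M" if "i < N" "k < n" for i k
    using L1_le_TL[of i k] L1_le_TL[of "N + i" k] TL_le_M that by simp_all
  have Ls: "L i k = (\<Sum>j<N. dd i j k)" "L (N + i) k = (\<Sum>j<N. dd j i k)" if "i < N" for i k
    using that by (simp_all add: L_def)
  show ?thesis
    unfolding setup_loads_def
    using assms(1) lim_2N lim_F Lim_le_M
    apply (simp add: params_def)
    apply (rule wp_Loop[where I = "%k S'. ALL k'<k. ALL p<2*N. S' aL p k' = L p k'"])
          apply (simp_all add: lim_n)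
    subgoal for k S1
      apply (rule wp_Loop[where I = "%i S'. (ALL k'<k. ALL p<2*N. S' aL p k' = L p k') &
          (ALL i'<i. S' aL i' k = L i' k & S' aL (N + i') k = L (N + i') k)"])
            apply (simp_all add: lim_N)
      subgoal for i S2
        apply (rule wp_SumTo)
              apply (simp_all add: lim_N d)
        subgoal using L1(1)[of i k] Ls(1)[of i k] by simp
        using L1(1)[of i k] Ls[of i k]
        apply simp
        apply (rule wp_SumTo)
              apply (simp_all add: lim_N d)
        subgoal using L1(2)[of i k] Ls(2)[of i k] by simp
        using L1(2)[of i k] Ls[of i k]
        by (auto simp: less_Suc_eq)
      subgoal for S2
      proof (intro allI impI)
        fix k' p assume a: "(ALL k'<k. ALL p<2*N. S2 aL p k' = L p k') &
            (ALL i'<N. S2 aL i' k = L i' k & S2 aL (N + i') k = L (N + i') k)" "k' < Suc k" "p < 2 * N"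
        show "S2 aL p k' = L p k'"
        proof (cases "k' = k")
          case True
          then show ?thesis using a(1,3) by (cases "p < N") (auto dest: spec[of _ "p - N"])
        qed (use a in auto)
      qed
      done
    subgoal for S1
      unfolding inst_ok_def params_def using assms d by (simp add: params_def)
    done
qed

end

section \<open>Computing the local ratio order\<close>

sublocale inst \<subseteq> loads: port_loads L "2 * N" n m .

definition eqx :: "ex => ex => ex" where
  "eqx a b = Cn 1 .- ((a .- b) .+ (b .- a))"

lemma ev_eqx [simp]: "ev S (eqx a b) = of_bool (ev S a = ev S b)"
  by (auto simp: eqx_def)

lemma wfe_eqx [simp]: "wfe (eqx a b) \<longleftrightarrow> wfe a & wfe b"
  by (auto simp: eqx_def)

abbreviation Ar1 :: "nat => ex => ex" where "Ar1 r e == Arr r e (Cn 0)"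

text \<open>\<open>aX\<close> marks the coflows already placed in the order; truncated subtraction
  from 1 turns it into the indicator of the remaining ones.\<close>

definition select_port :: pr where
  "select_port = vmu :=: Cn 0 ;; vbest :=: Cn 0 ;;
    Loop i2 v2N (
      SumTo t1 i3 vn ((Cn 1 .- Ar1 aX (V i3)) .* Arr aL (V i2) (V i3)) ;;
      Test (V t1 .- V vbest) (vmu :=: V i2 ;; vbest :=: V t1) Skp)"

text \<open>Searches for the smallest ratio of weight to load on the selected port, comparing ratios
  by cross-multiplication. A coflow without load there counts as having an infinite ratio.\<close>

definition select_coflow_step :: pr where
  "select_coflow_step = Test (Ar1 aX (V i2)) Skp (
      Test (V vfl)
        (Test (Arr aL (V vmu) (V i2))
          (Test (Arr aL (V vmu) (V vcur))
            (Test (Ar1 aW (V vcur) .* Arr aL (V vmu) (V i2) .- Ar1 aW (V i2) .* Arr aL (V vmu) (V vcur))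
              (vcur :=: V i2) Skp)
            (vcur :=: V i2))
          Skp)
        (vfl :=: Cn 1 ;; vcur :=: V i2))"

definition select_coflow :: pr where
  "select_coflow = vfl :=: Cn 0 ;; vcur :=: Cn 0 ;; Loop i2 vn select_coflow_step"

definition reduce_weights :: pr where
  "reduce_weights = Test (Arr aL (V vmu) (V vcur))
    (Loop i2 vn (Test (Ar1 aX (V i2) .+ eqx (V i2) (V vcur)) Skp
      (Put aW (V i2) (Cn 0)
        (Ar1 aW (V i2) .* Arr aL (V vmu) (V vcur) .- Ar1 aW (V vcur) .* Arr aL (V vmu) (V i2)))))
    Skp"

definition compute_order :: pr where
  "compute_order = Loop i1 vn (select_port ;; select_coflow ;; reduce_weights ;;
     Put aX (V vcur) (Cn 0) (Cn 1) ;; Put aOrd (V vn .- Cn 1 .- V i1) (Cn 0) (V vcur))"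

context alg
begin

lemma wp_select_port:
  assumes "inst_ok S" and U: "U \<subseteq> {..<n}" "!!k. k < n ==> S aX k 0 = of_bool (k ~: U)"
  shows "wp select_port (%S'. S' vmu 0 0 < 2 * N & loads.total_load U (S' vmu 0 0) = loads.max_load U) S"
proof -
  have tl: "(\<Sum>k<n. (Suc 0 - S aX k 0) * S aL p k) = loads.total_load U p" if "p < 2 * N" for p
  proof -
    have "(\<Sum>k<n. (Suc 0 - S aX k 0) * S aL p k) = (\<Sum>k<n. if k \<in> U then L p k else 0)"
      using assms that by (intro sum.cong) (auto simp: inst_ok_def)
    also have "... = (\<Sum>k\<in>{..<n} \<inter> U. L p k)" by (simp add: sum.If_cases)
    also have "{..<n} \<inter> U = U" using U by auto
    finally show ?thesis by (simp add: loads.total_load_def)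
  qed
  have bd: "loads.total_load U p <= M" if "p < 2 * N" for p
    unfolding loads.total_load_def using L_le_TL[OF that U(1)] TL_le_M by simp
  show ?thesis
    unfolding select_port_def
    apply simp
    apply (rule wp_Loop[where I = "%i S'. (ALL p<i. loads.total_load U p <= S' vbest 0 0) &
        (S' vbest 0 0 = 0 & S' vmu 0 0 = 0 \<or> S' vmu 0 0 < i & loads.total_load U (S' vmu 0 0) = S' vbest 0 0)"])
          apply (simp_all)
    subgoal using assms lim_2N by (simp add: inst_ok_def)
    subgoal for p S1
      apply (rule wp_SumTo)
            apply (simp_all)
      subgoal using assms lim_n by (simp add: inst_ok_def params_def)
      subgoal using assms tl[of p] bd[of p] by (simp add: inst_ok_def params_def)
      using assms tl[of p] bd[of p] lim_2N Lim_le_M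
      by (auto simp: inst_ok_def params_def less_Suc_eq)
    subgoal for S1
    proof -
      assume a: "(ALL p<S v2N 0 0. loads.total_load U p <= S1 vbest 0 0) &
        (S1 vbest 0 0 = 0 & S1 vmu 0 0 = 0 \<or> S1 vmu 0 0 < S v2N 0 0 & loads.total_load U (S1 vmu 0 0) = S1 vbest 0 0)"
      have N2: "S v2N 0 0 = 2 * N" using assms by (simp add: inst_ok_def)
      have mu: "S1 vmu 0 0 < 2 * N" using a N2 N_pos by auto
      have tm: "loads.total_load U (S1 vmu 0 0) = S1 vbest 0 0" using a N2 mu by force
      have "loads.max_load U <= S1 vbest 0 0" using a N2 by (simp add: loads.max_load_le_iff)
      then show "S1 vmu 0 0 < 2 * N & loads.total_load U (S1 vmu 0 0) = loads.max_load U"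
        using mu tm loads.total_load_le_max[OF mu, of U] by simp
    qed
    done
qed

text \<open>Transitivity of comparing ratios, in cross-multiplied form because \<open>lk\<close> may
  be 0; only the middle denominator has to be positive.\<close>

lemma ratio_trans:
  fixes wi wc wk li lc lk :: nat
  assumes "wi * lc < wc * li" "wc * lk <= wk * lc" "0 < lc"
  shows "wi * lk <= wk * li"
proof -
  have "lc * (wi * lk) <= (wc * li) * lk" using assms(1) by (simp add: mult_ac)
  also have "... = (wc * lk) * li" by (simp add: mult_ac)
  also have "... <= (wk * lc) * li" using assms(2) by (rule mult_le_mono1)
  finally have "lc * (wi * lk) <= lc * (wk * li)" by (simp add: mult_ac)
  then show ?thesis using assms(3) by simp
qed

lemma wp_select_coflow:
  assumes "inst_ok S" and U: "U \<subseteq> {..<n}" "U ~= {}" "!!k. k < n ==> S aX k 0 = of_bool (k ~: U)"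
    and mu: "S vmu 0 0 = \<mu>" "\<mu> < 2 * N"
  shows "wp select_coflow (%S'. S' vcur 0 0 \<in> U & (L \<mu> (S' vcur 0 0) = 0 --> (\<forall>k\<in>U. L \<mu> k = 0)) &
     (\<forall>k\<in>U. S aW (S' vcur 0 0) 0 * L \<mu> k <= S aW k 0 * L \<mu> (S' vcur 0 0))) S"
proof -
  have Ls: "S aL \<mu> k = L \<mu> k" if "k < n" for k using assms that by (simp add: inst_ok_def)
  let ?w = "%k. S aW k 0"
  let ?I = "%i S'. (S' vfl 0 0 = 0 & (ALL k<i. k ~: U)) \<or> (S' vfl 0 0 ~= 0 & S' vcur 0 0 \<in> U & S' vcur 0 0 < n &
     (\<forall>k\<in>U. k < i --> (L \<mu> (S' vcur 0 0) = 0 --> L \<mu> k = 0) & ?w (S' vcur 0 0) * L \<mu> k <= ?w k * L \<mu> (S' vcur 0 0)))"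
  let ?S = "upd (upd S vfl 0 0 0) vcur 0 0 0"
  have vn: "S vn 0 0 = n" using assms by (simp add: inst_ok_def params_def)
  have "wp (Loop i2 vn select_coflow_step) (%S'. S' vcur 0 0 \<in> U & (L \<mu> (S' vcur 0 0) = 0 --> (\<forall>k\<in>U. L \<mu> k = 0)) &
     (\<forall>k\<in>U. ?w (S' vcur 0 0) * L \<mu> k <= ?w k * L \<mu> (S' vcur 0 0))) ?S"
  proof (rule wp_Loop[where I = ?I])
    fix i S1
    assume i: "i < ?S vn 0 0" and inv: "?I i S1" and v: "S1 i2 0 0 = i"
      and fr: "!!r. r ~= i2 ==> r ~: mods select_coflow_step ==> S1 r = ?S r"
    have i_n: "i < n" using i vn by simp
    have iM: "i <= M" using i_n lim_n Lim_le_M by linarith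
    have M1: "Suc 0 <= M" using Lim_pos Lim_le_M by linarith
    define c where "c = S1 vcur 0 0"
    have fr': "S1 aX = S aX" "S1 aW = S aW" "S1 aL = S aL" "S1 vmu = S vmu"
      using fr by (simp_all add: select_coflow_step_def)
    consider "i ~: U" | "i \<in> U" "S1 vfl 0 0 = 0" | "i \<in> U" "S1 vfl 0 0 ~= 0" by blast
    then show "wp select_coflow_step (%S''. ?I (Suc i) (upd S'' i2 0 0 (Suc i))) S1"
    proof cases
      case 1
      then show ?thesis using inv v i_n U(3)[of i] by (auto simp: select_coflow_step_def fr' less_Suc_eq)
    next
      case 2
      then show ?thesis using inv v i_n U(3)[of i] iM M1 by (auto simp: select_coflow_step_def fr' less_Suc_eq)
    next
      case 3
      have cU: "c \<in> U" "c < n" and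
        all: "!!k. k \<in> U ==> k < i ==> (L \<mu> c = 0 --> L \<mu> k = 0) & ?w c * L \<mu> k <= ?w k * L \<mu> c"
        using inv 3 unfolding c_def by auto
      have "?w i * L \<mu> k <= ?w k * L \<mu> i" if "k \<in> U" "k < i" "L \<mu> c = 0 \<or> ?w i * L \<mu> c < ?w c * L \<mu> i" for k
        using all[OF that(1,2)] that(3) ratio_trans[of "?w i" "L \<mu> c" "?w c" "L \<mu> i" "L \<mu> k" "?w k"] by (cases "L \<mu> c = 0") auto
      then show ?thesis
        using 3 v i_n iM U(3)[of i] all cU Ls mu c_def[symmetric]
        by (auto simp: select_coflow_step_def fr' less_Suc_eq not_less)
    qed
  next
    fix S1 assume "?I (?S vn 0 0) S1"
    then show "S1 vcur 0 0 \<in> U & (L \<mu> (S1 vcur 0 0) = 0 --> (\<forall>k\<in>U. L \<mu> k = 0)) &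
     (\<forall>k\<in>U. ?w (S1 vcur 0 0) * L \<mu> k <= ?w k * L \<mu> (S1 vcur 0 0))"
      using U vn by (auto simp: subset_iff)
  qed (use vn lim_n in \<open>simp_all add: select_coflow_step_def\<close>)
  then show ?thesis unfolding select_coflow_def by simp
qed

lemma wp_reduce_weights:
  assumes "inst_ok S" and U: "U \<subseteq> {..<n}" "!!k. k < n ==> S aX k 0 = of_bool (k ~: U)"
    and mu: "S vmu 0 0 = \<mu>" "\<mu> < 2 * N" and cur: "S vcur 0 0 = c" "c \<in> U"
    and bd: "!!k. k < n ==> S aW k 0 * TL <= M"
  shows "wp reduce_weights (%S'. ALL k<n. S' aW k 0 = (if 0 < L \<mu> c & k \<in> U & k ~= c
     then S aW k 0 * L \<mu> c - S aW c 0 * L \<mu> k else S aW k 0)) S"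
proof -
  have Ls: "S aL \<mu> k = L \<mu> k" if "k < n" for k using assms that by (simp add: inst_ok_def)
  have c: "c < n" using U cur by auto
  show ?thesis
  proof (cases "L \<mu> c = 0")
    case True
    then show ?thesis unfolding reduce_weights_def using Ls[OF c] mu cur by simp
  next
    case False
    then show ?thesis
      unfolding reduce_weights_def using Ls[OF c] mu cur
      apply simp
      apply (rule wp_Loop[where I = "%i S'. ALL k<n. S' aW k 0 = (if k < i & k \<in> U & k ~= c
         then S aW k 0 * L \<mu> c - S aW c 0 * L \<mu> k else S aW k 0)"])
            apply (simp_all)
      subgoal using assms lim_n by (simp add: inst_ok_def params_def)
      subgoal for i S1
      proof -
        assume i: "i < S vn 0 0"
        have i_n: "i < n" using i assms by (simp add: inst_ok_def params_def)
        assume inv: "ALL k<n. S1 aW k 0 = (if k < i & k \<in> U & k ~= c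
            then S aW k 0 * L \<mu> c - S aW c 0 * L \<mu> k else S aW k 0)"
          and v: "S1 i2 0 0 = i" and fr: "!!r. r ~= i2 ==> r ~= aW ==> S1 r = S r"
        have w: "S1 aW i 0 = S aW i 0" "S1 aW c 0 = S aW c 0" using inv i_n c by auto
        have "S aW i 0 * L \<mu> c - S aW c 0 * L \<mu> i <= S aW i 0 * TL"
          using L1_le_TL[OF mu(2) c] by (meson diff_le_self le_trans mult_le_mono2)
        then have b: "S aW i 0 * L \<mu> c - S aW c 0 * L \<mu> i <= M" using bd[OF i_n] by linarith
        show ?thesis
          using inv v i_n c Ls mu cur U(2)[OF i_n] w b by (auto simp: fr less_Suc_eq)
      qed
      subgoal using assms by (simp add: inst_ok_def params_def)
      done
  qed
qed

text \<open>The list grows from its head, whereas \<open>local_ratio_order\<close> is built up from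
  the tail. The invariant therefore speaks of continuations: every local ratio order of the
  remaining coflows for the current weights completes the list found so far.\<close>

lemma wp_compute_order:
  assumes S: "inst_ok S" and X0: "!!k. k < n ==> S aX k 0 = 0" and W0: "!!k. k < n ==> S aW k 0 = W k"
  shows "wp compute_order (%S'. EX ys. distinct ys & set ys = {..<n} & loads.local_ratio_order W ys &
     (ALL t<n. S' aOrd t 0 = ys ! (n - 1 - t))) S"
proof -
  \<comment> \<open>A round multiplies a weight by a load of at most \<open>TL\<close>; the factor
    \<open>1 + TL\<close> also covers weights that stay unchanged.\<close>
  let ?B = "%s. (\<Sum>k<n. W k + 1) * (1 + TL) ^ s"
  have BM: "?B s <= M" if "s <= n" for s
  proof -
    have "?B s <= ?B n" using that by (intro mult_le_mono2 power_increasing) auto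
    then show ?thesis using bd_W unfolding TL_def by (rule order_trans)
  qed
  let ?I = "%s S'. EX ys. length ys = s & distinct ys & set ys \<subseteq> {..<n} &
     (ALL k<n. S' aX k 0 = of_bool (k \<in> set ys)) & (ALL t<s. S' aOrd (n - 1 - t) 0 = ys ! t) &
     (ALL k<n. S' aW k 0 <= ?B s) &
     (ALL xs. distinct xs & set xs = {..<n} - set ys & loads.local_ratio_order (%k. S' aW k 0) xs -->
        loads.local_ratio_order W (ys @ xs))"
  have vn: "S vn 0 0 = n" using S by (simp add: inst_ok_def params_def)
  show ?thesis
    unfolding compute_order_def
  proof (rule wp_Loop[where I = ?I])
    show "?I 0 (upd S i1 0 0 0)"
    proof (intro exI[of _ "[]"] conjI allI impI)
      fix k assume "k < n"
      then have "W k + 1 <= (\<Sum>k<n. W k + 1)" by (intro member_le_sum) auto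
      then show "upd S i1 0 0 0 aW k 0 <= ?B 0" using W0[OF \<open>k < n\<close>] by simp
    next
      fix xs assume xs: "distinct xs & set xs = {..<n} - set [] & loads.local_ratio_order (%k. upd S i1 0 0 0 aW k 0) xs"
      \<comment> \<open>Only the weights of listed coflows enter the order, so the stored weights
        may be exchanged for \<open>W\<close>.\<close>
      have "loads.local_ratio_order W' zs" if "loads.local_ratio_order V' zs" "!!k. k \<in> set zs ==> V' k = W' k" for V' W' zs
        using that
      proof (induction arbitrary: W' rule: loads.local_ratio_order.induct)
        case (Step \<mu> k xs V' V'')
        show ?case
          by (rule loads.local_ratio_order.Step[of \<mu> k xs W' V'']) (use Step in auto)
      qed (auto intro: loads.local_ratio_order.intros)
      from this[of "%k. S aW k 0" xs W] show "loads.local_ratio_order W ([] @ xs)" using xs W0 by auto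
    qed (use X0 in simp_all)
  next
    fix s S1
    assume s: "s < S vn 0 0" and inv: "?I s S1" and v: "S1 i1 0 0 = s"
      and fr: "!!r. r ~= i1 ==> r ~: mods (select_port ;; select_coflow ;; reduce_weights ;;
         Put aX (V vcur) (Cn 0) (Cn 1) ;; Put aOrd (V vn .- Cn 1 .- V i1) (Cn 0) (V vcur)) ==> S1 r = S r"
    have fr': "S1 r = S r" if "r ~: {i1, i2, i3, t1, vmu, vbest, vcur, vfl, aW, aX, aOrd}" for r
      using that by (intro fr) (auto simp: select_port_def select_coflow_def select_coflow_step_def reduce_weights_def)
    have ok1: "inst_ok S1" using S unfolding inst_ok_def params_def by (simp add: fr')
    obtain ys where ys: "length ys = s" "distinct ys" "set ys \<subseteq> {..<n}"
      "!!k. k < n ==> S1 aX k 0 = of_bool (k \<in> set ys)" "!!t. t < s ==> S1 aOrd (n - 1 - t) 0 = ys ! t"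
      "!!k. k < n ==> S1 aW k 0 <= ?B s"
      "!!xs. distinct xs ==> set xs = {..<n} - set ys ==> loads.local_ratio_order (%k. S1 aW k 0) xs ==>
        loads.local_ratio_order W (ys @ xs)"
      using inv by blast
    define U where "U = {..<n} - set ys"
    have U: "U \<subseteq> {..<n}" "!!k. k < n ==> S1 aX k 0 = of_bool (k ~: U)" using ys(4) by (auto simp: U_def)
    have "card (set ys) < n" using ys s vn by (simp add: distinct_card)
    then have Une: "U ~= {}"
      using card_mono[of "set ys" "{..<n}"] by (auto simp: U_def)
    have TLM: "S1 aW k 0 * TL <= ?B (Suc s)" if "k < n" for k
    proof -
      have "S1 aW k 0 * TL <= ?B s * (1 + TL)" using ys(6)[OF that] by (intro mult_le_mono) auto
      then show ?thesis by (simp add: algebra_simps)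
    qed
    let ?fin = "wp (Put aX (V vcur) (Cn 0) (Cn 1)) (wp (Put aOrd (V vn .- Cn 1 .- V i1) (Cn 0) (V vcur))
       (%S''. ?I (Suc s) (upd S'' i1 0 0 (Suc s))))"
    show "wp (select_port ;; select_coflow ;; reduce_weights ;; Put aX (V vcur) (Cn 0) (Cn 1) ;;
        Put aOrd (V vn .- Cn 1 .- V i1) (Cn 0) (V vcur)) (%S''. ?I (Suc s) (upd S'' i1 0 0 (Suc s))) S1"
      unfolding wp_Sq
    proof (rule wp_mono[OF wp_select_port[OF ok1 U]])
      fix S2
      assume mu: "S2 vmu 0 0 < 2 * N & loads.total_load U (S2 vmu 0 0) = loads.max_load U"
        and f2: "!!r. r ~: mods select_port ==> S2 r = S1 r"
      have f2': "S2 r = S1 r" if "r ~: {i2, i3, t1, vmu, vbest}" for r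
        using that by (intro f2) (auto simp: select_port_def)
      have ok2: "inst_ok S2" using ok1 unfolding inst_ok_def params_def by (simp add: f2')
      define \<mu> where "\<mu> = S2 vmu 0 0"
      have m: "\<mu> < 2 * N" "loads.total_load U \<mu> = loads.max_load U" using mu by (simp_all add: \<mu>_def)
      have U2: "!!k. k < n ==> S2 aX k 0 = of_bool (k ~: U)" using U(2) by (simp add: f2')
      show "wp select_coflow (wp reduce_weights (?fin)) S2"
      proof (rule wp_mono[OF wp_select_coflow[OF ok2 U(1) Une U2 \<mu>_def[symmetric] m(1)]])
        fix S3
        assume cur: "S3 vcur 0 0 \<in> U & (L \<mu> (S3 vcur 0 0) = 0 --> (\<forall>k\<in>U. L \<mu> k = 0)) &
            (\<forall>k\<in>U. S2 aW (S3 vcur 0 0) 0 * L \<mu> k <= S2 aW k 0 * L \<mu> (S3 vcur 0 0))"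
          and f3: "!!r. r ~: mods select_coflow ==> S3 r = S2 r"
        have f3': "S3 r = S2 r" if "r ~: {i2, vcur, vfl}" for r
          using that by (intro f3) (auto simp: select_coflow_def select_coflow_step_def)
        have ok3: "inst_ok S3" using ok2 unfolding inst_ok_def params_def by (simp add: f3')
        define c where "c = S3 vcur 0 0"
        have c: "c \<in> U" "c < n" "L \<mu> c = 0 ==> \<forall>k\<in>U. L \<mu> k = 0"
          "!!k. k \<in> U ==> S1 aW c 0 * L \<mu> k <= S1 aW k 0 * L \<mu> c"
          using cur U(1) unfolding c_def by (auto simp: f2')
        have U3: "!!k. k < n ==> S3 aX k 0 = of_bool (k ~: U)" using U2 by (simp add: f3')
        have b3: "!!k. k < n ==> S3 aW k 0 * TL <= M"
          using TLM BM[of "Suc s"] s vn by (simp add: f3' f2') (meson Suc_leI le_trans)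
        have m3: "S3 vmu 0 0 = \<mu>" by (simp add: f3' \<mu>_def)
        show "wp reduce_weights (?fin) S3"
        proof (rule wp_mono[OF wp_reduce_weights[OF ok3 U(1) U3 m3 m(1) c_def[symmetric] c(1) b3]])
          fix S4
          assume w: "ALL k<n. S4 aW k 0 = (if 0 < L \<mu> c & k \<in> U & k ~= c
             then S3 aW k 0 * L \<mu> c - S3 aW c 0 * L \<mu> k else S3 aW k 0)"
            and f4: "!!r. r ~: mods reduce_weights ==> S4 r = S3 r"
          have f4': "S4 r = S3 r" if "r ~: {i2, aW}" for r
            using that by (intro f4) (auto simp: reduce_weights_def)
          have w': "S4 aW k 0 = (if 0 < L \<mu> c & k \<in> U & k ~= c
             then S1 aW k 0 * L \<mu> c - S1 aW c 0 * L \<mu> k else S1 aW k 0)" if "k < n" for k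
            using w that by (simp add: f3' f2')
          have w_le: "S4 aW k 0 <= ?B (Suc s)" if k: "k < n" for k
          proof -
            have "S1 aW k 0 * L \<mu> c - S1 aW c 0 * L \<mu> k <= S1 aW k 0 * TL"
              using L1_le_TL[OF m(1) c(2)] by (meson diff_le_self le_trans mult_le_mono2)
            moreover have "S1 aW k 0 <= ?B (Suc s)" using ys(6)[OF k] by (simp add: distrib_left trans_le_add1)
            ultimately show ?thesis using w'[OF k] TLM[OF k] by auto
          qed
          have x4: "S4 vcur 0 0 = c" "S4 vn 0 0 = n" "S4 i1 0 0 = s" "S4 aX = S1 aX" "S4 aOrd = S1 aOrd"
            using vn v by (simp_all add: f4' f3' f2' fr' c_def)
          have cM: "c <= M" using c(2) lim_n Lim_le_M by linarith
          have s_n: "s < n" using s vn by simp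
          have cy: "c ~: set ys" using c(1) by (simp add: U_def)
          have "?I (Suc s) (upd (upd (upd S4 aX c 0 1) aOrd (n - 1 - s) 0 c) i1 0 0 (Suc s))"
          proof (intro exI[of _ "ys @ [c]"] conjI allI impI)
            fix t assume "t < Suc s"
            then show "upd (upd (upd S4 aX c 0 1) aOrd (n - 1 - s) 0 c) i1 0 0 (Suc s) aOrd (n - 1 - t) 0 = (ys @ [c]) ! t"
              using s_n ys(1,5) x4 by (auto simp: nth_append less_Suc_eq)
          next
            fix xs assume xs: "distinct xs & set xs = {..<n} - set (ys @ [c]) &
               loads.local_ratio_order (%k. upd (upd (upd S4 aX c 0 1) aOrd (n - 1 - s) 0 c) i1 0 0 (Suc s) aW k 0) xs"
            have setxs: "set (c # xs) = U" "c ~: set xs" using xs c by (auto simp: U_def)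
            have lr: "loads.local_ratio_order (%k. S4 aW k 0) xs" using xs by simp
            have "loads.local_ratio_order (%k. S1 aW k 0) (c # xs)"
            proof (cases "L \<mu> c = 0")
              case True
              \<comment> \<open>The chosen coflow lacks load on the busiest port only if all
                remaining coflows do. Then no port has any load, and every order is admissible by
                repeated use of \<open>Zero\<close>.\<close>
              have "loads.total_load U \<mu> = 0" using c(3)[OF True] by (simp add: loads.total_load_def)
              then have z: "loads.max_load (set (c # xs)) = 0" using m setxs by simp
              have "loads.local_ratio_order (%k. S1 aW k 0) zs" if "loads.max_load (set zs) = 0" for zs
                using that
              proof (induction zs)
                case (Cons z zs)
                have "loads.max_load (set zs) = 0"
                  using Cons.prems loads.max_load_mono[of "set (z # zs)" "set zs"] by auto
                then show ?case using Cons by (intro loads.local_ratio_order.Zero) auto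
              qed (rule loads.local_ratio_order.Nil)
              then show ?thesis using z by blast
            next
              case False
              show ?thesis
                by (rule loads.local_ratio_order.Step[where W' = "%k. S4 aW k 0" and \<mu> = \<mu>])
                  (use m setxs c(4) False lr w' U(1) in auto)
            qed
            then have "loads.local_ratio_order W (ys @ c # xs)"
              using ys(7)[of "c # xs"] xs setxs by (simp add: U_def)
            then show "loads.local_ratio_order W ((ys @ [c]) @ xs)" by simp
          qed (use ys c cy x4 w_le in \<open>auto simp: upd_apply\<close>)
          then show "?fin S4"
            using x4 cM Lim_pos Lim_le_M by simp
        qed
      qed
    qed
  next
    fix S1 assume "?I (S vn 0 0) S1"
    then obtain ys where ys: "length ys = n" "distinct ys" "set ys \<subseteq> {..<n}"
      "!!t. t < n ==> S1 aOrd (n - 1 - t) 0 = ys ! t"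
      "!!xs. distinct xs ==> set xs = {..<n} - set ys ==> loads.local_ratio_order (%k. S1 aW k 0) xs ==>
        loads.local_ratio_order W (ys @ xs)" unfolding vn by blast
    have "set ys = {..<n}"
      using ys by (intro card_subset_eq) (auto simp: distinct_card)
    moreover have "loads.local_ratio_order W ys"
      using ys(5)[of "[]"] \<open>set ys = {..<n}\<close> by (simp add: loads.local_ratio_order.Nil)
    moreover have "S1 aOrd t 0 = ys ! (n - 1 - t)" if "t < n" for t
      using ys(4)[of "n - 1 - t"] that by simp
    ultimately show "EX ys. distinct ys & set ys = {..<n} & loads.local_ratio_order W ys &
     (ALL t<n. S1 aOrd t 0 = ys ! (n - 1 - t))" using ys(2) by blast
  qed (use vn lim_n in \<open>simp_all add: select_port_def select_coflow_def select_coflow_step_def reduce_weights_def\<close>)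
qed

end

section \<open>The program: list scheduling on several cores\<close>

abbreviation "vmm == 260::nat"
abbreviation "vck == 261::nat"
abbreviation "vsz == 262::nat"
abbreviation "vi == 263::nat"
abbreviation "vj == 264::nat"
abbreviation "vhb == 265::nat"
abbreviation "vbv == 266::nat"
abbreviation "aLd == 267::nat"
abbreviation "vt == 268::nat"
abbreviation "vrem == 269::nat"
abbreviation "vcov == 270::nat"
abbreviation "vnxt == 271::nat"
abbreviation "v2F1 == 272::nat"

abbreviation "cS S == (%q. S pC q 0)"
abbreviation "fS S == (%q. (S pI q 0, S pJ q 0, S pK q 0))"
abbreviation "aS S == (%q. S pA q 0)"
abbreviation "bS S == (%q. S pB q 0)"
abbreviation "kS S == S cnt 0 0"

section \<open>Appending a period to the schedule\<close>

definition emit :: "ex => ex => ex => ex => ex => ex => pr" where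
  "emit h i j k a b = Put pC (V cnt) (Cn 0) h ;; Put pI (V cnt) (Cn 0) i ;; Put pJ (V cnt) (Cn 0) j ;;
     Put pK (V cnt) (Cn 0) k ;; Put pA (V cnt) (Cn 0) a ;; Put pB (V cnt) (Cn 0) b ;; cnt :=: V cnt .+ Cn 1"

definition emitted :: "store => nat => nat => nat => nat => nat => nat => store" where
  "emitted S h i j k a b = upd (upd (upd (upd (upd (upd (upd S pC (kS S) 0 h) pI (kS S) 0 i) pJ (kS S) 0 j)
     pK (kS S) 0 k) pA (kS S) 0 a) pB (kS S) 0 b) cnt 0 0 (Suc (kS S))"

lemma mods_emit [simp]: "mods (emit h i j k a b) = {pC, pI, pJ, pK, pA, pB, cnt}"
  by (auto simp: emit_def)

lemma wfp_emit [simp]: "wfp (emit h i j k a b) \<longleftrightarrow> wfe h & wfe i & wfe j & wfe k & wfe a & wfe b"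
  by (simp add: emit_def names_def)

lemma emitted_frame [simp]: "r ~: {pC, pI, pJ, pK, pA, pB, cnt} ==> emitted S h i j k a b r = S r"
  by (simp add: emitted_def)

lemma emitted_fields:
  "kS (emitted S h i j k a b) = Suc (kS S)"
  "cS (emitted S h i j k a b) q = (if q = kS S then h else cS S q)"
  "fS (emitted S h i j k a b) q = (if q = kS S then (i, j, k) else fS S q)"
  "aS (emitted S h i j k a b) q = (if q = kS S then a else aS S q)"
  "bS (emitted S h i j k a b) q = (if q = kS S then b else bS S q)"
  by (auto simp: emitted_def)

text \<open>The expressions must not read the period arrays, so their values do not change while the
  entries are being written.\<close>

lemma (in ram) wp_emit:
  assumes "(reads eh \<union> reads ei \<union> reads ej \<union> reads ek \<union> reads ea \<union> reads eb) \<inter> {pC, pI, pJ, pK, pA, pB, cnt} = {}"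
    and "ev S eh <= M" "ev S ei <= M" "ev S ej <= M" "ev S ek <= M" "ev S ea <= M" "ev S eb <= M" "kS S < Lim"
    and Q: "Q (emitted S (ev S eh) (ev S ei) (ev S ej) (ev S ek) (ev S ea) (ev S eb))"
  shows "wp (emit eh ei ej ek ea eb) Q S"
proof -
  have e: "ev (upd S' r i j v) x = ev S' x"
    if "x \<in> {eh, ei, ej, ek, ea, eb}" "r \<in> {pC, pI, pJ, pK, pA, pB, cnt}" for S' x r i j v
  proof (rule ev_cong, rule upd_other)
    fix r' assume "r' \<in> reads x"
    then show "r' ~= r" using that assms(1) by blast
  qed
  show ?thesis
    unfolding emit_def using assms(2-8) Q Lim_le_M by (simp add: e emitted_def)
qed

context inst
begin

definition "psched X S \<longleftrightarrow> partial_schedule X (kS S) (cS S) (fS S) (aS S) (bS S)"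
definition "snt S f = sent (kS S) (fS S) (aS S) (bS S) f"

lemma psched_emitted:
  assumes "psched X S" "h < m" "i < N" "j < N" "k < n" "X * rho k <= a" "a < b"
    and "!!q. q < kS S ==> cS S q = h ==> S pI q 0 = i \<or> S pJ q 0 = j ==> bS S q <= a \<or> b <= aS S q"
    and "!!q. q < kS S ==> fS S q = (i, j, k) ==> cS S q = h"
  shows "psched X (emitted S h i j k a b)"
  unfolding psched_def emitted_fields(1)
  by (rule partial_schedule_Suc[OF assms(1)[unfolded psched_def]])
    (use assms in \<open>auto simp: emitted_fields[simplified] share_port_def\<close>)

lemma snt_emitted: "snt (emitted S h i j k a b) f = snt S f + (if f = (i, j, k) then b - a else 0)"
  unfolding snt_def emitted_fields(1)
  by (subst sent_Suc[where fl = "fS S" and a = "aS S" and b = "bS S"]) (auto simp: emitted_fields[simplified])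

lemma pschedD:
  assumes "psched X S" "q < kS S"
  shows "cS S q < m" "S pI q 0 < N" "S pJ q 0 < N" "S pK q 0 < n" "X * rho (S pK q 0) <= aS S q" "aS S q < bS S q"
proof -
  have "cS S q < m & source (fS S q) < N & destination (fS S q) < N & coflow_of (fS S q) < n &
       X * rho (coflow_of (fS S q)) <= aS S q & aS S q < bS S q"
    using assms unfolding psched_def partial_schedule_def by blast
  then show "cS S q < m" "S pI q 0 < N" "S pJ q 0 < N" "S pK q 0 < n" "X * rho (S pK q 0) <= aS S q" "aS S q < bS S q"
    by simp_all
qed

end

definition scan_step :: pr where
  "scan_step = Test (eqx (Ar1 pC (V i4)) (V vhb))
    (Test (eqx (Ar1 pI (V i4)) (V vi) .+ eqx (Ar1 pJ (V i4)) (V vj))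
      (Test (Ar1 pA (V i4) .- V vt)
        (Test (V vnxt .- Ar1 pA (V i4)) (vnxt :=: Ar1 pA (V i4)) Skp)
        (Test (Ar1 pB (V i4) .- V vt) (vcov :=: Ar1 pB (V i4)) Skp))
      Skp) Skp"

text \<open>Among the periods on the chosen core that share a port with the flow,
  \<open>vcov\<close> records the end of one in progress at \<open>vt\<close>, and
  \<open>vnxt\<close> the earliest later start, capped at the time by which the flow would be
  finished. The value 0 can stand for no such period, since a period in progress ends after
  \<open>vt\<close>.\<close>

definition scan :: pr where
  "scan = vcov :=: Cn 0 ;; vnxt :=: V vt .+ V vrem ;; Loop i4 cnt scan_step"

text \<open>A round either jumps to the end of a blocking period or transmits until the next one
  starts.\<close>

definition place_step :: pr where
  "place_step = Test (V vrem) (scan ;; Test (V vcov) (vt :=: V vcov)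
     (emit (V vhb) (V vi) (V vj) (V vck) (V vt) (V vnxt) ;;
      vrem :=: V vrem .- (V vnxt .- V vt) ;; vt :=: V vnxt)) Skp"

definition choose_core :: pr where
  "choose_core = vhb :=: Cn 0 ;; vbv :=: Arr aLd (V vi) (Cn 0) .+ Arr aLd (V vN .+ V vj) (Cn 0) ;;
    Loop i3 vmm (Test (V vbv .- (Arr aLd (V vi) (V i3) .+ Arr aLd (V vN .+ V vj) (V i3)))
      (vhb :=: V i3 ;; vbv :=: Arr aLd (V vi) (V i3) .+ Arr aLd (V vN .+ V vj) (V i3)) Skp)"

definition place_flow :: pr where
  "place_flow = vsz :=: Arr aD (V vck) (V i2) ;;
    Test (V vsz)
     (vi :=: V i2 \<oslash> V vN ;; vj :=: V i2 .- V vi .* V vN ;; choose_core ;;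
      Put aLd (V vi) (V vhb) (Arr aLd (V vi) (V vhb) .+ V vsz) ;;
      Put aLd (V vN .+ V vj) (V vhb) (Arr aLd (V vN .+ V vj) (V vhb) .+ V vsz) ;;
      vt :=: Ar1 aRho (V vck) ;; vrem :=: V vsz ;; Loop i3 v2F1 place_step) Skp"

definition place_all :: pr where
  "place_all = Loop i1 vn (vck :=: Ar1 aOrd (V i1) ;; Loop i2 vNN place_flow)"

text \<open>Only \<open>min m (N * N * n)\<close> cores are searched: \<open>m\<close> is written in
  binary, so a loop over all cores need not be polynomial.\<close>

definition list_scheduling :: pr where
  "list_scheduling = compute_order ;;
    Test (V vF .- V vm) (vmm :=: V vm) (vmm :=: V vF) ;; v2F1 :=: Cn 2 .* V vF .+ Cn 1 ;;
    place_all ;; vDen :=: V vD"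

lemma mods_scan [simp]: "mods scan = {vcov, vnxt, i4}"
  by (auto simp: scan_def scan_step_def)

lemma mods_place_step [simp]: "mods place_step = {vcov, vnxt, i4, vt, vrem, pC, pI, pJ, pK, pA, pB, cnt}"
  by (auto simp: place_step_def)

lemma mods_choose_core [simp]: "mods choose_core = {vhb, vbv, i3}"
  by (auto simp: choose_core_def)

definition conf :: "store => nat => nat => nat => nat => bool" where
  "conf S h i j q \<longleftrightarrow> cS S q = h & (S pI q 0 = i \<or> S pJ q 0 = j)"

text \<open>Distinct endpoints are counted instead of periods. A flow may be interrupted many times,
  but it adds at most two new values, which bounds the rounds needed for each later flow.\<close>

definition ends :: "store => nat set" where
  "ends S = (\<Union>q<kS S. {aS S q, bS S q})"

lemma finite_ends [simp]: "finite (ends S)"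
  by (simp add: ends_def)

locale alg1 = alg +
  assumes lim_periods: "N * N * n * (2 * (N * N * n) + 1) <= Lim"
begin

abbreviation "F == N * N * n"

lemma F_pos: "1 <= F"
  using N_pos coflows_pos by simp

lemma wp_scan:
  assumes S: "S vhb 0 0 = h" "S vi 0 0 = i" "S vj 0 0 = j" "S vt 0 0 = t" "S vrem 0 0 = rm" "0 < rm"
    and bd: "kS S <= Lim" "t + rm <= M" "!!q. q < kS S ==> bS S q <= M"
  shows "wp scan (%S'. (S' vcov 0 0 = 0 & (ALL q<kS S. conf S h i j q --> \<not> (aS S q <= t & t < bS S q)) \<or>
        (EX q<kS S. conf S h i j q & aS S q <= t & t < bS S q & S' vcov 0 0 = bS S q)) &
      t < S' vnxt 0 0 & S' vnxt 0 0 <= t + rm &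
      (ALL q<kS S. conf S h i j q --> t < aS S q --> S' vnxt 0 0 <= aS S q) &
      (S' vnxt 0 0 = t + rm \<or> (EX q<kS S. conf S h i j q & S' vnxt 0 0 = aS S q))) S"
proof -
  let ?S = "upd (upd S vcov 0 0 0) vnxt 0 0 (t + rm)"
  define cov where "cov x v \<longleftrightarrow> v = 0 & (ALL q<x. conf S h i j q --> \<not> (aS S q <= t & t < bS S q)) \<or>
        (EX q<kS S. conf S h i j q & aS S q <= t & t < bS S q & v = bS S q)" for x v
  define nxt where "nxt x w \<longleftrightarrow> t < w & w <= t + rm &
      (ALL q<x. conf S h i j q --> t < aS S q --> w <= aS S q) &
      (w = t + rm \<or> (EX q<kS S. conf S h i j q & w = aS S q))" for x w
  have cov1: "cov (Suc x) v" if "cov x v" "\<not> (conf S h i j x & aS S x <= t & t < bS S x)" for x v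
    using that unfolding cov_def less_Suc_eq by blast
  have cov2: "cov (Suc x) (bS S x)" if "conf S h i j x" "aS S x <= t" "t < bS S x" "x < kS S" for x
    using that unfolding cov_def by blast
  have nxt1: "nxt (Suc x) w" if "nxt x w" "conf S h i j x ==> t < aS S x ==> w <= aS S x" for x w
    using that unfolding nxt_def less_Suc_eq by blast
  have nxt2: "nxt (Suc x) (aS S x)" if "nxt x w" "conf S h i j x" "t < aS S x" "aS S x < w" "x < kS S" for x w
  proof -
    have "ALL q<x. conf S h i j q --> t < aS S q --> aS S x <= aS S q" "aS S x <= t + rm"
      using that unfolding nxt_def by (meson less_imp_le_nat less_le_trans, linarith)
    then show ?thesis using that unfolding nxt_def less_Suc_eq by blast
  qed
  let ?I = "%x S'. cov x (S' vcov 0 0) & nxt x (S' vnxt 0 0)"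
  have "wp (Loop i4 cnt scan_step) (?I (kS S)) ?S"
  proof (rule wp_Loop[where I = ?I])
    show "?I 0 (upd ?S i4 0 0 0)" using S by (simp add: cov_def nxt_def)
  next
    fix x S1
    assume x: "x < ?S cnt 0 0" and inv: "?I x S1" and v: "S1 i4 0 0 = x"
      and fr: "!!r. r ~= i4 ==> r ~: mods scan_step ==> S1 r = ?S r"
    have x': "x < kS S" using x by simp
    have fr': "S1 pC = S pC" "S1 pI = S pI" "S1 pJ = S pJ" "S1 pA = S pA" "S1 pB = S pB"
      "S1 vhb 0 0 = h" "S1 vi 0 0 = i" "S1 vj 0 0 = j" "S1 vt 0 0 = t"
      using fr S by (simp_all add: scan_step_def)
    have ci: "cov x (S1 vcov 0 0)" and ni: "nxt x (S1 vnxt 0 0)" using inv by simp_all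
    have nM: "S1 vnxt 0 0 <= M" using ni bd(2) by (simp add: nxt_def)
    consider "\<not> conf S h i j x" | "conf S h i j x" "t < aS S x" "aS S x < S1 vnxt 0 0"
      | "conf S h i j x" "t < aS S x" "S1 vnxt 0 0 <= aS S x"
      | "conf S h i j x" "aS S x <= t" "t < bS S x" | "conf S h i j x" "aS S x <= t" "bS S x <= t"
      by linarith
    then show "wp scan_step (%S''. ?I (Suc x) (upd S'' i4 0 0 (Suc x))) S1"
    proof cases
      case 1
      then show ?thesis using cov1[OF ci] nxt1[OF ni] by (auto simp: scan_step_def v fr' conf_def)
    next
      case 2
      then show ?thesis using cov1[OF ci] nxt2[OF ni] x' nM by (auto simp: scan_step_def v fr' conf_def)
    next
      case 3
      then show ?thesis using cov1[OF ci] nxt1[OF ni] by (auto simp: scan_step_def v fr' conf_def)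
    next
      case 4
      then show ?thesis using cov2[of x] nxt1[OF ni] x' bd(3)[OF x'] by (auto simp: scan_step_def v fr' conf_def)
    next
      case 5
      then show ?thesis using cov1[OF ci] nxt1[OF ni] by (auto simp: scan_step_def v fr' conf_def)
    qed
  qed (use S bd in \<open>simp_all add: scan_step_def\<close>)
  then show ?thesis unfolding scan_def cov_def nxt_def using S bd by simp
qed

lemma wp_choose_core:
  assumes S: "S vi 0 0 = i" "S vj 0 0 = j" "S vN 0 0 = N" "S vmm 0 0 = mm" "1 <= mm" "mm <= Lim"
    and bd: "!!h. h < mm ==> S aLd i h + S aLd (N + j) h <= M"
  shows "wp choose_core (%S'. S' vhb 0 0 < mm &
    (ALL h<mm. S aLd i (S' vhb 0 0) + S aLd (N + j) (S' vhb 0 0) <= S aLd i h + S aLd (N + j) h)) S"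
proof -
  have b0: "S aLd i 0 + S aLd (N + j) 0 <= M" using bd[of 0] S by simp
  show ?thesis
    unfolding choose_core_def
    using S b0
    apply simp
    apply (rule wp_Loop[where I = "%x S'. S' vhb 0 0 < mm & S' vbv 0 0 = S aLd i (S' vhb 0 0) + S aLd (N + j) (S' vhb 0 0) &
      (ALL h<x. S' vbv 0 0 <= S aLd i h + S aLd (N + j) h)"])
          apply (simp_all)
    subgoal for x S1
      using bd[of x] S Lim_le_M by (auto simp: less_Suc_eq not_less)
    subgoal for S1 by force
    done
qed

end

text \<open>The total length before \<open>t\<close> of the periods on core \<open>h\<close> that
  use input \<open>i\<close> or output \<open>j\<close>. Such periods may overlap at different ports
  and are then counted separately.\<close>

definition cover :: "store => nat => nat => nat => nat => nat" where
  "cover S h i j t = (\<Sum>q | q < kS S & conf S h i j q. min (bS S q) t - min (aS S q) t)"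

lemma cover_mono:
  assumes "!!q. q < kS S ==> aS S q <= bS S q" "t <= t'"
  shows "cover S h i j t <= cover S h i j t'"
  unfolding cover_def
proof (intro sum_mono)
  fix q assume "q \<in> {q. q < kS S & conf S h i j q}"
  then have "aS S q <= bS S q" using assms by simp
  then show "min (bS S q) t - min (aS S q) t <= min (bS S q) t' - min (aS S q) t'"
    using assms(2) by (auto simp: min_def)
qed

text \<open>While a conflicting period is in progress, the covered time grows at least as fast as
  time itself; the other periods can only add to it.\<close>

lemma cover_covered:
  assumes "!!q. q < kS S ==> aS S q <= bS S q" "q0 < kS S" "conf S h i j q0" "aS S q0 <= t" "t <= bS S q0"
  shows "cover S h i j t + (bS S q0 - t) <= cover S h i j (bS S q0)"
proof -
  let ?A = "{q. q < kS S & conf S h i j q}"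
  have fin: "finite ?A" "q0 \<in> ?A" using assms by auto
  have "(\<Sum>q\<in>?A - {q0}. min (bS S q) t - min (aS S q) t) <= (\<Sum>q\<in>?A - {q0}. min (bS S q) (bS S q0) - min (aS S q) (bS S q0))"
  proof (intro sum_mono)
    fix q assume "q \<in> ?A - {q0}"
    then have "aS S q <= bS S q" using assms by simp
    then show "min (bS S q) t - min (aS S q) t <= min (bS S q) (bS S q0) - min (aS S q) (bS S q0)"
      using assms(5) by (auto simp: min_def)
  qed
  moreover have "(min (bS S q0) t - min (aS S q0) t) + (bS S q0 - t) = min (bS S q0) (bS S q0) - min (aS S q0) (bS S q0)"
    using assms(4,5) by auto
  ultimately show ?thesis
    unfolding cover_def sum.remove[OF fin] by linarith
qed

lemma cover_le_total:
  assumes "!!q. q < kS S ==> aS S q <= bS S q"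
  shows "cover S h i j t <= (\<Sum>q | q < kS S & conf S h i j q. bS S q - aS S q)"
  unfolding cover_def
proof (intro sum_mono)
  fix q assume "q \<in> {q. q < kS S & conf S h i j q}"
  then have "aS S q <= bS S q" using assms by simp
  then show "min (bS S q) t - min (aS S q) t <= bS S q - aS S q" by (auto simp: min_def)
qed

context alg1
begin

definition "extends S0 S \<longleftrightarrow> (ALL q<kS S0. cS S q = cS S0 q & S pI q 0 = S0 pI q 0 & S pJ q 0 = S0 pJ q 0 & S pK q 0 = S0 pK q 0 &
   aS S q = aS S0 q & bS S q = bS S0 q)"

text \<open>\<open>S0\<close> is the store before the flow is placed. Two conjuncts carry the
  argument: the time since the release is accounted for by transmission and covered time; and while
  data remain, the current time is the release or an old endpoint, with at least \<open>x\<close>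
  old endpoints up to it.\<close>

definition "placing S0 h i j k d x S \<longleftrightarrow>
    psched 1 S & kS S0 <= kS S & kS S <= kS S0 + x &
    extends S0 S &
    (ALL q<kS S. kS S0 <= q --> fS S q = (i, j, k) & cS S q = h & bS S q <= S vt 0 0 &
       {aS S q, bS S q} \<subseteq> ends S0 \<union> {rho k} \<union> (if S vrem 0 0 = 0 then {S vt 0 0} else {})) &
    rho k <= S vt 0 0 &
    snt S (i, j, k) + S vrem 0 0 = d & (ALL f. f ~= (i, j, k) --> snt S f = snt S0 f) &
    S vt 0 0 + S vrem 0 0 <= rho k + cover S0 h i j (S vt 0 0) + d &
    (S vrem 0 0 = 0 \<or> S vt 0 0 \<in> ends S0 \<union> {rho k} & x <= card {e \<in> ends S0. e <= S vt 0 0})"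

text \<open>A jump adds at least its length to \<open>cover\<close>, and a transmission lowers
  \<open>vrem\<close> by as much as it raises \<open>vt\<close>, so the inequality on
  \<open>vt + vrem\<close> persists. Unless the flow is finished, a further old endpoint has been
  reached.\<close>

lemma wp_place_step:
  assumes pl: "placing S0 h i j k d x S"
    and S: "S vhb 0 0 = h" "S vi 0 0 = i" "S vj 0 0 = j" "S vck 0 0 = k"
    and hij: "h < m" "i < N" "j < N" "k < n" "h <= M"
    and S0: "psched 1 S0" "!!q. q < kS S0 ==> fS S0 q ~= (i, j, k)"
    and bd: "rho k + (\<Sum>q | q < kS S0 & conf S0 h i j q. bS S0 q - aS S0 q) + d <= M"
      "!!q. q < kS S0 ==> bS S0 q <= M" "kS S0 + x < Lim"
  shows "wp place_step (placing S0 h i j k d (Suc x)) S"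
proof (cases "S vrem 0 0 = 0")
  case True
  then have "placing S0 h i j k d (Suc x) S" using pl unfolding placing_def by auto
  then show ?thesis using True by (simp add: place_step_def)
next
  case False
  let ?t = "S vt 0 0" and ?r = "S vrem 0 0"
  let ?N = "%S' q. fS S' q = (i, j, k) & cS S' q = h & bS S' q <= S' vt 0 0 &
     {aS S' q, bS S' q} \<subseteq> ends S0 \<union> {rho k} \<union> (if S' vrem 0 0 = 0 then {S' vt 0 0} else {})"
  let ?E = "wp (emit (V vhb) (V vi) (V vj) (V vck) (V vt) (V vnxt))
     (wp (vrem :=: V vrem .- (V vnxt .- V vt)) (wp (vt :=: V vnxt) (placing S0 h i j k d (Suc x))))"
  note pl' = pl[unfolded placing_def]
  have P: "psched 1 S" "kS S0 <= kS S" "kS S <= kS S0 + x" using pl' by blast+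
  have old: "!!q. q < kS S0 ==> cS S q = cS S0 q & S pI q 0 = S0 pI q 0 & S pJ q 0 = S0 pJ q 0 & S pK q 0 = S0 pK q 0 &
       aS S q = aS S0 q & bS S q = bS S0 q" using pl' unfolding extends_def by blast
  have new: "!!q. q < kS S ==> kS S0 <= q ==> fS S q = (i, j, k) & cS S q = h & bS S q <= ?t &
       {aS S q, bS S q} \<subseteq> ends S0 \<union> {rho k}"
  proof -
    fix q assume "q < kS S" "kS S0 <= q"
    then have "?N S q" using pl' by blast
    then show "fS S q = (i, j, k) & cS S q = h & bS S q <= ?t & {aS S q, bS S q} \<subseteq> ends S0 \<union> {rho k}"
      using False by simp
  qed
  have rt: "rho k <= ?t" using pl' by blast
  have sn: "snt S (i, j, k) + ?r = d" "!!f. f ~= (i, j, k) ==> snt S f = snt S0 f" using pl' by blast+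
  have tc: "?t + ?r <= rho k + cover S0 h i j ?t + d" using pl' by blast
  have te: "?t \<in> ends S0 \<union> {rho k}" "x <= card {e \<in> ends S0. e <= ?t}" using pl' False by blast+
  have ab0: "aS S0 q <= bS S0 q" if "q < kS S0" for q using pschedD(6)[OF S0(1) that] by simp
  have trM: "?t + ?r <= M"
    using tc cover_le_total[of S0 h i j "?t", OF ab0] bd(1) by linarith
  have bM: "bS S q <= M" if "q < kS S" for q
    using old[of q] new[OF that] bd(2)[of q] trM by (cases "q < kS S0") auto
  have kLim: "kS S <= Lim" "kS S < Lim" using P(3) bd(3) by simp_all
  have rp: "0 < ?r" using False by simp
  have cf: "conf S h i j q \<longleftrightarrow> conf S0 h i j q" if "q < kS S0" for q
    using old[OF that] by (simp add: conf_def)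
  have step: "Suc x <= card {e \<in> ends S0. e <= t'}" if "t' \<in> ends S0" "?t < t'" for t'
  proof -
    have "t' \<in> {e \<in> ends S0. e <= t'} - {e \<in> ends S0. e <= ?t}" using that by auto
    then have "{e \<in> ends S0. e <= ?t} \<subset> {e \<in> ends S0. e <= t'}" using that by fastforce
    then have "card {e \<in> ends S0. e <= ?t} < card {e \<in> ends S0. e <= t'}"
      by (intro psubset_card_mono) auto
    then show ?thesis using te(2) by linarith
  qed
  have "wp scan (%S. if ev S (V vcov) ~= 0 then wp (vt :=: V vcov) (placing S0 h i j k d (Suc x)) S
        else ?E S) S"
  proof (rule wp_mono[OF wp_scan[of S h i j ?t ?r, OF S(1-3) refl refl rp kLim(1) trM bM]])
    fix S2
    assume sc: "(S2 vcov 0 0 = 0 & (ALL q<kS S. conf S h i j q --> \<not> (aS S q <= ?t & ?t < bS S q)) \<or>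
        (EX q<kS S. conf S h i j q & aS S q <= ?t & ?t < bS S q & S2 vcov 0 0 = bS S q)) &
      ?t < S2 vnxt 0 0 & S2 vnxt 0 0 <= ?t + ?r &
      (ALL q<kS S. conf S h i j q --> ?t < aS S q --> S2 vnxt 0 0 <= aS S q) &
      (S2 vnxt 0 0 = ?t + ?r \<or> (EX q<kS S. conf S h i j q & S2 vnxt 0 0 = aS S q))"
      and f2: "!!r. r ~: mods scan ==> S2 r = S r"
    note sc1 = sc[THEN conjunct1] and sc2 = sc[THEN conjunct2]
    have f2': "S2 r = S r" if "r ~: {vcov, vnxt, i4}" for r using that f2 by simp
    have psn: "psched 1 S2 = psched 1 S" "snt S2 = snt S" by (simp_all add: psched_def snt_def f2' fun_eq_iff)
    show "if ev S2 (V vcov) ~= 0 then wp (vt :=: V vcov) (placing S0 h i j k d (Suc x)) S2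
        else ?E S2"
    proof (cases "S2 vcov 0 0 = 0")
      case cov: False
      then obtain q where q: "q < kS S" "conf S h i j q" "aS S q <= ?t" "?t < bS S q" "S2 vcov 0 0 = bS S q"
        using sc1 by auto
      \<comment> \<open>Periods of the flow itself end by the current time, so the blocking period
        belongs to an earlier flow.\<close>
      have q0: "q < kS S0" using new[OF q(1)] q(4) by (meson leD le_less_linear)
      define t' where "t' = bS S q"
      have t': "t' = bS S0 q" using old[OF q0] by (simp add: t'_def)
      have t'e: "t' \<in> ends S0" using q0 t' by (auto simp: ends_def)
      have tt': "?t < t'" using q(4) by (simp add: t'_def)
      have "cover S0 h i j ?t + (t' - ?t) <= cover S0 h i j t'"
        unfolding t' using old[OF q0] q cf[OF q0] by (intro cover_covered ab0 q0) auto
      then have tc': "t' + ?r <= rho k + cover S0 h i j t' + d" using tc tt' by linarith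
      let ?S3 = "upd S2 vt 0 0 t'"
      have eq: "psched 1 ?S3 = psched 1 S" "snt ?S3 = snt S"
        by (simp_all add: psched_def snt_def f2' fun_eq_iff)
      have "placing S0 h i j k d (Suc x) ?S3"
        unfolding placing_def
      proof (intro conjI)
        show "psched 1 ?S3" using P eq by simp
        show "kS S0 <= kS ?S3" "kS ?S3 <= kS S0 + Suc x" using P by (simp_all add: f2')
        show "extends S0 ?S3" using old by (simp add: extends_def f2')
        show "ALL q<kS ?S3. kS S0 <= q --> ?N ?S3 q"
        proof (intro allI impI)
          fix q assume "q < kS ?S3" "kS S0 <= q"
          then show "?N ?S3 q"
            using new[of q] tt' by (auto simp: f2')
        qed
        show "rho k <= ?S3 vt 0 0" using rt tt' by simp
        show "snt ?S3 (i, j, k) + ?S3 vrem 0 0 = d" using sn(1) eq by (simp add: f2')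
        show "ALL f. f ~= (i, j, k) --> snt ?S3 f = snt S0 f" using sn(2) eq by simp
        show "?S3 vt 0 0 + ?S3 vrem 0 0 <= rho k + cover S0 h i j (?S3 vt 0 0) + d" using tc' by (simp add: f2')
        show "?S3 vrem 0 0 = 0 \<or> ?S3 vt 0 0 \<in> ends S0 \<union> {rho k} & Suc x <= card {e \<in> ends S0. e <= ?S3 vt 0 0}"
          using t'e step[OF t'e tt'] by simp
      qed
      moreover have "t' <= M" using bM[OF q(1)] by (simp add: t'_def)
      ultimately show ?thesis using cov q(5) by (simp add: t'_def)
    next
      case cov: True
      define t' where "t' = S2 vnxt 0 0"
      have nc: "!!q. q < kS S ==> conf S h i j q ==> \<not> (aS S q <= ?t & ?t < bS S q)"
        using sc1 cov by auto
      have t': "?t < t'" "t' <= ?t + ?r" "!!q. q < kS S ==> conf S h i j q ==> ?t < aS S q ==> t' <= aS S q"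
        "t' = ?t + ?r \<or> (EX q<kS S. conf S h i j q & t' = aS S q)"
        using sc2 unfolding t'_def by auto
      have t'e: "t' = ?t + ?r \<or> t' \<in> ends S0"
      \<comment> \<open>Own periods also start before the current time, so a transmission is cut
        short only where a period of an earlier flow starts.\<close>
      proof -
        have lt: "q < kS S0" if "q < kS S" "t' = aS S q" for q
        proof (rule ccontr)
          assume "\<not> q < kS S0"
          then have "bS S q <= ?t" using new[OF that(1)] by simp
          then show False using pschedD(6)[OF P(1) that(1)] that(2) t'(1) by linarith
        qed
        have "t' \<in> ends S0" if "q < kS S" "t' = aS S q" for q
        proof -
          note q0 = lt[OF that]
          then have "t' = aS S0 q" using old[OF q0] that(2) by (simp only:)
          then show ?thesis using q0 unfolding ends_def by (simp only: UN_iff lessThan_iff) blast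
        qed
        then show ?thesis using t'(4) by blast
      qed
      define S3 where "S3 = emitted S2 h i j k ?t t'"
      have ps3: "psched 1 S3"
        unfolding S3_def
      proof (rule psched_emitted)
        show "psched 1 S2" using P psn by simp
        fix q assume q: "q < kS S2" "cS S2 q = h" "S2 pI q 0 = i \<or> S2 pJ q 0 = j"
        then have "q < kS S" "conf S h i j q" by (auto simp: f2' conf_def)
        then show "bS S2 q <= ?t \<or> t' <= aS S2 q"
          using nc[of q] t'(3)[of q] by (auto simp: f2' not_less not_le)
      next
        fix q assume q: "q < kS S2" "fS S2 q = (i, j, k)"
        then have "q < kS S" "fS S q = (i, j, k)" by (auto simp: f2')
        then show "cS S2 q = h"
          using new[of q] S0(2)[of q] old[of q] by (cases "q < kS S0") (auto simp: f2')
      qed (use hij rt t' in auto)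
      have sn3: "snt S3 f = snt S f + (if f = (i, j, k) then t' - ?t else 0)" for f
        unfolding S3_def snt_emitted psn ..
      let ?S4 = "upd (upd S3 vrem 0 0 (?r - (t' - ?t))) vt 0 0 t'"
      have pl4: "placing S0 h i j k d (Suc x) ?S4"
        unfolding placing_def
      proof (intro conjI)
        have eq: "psched 1 ?S4 = psched 1 S3" "snt ?S4 = snt S3"
          by (simp_all add: psched_def snt_def fun_eq_iff)
        show "psched 1 ?S4" using ps3 eq by simp
        show "snt ?S4 (i, j, k) + ?S4 vrem 0 0 = d" using sn sn3 t' eq by simp
        show "ALL f. f ~= (i, j, k) --> snt ?S4 f = snt S0 f" using sn sn3 eq by simp
        have k3: "kS ?S4 = Suc (kS S)" by (simp add: S3_def emitted_fields f2')
        show "kS S0 <= kS ?S4" "kS ?S4 <= kS S0 + Suc x" using P k3 by simp_all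
        show "extends S0 ?S4" using old P by (auto simp: extends_def S3_def emitted_def f2')
        show "ALL q<kS ?S4. kS S0 <= q --> ?N ?S4 q"
        proof (intro allI impI)
          fix q assume q: "q < kS ?S4" "kS S0 <= q"
          show "?N ?S4 q"
          proof (cases "q = kS S")
            case True
            then show ?thesis using te t' t'e by (auto simp: S3_def emitted_def f2')
          next
            case False
            then have "q < kS S" using q k3 by simp
            then show ?thesis using new[OF _ q(2)] False t'(1) by (auto simp: S3_def emitted_def f2')
          qed
        qed
        show "rho k <= ?S4 vt 0 0" using rt t' by simp
        have "cover S0 h i j ?t <= cover S0 h i j t'" using t'(1) by (intro cover_mono ab0) auto
        then show "?S4 vt 0 0 + ?S4 vrem 0 0 <= rho k + cover S0 h i j (?S4 vt 0 0) + d" using tc t' by simp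
        show "?S4 vrem 0 0 = 0 \<or> ?S4 vt 0 0 \<in> ends S0 \<union> {rho k} & Suc x <= card {e \<in> ends S0. e <= ?S4 vt 0 0}"
          using t'e step[of t'] t' by auto
      qed
      have vals: "ev S2 (V vhb) = h" "ev S2 (V vi) = i" "ev S2 (V vj) = j" "ev S2 (V vck) = k" "ev S2 (V vt) = ?t" "ev S2 (V vnxt) = t'"
        using S by (simp_all add: f2' t'_def)
      have NM: "i <= M" "j <= M" "k <= M" using hij lim_N lim_n Lim_le_M by linarith+
      have "?E S2"
      proof (rule wp_emit)
        show "wp (vrem :=: V vrem .- (V vnxt .- V vt)) (wp (vt :=: V vnxt) (placing S0 h i j k d (Suc x)))
          (emitted S2 (ev S2 (V vhb)) (ev S2 (V vi)) (ev S2 (V vj)) (ev S2 (V vck)) (ev S2 (V vt)) (ev S2 (V vnxt)))"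
          unfolding vals S3_def[symmetric] using pl4 trM t'
          by (simp add: S3_def f2' t'_def[symmetric])
      qed (use vals trM t' NM hij kLim in \<open>simp_all add: f2'\<close>)
      then show ?thesis using cov by simp
    qed
  qed
  moreover have "ev S (V vrem) ~= 0" using False by simp
  ultimately show ?thesis unfolding place_step_def wp_Test wp_Sq by (simp only: if_True not_False_eq_True)
qed

end

section \<open>Port loads and the invariant of list scheduling\<close>

context inst
begin

definition pt :: "nat => flow => bool" where
  "pt p f \<longleftrightarrow> p = source f \<or> p = N + destination f"

definition ddf :: "flow => nat" where
  "ddf f = dd (source f) (destination f) (coflow_of f)"

definition port_sum :: "flow set => nat => nat" where
  "port_sum X p = (\<Sum>f | f \<in> X & pt p f. ddf f)"

definition busy :: "store => nat => nat => nat" where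
  "busy S p h = (\<Sum>q | q < kS S & cS S q = h & pt p (fS S q). bS S q - aS S q)"

lemma port_sum_insert:
  assumes "finite X" "f ~: X"
  shows "port_sum (insert f X) p = port_sum X p + (if pt p f then ddf f else 0)"
proof -
  have "{g. g \<in> insert f X & pt p g} = {g. g \<in> X & pt p g} \<union> (if pt p f then {f} else {})" by auto
  then show ?thesis
    unfolding port_sum_def using assms by (simp add: sum.union_disjoint)
qed

lemma port_sum_coflows:
  assumes p: "p < 2 * N" and A: "finite A" and X: "X \<subseteq> {..<N} \<times> {..<N} \<times> A"
  shows "port_sum X p <= loads.total_load A p"
proof -
  define F where "F = (if p < N then {p} \<times> {..<N} \<times> A else {..<N} \<times> {p - N} \<times> A)"
  have fin: "finite F" using A by (simp add: F_def)
  have "port_sum X p <= (\<Sum>f\<in>F. ddf f)"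
    unfolding port_sum_def
  proof (rule sum_mono2[OF fin])
    show "{f. f \<in> X & pt p f} \<subseteq> F" using X p by (auto simp: F_def pt_def)
  qed auto
  also have "... = loads.total_load A p"
  proof (cases "p < N")
    case True
    have "(\<Sum>f\<in>F. ddf f) = (\<Sum>j<N. \<Sum>k\<in>A. dd p j k)"
      using True by (simp add: F_def ddf_def sum.cartesian_product')
    also have "... = (\<Sum>k\<in>A. \<Sum>j<N. dd p j k)" by (rule sum.swap)
    finally show ?thesis using True by (simp add: loads.total_load_def L_def)
  next
    case False
    have "(\<Sum>f\<in>F. ddf f) = (\<Sum>i<N. \<Sum>k\<in>A. dd i (p - N) k)"
      using False by (simp add: F_def ddf_def sum.cartesian_product')
    also have "... = (\<Sum>k\<in>A. \<Sum>i<N. dd i (p - N) k)" by (rule sum.swap)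
    finally show ?thesis using False by (simp add: loads.total_load_def L_def)
  qed
  finally show ?thesis .
qed

text \<open>A conflicting period uses one of the two ports; one that uses both is counted twice on
  the right.\<close>

lemma conf_le_busy:
  "(\<Sum>q | q < kS S & conf S h i j q. bS S q - aS S q) <= busy S i h + busy S (N + j) h"
proof -
  let ?A = "{q. q < kS S & cS S q = h & pt i (fS S q)}" and ?B = "{q. q < kS S & cS S q = h & pt (N + j) (fS S q)}"
  have "(\<Sum>q | q < kS S & conf S h i j q. bS S q - aS S q) <= (\<Sum>q\<in>?A \<union> ?B. bS S q - aS S q)"
    by (rule sum_mono2) (auto simp: conf_def pt_def)
  also have "... <= busy S i h + busy S (N + j) h"
    unfolding busy_def by (subst sum_Un_nat) auto
  finally show ?thesis .
qed

end

context alg1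
begin

definition "mm = min m F"

definition "placed S0 h i j k d S \<longleftrightarrow>
    psched 1 S & kS S0 <= kS S & kS S <= kS S0 + (2 * F + 1) &
    extends S0 S &
    (ALL q<kS S. kS S0 <= q --> fS S q = (i, j, k) & cS S q = h &
       bS S q <= rho k + (\<Sum>q | q < kS S0 & conf S0 h i j q. bS S0 q - aS S0 q) + d) &
    card (ends S) <= card (ends S0) + 2 &
    snt S (i, j, k) = d & (ALL f. f ~= (i, j, k) --> snt S f = snt S0 f)"

text \<open>With data left after \<open>2 * F + 1\<close> rounds there would be more than
  \<open>2 * F\<close> old endpoints up to the current time.\<close>

lemma wp_place_loop:
  assumes S0: "psched 1 S0" "!!q. q < kS S0 ==> fS S0 q ~= (i, j, k)"
    and S: "S0 vhb 0 0 = h" "S0 vi 0 0 = i" "S0 vj 0 0 = j" "S0 vck 0 0 = k" "S0 v2F1 0 0 = 2 * F + 1"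
      "S0 vt 0 0 = rho k" "S0 vrem 0 0 = d" "0 < d"
    and hij: "h < m" "i < N" "j < N" "k < n" "h <= M"
    and bd: "rho k + (\<Sum>q | q < kS S0 & conf S0 h i j q. bS S0 q - aS S0 q) + d <= M"
      "!!q. q < kS S0 ==> bS S0 q <= M" "kS S0 + (2 * F + 1) <= Lim" "card (ends S0) <= 2 * F"
  shows "wp (Loop i3 v2F1 place_step) (placed S0 h i j k d) S0"
proof (rule wp_Loop[where I = "%x S. placing S0 h i j k d x S"])
  let ?S = "upd S0 i3 0 0 0"
  have "snt S0 (i, j, k) = 0"
    unfolding snt_def sent_def using S0(2) by (intro sum.neutral) blast
  moreover have "psched 1 ?S = psched 1 S0" "snt ?S = snt S0" by (simp_all add: psched_def snt_def fun_eq_iff)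
  ultimately show "placing S0 h i j k d 0 ?S"
    unfolding placing_def extends_def using S0(1) S by simp
next
  fix x S1
  assume x: "x < S0 v2F1 0 0" and pl: "placing S0 h i j k d x S1" and v: "S1 i3 0 0 = x"
    and fr: "!!r. r ~= i3 ==> r ~: mods place_step ==> S1 r = S0 r"
  have "wp place_step (placing S0 h i j k d (Suc x)) S1"
    by (rule wp_place_step[OF pl]) (use S hij S0 bd x fr in auto)
  then show "wp place_step (%S''. placing S0 h i j k d (Suc x) (upd S'' i3 0 0 (Suc x))) S1"
  proof (rule wp_mono)
    fix S' :: store assume pl': "placing S0 h i j k d (Suc x) S'"
    let ?T = "upd S' i3 0 0 (Suc x)"
    have eqs: "psched 1 ?T = psched 1 S'" "snt ?T = snt S'" "?T cnt = S' cnt" "?T pC = S' pC" "?T pI = S' pI"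
      "?T pJ = S' pJ" "?T pK = S' pK" "?T pA = S' pA" "?T pB = S' pB" "?T vt = S' vt" "?T vrem = S' vrem"
      by (simp_all add: psched_def snt_def fun_eq_iff)
    show "placing S0 h i j k d (Suc x) ?T"
      using pl' unfolding placing_def extends_def eqs .
  qed
next
  fix S1 :: store
  assume pl: "placing S0 h i j k d (S0 v2F1 0 0) S1"
  note pl' = pl[unfolded placing_def S(5)]
  have "card {e \<in> ends S0. e <= S1 vt 0 0} <= card (ends S0)" by (intro card_mono) auto
  then have r0: "S1 vrem 0 0 = 0" using pl' bd(4) by linarith
  have tt: "S1 vt 0 0 <= rho k + (\<Sum>q | q < kS S0 & conf S0 h i j q. bS S0 q - aS S0 q) + d"
  proof -
    have "aS S0 q <= bS S0 q" if "q < kS S0" for q using pschedD(6)[OF S0(1) that] by simp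
    from cover_le_total[of S0 h i j "S1 vt 0 0", OF this] show ?thesis using pl' by linarith
  qed
  show "placed S0 h i j k d S1"
    unfolding placed_def
  proof (intro conjI)
    show "psched 1 S1" "kS S0 <= kS S1" "kS S1 <= kS S0 + (2 * F + 1)" using pl' by blast+
    show "extends S0 S1" using pl' by blast
    show "ALL q<kS S1. kS S0 <= q --> fS S1 q = (i, j, k) & cS S1 q = h &
       bS S1 q <= rho k + (\<Sum>q | q < kS S0 & conf S0 h i j q. bS S0 q - aS S0 q) + d"
    proof (intro allI impI)
      fix q assume "q < kS S1" "kS S0 <= q"
      then have "fS S1 q = (i, j, k) & cS S1 q = h & bS S1 q <= S1 vt 0 0" using pl' by blast
      then show "fS S1 q = (i, j, k) & cS S1 q = h &
         bS S1 q <= rho k + (\<Sum>q | q < kS S0 & conf S0 h i j q. bS S0 q - aS S0 q) + d" using tt by auto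
    qed
    \<comment> \<open>Interruptions begin and end at old endpoints; only the release and the final
      time can be new.\<close>
    have "ends S1 \<subseteq> ends S0 \<union> {rho k, S1 vt 0 0}"
    proof
      fix e assume "e \<in> ends S1"
      then obtain q where q: "q < kS S1" "e = aS S1 q \<or> e = bS S1 q" by (auto simp: ends_def)
      show "e \<in> ends S0 \<union> {rho k, S1 vt 0 0}"
      proof (cases "q < kS S0")
        case True
        then have "aS S1 q = aS S0 q & bS S1 q = bS S0 q" using pl' unfolding extends_def by blast
        then show ?thesis using q True unfolding ends_def by auto
      next
        case False
        then have "{aS S1 q, bS S1 q} \<subseteq> ends S0 \<union> {rho k} \<union> (if S1 vrem 0 0 = 0 then {S1 vt 0 0} else {})"
          using pl' q(1) by (meson not_le)
        then show ?thesis using q(2) r0 by auto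
      qed
    qed
    then have "card (ends S1) <= card (ends S0 \<union> {rho k, S1 vt 0 0})" by (intro card_mono) auto
    also have "... <= card (ends S0) + card {rho k, S1 vt 0 0}" by (rule card_Un_le)
    also have "card {rho k, S1 vt 0 0} <= 2" by (simp add: card_insert_if)
    finally show "card (ends S1) <= card (ends S0) + 2" by simp
    show "snt S1 (i, j, k) = d" using pl' r0 by simp
    show "ALL f. f ~= (i, j, k) --> snt S1 f = snt S0 f" using pl' by blast
  qed
qed (use S bd in simp_all)

text \<open>\<open>X\<close> is the set of flows placed so far. The set of cores in use, at most one
  per flow, matters when there are more cores than flows. End times appear multiplied by
  \<open>m\<close> to stay integral; \<open>mxl k\<close> will be the maximal load of the coflows up
  to \<open>k\<close>.\<close>

definition list_inv :: "(nat => nat) => flow set => store => bool" where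
  "list_inv mxl X S \<longleftrightarrow> X \<subseteq> flows I & psched 1 S & (\<forall>f\<in>X. snt S f = ddf f) &
    (ALL q<kS S. fS S q \<in> X & cS S q < mm) &
    (ALL p<2*N. ALL h<mm. S aLd p h = busy S p h) &
    (ALL p<2*N. (\<Sum>h<mm. S aLd p h) = port_sum X p) &
    (\<exists>H\<subseteq>{..<mm}. card H <= card X & (ALL h<mm. h ~: H --> (ALL p<2*N. S aLd p h = 0))) &
    (ALL q<kS S. m * bS S q <= m * (rho (S pK q 0) + ddf (fS S q)) + 2 * mxl (S pK q 0)) &
    card (ends S) <= 2 * card X & kS S <= card X * (2 * F + 1)"

lemma card_flows: "card (flows I) = F"
  by (simp add: flows_def card_cartesian_product)

lemma list_inv_cong:
  assumes "list_inv mxl X S" "!!r. r \<in> {cnt, pC, pI, pJ, pK, pA, pB, aLd} ==> S' r = S r"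
  shows "list_inv mxl X S'"
proof -
  have eqs: "S' cnt = S cnt" "S' pC = S pC" "S' pI = S pI" "S' pJ = S pJ" "S' pK = S pK" "S' pA = S pA"
    "S' pB = S pB" "S' aLd = S aLd"
    using assms(2) by simp_all
  show ?thesis
    using assms(1) unfolding list_inv_def psched_def snt_def busy_def ends_def eqs .
qed

lemma list_inv_core_loads:
  "list_inv mxl X S ==> p < 2 * N ==> (\<Sum>h<mm. S aLd p h) = port_sum X p"
  unfolding list_inv_def by blast

lemma snt_absent: "(!!q. q < kS S ==> fS S q ~= f) ==> snt S f = 0"
  unfolding snt_def sent_def by (intro sum.neutral) blast

lemma list_inv_zero:
  assumes "list_inv mxl X S" "f \<in> flows I" "f ~: X" "ddf f = 0"
  shows "list_inv mxl (insert f X) S"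
proof -
  have fin: "finite X" using assms finite_subset[OF _ finite_flows] by (auto simp: list_inv_def)
  have "snt S f = 0" using assms by (intro snt_absent) (auto simp: list_inv_def)
  moreover obtain H where "H \<subseteq> {..<mm} & card H <= card X & (ALL h<mm. h ~: H --> (ALL p<2*N. S aLd p h = 0))"
    using assms unfolding list_inv_def by blast
  then have "\<exists>H\<subseteq>{..<mm}. card H <= card (insert f X) & (ALL h<mm. h ~: H --> (ALL p<2*N. S aLd p h = 0))"
    using fin assms(3) by (intro exI[of _ H]) auto
  ultimately show ?thesis
    using assms fin unfolding list_inv_def by (auto simp: port_sum_insert)
qed

text \<open>If all \<open>m\<close> cores are searched, the smallest combined load is at most the
  average. Otherwise as many cores are searched as there are flows; since \<open>f\<close> is not
  yet placed, one of them is empty and the smallest load is 0.\<close>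

lemma least_loaded_core:
  assumes inv: "list_inv mxl X S" and f: "f \<in> flows I" "f ~: X"
    and min: "!!h'. h' < mm ==> S aLd p h + S aLd p' h <= S aLd p h' + S aLd p' h'"
    and p: "p < 2 * N" "p' < 2 * N"
  shows "m * (S aLd p h + S aLd p' h) <= port_sum X p + port_sum X p'"
proof (cases "m <= F")
  case True
  then have mm: "mm = m" by (simp add: mm_def)
  have "m * (S aLd p h + S aLd p' h) = (\<Sum>h'<mm. S aLd p h + S aLd p' h)" using mm by simp
  also have "... <= (\<Sum>h'<mm. S aLd p h' + S aLd p' h')" using min by (intro sum_mono) auto
  also have "... = port_sum X p + port_sum X p'"
    using list_inv_core_loads[OF inv] p by (simp add: sum.distrib)
  finally show ?thesis .
next
  case False
  then have mm: "mm = F" by (simp add: mm_def)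
  obtain H where H: "H \<subseteq> {..<mm}" "card H <= card X" "!!h p. h < mm ==> h ~: H ==> p < 2 * N ==> S aLd p h = 0"
    using inv unfolding list_inv_def by blast
  have "X \<subset> flows I" using inv f by (auto simp: list_inv_def)
  then have "card X < F" using card_flows psubset_card_mono[OF finite_flows] by metis
  then have "card H < card {..<mm}" using H mm by simp
  then obtain h' where "h' < mm" "h' ~: H"
    by (metis H(1) card_mono finite_lessThan leD lessThan_iff subsetI finite_subset)
  then have "S aLd p h + S aLd p' h <= 0" using min[of h'] H(3) p by simp
  then show ?thesis by simp
qed

lemma list_inv_insert:
  assumes inv: "list_inv mxl X S0" and f: "f = (i, j, k)" "i < N" "j < N" "k < n" "f ~: X"
    and h: "h < mm" and mxl: "!!p. p < 2 * N ==> port_sum X p <= mxl k"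
    and min: "!!h'. h' < mm ==> S0 aLd i h + S0 aLd (N + j) h <= S0 aLd i h' + S0 aLd (N + j) h'"
    and pl: "placed S0 h i j k (ddf f) S"
    and ld: "!!p h'. p < 2 * N ==> h' < mm ==> S aLd p h' = S0 aLd p h' + (if h' = h & pt p f then ddf f else 0)"
  shows "list_inv mxl (insert f X) S"
proof -
  have fI: "f \<in> flows I" using f by (simp add: flows_def)
  have X: "X \<subseteq> flows I" and fin: "finite X"
    using inv finite_subset[OF _ finite_flows] by (auto simp: list_inv_def)
  have fne: "fS S0 q ~= f" if "q < kS S0" for q using inv f(5) that unfolding list_inv_def by blast
  note pl' = pl[unfolded placed_def]
  have P: "psched 1 S" and k1: "kS S0 <= kS S" and k2: "kS S <= kS S0 + (2 * F + 1)" using pl' by blast+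
  have old: "cS S q = cS S0 q & S pI q 0 = S0 pI q 0 & S pJ q 0 = S0 pJ q 0 & S pK q 0 = S0 pK q 0 &
       aS S q = aS S0 q & bS S q = bS S0 q" if "q < kS S0" for q using pl' that unfolding extends_def by blast
  have new: "fS S q = f & cS S q = h & bS S q <= rho k + (\<Sum>q | q < kS S0 & conf S0 h i j q. bS S0 q - aS S0 q) + ddf f"
    if "q < kS S" "\<not> q < kS S0" for q using pl' that f(1) by (meson not_less)
  have sn: "snt S f = ddf f" "!!g. g ~= f ==> snt S g = snt S0 g" using pl' f(1) by blast+
  have bs: "busy S p h' = busy S0 p h' + (if h' = h & pt p f then ddf f else 0)" for p h'
  proof -
    have "{q. q < kS S & cS S q = h' & pt p (fS S q)} =
       {q. q < kS S0 & cS S0 q = h' & pt p (fS S0 q)} \<union> (if h' = h & pt p f then {q. q < kS S & \<not> q < kS S0} else {})"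
      (is "?A = ?B \<union> ?C")
    proof (intro set_eqI)
      fix q
      show "q \<in> ?A \<longleftrightarrow> q \<in> ?B \<union> ?C"
      proof (cases "q < kS S0")
        case True
        then show ?thesis using old[OF True] k1 by auto
      next
        case False
        then show ?thesis using new[of q] by auto
      qed
    qed
    then have "busy S p h' = (\<Sum>q\<in>?B. bS S q - aS S q) + (\<Sum>q\<in>?C. bS S q - aS S q)"
      unfolding busy_def by (simp only:) (rule sum.union_disjoint, auto)
    also have "(\<Sum>q\<in>?B. bS S q - aS S q) = busy S0 p h'"
      unfolding busy_def using old by (intro sum.cong) auto
    also have "(\<Sum>q\<in>?C. bS S q - aS S q) = (if h' = h & pt p f then ddf f else 0)"
    proof -
      have "{q. q < kS S & \<not> q < kS S0} = {q. q < kS S & fS S q = f}"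
      proof (intro set_eqI)
        fix q
        show "q \<in> {q. q < kS S & \<not> q < kS S0} \<longleftrightarrow> q \<in> {q. q < kS S & fS S q = f}"
          using new[of q] old[of q] fne[of q] by (cases "q < kS S0") auto
      qed
      then show ?thesis using sn(1) by (simp add: snt_def sent_def)
    qed
    finally show ?thesis .
  qed
  have endb: "m * bS S q <= m * (rho (S pK q 0) + ddf (fS S q)) + 2 * mxl (S pK q 0)" if q: "q < kS S" for q
  proof (cases "q < kS S0")
    case True
    then show ?thesis using inv old[OF True] unfolding list_inv_def by simp
  next
    case False
    have nw: "fS S q = f" "bS S q <= rho k + (\<Sum>q | q < kS S0 & conf S0 h i j q. bS S0 q - aS S0 q) + ddf f"
      using new[OF q False] by auto
    have "(\<Sum>q | q < kS S0 & conf S0 h i j q. bS S0 q - aS S0 q) <= S0 aLd i h + S0 aLd (N + j) h"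
      using conf_le_busy[of S0 h i j] inv h f by (simp add: list_inv_def)
    then have "bS S q <= (rho k + ddf f) + (S0 aLd i h + S0 aLd (N + j) h)" using nw by linarith
    then have "m * bS S q <= m * (rho k + ddf f) + m * (S0 aLd i h + S0 aLd (N + j) h)"
      by (metis distrib_left mult_le_mono2)
    moreover have "m * (S0 aLd i h + S0 aLd (N + j) h) <= port_sum X i + port_sum X (N + j)"
      using f by (intro least_loaded_core[OF inv fI f(5)] min) auto
    moreover have "port_sum X i + port_sum X (N + j) <= 2 * mxl k"
      using mxl[of i] mxl[of "N + j"] f by simp
    moreover have "S pK q 0 = k" using nw(1) f(1) by simp
    ultimately show ?thesis using nw(1) by simp
  qed
  have c: "card (insert f X) = Suc (card X)" using fin f by simp
  obtain H where H: "H \<subseteq> {..<mm}" "card H <= card X" "!!h p. h < mm ==> h ~: H ==> p < 2 * N ==> S0 aLd p h = 0"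
    using inv unfolding list_inv_def by blast
  show ?thesis
    unfolding list_inv_def
  proof (intro conjI)
    show "insert f X \<subseteq> flows I" using X fI by simp
    show "psched 1 S" by (rule P)
    show "\<forall>g\<in>insert f X. snt S g = ddf g"
      using inv sn f(5) unfolding list_inv_def by (metis insert_iff)
    show "ALL q<kS S. fS S q \<in> insert f X & cS S q < mm"
    proof (intro allI impI)
      fix q assume "q < kS S"
      then show "fS S q \<in> insert f X & cS S q < mm"
        using old[of q] new[of q] inv h by (cases "q < kS S0") (auto simp: list_inv_def)
    qed
    show "ALL p<2*N. ALL h<mm. S aLd p h = busy S p h"
      using inv ld bs by (simp add: list_inv_def)
    show "ALL p<2*N. (\<Sum>h<mm. S aLd p h) = port_sum (insert f X) p"
    proof (intro allI impI)
      fix p assume p: "p < 2 * N"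
      have "(\<Sum>h'<mm. S aLd p h') = (\<Sum>h'<mm. S0 aLd p h') + (\<Sum>h'<mm. if h' = h then (if pt p f then ddf f else 0) else 0)"
        unfolding sum.distrib[symmetric] using ld[OF p] by (intro sum.cong) auto
      also have "... = port_sum X p + (if pt p f then ddf f else 0)"
        using list_inv_core_loads[OF inv p] h by simp
      finally show "(\<Sum>h<mm. S aLd p h) = port_sum (insert f X) p"
        using port_sum_insert[OF fin f(5)] by simp
    qed
    show "\<exists>H\<subseteq>{..<mm}. card H <= card (insert f X) & (ALL h<mm. h ~: H --> (ALL p<2*N. S aLd p h = 0))"
    proof (intro exI[of _ "insert h H"] conjI)
      have "card (insert h H) <= Suc (card H)" by (rule card_insert_le_m1) auto
      then show "card (insert h H) <= card (insert f X)" using c H(2) by simp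
    qed (use H h ld in auto)
    show "ALL q<kS S. m * bS S q <= m * (rho (S pK q 0) + ddf (fS S q)) + 2 * mxl (S pK q 0)"
      using endb by blast
    show "card (ends S) <= 2 * card (insert f X)" using inv pl' c by (simp add: list_inv_def)
    show "kS S <= card (insert f X) * (2 * F + 1)" using inv k2 c by (simp add: list_inv_def)
  qed
qed

lemma mods_place_flow [simp]: "mods place_flow = {vsz, vi, vj, vhb, vbv, i3, aLd, vt, vrem, vcov, vnxt, i4, pC, pI, pJ, pK, pA, pB, cnt}"
  by (auto simp: place_flow_def)

lemma wp_place_flow:
  assumes ok: "inst_ok S" and inv: "list_inv mxl X S" and k: "S vck 0 0 = k" "k < n"
    and e: "S i2 0 0 = e" "e < N * N" and new: "(e div N, e mod N, k) ~: X"
    and mmS: "S vmm 0 0 = mm" "S v2F1 0 0 = 2 * F + 1"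
    and mxl: "!!p. p < 2 * N ==> port_sum X p <= mxl k" and mxlT: "!!k. k < n ==> mxl k <= TL"
  shows "wp place_flow (list_inv mxl (insert (e div N, e mod N, k) X)) S"
proof -
  define i j f where "i = e div N" and "j = e mod N" and "f = (i, j, k)"
  have ij: "i < N" "j < N" "i * N + j = e" using div_mod_N[of e] e by (simp_all add: i_def j_def)
  have sz: "S aD k e = ddf f" using ok k ij unfolding inst_ok_def by (auto simp: ddf_def f_def)
  have fI: "f \<in> flows I" "f ~: X" using ij k new by (simp_all add: flows_def f_def i_def j_def)
  have ddM: "ddf f <= TL" using dd_le_TL[OF ij(1,2) k(2)] by (simp add: ddf_def f_def)
  have mm1: "1 <= mm" "mm <= Lim" "mm <= m" using m_pos F_pos lim_F by (auto simp: mm_def)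
  have par: "S vN 0 0 = N" "S vck 0 0 = k" using ok k by (simp_all add: inst_ok_def params_def)
  have XI: "X \<subseteq> flows I" "finite X" using inv finite_subset[OF _ finite_flows] by (auto simp: list_inv_def)
  have psT: "port_sum X p <= TL" if "p < 2 * N" for p using mxl[OF that] mxlT[OF k(2)] by simp
  have ldT: "S aLd p h <= TL" if "p < 2 * N" "h < mm" for p h
  proof -
    have "S aLd p h <= (\<Sum>h<mm. S aLd p h)" using that by (intro member_le_sum) auto
    also have "... = port_sum X p" using list_inv_core_loads[OF inv] that by simp
    finally show ?thesis using psT[OF that(1)] by simp
  qed
  have TLM: "TL + TL <= M" "TL <= M" using TL_le_M by simp_all
  show ?thesis
  proof (cases "ddf f = 0")
    case True
    have "list_inv mxl (insert f X) (upd S vsz 0 0 0)"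
      by (rule list_inv_cong[OF list_inv_zero[OF inv fI True]]) auto
    then show ?thesis using True sz k e by (simp add: place_flow_def f_def i_def j_def)
  next
    case False
    define S1 where "S1 = upd (upd (upd S vsz 0 0 (ddf f)) vi 0 0 i) vj 0 0 j"
    have S1f: "S1 r = S r" if "r ~: {vsz, vi, vj}" for r using that by (simp add: S1_def)
    have ejM: "e - i * N = j" using ij by simp
    have iM: "i <= M" "j <= M" using ij lim_N Lim_le_M by linarith+
    let ?Q = "list_inv mxl (insert f X)"
    have main: "wp choose_core (wp (Put aLd (V vi) (V vhb) (Arr aLd (V vi) (V vhb) .+ V vsz))
      (wp (Put aLd (V vN .+ V vj) (V vhb) (Arr aLd (V vN .+ V vj) (V vhb) .+ V vsz))
       (wp (vt :=: Ar1 aRho (V vck)) (wp (vrem :=: V vsz) (wp (Loop i3 v2F1 place_step) ?Q))))) S1"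
    proof (rule wp_mono[OF wp_choose_core[where i = i and j = j and mm = mm]])
      show "S1 vi 0 0 = i" "S1 vj 0 0 = j" "S1 vN 0 0 = N" "S1 vmm 0 0 = mm" "1 <= mm" "mm <= Lim"
        using par mmS mm1 by (simp_all add: S1_def)
      show "S1 aLd i h + S1 aLd (N + j) h <= M" if "h < mm" for h
        using ldT[of i h] ldT[of "N + j" h] ij that TLM by (simp add: S1f)
      fix S2
      assume core: "S2 vhb 0 0 < mm & (ALL h<mm. S1 aLd i (S2 vhb 0 0) + S1 aLd (N + j) (S2 vhb 0 0) <= S1 aLd i h + S1 aLd (N + j) h)"
        and f2: "!!r. r ~: mods choose_core ==> S2 r = S1 r"
      define h where "h = S2 vhb 0 0"
      have h: "h < mm" "!!h'. h' < mm ==> S aLd i h + S aLd (N + j) h <= S aLd i h' + S aLd (N + j) h'"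
        using core unfolding h_def by (simp_all add: S1f)
      have f2': "S2 r = S r" if "r ~: {vsz, vi, vj, vhb, vbv, i3}" for r using that f2 by (simp add: S1f)
      have v2: "S2 vi 0 0 = i" "S2 vj 0 0 = j" "S2 vsz 0 0 = ddf f" "S2 vhb 0 0 = h" "S2 vN 0 0 = N" "S2 vck 0 0 = k"
        using f2 par by (simp_all add: S1_def h_def)
      define S3 where "S3 = upd (upd S2 aLd i h (S aLd i h + ddf f)) aLd (N + j) h (S aLd (N + j) h + ddf f)"
      define S4 where "S4 = upd (upd S3 vt 0 0 (rho k)) vrem 0 0 (ddf f)"
      have f4: "S4 r = S r" if "r ~: {vsz, vi, vj, vhb, vbv, i3, aLd, vt, vrem}" for r
        using that by (simp add: S4_def S3_def f2')
      have same: "psched 1 S4 = psched 1 S" "conf S4 = conf S" "ends S4 = ends S" "snt S4 = snt S"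
        by (simp_all add: psched_def conf_def[abs_def] ends_def snt_def[abs_def] f4)
      have ld4: "S4 aLd p h' = S aLd p h' + (if h' = h & pt p f then ddf f else 0)" if "p < 2 * N" "h' < mm" for p h'
        using ij by (auto simp: S4_def S3_def f2' upd_apply pt_def f_def)
      have hM: "h < m" "h <= M" using h mm1 Lim_le_M by linarith+
      have busyT: "(\<Sum>q | q < kS S & conf S h i j q. bS S q - aS S q) <= 2 * TL"
      proof -
        have "busy S i h + busy S (N + j) h = S aLd i h + S aLd (N + j) h"
          using inv h(1) ij by (simp add: list_inv_def)
        then show ?thesis using conf_le_busy[of S h i j] ldT[of i h] ldT[of "N + j" h] h(1) ij by simp
      qed
      have bM: "bS S q <= M" if q: "q < kS S" for q
      proof -
        have ps: "psched 1 S" using inv by (simp add: list_inv_def)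
        have kq: "S pK q 0 < n" "S pI q 0 < N" "S pJ q 0 < N" using pschedD[OF ps q] by auto
        have "m * bS S q <= m * (rho (S pK q 0) + ddf (fS S q)) + 2 * mxl (S pK q 0)"
          using inv q by (simp add: list_inv_def)
        also have "2 * mxl (S pK q 0) <= m * (2 * TL)"
          using mxlT[OF kq(1)] m_pos mult_le_mono[OF m_pos, of "2 * mxl (S pK q 0)" "2 * TL"] by simp
        finally have "m * bS S q <= m * (rho (S pK q 0) + ddf (fS S q) + 2 * TL)" by (simp add: algebra_simps)
        then have "bS S q <= rho (S pK q 0) + ddf (fS S q) + 2 * TL" using m_pos by simp
        also have "ddf (fS S q) <= TL" using dd_le_TL[OF kq(2,3,1)] by (simp add: ddf_def)
        finally show ?thesis using rho_TL[OF kq(1)] by simp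
      qed
      have cX: "card X < F"
        using XI fI psubset_card_mono[OF finite_flows, of X I] card_flows by auto
      have kLim: "kS S + (2 * F + 1) <= Lim"
      proof -
        have "kS S + (2 * F + 1) <= card X * (2 * F + 1) + (2 * F + 1)" using inv by (simp add: list_inv_def)
        also have "... = Suc (card X) * (2 * F + 1)" by simp
        also have "... <= F * (2 * F + 1)" using cX by (intro mult_le_mono1) simp
        finally show ?thesis using lim_periods by (rule order_trans)
      qed
      have loop: "wp (Loop i3 v2F1 place_step) (placed S4 h i j k (ddf f)) S4"
      proof (rule wp_place_loop)
        show "psched 1 S4" unfolding same using inv unfolding list_inv_def by blast
        show "fS S4 q ~= (i, j, k)" if "q < kS S4" for q
        proof -
          have "q < kS S" using that by (simp add: f4)
          then have "fS S q \<in> X" using inv by (simp add: list_inv_def)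
          then show ?thesis using fI(2) unfolding f_def by (auto simp: f4)
        qed
        show "rho k + (\<Sum>q | q < kS S4 & conf S4 h i j q. bS S4 q - aS S4 q) + ddf f <= M"
          using busyT ddM rho_TL[OF k(2)] by (simp add: same f4)
        show "bS S4 q <= M" if "q < kS S4" for q using bM[of q] that by (simp add: f4)
        show "card (ends S4) <= 2 * F" using inv cX by (simp add: same list_inv_def)
        show "kS S4 + (2 * F + 1) <= Lim" using kLim by (simp add: f4)
      qed (use v2 ij k hM False mmS in \<open>simp_all add: S4_def S3_def f2'\<close>)
      have fin: "wp (Loop i3 v2F1 place_step) ?Q S4"
      proof (rule wp_mono[OF loop])
        fix S5 assume pl: "placed S4 h i j k (ddf f) S5" and f5: "!!r. r ~: mods (Loop i3 v2F1 place_step) ==> S5 r = S4 r"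
        have "placed S h i j k (ddf f) S5"
          using pl unfolding placed_def extends_def same by (simp add: f4)
        moreover have "S5 aLd = S4 aLd" by (rule f5) simp
        ultimately show "?Q S5"
          using ij k fI h mxl ld4 by (intro list_inv_insert[OF inv f_def, where h = h]) auto
      qed
      have vals: "S aLd i h + ddf f <= M" "S aLd (N + j) h + ddf f <= M"
        using ldT[of i h] ldT[of "N + j" h] h ij ddM TLM by linarith+
      have rM: "rho k <= M" "ddf f <= M" using rho_le_M[OF k(2)] ddM TLM by linarith+
      have rk: "S aRho k 0 = rho k" using ok k by (simp add: inst_ok_def)
      have neq: "i ~= N + j" using ij by simp
      show "wp (Put aLd (V vi) (V vhb) (Arr aLd (V vi) (V vhb) .+ V vsz))
        (wp (Put aLd (V vN .+ V vj) (V vhb) (Arr aLd (V vN .+ V vj) (V vhb) .+ V vsz))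
         (wp (vt :=: Ar1 aRho (V vck)) (wp (vrem :=: V vsz) (wp (Loop i3 v2F1 place_step) ?Q)))) S2"
        using fin vals rM neq neq[symmetric] rk unfolding S4_def S3_def by (simp add: v2 f2' par)
    qed
    then show ?thesis
      unfolding place_flow_def wp_Sq wp_Test wp_Put using False sz k e par iM ejM ddM TLM
      by (simp add: i_def[symmetric] S1_def f_def[symmetric] j_def[symmetric])
  qed
qed

text \<open>The flows handled when the coflows in \<open>A\<close> are done and the first
  \<open>e\<close> flows of coflow \<open>k\<close> as well.\<close>

definition grid :: "nat set => nat => nat => flow set" where
  "grid A k e = {(i, j, k'). i < N & j < N & (k' \<in> A \<or> k' = k & i * N + j < e)}"

lemma grid_Suc: "e < N * N ==> grid A k (Suc e) = insert (e div N, e mod N, k) (grid A k e)"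
proof -
  assume e: "e < N * N"
  have "i * N + j = e \<longleftrightarrow> i = e div N & j = e mod N" if "j < N" for i j
    using that by auto
  then show ?thesis using div_mod_N(1)[OF e] div_mod_N(2)[of e]
    by (auto simp: grid_def less_Suc_eq)
qed

lemma grid_full: "grid A k (N * N) = grid (insert k A) k' 0"
proof -
  have "i * N + j < N * N" if "i < N" "j < N" for i j
  proof -
    have "i * N + j < Suc i * N" using that by simp
    also have "... <= N * N" using that by (intro mult_le_mono1) simp
    finally show ?thesis .
  qed
  then show ?thesis by (auto simp: grid_def)
qed

lemma grid_subset: "grid A k e \<subseteq> {..<N} \<times> {..<N} \<times> insert k A"
  by (auto simp: grid_def)

end

lemma dropWhile_nth: "distinct ys ==> t < length ys ==> dropWhile (%x. x ~= ys ! t) ys = drop t ys"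
proof (induction ys arbitrary: t)
  case (Cons y ys)
  then show ?case by (cases t) auto
qed simp

text \<open>Dropping the elements before \<open>k\<close> leaves \<open>k\<close> and the coflows
  scheduled before it, which turns the recursive cost into a sum over coflows.\<close>

lemma (in port_loads) order_cost_sum:
  "distinct ys ==> order_cost W ys = (\<Sum>k\<in>set ys. W k * max_load (set (dropWhile (%x. x ~= k) ys)))"
proof (induction ys)
  case (Cons y ys)
  have "(\<Sum>k\<in>set ys. W k * max_load (set (dropWhile (%x. x ~= k) (y # ys)))) =
      (\<Sum>k\<in>set ys. W k * max_load (set (dropWhile (%x. x ~= k) ys)))"
    using Cons.prems by (intro sum.cong) auto
  then show ?case using Cons by simp
qed simp

context alg1
begin

lemma wp_place_all:
  assumes ok: "inst_ok S" and mmS: "S vmm 0 0 = mm" "S v2F1 0 0 = 2 * F + 1"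
    and zero: "kS S = 0" "S aLd = (%_ _. 0)"
    and ys: "distinct ys" "set ys = {..<n}" "!!t. t < n ==> S aOrd t 0 = ys ! (n - 1 - t)"
  defines "mxl == %k. loads.max_load (set (dropWhile (%x. x ~= k) ys))"
  shows "wp place_all (list_inv mxl (flows I)) S"
proof -
  have len: "length ys = n" using ys by (metis card_lessThan distinct_card)
  have vn: "S vn 0 0 = n" "S vNN 0 0 = N * N" using ok by (simp_all add: inst_ok_def params_def)
  \<comment> \<open>The first \<open>t\<close> coflows of the schedule, since \<open>ys\<close>
    begins with the last one.\<close>
  define A where "A t = set (drop (n - t) ys)" for t
  have An: "A t \<subseteq> {..<n}" for t using ys(2) set_drop_subset[of "n - t" ys] by (simp add: A_def)
  have mxlT: "mxl k <= TL" if "k < n" for k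
    unfolding mxl_def loads.max_load_le_iff loads.total_load_def
    using L_le_TL ys(2) set_dropWhileD by (metis subsetI)
  show ?thesis
    unfolding place_all_def
  proof (rule wp_Loop[where I = "%t S'. list_inv mxl (grid (A t) 0 0) S'"])
    show "list_inv mxl (grid (A 0) 0 0) (upd S i1 0 0 0)"
    proof -
      have "grid (A 0) 0 0 = {}" using len by (auto simp: grid_def A_def)
      then show ?thesis
        using zero by (auto simp: list_inv_def psched_def partial_schedule_0 busy_def port_sum_def ends_def)
    qed
  next
    fix t S1
    assume t: "t < S vn 0 0" and inv: "list_inv mxl (grid (A t) 0 0) S1" and v: "S1 i1 0 0 = t"
      and fr: "!!r. r ~= i1 ==> r ~: mods (vck :=: Ar1 aOrd (V i1) ;; Loop i2 vNN place_flow) ==> S1 r = S r"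
    have fr': "S1 r = S r" if "r ~: {i1, vck, i2, vsz, vi, vj, vhb, vbv, i3, aLd, vt, vrem, vcov, vnxt, i4, pC, pI, pJ, pK, pA, pB, cnt}" for r
      using that by (intro fr) auto
    have tn: "t < n" using t vn by simp
    define k where "k = ys ! (n - 1 - t)"
    have k1: "k \<in> set ys" unfolding k_def using len tn by (intro nth_mem) linarith
    have k: "k \<in> set ys" "k < n" using k1 ys(2) by blast+
    have kd: "drop (n - 1 - t) ys = k # drop (n - t) ys"
    proof -
      have "n - t = Suc (n - 1 - t)" using tn by simp
      then show ?thesis using len tn by (simp add: k_def Cons_nth_drop_Suc)
    qed
    have AS: "A (Suc t) = insert k (A t)"
      using kd by (simp add: A_def)
    have mxlk: "mxl k = loads.max_load (insert k (A t))"
    proof -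
      have "dropWhile (%x. x ~= k) ys = drop (n - 1 - t) ys"
        unfolding k_def using len tn by (intro dropWhile_nth[OF ys(1)]) linarith
      then show ?thesis by (simp only: mxl_def kd A_def list.set)
    qed
    let ?S2 = "upd S1 vck 0 0 k"
    have "wp (Loop i2 vNN place_flow) (%S''. list_inv mxl (grid (A (Suc t)) 0 0) (upd S'' i1 0 0 (Suc t))) ?S2"
    proof (rule wp_Loop[where I = "%e S'. list_inv mxl (grid (A t) k e) S'"])
      have g0: "grid (A t) k 0 = grid (A t) 0 0" by (auto simp: grid_def)
      show "list_inv mxl (grid (A t) k 0) (upd ?S2 i2 0 0 0)"
        unfolding g0 by (rule list_inv_cong[OF inv]) auto
    next
      fix e S3
      assume e: "e < ?S2 vNN 0 0" and inv3: "list_inv mxl (grid (A t) k e) S3" and v3: "S3 i2 0 0 = e"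
        and fr3: "!!r. r ~= i2 ==> r ~: mods place_flow ==> S3 r = ?S2 r"
      have fr3': "S3 r = S r" if "r ~: {i1, vck, i2, vsz, vi, vj, vhb, vbv, i3, aLd, vt, vrem, vcov, vnxt, i4, pC, pI, pJ, pK, pA, pB, cnt}" for r
        using that fr' by (simp add: fr3)
      have eN: "e < N * N" using e vn by (simp add: fr')
      have ok3: "inst_ok S3" using ok unfolding inst_ok_def params_def by (simp add: fr3')
      have kA: "k ~: A t"
      proof -
        have "distinct (k # drop (n - t) ys)" using kd ys(1) distinct_drop by metis
        then show ?thesis by (simp add: A_def)
      qed
      have "wp place_flow (list_inv mxl (insert (e div N, e mod N, k) (grid (A t) k e))) S3"
      proof (rule wp_place_flow[OF ok3 inv3 _ k(2) v3 eN])
        show "S3 vck 0 0 = k" using fr3[of vck] by simp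
        show "(e div N, e mod N, k) ~: grid (A t) k e" using kA by (auto simp: grid_def)
        show "S3 vmm 0 0 = mm" "S3 v2F1 0 0 = 2 * F + 1" using mmS by (simp_all add: fr3')
        show "port_sum (grid (A t) k e) p <= mxl k" if "p < 2 * N" for p
        proof -
          have fin: "finite (insert k (A t))" by (simp add: A_def)
          show ?thesis unfolding mxlk
            using port_sum_coflows[OF that fin grid_subset] loads.total_load_le_max[OF that] order_trans by blast
        qed
      qed (rule mxlT)
      then show "wp place_flow (%S''. list_inv mxl (grid (A t) k (Suc e)) (upd S'' i2 0 0 (Suc e))) S3"
        unfolding grid_Suc[OF eN] by (rule wp_mono) (erule list_inv_cong, auto)
    next
      fix S3 assume "list_inv mxl (grid (A t) k (?S2 vNN 0 0)) S3"
      then have "list_inv mxl (grid (A (Suc t)) 0 0) S3"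
        using vn grid_full[of "A t" k 0] AS by (simp add: fr')
      then show "list_inv mxl (grid (A (Suc t)) 0 0) (upd S3 i1 0 0 (Suc t))"
        by (rule list_inv_cong) auto
    qed (use vn lim_NN in \<open>simp_all add: fr'\<close>)
    moreover have "S1 aOrd t 0 = k" "k <= M" using ys(3)[OF tn] k lim_n Lim_le_M by (auto simp: fr' k_def)
    ultimately show "wp (vck :=: Ar1 aOrd (V i1) ;; Loop i2 vNN place_flow)
        (%S''. list_inv mxl (grid (A (Suc t)) 0 0) (upd S'' i1 0 0 (Suc t))) S1"
      using v by simp
  next
    fix S1 assume "list_inv mxl (grid (A (S vn 0 0)) 0 0) S1"
    moreover have "grid (A n) 0 0 = flows I" using ys(2) by (auto simp: grid_def A_def flows_def)
    ultimately show "list_inv mxl (flows I) S1" using vn by simp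
  qed (use vn lim_n in simp_all)
qed

text \<open>The common specification of both algorithms, consisting of the hypotheses of
  \<open>complete_schedule\<close> read off the store.\<close>

definition "good_schedule X \<rho> S \<longleftrightarrow> psched X S & (ALL i<N. ALL j<N. ALL k<n. snt S (i, j, k) = X * dd i j k) &
   (ALL C::nat => real. lower_bounds C --> (EX U::nat => real. (ALL k<n. rho k <= U k) &
      (ALL q<kS S. bS S q <= X * U (S pK q 0)) & (\<Sum>k<n. W k * U k) <= \<rho> * (\<Sum>k<n. W k * C k)))"

text \<open>
  A flow waits only while one of its two ports is busy with flows of higher priority. On the least
  loaded core these take at most \<open>2 / m\<close> times the load of the coflows up to its own, and the sum
  of its size and its release time is at most the optimal completion time.
\<close>

lemma list_inv_good:
  assumes ys: "distinct ys" "set ys = {..<n}" "loads.local_ratio_order W ys"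
    and inv: "list_inv (%k. loads.max_load (set (dropWhile (%x. x ~= k) ys))) (flows I) S"
  shows "good_schedule 1 5 S"
proof -
  define mxl where "mxl k = loads.max_load (set (dropWhile (%x. x ~= k) ys))" for k
  have "EX U::nat => real. (ALL k<n. rho k <= U k) &
      (ALL q<kS S. bS S q <= real 1 * U (S pK q 0)) & (\<Sum>k<n. W k * U k) <= 5 * (\<Sum>k<n. W k * C k)"
    if C: "lower_bounds C" for C :: "nat => real"
  proof (intro exI[of _ "%k. C k + 2 * mxl k / m"] conjI allI impI)
    have rd: "real (rho k + dd i j k) <= C k" if "k < n" "i < N" "j < N" for k i j
      using C that by (simp add: lower_bounds_def)
    have m0: "0 < real m" using m_pos by simp
    show "rho k <= C k + 2 * mxl k / m" if "k < n" for k
    proof -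
      have "real (rho k) <= C k" using rd[OF that, of 0 0] N_pos by simp
      then show ?thesis using m0 by (simp add: add_increasing2)
    qed
    show "bS S q <= real 1 * (C (S pK q 0) + 2 * mxl (S pK q 0) / m)" if q: "q < kS S" for q
    proof -
      let ?k = "S pK q 0"
      have ps: "psched 1 S" using inv by (simp add: list_inv_def)
      have "m * bS S q <= m * (rho ?k + ddf (fS S q)) + 2 * mxl ?k"
        using inv q unfolding list_inv_def mxl_def by blast
      then have "real (m * bS S q) <= real (m * (rho ?k + ddf (fS S q)) + 2 * mxl ?k)"
        by (simp only: of_nat_le_iff)
      then have "real m * bS S q <= real m * real (rho ?k + ddf (fS S q)) + 2 * mxl ?k" by simp
      moreover have "real (rho ?k + ddf (fS S q)) <= C ?k"
        using rd pschedD[OF ps q] by (simp add: ddf_def)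
      then have "real m * real (rho ?k + ddf (fS S q)) <= real m * C ?k" by (intro mult_left_mono) auto
      ultimately have "real m * bS S q <= real m * C ?k + 2 * mxl ?k" by linarith
      then show ?thesis using m0 by (simp add: field_simps)
    qed
    have "real (loads.order_cost W ys) <= 2 * real m * (\<Sum>k\<in>set ys. W k * C k)"
    proof (rule loads.local_ratio_order_cost[OF ys(3,1)])
      show "0 <= C k" if "k < n" for k using rd[OF that, of 0 0] N_pos by simp
      show "real (\<Sum>k | k < n & C k <= t. L p k) <= m * t" if "0 <= t" "p < 2 * N" for t :: real and p
        by (rule C[unfolded lower_bounds_def, THEN conjunct1, rule_format, OF that])
    qed (use ys in simp)
    then have oc: "(\<Sum>k<n. real (W k) * mxl k) <= 2 * real m * (\<Sum>k<n. W k * C k)"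
      unfolding loads.order_cost_sum[OF ys(1)] ys(2) mxl_def by simp
    have "(\<Sum>k<n. W k * (C k + 2 * mxl k / m)) = (\<Sum>k<n. W k * C k) + 2 / m * (\<Sum>k<n. real (W k) * mxl k)"
      by (simp add: distrib_left sum.distrib sum_distrib_left mult_ac)
    also have "... <= (\<Sum>k<n. W k * C k) + 2 / m * (2 * real m * (\<Sum>k<n. W k * C k))"
      using oc m0 by (intro add_left_mono mult_left_mono) auto
    also have "... = 5 * (\<Sum>k<n. W k * C k)" using m0 by simp
    finally show "(\<Sum>k<n. W k * (C k + 2 * mxl k / m)) <= 5 * (\<Sum>k<n. W k * C k)" .
  qed
  moreover have "snt S (i, j, k) = 1 * dd i j k" if "i < N" "j < N" "k < n" for i j k
    using inv that by (auto simp: list_inv_def flows_def ddf_def)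
  ultimately show ?thesis using inv unfolding good_schedule_def list_inv_def by blast
qed

lemma wp_list_scheduling:
  assumes ok: "inst_ok S" and W0: "!!k. k < n ==> S aW k 0 = W k"
    and zero: "kS S = 0" "S aLd = (%_ _. 0)" "S aX = (%_ _. 0)"
  shows "wp list_scheduling (%S'. good_schedule 1 5 S' & S' vDen 0 0 = D * 1 & kS S' <= Lim) S"
proof -
  have "wp compute_order (wp (Test (V vF .- V vm) (vmm :=: V vm) (vmm :=: V vF))
     (wp (v2F1 :=: Cn 2 .* V vF .+ Cn 1) (wp place_all (wp (vDen :=: V vD)
     (%S'. good_schedule 1 5 S' & S' vDen 0 0 = D * 1 & kS S' <= Lim))))) S"
  proof (rule wp_mono[OF wp_compute_order[OF ok]])
    fix S1
    assume "EX ys. distinct ys & set ys = {..<n} & loads.local_ratio_order W ys & (ALL t<n. S1 aOrd t 0 = ys ! (n - 1 - t))"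
      and f1: "!!r. r ~: mods compute_order ==> S1 r = S r"
    then obtain ys where ys: "distinct ys" "set ys = {..<n}" "loads.local_ratio_order W ys"
      "!!t. t < n ==> S1 aOrd t 0 = ys ! (n - 1 - t)" by blast
    have f1': "S1 r = S r" if "r ~: {i1, i2, i3, t1, vmu, vbest, vcur, vfl, aW, aX, aOrd}" for r
      using that by (intro f1) (auto simp: compute_order_def select_port_def select_coflow_def select_coflow_step_def reduce_weights_def)
    have par: "S1 vF 0 0 = F" "S1 vm 0 0 = m" using ok by (simp_all add: inst_ok_def params_def f1')
    let ?S2 = "upd (upd S1 vmm 0 0 mm) v2F1 0 0 (2 * F + 1)"
    have "wp place_all (list_inv (%k. loads.max_load (set (dropWhile (%x. x ~= k) ys))) (flows I)) ?S2"
      by (rule wp_place_all) (use ok zero ys in \<open>simp_all add: inst_ok_def params_def f1'\<close>)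
    then have "wp place_all (wp (vDen :=: V vD) (%S'. good_schedule 1 5 S' & S' vDen 0 0 = D * 1 & kS S' <= Lim)) ?S2"
    proof (rule wp_mono)
      fix S3
      assume inv: "list_inv (%k. loads.max_load (set (dropWhile (%x. x ~= k) ys))) (flows I) S3"
        and f3: "!!r. r ~: mods place_all ==> S3 r = ?S2 r"
      have "list_inv (%k. loads.max_load (set (dropWhile (%x. x ~= k) ys))) (flows I) (upd S3 vDen 0 0 D)"
        using inv by (rule list_inv_cong) auto
      then have "good_schedule 1 5 (upd S3 vDen 0 0 D)" by (rule list_inv_good[OF ys(1-3)])
      moreover have "S3 vD 0 0 = D" using f3[of vD] ok by (simp add: place_all_def f1' inst_ok_def)
      moreover have "kS S3 <= Lim" using inv lim_periods card_flows unfolding list_inv_def by simp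
      ultimately show "wp (vDen :=: V vD) (%S'. good_schedule 1 5 S' & S' vDen 0 0 = D * 1 & kS S' <= Lim) S3"
        using bd_scale by simp
    qed
    moreover have "F <= M" "2 * F + 1 <= M"
    proof -
      have "1 * (2 * F + 1) <= F * (2 * F + 1)" using F_pos by (intro mult_le_mono1)
      from order_trans[OF order_trans[OF this lim_periods] Lim_le_M] show "2 * F + 1 <= M" by (simp only: mult_1)
      then show "F <= M" by simp
    qed
    moreover have "mm = (if m < F then m else F)" by (simp add: mm_def)
    ultimately show "wp (Test (V vF .- V vm) (vmm :=: V vm) (vmm :=: V vF))
     (wp (v2F1 :=: Cn 2 .* V vF .+ Cn 1) (wp place_all (wp (vDen :=: V vD)
     (%S'. good_schedule 1 5 S' & S' vDen 0 0 = D * 1 & kS S' <= Lim)))) S1"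
      using par by (cases "m < F") simp_all
  qed (use zero W0 in auto)
  then show ?thesis unfolding list_scheduling_def wp_Sq .
qed

end

section \<open>The program: fractional completion for a single core\<close>

abbreviation "vNn == 280::nat"
abbreviation "vK == 281::nat"
abbreviation "aB == 282::nat"
abbreviation "vbm == 283::nat"
abbreviation "vlen == 284::nat"
abbreviation "vtmp == 285::nat"
abbreviation "vG == 286::nat"
abbreviation "vH == 287::nat"
abbreviation "vP10 == 288::nat"
abbreviation "vP110 == 289::nat"
abbreviation "aT == 290::nat"
abbreviation "vlam == 291::nat"
abbreviation "vBc == 292::nat"
abbreviation "vSx == 293::nat"
abbreviation "vc1 == 294::nat"
abbreviation "vc2 == 295::nat"
abbreviation "aQ == 296::nat"
abbreviation "aY == 297::nat"
abbreviation "aG == 298::nat"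
abbreviation "vacc == 299::nat"
abbreviation "vfl2 == 300::nat"
abbreviation "vg == 301::nat"
abbreviation "vcost == 302::nat"
abbreviation "vbst == 303::nat"
abbreviation "vr == 304::nat"
abbreviation "t2 == 320::nat"
abbreviation "vbb == 321::nat"

definition largest_load :: pr where
  "largest_load = Loop i2 v2N (Test (Arr aL (V i2) (V i1) .- V vbb) (vbb :=: Arr aL (V i2) (V i1)) Skp)"

text \<open>A coflow without data finishes at its release in the schedules constructed here, so its
  weight is removed from the relaxation. Otherwise it could have positive weight and lower bound 0,
  below the first grid point 1.\<close>

definition record_bound :: pr where
  "record_bound = Test (V vbb) Skp (Put aW (V i1) (Cn 0) (Cn 0)) ;;
    Test (Ar1 aRho (V i1) .- V vbb) (vbb :=: Ar1 aRho (V i1)) Skp ;;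
    Put aB (V i1) (Cn 0) (V vbb) ;; Test (V vbb .- V vbm) (vbm :=: V vbb) Skp"

definition coflow_bound :: pr where
  "coflow_bound = vbb :=: Cn 0 ;; largest_load ;;
    record_bound"

definition prepare_bounds :: pr where
  "prepare_bounds = vNn :=: V vN .* V vn ;; vK :=: Cn 12 .* V vNn ;; vbm :=: Cn 0 ;; Loop i1 vn coflow_bound"

text \<open>Eight grid points more than double the time, as \<open>11 ^ 8 > 2 * 10 ^ 8\<close>.
  Hence \<open>8 * vlen\<close> points reach \<open>n * Bm\<close>, and 12 more leave room for the
  finish index.\<close>

definition prepare_powers :: pr where
  "prepare_powers = Len vlen vtmp (V vn .* V vbm) ;; vG :=: Cn 8 .* V vlen ;; vH :=: V vG .+ Cn 12 ;;
    vP10 :=: Cn 1 ;; vP110 :=: Cn 1 ;;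
    Loop i1 vH (vP10 :=: V vP10 .* Cn 10 ;; vP110 :=: V vP110 .* Cn 110)"

definition prepare_times :: pr where
  "prepare_times = Put aT (Cn 0) (Cn 0) (V vP10) ;;
    Loop i1 vH (Put aT (V i1 .+ Cn 1) (Cn 0) (Ar1 aT (V i1) .* Cn 11 \<oslash> Cn 10))"

definition prepare_constants :: pr where
  "prepare_constants =
    SumTo vlam i1 vn (Ar1 aW (V i1) .* Ar1 aB (V i1)) ;; vlam :=: V vlam .* V vP10 .+ Cn 1 ;;
    vBc :=: V vN .* V vH .* V vn .* V vn ;;
    vSx :=: Cn 9000 .* V vN .* V vH .* V vn .* V vn .* V vn ;;
    vc1 :=: Cn 40 .* V vBc .* V vP110 .* V vP110 ;; vc2 :=: V vlam .* V vP10"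

definition prepare_grid :: pr where
  "prepare_grid = prepare_bounds ;; prepare_powers ;; prepare_times ;; prepare_constants"

lemma (in ram) wp_seq:
  assumes "wp p R S" "!!S'. R S' ==> (!!r. r ~: mods p ==> S' r = S r) ==> wp q Q S'"
  shows "wp (p ;; q) Q S"
  unfolding wp_Sq using assms(1) by (rule wp_mono) (rule assms(2))

text \<open>A double loop that writes every cell once. The body is verified in a store where its own
  cell still has the initial value, and it must leave the other cells of \<open>arr\<close>
  alone.\<close>

lemma (in ram) wp_fill:
  assumes wf: "x ~= y" "la ~: {x, y}" "lb ~: {x, y}" "arr ~: {x, y}" "{x, y, la, lb} \<inter> mods b = {}"
    and lim: "S la 0 0 <= Lim" "S lb 0 0 <= Lim"
    and body: "!!i j S1. i < S la 0 0 ==> j < S lb 0 0 ==> S1 x 0 0 = i ==> S1 y 0 0 = j ==>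
       (!!r. r ~: insert x (insert y (mods b)) ==> S1 r = S r) ==> S1 arr i j = S arr i j ==>
       wp b (%S'. S' arr i j = f i j & (ALL i' j'. \<not> (i' = i & j' = j) --> S' arr i' j' = S1 arr i' j')) S1"
  shows "wp (Loop x la (Loop y lb b)) (%S'. ALL i<S la 0 0. ALL j<S lb 0 0. S' arr i j = f i j) S"
proof -
  define P where "P i j S' \<longleftrightarrow> (ALL i' j'. j' < S lb 0 0 -->
     S' arr i' j' = (if i' < i \<or> i' = i & j' < j then f i' j' else S arr i' j'))" for i j and S' :: store
  have Pu: "P i j (upd S' r 0 0 z) = P i j S'" if "r ~= arr" for i j r z and S' :: store using that by (simp add: P_def)
  show ?thesis
  proof (rule wp_Loop[where I = "%i. P i 0"])
    fix i and S1 :: store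
    assume i: "i < S la 0 0" and inv: "P i 0 S1" and v: "S1 x 0 0 = i"
      and fr: "!!r. r ~= x ==> r ~: mods (Loop y lb b) ==> S1 r = S r"
    have lb: "S1 lb = S lb" using fr wf by auto
    show "wp (Loop y lb b) (%S''. P (Suc i) 0 (upd S'' x 0 0 (Suc i))) S1"
    proof (rule wp_Loop[where I = "P i"])
      fix j and S2 :: store
      assume j: "j < S1 lb 0 0" and inv2: "P i j S2" and v2: "S2 y 0 0 = j"
        and fr2: "!!r. r ~= y ==> r ~: mods b ==> S2 r = S1 r"
      have "wp b (%S'. S' arr i j = f i j & (ALL i' j'. \<not> (i' = i & j' = j) --> S' arr i' j' = S2 arr i' j')) S2"
        by (rule body) (use i j lb v v2 fr fr2 wf inv2 in \<open>auto simp: P_def\<close>)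
      then show "wp b (%S''. P i (Suc j) (upd S'' y 0 0 (Suc j))) S2"
        by (rule wp_mono) (use inv2 wf in \<open>auto simp: P_def less_Suc_eq\<close>)
    next
      fix S2 :: store
      assume "P i (S1 lb 0 0) S2"
      then have "P (Suc i) 0 S2" using lb by (auto simp: P_def less_Suc_eq)
      then show "P (Suc i) 0 (upd S2 x 0 0 (Suc i))" using wf Pu by auto
    qed (use wf lim lb inv Pu in auto)
  next
    fix S1 :: store
    assume "P (S la 0 0) 0 S1"
    then show "ALL i<S la 0 0. ALL j<S lb 0 0. S1 arr i j = f i j" by (simp add: P_def)
  qed (use wf lim in \<open>auto simp: P_def\<close>)
qed

definition compare_point :: pr where
  "compare_point = Test (V vg .- V vG) Skp (Test (V vP10 .* Ar1 aB (V i2) .- Ar1 aT (V vg)) Skp (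
      vcost :=: V vc1 .* Ar1 aW (V i2) .* Ar1 aT (V vg) .+ V vc2 .* V vacc ;;
      Test ((Cn 1 .- V vfl2) .+ (V vbst .- V vcost))
        (vfl2 :=: Cn 1 ;; vbst :=: V vcost ;; Put aG (V i2) (Cn 0) (V vg)) Skp))"

text \<open>The points are visited from last to first, so the queue part of the cost, a sum over all
  later points, grows by one term per round.\<close>

definition choose_point :: pr where
  "choose_point = vg :=: V vH .- Cn 1 .- V i3 ;; vr :=: V vP110 \<oslash> Ar1 aT (V vg) ;;
    SumTo t2 i4 v2N (Arr aQ (V i4) (V vg) .* Arr aL (V i4) (V i2)) ;;
    vacc :=: V vacc .+ V t2 .* V vr .* V vr ;;
    compare_point"

definition choose_points :: pr where
  "choose_points = Loop i2 vn (vacc :=: Cn 0 ;; vfl2 :=: Cn 0 ;; Loop i3 vH choose_point)"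

definition count_points :: pr where
  "count_points = Loop i2 vn (Loop i3 vH (
     Test (Ar1 aG (V i2) .- V i3) Skp (Put aY (V i2) (V i3) (Arr aY (V i2) (V i3) .+ Cn 1))))"

definition update_queues :: pr where
  "update_queues = Loop i2 v2N (Loop i3 vH (
     SumTo t2 i4 vn (Arr aL (V i2) (V i4) .* (Cn 1 .- (Ar1 aG (V i4) .- V i3))) ;;
     Put aQ (V i2) (V i3) (Arr aQ (V i2) (V i3) .+ V vP10 .* V t2 .- Ar1 aT (V i3))))"

definition run_drift :: pr where
  "run_drift = Loop i1 vSx (choose_points ;; count_points ;; update_queues)"

section \<open>Lower bounds and grid parameters of an instance\<close>

context inst
begin

text \<open>On a single core no coflow completes before its release or before its largest port load
  has been served.\<close>

definition "Bk k = max (rho k) (loads.max_load {k})"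
definition "W2 k = (if loads.max_load {k} = 0 then 0 else W k)"
definition "Bm = Max (insert 0 (Bk ` {..<n}))"
definition "H = 8 * floorlog 2 (n * Bm) + 12"
text \<open>The number of slots per grid interval. A port needs at most \<open>11 * (N * n)\<close>
  of them before rounding, and each of its \<open>N * n\<close> flows is rounded up by at most
  one.\<close>

definition "K = 12 * (N * n)"

lemma L_le_Bk: "p < 2 * N ==> L p k <= Bk k"
  using loads.total_load_le_max[of p "{k}"] by (simp add: loads.total_load_def Bk_def)

lemma Bk_le_Bm: "k < n ==> Bk k <= Bm"
  unfolding Bm_def by (intro Max_ge) auto

sublocale dr: drift N n H L Bk W2
proof
  show "1 <= N" by (rule N_pos)
  show "1 <= n" by (rule coflows_pos)
  show "12 <= H" by (simp add: H_def)
  show "L p k <= Bk k" if "p < 2 * N" "k < n" for p k using that L_le_Bk by simp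
  show "0 < Bk k" if "0 < W2 k" for k using that by (auto simp: W2_def Bk_def split: if_splits)
  fix k assume k: "k < n"
  let ?b = "floorlog 2 (n * Bm)"
  have "n * Bk k <= n * Bm" using Bk_le_Bm[OF k] by simp
  also have "... <= 2 ^ ?b"
    using floorlog_le_iff[of 2 "n * Bm" ?b] by (simp add: less_imp_le)
  finally have "n * Bk k * 10 ^ (8 * ?b) <= 2 ^ ?b * 10 ^ (8 * ?b)" by (intro mult_le_mono1)
  also have "... = (2 * 10 ^ 8) ^ ?b" unfolding power_mult power_mult_distrib ..
  also have "... <= (11 ^ 8) ^ ?b" by (intro power_mono) auto
  also have "... = 11 ^ (8 * ?b)" by (simp add: power_mult)
  finally show "n * Bk k * 10 ^ (H - 12) <= 11 ^ (H - 12)" by (simp add: H_def)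
qed

lemma T_0: "dr.T 0 = 10 ^ H"
  by (simp add: dr.T_def)

lemma T_Suc: "g < H ==> dr.T g * 11 = 10 * dr.T (Suc g)"
proof -
  assume "g < H"
  then have "H - g = Suc (H - Suc g)" by simp
  then show ?thesis by (simp add: dr.T_def)
qed

lemma T_le: "g <= H ==> dr.T g <= 11 ^ H"
proof -
  assume g: "g <= H"
  have "dr.T g <= 11 ^ g * 11 ^ (H - g)" unfolding dr.T_def by (intro mult_le_mono2 power_mono) auto
  then show ?thesis using g by (simp flip: power_add)
qed

lemma T_mono: "g <= g' ==> g' <= H ==> dr.T g <= dr.T g'"
proof (induction rule: dec_induct)
  case (step x)
  then have "dr.T x * 11 = 10 * dr.T (Suc x)" by (intro T_Suc) simp
  then show ?case using step by simp
qed simp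

end

text \<open>The summands of \<open>bd2\<close> bound, in turn, the penalty part and the queue part
  of the cost, the queues, the scaled sizes, the end times of periods, the common denominator of the
  output, and the number that determines the grid.\<close>

locale alg2 = alg1 +
  assumes lim_H: "H + 1 <= Lim" and lim_S: "dr.Sx <= Lim" and lim_K: "K <= Lim" and lim_HKN: "H * (K * N) <= Lim"
    and bd2: "40 * dr.Bc * 110 ^ H * 110 ^ H * ((\<Sum>k<n. W k) + 1) * 11 ^ H +
       dr.lam * 10 ^ H * (H * (2 * N * (dr.Sx * 10 ^ H * TL * TL) * 110 ^ H * 110 ^ H) + 1) +
       dr.Sx * 10 ^ H * TL + TL * (10 * K * 10 ^ H) + 22 * K * 11 ^ H + D * (10 * K * 10 ^ H) + n * Bm <= M"
begin

lemma Bc_pos: "1 <= dr.Bc"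
  using N_pos coflows_pos dr.H by (simp add: dr.Bc_def)

lemma bd_c1: "40 * dr.Bc * 110 ^ H * 110 ^ H * (w + 1) * t <= M" if "w <= (\<Sum>k<n. W k)" "t <= 11 ^ H" for w t
proof -
  have "40 * dr.Bc * 110 ^ H * 110 ^ H * (w + 1) * t <= 40 * dr.Bc * 110 ^ H * 110 ^ H * ((\<Sum>k<n. W k) + 1) * 11 ^ H"
    using that by (intro mult_le_mono) auto
  then show ?thesis using bd2 by linarith
qed

lemma bd_P110: "110 ^ H * 110 ^ H * 40 * dr.Bc <= M" "110 ^ H <= M" "10 ^ H <= M" "dr.Bc <= M" "11 ^ H * 110 ^ H <= M"
proof -
  have a: "40 * dr.Bc * 110 ^ H * 110 ^ H * (0 + 1) * 1 <= M" by (rule bd_c1) auto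
  show "110 ^ H * 110 ^ H * 40 * dr.Bc <= M" using a by (simp add: mult_ac)
  have p: "(1::nat) <= 110 ^ H" by simp
  have "110 ^ H * 1 <= 110 ^ H * (110 ^ H * (40 * dr.Bc))" using Bc_pos by (intro mult_le_mono2) simp
  then have "110 ^ H <= 40 * dr.Bc * 110 ^ H * 110 ^ H * (0 + 1) * 1" by (simp only: mult_ac mult_1_right mult_1 add_0)
  then show b: "110 ^ H <= M" using a by (rule order_trans)
  have "(10::nat) ^ H <= 110 ^ H" by (intro power_mono) auto
  then show "10 ^ H <= M" using b by linarith
  have "dr.Bc * 1 <= dr.Bc * (40 * 110 ^ H * 110 ^ H)" by (intro mult_le_mono2) simp
  then have "dr.Bc <= 40 * dr.Bc * 110 ^ H * 110 ^ H * (0 + 1) * 1" by (simp only: mult_ac mult_1_right mult_1 add_0)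
  then show "dr.Bc <= M" using a by (rule order_trans)
  have a': "40 * dr.Bc * 110 ^ H * 110 ^ H * (0 + 1) * 11 ^ H <= M" by (rule bd_c1) auto
  have "11 ^ H * 110 ^ H * 1 <= 11 ^ H * 110 ^ H * (40 * dr.Bc * 110 ^ H)" using Bc_pos by (intro mult_le_mono2) simp
  then have "11 ^ H * 110 ^ H <= 40 * dr.Bc * 110 ^ H * 110 ^ H * (0 + 1) * 11 ^ H" by (simp only: mult_ac mult_1_right mult_1 add_0)
  then show "11 ^ H * 110 ^ H <= M" using a' by (rule order_trans)
qed

lemma bd_T: "g <= H ==> dr.T g <= M" "g <= H ==> dr.T g * 110 ^ H <= M"
proof -
  assume "g <= H"
  then have "dr.T g * 110 ^ H <= 11 ^ H * 110 ^ H" by (intro mult_le_mono1 T_le)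
  then show "dr.T g * 110 ^ H <= M" using bd_P110(5) by linarith
  moreover have "dr.T g * 1 <= dr.T g * 110 ^ H" by (intro mult_le_mono2) simp
  ultimately show "dr.T g <= M" by linarith
qed

lemma bd_lam: "dr.lam * 10 ^ H <= M" "dr.lam <= M"
proof -
  have "dr.lam * 10 ^ H * 1 <= dr.lam * 10 ^ H * (H * (2 * N * (dr.Sx * 10 ^ H * TL * TL) * 110 ^ H * 110 ^ H) + 1)"
    by (intro mult_le_mono2) simp
  then show a: "dr.lam * 10 ^ H <= M" using bd2 by linarith
  have "dr.lam * 1 <= dr.lam * 10 ^ H" by (intro mult_le_mono2) simp
  then show "dr.lam <= M" using a by linarith
qed

lemma bd_nBm: "n * Bm <= M" "Bm <= M"
proof -
  show a: "n * Bm <= M" using bd2 by linarith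
  have "1 * Bm <= n * Bm" using coflows_pos by (rule mult_le_mono1)
  then show "Bm <= M" using a by linarith
qed

lemma max_load_single: "loads.max_load {k} = x"
  if "!!p. p < 2 * N ==> L p k <= x" "x = 0 \<or> (EX p<2*N. x = L p k)"
proof (rule antisym)
  show "loads.max_load {k} <= x" using that(1) by (simp add: loads.max_load_le_iff loads.total_load_def)
  show "x <= loads.max_load {k}"
    using that(2) loads.total_load_le_max[of _ "{k}"] by (auto simp: loads.total_load_def)
qed

lemma wp_coflow_bound:
  assumes ok: "inst_ok S" and k: "S i1 0 0 = k" "k < n" and W: "S aW k 0 = W k" and bm: "S vbm 0 0 <= Bm"
  shows "wp coflow_bound (%S'. S' aB k 0 = Bk k & S' aW k 0 = W2 k & S' vbm 0 0 = max (Bk k) (S vbm 0 0) &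
    (ALL k'. k' ~= k --> S' aB k' 0 = S aB k' 0 & S' aW k' 0 = S aW k' 0)) S"
proof -
  have Lk: "S aL p k = L p k" if "p < 2 * N" for p using ok k that by (simp add: inst_ok_def)
  have LM: "L p k <= M" if "p < 2 * N" for p using L1_le_TL[OF that k(2)] TL_le_M by simp
  have BkM: "Bk k <= M" using Bk_le_Bm[OF k(2)] bd_nBm by simp
  have v2: "S v2N 0 0 = 2 * N" "S aRho k 0 = rho k" using ok k by (simp_all add: inst_ok_def)
  let ?Q = "%S'. S' aB k 0 = Bk k & S' aW k 0 = W2 k & S' vbm 0 0 = max (Bk k) (S vbm 0 0) &
    (ALL k'. k' ~= k --> S' aB k' 0 = S aB k' 0 & S' aW k' 0 = S aW k' 0)"
  have "wp largest_load (%S'. S' vbb 0 0 = loads.max_load {k}) (upd S vbb 0 0 0)"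
    unfolding largest_load_def
    apply (rule wp_Loop[where I = "%i S'. (ALL p<i. L p k <= S' vbb 0 0) & (S' vbb 0 0 = 0 \<or> (EX p<2*N. S' vbb 0 0 = L p k))"])
          apply simp_all
    subgoal using v2 lim_2N by simp
    subgoal for i S1 using v2 k Lk[of i] LM[of i] by (auto simp: less_Suc_eq)
    subgoal for S1 using v2 max_load_single[of k "S1 vbb 0 0"] by simp
    done
  then have "wp largest_load (wp record_bound ?Q) (upd S vbb 0 0 0)"
  proof (rule wp_mono)
    fix S1 :: store
    assume b: "S1 vbb 0 0 = loads.max_load {k}" and f: "!!r. r ~: mods largest_load ==> S1 r = upd S vbb 0 0 0 r"
    have f': "S1 r = S r" if "r ~: {i2, vbb}" for r using that f by (simp add: largest_load_def)
    have "Bk k = (if loads.max_load {k} < rho k then rho k else loads.max_load {k})" by (auto simp: Bk_def)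
    then show "wp record_bound ?Q S1" unfolding record_bound_def
      using b k v2 BkM W by (cases "loads.max_load {k} = 0"; cases "loads.max_load {k} < rho k") (auto simp: f' W2_def)
  qed
  then show ?thesis unfolding coflow_bound_def by simp
qed

definition "grid_ok S \<longleftrightarrow> inst_ok S & S vNn 0 0 = N * n & S vK 0 0 = K & S vG 0 0 = H - 12 & S vH 0 0 = H &
   S vP10 0 0 = 10 ^ H & S vP110 0 0 = 110 ^ H & S vSx 0 0 = dr.Sx &
   S vc1 0 0 = 40 * dr.Bc * 110 ^ H * 110 ^ H & S vc2 0 0 = dr.lam * 10 ^ H &
   (ALL g<=H. S aT g 0 = dr.T g) & (ALL k<n. S aB k 0 = Bk k & S aW k 0 = W2 k)"

lemma mods_coflow_bound [simp]: "mods coflow_bound = {vbb, i2, aW, aB, vbm}"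
  by (auto simp: coflow_bound_def largest_load_def record_bound_def)

lemma lim_Nn: "N * n <= Lim" "H <= Lim"
  using lim_K lim_H by (simp_all add: K_def)

lemma limM: "K <= M" "N * n <= M" "H <= M" "dr.Sx <= M"
  using lim_K lim_Nn lim_S Lim_le_M by linarith+

lemma mods_prepare_bounds [simp]: "mods prepare_bounds = {vNn, vK, i1, vbb, i2, aW, aB, vbm}"
  by (auto simp: prepare_bounds_def)

lemma mods_prepare_powers [simp]: "mods prepare_powers = {vlen, vtmp, vG, vH, vP10, vP110, i1}"
  by (auto simp: prepare_powers_def)

lemma mods_prepare_times [simp]: "mods prepare_times = {aT, i1}"
  by (auto simp: prepare_times_def)

lemma wp_prepare_bounds:
  assumes ok: "inst_ok S" and W0: "!!k. k < n ==> S aW k 0 = W k"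
  shows "wp prepare_bounds (%S'. (ALL k<n. S' aB k 0 = Bk k & S' aW k 0 = W2 k) & S' vbm 0 0 = Bm &
     S' vNn 0 0 = N * n & S' vK 0 0 = K) S"
proof -
  have par: "S vN 0 0 = N" "S vn 0 0 = n" using ok by (simp_all add: inst_ok_def params_def)
  let ?S = "upd (upd (upd S vNn 0 0 (N * n)) vK 0 0 K) vbm 0 0 0"
  let ?P = "%i S'. (ALL k<n. if k < i then S' aB k 0 = Bk k & S' aW k 0 = W2 k else S' aW k 0 = W k) &
      S' vbm 0 0 = Max (insert 0 (Bk ` {..<i}))"
  have "wp (Loop i1 vn coflow_bound) (%S'. (ALL k<n. S' aB k 0 = Bk k & S' aW k 0 = W2 k) & S' vbm 0 0 = Bm &
     S' vNn 0 0 = N * n & S' vK 0 0 = K) ?S"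
  proof (rule wp_Loop[where I = ?P])
    fix k and S1 :: store
    assume k: "k < ?S vn 0 0" and inv: "?P k S1" and v: "S1 i1 0 0 = k"
      and fr: "!!r. r ~= i1 ==> r ~: mods coflow_bound ==> S1 r = ?S r"
    have kn: "k < n" using k par by simp
    have ok1: "inst_ok S1" using ok unfolding inst_ok_def params_def by (simp add: fr)
    have "Max (insert 0 (Bk ` {..<k})) <= Bm" unfolding Bm_def using kn by (intro Max_mono) auto
    then have "S1 vbm 0 0 <= Bm" using inv by simp
    moreover have "S1 aW k 0 = W k" using inv kn by simp
    ultimately have "wp coflow_bound (%S'. S' aB k 0 = Bk k & S' aW k 0 = W2 k & S' vbm 0 0 = max (Bk k) (S1 vbm 0 0) &
        (ALL k'. k' ~= k --> S' aB k' 0 = S1 aB k' 0 & S' aW k' 0 = S1 aW k' 0)) S1"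
      using wp_coflow_bound[OF ok1 v kn] by blast
    then show "wp coflow_bound (%S''. ?P (Suc k) (upd S'' i1 0 0 (Suc k))) S1"
    proof (rule wp_mono)
      fix S' :: store
      assume a: "S' aB k 0 = Bk k & S' aW k 0 = W2 k & S' vbm 0 0 = max (Bk k) (S1 vbm 0 0) &
        (ALL k'. k' ~= k --> S' aB k' 0 = S1 aB k' 0 & S' aW k' 0 = S1 aW k' 0)"
      have "Max (insert 0 (Bk ` {..<Suc k})) = max (Bk k) (Max (insert 0 (Bk ` {..<k})))"
        by (simp add: lessThan_Suc insert_commute[of 0])
      then show "?P (Suc k) (upd S' i1 0 0 (Suc k))" using a inv by (auto simp: less_Suc_eq)
    qed
  next
    fix S1 :: store
    assume "?P (?S vn 0 0) S1" and f: "!!r. r ~= i1 ==> r ~: mods coflow_bound ==> S1 r = ?S r"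
    then show "(ALL k<n. S1 aB k 0 = Bk k & S1 aW k 0 = W2 k) & S1 vbm 0 0 = Bm & S1 vNn 0 0 = N * n & S1 vK 0 0 = K"
      using par by (simp add: Bm_def)
  qed (use par lim_n W0 in simp_all)
  then show ?thesis unfolding prepare_bounds_def using limM par by (simp add: K_def)
qed

lemma wp_prepare_powers:
  assumes "S vn 0 0 = n" "S vbm 0 0 = Bm"
  shows "wp prepare_powers (%S'. S' vG 0 0 = H - 12 & S' vH 0 0 = H & S' vP10 0 0 = 10 ^ H & S' vP110 0 0 = 110 ^ H) S"
proof -
  have lenH: "floorlog 2 (n * Bm) <= Lim" "8 * floorlog 2 (n * Bm) <= M" "8 * floorlog 2 (n * Bm) + 12 <= M"
    using lim_Nn(2) limM(3) by (simp_all add: H_def)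
  have M1: "Suc 0 <= M" using Lim_pos Lim_le_M by linarith
  have pw: "10 ^ i * 10 <= M & 110 ^ i * 110 <= M" if "i < H" for i
  proof -
    have "(10::nat) ^ Suc i <= 10 ^ H" "(110::nat) ^ Suc i <= 110 ^ H" using that by (intro power_increasing; simp)+
    then show ?thesis using bd_P110(2,3) unfolding power_Suc2 by (auto intro: order_trans)
  qed
  show ?thesis
    unfolding prepare_powers_def
    using assms bd_nBm lenH M1
    apply simp
    apply (rule wp_Loop[where I = "%i S'. S' vP10 0 0 = 10 ^ i & S' vP110 0 0 = 110 ^ i"])
          apply (simp_all add: lim_Nn H_def[symmetric])
    subgoal premises pr for i S'
    proof -
      have "i < H" using pr by (simp add: H_def)
      from pw[OF this] show ?thesis by simp
    qed
    apply (simp_all add: H_def)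
    done
qed

lemma wp_prepare_times:
  assumes "S vH 0 0 = H" "S vP10 0 0 = 10 ^ H"
  shows "wp prepare_times (%S'. ALL g<=H. S' aT g 0 = dr.T g) S"
  unfolding prepare_times_def using assms bd_P110(3)
  apply simp
  apply (rule wp_Loop[where I = "%i S'. ALL g<=i. S' aT g 0 = dr.T g"])
        apply (simp_all add: lim_Nn T_0)
  subgoal for g S'
    using bd_T(1)[of "Suc g"] T_Suc[of g] by (auto simp: le_Suc_eq)
  done

lemma wp_prepare_constants:
  assumes ok: "inst_ok S" and p: "S vP10 0 0 = 10 ^ H" "S vP110 0 0 = 110 ^ H" "S vH 0 0 = H" "S vG 0 0 = H - 12" "S vNn 0 0 = N * n"
      "S vK 0 0 = K" and BW: "!!k. k < n ==> S aB k 0 = Bk k & S aW k 0 = W2 k" and T: "ALL g<=H. S aT g 0 = dr.T g"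
  shows "wp prepare_constants grid_ok S"
proof -
  have par: "S vN 0 0 = N" "S vn 0 0 = n" using ok by (simp_all add: inst_ok_def params_def)
  define LS where "LS = (\<Sum>k<n. W2 k * Bk k)"
  have sum: "(\<Sum>i<n. S aW i 0 * S aB i 0) = LS" unfolding LS_def using BW by (intro sum.cong) auto
  have lamLS: "dr.lam = LS * 10 ^ H + 1" by (simp add: dr.lam_def LS_def)
  have LSM: "LS <= M"
  proof -
    have "LS * 1 <= LS * 10 ^ H" by (intro mult_le_mono2) simp
    then show ?thesis using bd_lam(2) lamLS by linarith
  qed
  have bds: "dr.lam <= M" "dr.Bc <= M" "dr.Sx <= M" "40 * dr.Bc * 110 ^ H * 110 ^ H <= M" "dr.lam * 10 ^ H <= M"
    using bd_lam bd_P110 limM by (simp_all add: mult_ac)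
  define f where "f S1 = upd (upd (upd (upd (upd S1 vlam 0 0 dr.lam) vBc 0 0 dr.Bc) vSx 0 0 dr.Sx) vc1 0 0 (40 * dr.Bc * 110 ^ H * 110 ^ H)) vc2 0 0 (dr.lam * 10 ^ H)" for S1
  let ?S6 = "upd (upd S i1 0 0 (S vn 0 0)) vlam 0 0 LS"
  have eqs: "Suc (LS * 10 ^ H) = dr.lam" "N * H * n * n = dr.Bc" "9000 * N * H * n * n * n = dr.Sx"
    by (simp_all add: lamLS dr.Bc_def dr.Sx_def)
  have good: "grid_ok (f ?S6)"
    using ok p T BW par unfolding grid_ok_def inst_ok_def params_def f_def by simp
  show ?thesis
    unfolding prepare_constants_def wp_Sq
  proof (rule wp_SumTo)
    have e: "(\<Sum>i<S vn 0 0. ev (upd S i1 0 0 i) (Ar1 aW (V i1) .* Ar1 aB (V i1))) = LS"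
      using sum par by simp
    show "(\<Sum>i<S vn 0 0. ev (upd S i1 0 0 i) (Ar1 aW (V i1) .* Ar1 aB (V i1))) <= M" unfolding e by (rule LSM)
    show "wp (vlam :=: V vlam .* V vP10 .+ Cn 1)
       (wp (vBc :=: V vN .* V vH .* V vn .* V vn)
       (wp (vSx :=: Cn 9000 .* V vN .* V vH .* V vn .* V vn .* V vn)
       (wp (vc1 :=: Cn 40 .* V vBc .* V vP110 .* V vP110) (wp (vc2 :=: V vlam .* V vP10) grid_ok))))
      (upd (upd S i1 0 0 (S vn 0 0)) vlam 0 0 (\<Sum>i<S vn 0 0. ev (upd S i1 0 0 i) (Ar1 aW (V i1) .* Ar1 aB (V i1))))"
      unfolding e using bds good unfolding f_def by (simp add: p par eqs)
  qed (use par lim_n in auto)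
qed

lemma wp_prepare_grid:
  assumes ok: "inst_ok S" and W0: "!!k. k < n ==> S aW k 0 = W k"
  shows "wp prepare_grid grid_ok S"
  unfolding prepare_grid_def
proof (rule wp_seq[OF wp_prepare_bounds[OF ok W0]], assumption)
  fix S1 :: store
  assume a1: "(ALL k<n. S1 aB k 0 = Bk k & S1 aW k 0 = W2 k) & S1 vbm 0 0 = Bm & S1 vNn 0 0 = N * n & S1 vK 0 0 = K"
    and f1: "!!r. r ~: mods prepare_bounds ==> S1 r = S r"
  have vn: "S1 vn 0 0 = n" "S1 vbm 0 0 = Bm" using ok a1 by (simp_all add: f1 inst_ok_def params_def)
  show "wp (prepare_powers ;; prepare_times ;; prepare_constants) grid_ok S1"
  proof (rule wp_seq[OF wp_prepare_powers[of S1, OF vn]])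
    fix S2 :: store
    assume a2: "S2 vG 0 0 = H - 12 & S2 vH 0 0 = H & S2 vP10 0 0 = 10 ^ H & S2 vP110 0 0 = 110 ^ H"
      and f2: "!!r. r ~: mods prepare_powers ==> S2 r = S1 r"
    have p2: "S2 vH 0 0 = H" "S2 vP10 0 0 = 10 ^ H" using a2 by auto
    show "wp (prepare_times ;; prepare_constants) grid_ok S2"
    proof (rule wp_seq[OF wp_prepare_times[of S2, OF p2]])
      fix S3 :: store
      assume a3: "ALL g<=H. S3 aT g 0 = dr.T g" and f3: "!!r. r ~: mods prepare_times ==> S3 r = S2 r"
      have ok3: "inst_ok S3" using ok unfolding inst_ok_def params_def by (simp add: f3 f2 f1)
      show "wp prepare_constants grid_ok S3"
        by (rule wp_prepare_constants[OF ok3]) (use a1 a2 a3 in \<open>simp_all add: f3 f2 f1\<close>)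
    qed
  qed
qed

section \<open>One round of the iteration\<close>

definition acc :: "(nat => nat => nat) => nat => nat => nat" where
  "acc q k e = (\<Sum>g\<in>{H - e..<H}. (\<Sum>p<2*N. q p g * L p k) * (110 ^ H div dr.T g) * (110 ^ H div dr.T g))"

definition queue_bounded :: "(nat => nat => nat) => bool" where
  "queue_bounded q \<longleftrightarrow> (ALL p<2*N. ALL g<H. q p g <= dr.Sx * 10 ^ H * TL)"

text \<open>The candidate after the last \<open>e\<close> grid points have been examined. While the
  flag is 0 none of them was allowed, and nothing is claimed about \<open>aG\<close>.\<close>

definition chosen :: "(nat => nat => nat) => nat => nat => store => bool" where
  "chosen q k e S \<longleftrightarrow>
     (if S vfl2 0 0 = 0 then ALL g. H - e <= g --> \<not> dr.allowed k g
      else dr.allowed k (S aG k 0) & S vbst 0 0 = dr.cost q k (S aG k 0) &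
        (ALL g. H - e <= g --> dr.allowed k g --> S vbst 0 0 <= dr.cost q k g))"

lemma chosen_counter: "chosen q k e (upd S i3 0 0 x) = chosen q k e S"
  by (simp add: chosen_def)

lemma acc_Suc: "e < H ==> acc q k (Suc e) = acc q k e +
   (\<Sum>p<2*N. q p (H - 1 - e) * L p k) * (110 ^ H div dr.T (H - 1 - e)) * (110 ^ H div dr.T (H - 1 - e))"
proof -
  assume e: "e < H"
  have "{H - Suc e..<H} = insert (H - 1 - e) {H - e..<H}" using e by auto
  moreover have "H - 1 - e ~: {H - e..<H}" using e by auto
  ultimately show ?thesis unfolding acc_def by (simp add: add.commute)
qed

lemma cost_acc: "e < H ==> dr.cost q k (H - 1 - e) =
   40 * dr.Bc * 110 ^ H * 110 ^ H * W2 k * dr.T (H - 1 - e) + dr.lam * 10 ^ H * acc q k (Suc e)"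
  by (simp add: dr.cost_def acc_def)

lemma acc_le:
  assumes "queue_bounded q" "k < n" "e <= H"
  shows "acc q k e <= H * (2 * N * (dr.Sx * 10 ^ H * TL * TL) * 110 ^ H * 110 ^ H)"
    and "g < H ==> (\<Sum>p<2*N. q p g * L p k) <= 2 * N * (dr.Sx * 10 ^ H * TL * TL)"
proof -
  have s: "(\<Sum>p<2*N. q p g * L p k) <= 2 * N * (dr.Sx * 10 ^ H * TL * TL)" if "g < H" for g
  proof -
    have "(\<Sum>p<2*N. q p g * L p k) <= of_nat (card {..<2*N}) * (dr.Sx * 10 ^ H * TL * TL)"
      using assms(1,2) that L1_le_TL unfolding queue_bounded_def by (intro sum_bounded_above mult_le_mono) auto
    then show ?thesis by simp
  qed
  then show "g < H ==> (\<Sum>p<2*N. q p g * L p k) <= 2 * N * (dr.Sx * 10 ^ H * TL * TL)" .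
  have "acc q k e <= of_nat (card {H - e..<H}) * (2 * N * (dr.Sx * 10 ^ H * TL * TL) * 110 ^ H * 110 ^ H)"
    unfolding acc_def using s by (intro sum_bounded_above mult_le_mono div_le_dividend) auto
  also have "... <= H * (2 * N * (dr.Sx * 10 ^ H * TL * TL) * 110 ^ H * 110 ^ H)"
    by (intro mult_le_mono1) auto
  finally show "acc q k e <= H * (2 * N * (dr.Sx * 10 ^ H * TL * TL) * 110 ^ H * 110 ^ H)" .
qed

lemma acc_bounds:
  assumes q: "queue_bounded q" and k: "k < n" and e: "e < H"
  shows "acc q k (Suc e) <= M" "dr.cost q k (H - 1 - e) <= M" "(\<Sum>p<2*N. q p (H - 1 - e) * L p k) <= M"
proof -
  define A where "A = 2 * N * (dr.Sx * 10 ^ H * TL * TL)"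
  define P :: nat where "P = 110 ^ H"
  have P: "1 <= P" unfolding P_def by simp
  have a: "acc q k (Suc e) <= H * (A * P * P)" using acc_le(1)[OF q k, of "Suc e"] e by (simp add: A_def P_def)
  have lam: "1 <= dr.lam * 10 ^ H" by (simp add: dr.lam_def Suc_le_eq)
  have W: "W2 k <= (\<Sum>k<n. W k)"
  proof -
    have "W k <= (\<Sum>k<n. W k)" using k by (intro member_le_sum) auto
    then show ?thesis by (auto simp: W2_def)
  qed
  have c: "40 * dr.Bc * P * P * W2 k * dr.T (H - 1 - e) <= 40 * dr.Bc * P * P * ((\<Sum>k<n. W k) + 1) * 11 ^ H"
    using W T_le[of "H - 1 - e"] by (intro mult_le_mono) auto
  have d: "dr.lam * 10 ^ H * acc q k (Suc e) <= dr.lam * 10 ^ H * (H * (A * P * P) + 1)"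
    using a by (intro mult_le_mono) auto
  have M: "40 * dr.Bc * P * P * ((\<Sum>k<n. W k) + 1) * 11 ^ H + dr.lam * 10 ^ H * (H * (A * P * P) + 1) <= M"
    using bd2 unfolding A_def P_def by linarith
  show "dr.cost q k (H - 1 - e) <= M" unfolding cost_acc[OF e] P_def[symmetric] using c d M by linarith
  define Z where "Z = H * (A * P * P)"
  have "1 * (Z + 1) <= dr.lam * 10 ^ H * (Z + 1)" using lam by (rule mult_le_mono1)
  moreover have "dr.lam * 10 ^ H * (Z + 1) <= M" using M unfolding Z_def by (rule add_leD2)
  ultimately have "1 * (Z + 1) <= M" by (rule order_trans)
  then have "Suc Z <= M" by simp
  then have "Z <= M" by (rule Suc_leD)
  then have M2: "H * (A * P * P) <= M" unfolding Z_def .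
  then show "acc q k (Suc e) <= M" using a by (rule order_trans[rotated])
  have "1 * (A * (1 * 1)) <= H * (A * (P * P))" using P e by (intro mult_le_mono) auto
  then have "A <= M" using M2 by (simp only: mult_1 mult_1_right mult.assoc)
  then show "(\<Sum>p<2*N. q p (H - 1 - e) * L p k) <= M" using acc_le(2)[OF q k, of 0 "H - 1 - e"] e unfolding A_def by simp
qed

lemma mods_choose_point [simp]: "mods choose_point = {vg, vr, t2, i4, vacc, vcost, vfl2, vbst, aG}"
  by (auto simp: choose_point_def compare_point_def SumTo_def)

lemma allowed_less: "dr.allowed k g ==> g < H"
  using dr.H unfolding dr.allowed_def by linarith

lemma wp_choose_point:
  assumes ok: "grid_ok S" and k: "S i2 0 0 = k" "k < n" and e: "S i3 0 0 = e" "e < H"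
    and q: "queue_bounded (S aQ)" and a: "S vacc 0 0 = acc (S aQ) k e" and c: "chosen (S aQ) k e S"
  shows "wp choose_point (%S'. S' vacc 0 0 = acc (S aQ) k (Suc e) & chosen (S aQ) k (Suc e) S' &
    (ALL k'. k' ~= k --> S' aG k' 0 = S aG k' 0)) S"
proof -
  define g where "g = H - 1 - e"
  have g: "H - Suc e = g" by (simp add: g_def)
  let ?q = "S aQ"
  have gH: "g <= H" by (simp add: g_def)
  have vals: "S vH 0 0 = H" "S vP110 0 0 = 110 ^ H" "S v2N 0 0 = 2 * N" "S aT g 0 = dr.T g" "S vG 0 0 = H - 12"
      "S vP10 0 0 = 10 ^ H" "S aB k 0 = Bk k" "S aW k 0 = W2 k" "S vc1 0 0 = 40 * dr.Bc * 110 ^ H * 110 ^ H"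
      "S vc2 0 0 = dr.lam * 10 ^ H" "!!p. p < 2 * N ==> S aL p k = L p k"
    using ok k gH unfolding grid_ok_def inst_ok_def by auto
  define s where "s = (\<Sum>p<2*N. ?q p g * L p k)"
  define R where "R = 110 ^ H div dr.T g"
  have aS: "acc ?q k e + s * R * R = acc ?q k (Suc e)" unfolding s_def R_def acc_Suc[OF e(2)] g_def ..
  note b = acc_bounds[OF q k(2) e(2), folded g_def]
  have RM: "R <= M" using bd_P110(2) div_le_dividend[of "110 ^ H" "dr.T g"] unfolding R_def by linarith
  have sM: "s <= M" using b(3) by (simp add: s_def)
  have gM: "g <= M" using limM(3) gH by linarith
  let ?S1 = "upd (upd S vg 0 0 g) vr 0 0 R"
  let ?S2 = "upd (upd (upd ?S1 i4 0 0 (2 * N)) t2 0 0 s) vacc 0 0 (acc ?q k (Suc e))"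
  have cost: "40 * dr.Bc * 110 ^ H * 110 ^ H * W2 k * dr.T g + dr.lam * 10 ^ H * acc ?q k (Suc e) = dr.cost ?q k g"
    unfolding g_def cost_acc[OF e(2)] ..
  have ge: "H - Suc e <= g' \<longleftrightarrow> g' = g \<or> H - e <= g'" for g' using e by (auto simp: g_def)
  let ?Q = "%S'. S' vacc 0 0 = acc ?q k (Suc e) & chosen ?q k (Suc e) S' & (ALL k'. k' ~= k --> S' aG k' 0 = S aG k' 0)"
  have rest: "wp compare_point ?Q ?S2"
  proof (cases "dr.allowed k g")
    case False
    have keep: "chosen ?q k (Suc e) ?S2" using c False unfolding chosen_def ge by (auto split: if_splits)
    show ?thesis
    proof (cases "H - 12 < g")
      case True
      then show ?thesis using vals k keep by (simp add: compare_point_def)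
    next
      case F2: False
      then have "\<not> 10 ^ H * Bk k <= dr.T g" using False by (auto simp: dr.allowed_def)
      then show ?thesis using vals k keep F2 by (simp add: compare_point_def)
    qed
  next
    case al: True
    then have al': "g <= H - 12" "10 ^ H * Bk k <= dr.T g" by (auto simp: dr.allowed_def)
    let ?new = "S vfl2 0 0 = 0 \<or> dr.cost ?q k g < S vbst 0 0"
    have up: "chosen ?q k (Suc e) (upd (upd (upd (upd ?S2 vcost 0 0 (dr.cost ?q k g)) vfl2 0 0 (Suc 0)) vbst 0 0 (dr.cost ?q k g)) aG k 0 g)" if ?new
      using c al that unfolding chosen_def ge by (auto split: if_splits intro: less_imp_le order_trans[OF less_imp_le])
    have keep: "chosen ?q k (Suc e) (upd ?S2 vcost 0 0 (dr.cost ?q k g))" if "\<not> ?new"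
      using c al that unfolding chosen_def ge by (auto split: if_splits)
    show ?thesis
    proof (cases ?new)
      case True
      then show ?thesis using vals k al' up[OF True] b(2) cost gM Lim_pos Lim_le_M by (auto simp: compare_point_def)
    next
      case False
      then show ?thesis using vals k al' keep[OF False] b(2) cost by (simp add: compare_point_def)
    qed
  qed
  have sum: "(\<Sum>i<?S1 v2N 0 0. ev (upd ?S1 i4 0 0 i) (Arr aQ (V i4) (V vg) .* Arr aL (V i4) (V i2))) = s"
    unfolding s_def using vals k by simp
  have "wp (SumTo t2 i4 v2N (Arr aQ (V i4) (V vg) .* Arr aL (V i4) (V i2)))
    (wp (vacc :=: V vacc .+ V t2 .* V vr .* V vr) (wp compare_point ?Q)) ?S1"
  proof (rule wp_SumTo, goal_cases)
    case 6
    show ?case unfolding sum by (rule sM)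
  next
    case 7
    have v: "?S1 v2N 0 0 = 2 * N" using vals by simp
    show ?case unfolding sum unfolding v wp_Put using rest b(1) a aS by simp
  qed (use vals lim_2N in simp_all)
  then show ?thesis unfolding choose_point_def wp_Sq using vals e gM RM by (simp add: R_def g)
qed

lemma wp_choose_loop:
  assumes ok: "grid_ok S" and k: "S i2 0 0 = k" "k < n" and q: "queue_bounded (S aQ)"
    and i: "S vacc 0 0 = 0" "S vfl2 0 0 = 0"
  shows "wp (Loop i3 vH choose_point) (%S'. dr.best (S aQ) k (S' aG k 0) & (ALL k'. k' ~= k --> S' aG k' 0 = S aG k' 0)) S"
proof (rule wp_Loop[where I = "%e S'. S' vacc 0 0 = acc (S aQ) k e & chosen (S aQ) k e S' & (ALL k'. k' ~= k --> S' aG k' 0 = S aG k' 0)"])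
  have vH: "S vH 0 0 = H" using ok by (simp add: grid_ok_def)
  show "S vH 0 0 <= Lim" using vH lim_Nn by simp
  show "upd S i3 0 0 0 vacc 0 0 = acc (S aQ) k 0 & chosen (S aQ) k 0 (upd S i3 0 0 0) & (ALL k'. k' ~= k --> upd S i3 0 0 0 aG k' 0 = S aG k' 0)"
    using i allowed_less by (fastforce simp: chosen_def acc_def)
  fix e and S1 :: store
  assume e: "e < S vH 0 0" and inv: "S1 vacc 0 0 = acc (S aQ) k e & chosen (S aQ) k e S1 & (ALL k'. k' ~= k --> S1 aG k' 0 = S aG k' 0)"
    and v: "S1 i3 0 0 = e" and fr: "!!r. r ~= i3 ==> r ~: mods choose_point ==> S1 r = S r"
  have q1: "S1 aQ = S aQ" by (simp add: fr)
  have ok1: "grid_ok S1" using ok unfolding grid_ok_def inst_ok_def params_def by (simp add: fr)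
  have k1: "S1 i2 0 0 = k" using k by (simp add: fr)
  have "wp choose_point (%S'. S' vacc 0 0 = acc (S1 aQ) k (Suc e) & chosen (S1 aQ) k (Suc e) S' &
    (ALL k'. k' ~= k --> S' aG k' 0 = S1 aG k' 0)) S1"
    using e vH inv q unfolding q1[symmetric] by (intro wp_choose_point[OF ok1 k1 k(2) v]) auto
  then show "wp choose_point (%S'. upd S' i3 0 0 (Suc e) vacc 0 0 = acc (S aQ) k (Suc e) & chosen (S aQ) k (Suc e) (upd S' i3 0 0 (Suc e)) &
     (ALL k'. k' ~= k --> upd S' i3 0 0 (Suc e) aG k' 0 = S aG k' 0)) S1"
    by (rule wp_mono) (use inv q1 in \<open>simp add: chosen_counter\<close>)
next
  fix S1 :: store
  assume inv: "S1 vacc 0 0 = acc (S aQ) k (S vH 0 0) & chosen (S aQ) k (S vH 0 0) S1 & (ALL k'. k' ~= k --> S1 aG k' 0 = S aG k' 0)"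
  have vH: "S vH 0 0 = H" using ok by (simp add: grid_ok_def)
  \<comment> \<open>At least one point is allowed, so the flag must be set at the end.\<close>
  have "dr.allowed k (H - 12)" using dr.B_le_top[OF k(2)] by (simp add: dr.allowed_iff)
  then show "dr.best (S aQ) k (S1 aG k 0) & (ALL k'. k' ~= k --> S1 aG k' 0 = S aG k' 0)"
    using inv unfolding chosen_def dr.best_def vH by (auto split: if_splits)
qed auto

lemma mods_choose_points [simp]: "mods choose_points = {i2, i3, vg, vr, t2, i4, vacc, vcost, vfl2, vbst, aG}"
  by (auto simp: choose_points_def)

lemma wp_choose_points:
  assumes ok: "grid_ok S" and q: "queue_bounded (S aQ)"
  shows "wp choose_points (%S'. ALL k<n. dr.best (S aQ) k (S' aG k 0)) S"
  unfolding choose_points_def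
proof (rule wp_Loop[where I = "%k S'. ALL k'<k. dr.best (S aQ) k' (S' aG k' 0)"])
  have vn: "S vn 0 0 = n" using ok by (simp add: grid_ok_def inst_ok_def params_def)
  show "S vn 0 0 <= Lim" using vn lim_n by simp
  fix k and S1 :: store
  assume k: "k < S vn 0 0" and inv: "ALL k'<k. dr.best (S aQ) k' (S1 aG k' 0)" and v: "S1 i2 0 0 = k"
    and fr: "!!r. r ~= i2 ==> r ~: mods (vacc :=: Cn 0 ;; vfl2 :=: Cn 0 ;; Loop i3 vH choose_point) ==> S1 r = S r"
  let ?S = "upd (upd S1 vacc 0 0 0) vfl2 0 0 0"
  have q1: "?S aQ = S aQ" by (simp add: fr)
  have ok1: "grid_ok ?S" using ok unfolding grid_ok_def inst_ok_def params_def by (simp add: fr)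
  have "wp (Loop i3 vH choose_point) (%S'. dr.best (?S aQ) k (S' aG k 0) & (ALL k'. k' ~= k --> S' aG k' 0 = ?S aG k' 0)) ?S"
    using k vn v q q1 by (intro wp_choose_loop[OF ok1]) auto
  then have "wp (Loop i3 vH choose_point) (%S'. ALL k'<Suc k. dr.best (S aQ) k' (upd S' i2 0 0 (Suc k) aG k' 0)) ?S"
    by (rule wp_mono) (use inv in \<open>auto simp: less_Suc_eq q1\<close>)
  then show "wp (vacc :=: Cn 0 ;; vfl2 :=: Cn 0 ;; Loop i3 vH choose_point)
     (%S'. ALL k'<Suc k. dr.best (S aQ) k' (upd S' i2 0 0 (Suc k) aG k' 0)) S1" by simp
next
  fix S1 :: store
  assume "ALL k'<S vn 0 0. dr.best (S aQ) k' (S1 aG k' 0)"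
  then show "ALL k<n. dr.best (S aQ) k (S1 aG k 0)" using ok by (simp add: grid_ok_def inst_ok_def params_def)
qed auto

definition counts :: "(nat => nat => nat) => nat => nat => nat => nat" where
  "counts Gs s k g = (\<Sum>s'<s. of_bool (Gs s' k <= g))"

lemma mods_count_points [simp]: "mods count_points = {i2, i3, aY}"
  by (auto simp: count_points_def)

lemma wp_count_points:
  assumes ok: "grid_ok S" and Y: "!!k g. k < n ==> g < H ==> S aY k g < dr.Sx"
  shows "wp count_points (%S'. ALL k<n. ALL g<H. S' aY k g = S aY k g + of_bool (S aG k 0 <= g)) S"
proof -
  have par: "S vn 0 0 = n" "S vH 0 0 = H" using ok by (simp_all add: grid_ok_def inst_ok_def params_def)
  have Y': "Suc (S aY k g) <= M" if "k < n" "g < H" for k g using Y[OF that] limM(4) by simp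
  have "wp count_points (%S'. ALL k<S vn 0 0. ALL g<S vH 0 0. S' aY k g = S aY k g + of_bool (S aG k 0 <= g)) S"
    unfolding count_points_def
  proof (rule wp_fill)
    fix k g and S1 :: store
    let ?b = "Test (Ar1 aG (V i2) .- V i3) Skp (Put aY (V i2) (V i3) (Arr aY (V i2) (V i3) .+ Cn 1))"
    assume "k < S vn 0 0" "g < S vH 0 0" "S1 i2 0 0 = k" "S1 i3 0 0 = g"
      "!!r. r ~: insert i2 (insert i3 (mods ?b)) ==> S1 r = S r" "S1 aY k g = S aY k g"
    then show "wp ?b (%S'. S' aY k g = S aY k g + of_bool (S aG k 0 <= g) &
        (ALL k' g'. \<not> (k' = k & g' = g) --> S' aY k' g' = S1 aY k' g')) S1"
      using Y' par by auto
  qed (use par lim_n lim_Nn in auto)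
  then show ?thesis by (simp add: par)
qed

definition update_queue :: pr where
  "update_queue = SumTo t2 i4 vn (Arr aL (V i2) (V i4) .* (Cn 1 .- (Ar1 aG (V i4) .- V i3))) ;;
     Put aQ (V i2) (V i3) (Arr aQ (V i2) (V i3) .+ V vP10 .* V t2 .- Ar1 aT (V i3))"

lemma update_queues_eq: "update_queues = Loop i2 v2N (Loop i3 vH update_queue)"
  by (simp add: update_queues_def update_queue_def)

lemma mods_update_queue [simp]: "mods update_queue = {t2, i4, aQ}"
  by (auto simp: update_queue_def SumTo_def)

lemma mods_update_queues [simp]: "mods update_queues = {i2, i3, t2, i4, aQ}"
  by (auto simp: update_queues_eq)

lemma load_le: "p < 2 * N ==> dr.load G p g <= TL"
proof -
  assume p: "p < 2 * N"
  have "dr.load G p g <= (\<Sum>k<n. L p k)" unfolding dr.load_def by (intro sum_mono) auto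
  also have "... <= TL" unfolding TL_def using p by (intro member_le_sum[of p "{..<2*N}" "%p. \<Sum>k<n. L p k"]) auto
  finally show ?thesis .
qed

lemma wp_update_queue:
  assumes ok: "grid_ok S" and p: "S i2 0 0 = p" "p < 2 * N" and g: "S i3 0 0 = g" "g < H"
    and M: "S aQ p g + 10 ^ H * TL <= M"
  shows "wp update_queue (%S'. S' aQ p g = S aQ p g + 10 ^ H * dr.load (%k. S aG k 0) p g - dr.T g &
    (ALL p' g'. \<not> (p' = p & g' = g) --> S' aQ p' g' = S aQ p' g')) S"
proof -
  let ?e = "Arr aL (V i2) (V i4) .* (Cn 1 .- (Ar1 aG (V i4) .- V i3))"
  let ?l = "dr.load (%k. S aG k 0) p g"
  have vals: "S vn 0 0 = n" "S vP10 0 0 = 10 ^ H" "S aT g 0 = dr.T g" "!!k. k < n ==> S aL p k = L p k"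
    using ok p g unfolding grid_ok_def inst_ok_def params_def by auto
  have sum: "(\<Sum>i<S vn 0 0. ev (upd S i4 0 0 i) ?e) = ?l"
    unfolding dr.load_def vals(1) using p g vals by (intro sum.cong) (auto simp: of_bool_def)
  have l: "?l <= TL" using p by (intro load_le)
  have l2: "10 ^ H * ?l <= 10 ^ H * TL" using l by (rule mult_le_mono2)
  show ?thesis
    unfolding update_queue_def wp_Sq
  proof (rule wp_SumTo, goal_cases)
    case 6
    show ?case unfolding sum using l TL_le_M by simp
  next
    case 7
    show ?case unfolding sum using vals p g order_trans[OF add_left_mono[OF l2] M] by simp
  qed (use vals lim_n in simp_all)
qed

lemma wp_update_queues:
  assumes ok: "grid_ok S" and M: "!!p g. p < 2 * N ==> g < H ==> S aQ p g + 10 ^ H * TL <= M"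
  shows "wp update_queues (%S'. ALL p<2*N. ALL g<H. S' aQ p g = S aQ p g + 10 ^ H * dr.load (%k. S aG k 0) p g - dr.T g) S"
proof -
  have par: "S v2N 0 0 = 2 * N" "S vH 0 0 = H" using ok by (simp_all add: grid_ok_def inst_ok_def params_def)
  have "wp update_queues (%S'. ALL p<S v2N 0 0. ALL g<S vH 0 0. S' aQ p g = S aQ p g + 10 ^ H * dr.load (%k. S aG k 0) p g - dr.T g) S"
    unfolding update_queues_eq
  proof (rule wp_fill)
    fix p g and S1 :: store
    assume a: "p < S v2N 0 0" "g < S vH 0 0" "S1 i2 0 0 = p" "S1 i3 0 0 = g"
      and fr: "!!r. r ~: insert i2 (insert i3 (mods update_queue)) ==> S1 r = S r" and e: "S1 aQ p g = S aQ p g"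
    have ok1: "grid_ok S1" using ok unfolding grid_ok_def inst_ok_def params_def by (simp add: fr)
    have "S1 aG = S aG" by (simp add: fr)
    then show "wp update_queue (%S'. S' aQ p g = S aQ p g + 10 ^ H * dr.load (%k. S aG k 0) p g - dr.T g &
        (ALL p' g'. \<not> (p' = p & g' = g) --> S' aQ p' g' = S1 aQ p' g')) S1"
      using wp_update_queue[of S1 p g] ok1 a e M[of p g] par by simp
  qed (use par lim_2N lim_Nn in auto)
  then show ?thesis by (simp add: par)
qed

text \<open>The queues before round \<open>s\<close> depend only on earlier choices of actual
  coflows, so recording a new round leaves them unchanged.\<close>

lemma queue_cong:
  assumes "!!s' k. s' < s ==> k < n ==> Gs s' k = Gs' s' k"
  shows "dr.queue Gs s = dr.queue Gs' s"
  using assms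
proof (induction s)
  case (Suc s)
  have "dr.load (Gs s) p g = dr.load (Gs' s) p g" for p g
    unfolding dr.load_def using Suc.prems by (intro sum.cong) auto
  then show ?case using Suc by simp
qed simp

lemma queue_le: "p < 2 * N ==> dr.queue Gs s p g <= s * (10 ^ H * TL)"
proof (induction s)
  case (Suc s)
  have "dr.queue Gs s p g + 10 ^ H * dr.load (Gs s) p g <= s * (10 ^ H * TL) + 10 ^ H * TL"
    using Suc load_le[of p] by (intro add_mono mult_le_mono2) auto
  then show ?case by simp
qed simp

lemma cost_cong:
  assumes "!!p g. p < 2 * N ==> g < H ==> q p g = q' p g"
  shows "dr.cost q k g = dr.cost q' k g"
  unfolding dr.cost_def using assms by simp

lemma best_cong:
  assumes "!!p g. p < 2 * N ==> g < H ==> q p g = q' p g"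
  shows "dr.best q k g \<longleftrightarrow> dr.best q' k g"
  unfolding dr.best_def using cost_cong[of q q', OF assms] by simp

text \<open>\<open>Gs\<close> is a ghost variable: the program keeps no history of choices, only the
  queues and counts determined by it.\<close>

definition drift_inv :: "nat => (nat => nat => nat) => store => bool" where
  "drift_inv s Gs S \<longleftrightarrow> (ALL s'<s. ALL k<n. dr.best (dr.queue Gs s') k (Gs s' k)) &
     (ALL p<2*N. ALL g<H. S aQ p g = dr.queue Gs s p g) & (ALL k<n. ALL g<H. S aY k g = counts Gs s k g)"

lemma wp_drift_step:
  assumes ok: "grid_ok S" and s: "s < dr.Sx" and inv: "drift_inv s Gs S"
  shows "wp (choose_points ;; count_points ;; update_queues) (%S'. EX Gs'. drift_inv (Suc s) Gs' S') S"
proof -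
  have ql: "dr.queue Gs s p g + 10 ^ H * TL <= dr.Sx * 10 ^ H * TL" if "p < 2 * N" for p g
  proof -
    have "dr.queue Gs s p g + 10 ^ H * TL <= Suc s * (10 ^ H * TL)" using queue_le[OF that, of Gs s g] by simp
    also have "... <= dr.Sx * (10 ^ H * TL)" using s by (intro mult_le_mono1) simp
    finally show ?thesis by (simp only: mult.assoc)
  qed
  have QM: "S aQ p g + 10 ^ H * TL <= M" "S aQ p g <= dr.Sx * 10 ^ H * TL" if "p < 2 * N" "g < H" for p g
    using ql[OF that(1), of g] inv that bd2 unfolding drift_inv_def by auto
  then have qb: "queue_bounded (S aQ)" unfolding queue_bounded_def by blast
  show ?thesis
  proof (rule wp_seq[OF wp_choose_points[OF ok qb]])
    fix S1 :: store
    assume b1: "ALL k<n. dr.best (S aQ) k (S1 aG k 0)" and f1: "!!r. r ~: mods choose_points ==> S1 r = S r"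
    have ok1: "grid_ok S1" using ok unfolding grid_ok_def inst_ok_def params_def by (simp add: f1)
    have e1: "S1 aQ = S aQ" "S1 aY = S aY" by (simp_all add: f1)
    have Yl: "S1 aY k g < dr.Sx" if "k < n" "g < H" for k g
    proof -
      have "counts Gs s k g <= of_nat (card {..<s}) * 1" unfolding counts_def by (intro sum_bounded_above) simp
      then show ?thesis using s inv that e1 by (simp add: drift_inv_def)
    qed
    show "wp (count_points ;; update_queues) (%S'. EX Gs'. drift_inv (Suc s) Gs' S') S1"
    proof (rule wp_seq[OF wp_count_points[of S1, OF ok1 Yl]], assumption, assumption)
      fix S2 :: store
      assume b2: "ALL k<n. ALL g<H. S2 aY k g = S1 aY k g + of_bool (S1 aG k 0 <= g)"
        and f2: "!!r. r ~: mods count_points ==> S2 r = S1 r"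
      have ok2: "grid_ok S2" using ok1 unfolding grid_ok_def inst_ok_def params_def by (simp add: f2)
      have e2: "S2 aQ = S aQ" "S2 aG = S1 aG" by (simp_all add: f2 f1)
      have M2: "S2 aQ p g + 10 ^ H * TL <= M" if "p < 2 * N" "g < H" for p g using QM(1)[OF that] e2 by simp
      show "wp update_queues (%S'. EX Gs'. drift_inv (Suc s) Gs' S') S2"
      proof (rule wp_mono[OF wp_update_queues[of S2, OF ok2 M2]], assumption, assumption)
        fix S3 :: store
        assume b3: "ALL p<2*N. ALL g<H. S3 aQ p g = S2 aQ p g + 10 ^ H * dr.load (%k. S2 aG k 0) p g - dr.T g"
          and f3: "!!r. r ~: mods update_queues ==> S3 r = S2 r"
        define Gs' where "Gs' = Gs(s := %k. S1 aG k 0)"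
        have qe: "dr.queue Gs' s' = dr.queue Gs s'" if "s' <= s" for s'
          using that by (intro queue_cong) (auto simp: Gs'_def)
        have qs: "p < 2 * N ==> g < H ==> S aQ p g = dr.queue Gs s p g" for p g using inv by (simp add: drift_inv_def)
        have "dr.best (dr.queue Gs' s') k (Gs' s' k)" if "s' < Suc s" "k < n" for s' k
        proof (cases "s' = s")
          case True
          have "dr.best (dr.queue Gs s) k (S1 aG k 0)"
            using b1 that best_cong[of "S aQ" "dr.queue Gs s" k, OF qs] by blast
          then show ?thesis using True qe by (simp add: Gs'_def)
        next
          case False
          then show ?thesis using that inv qe[of s'] by (simp add: Gs'_def drift_inv_def)
        qed
        moreover have "S3 aQ p g = dr.queue Gs' (Suc s) p g" if "p < 2 * N" "g < H" for p g
          using b3 that e2 qs qe[of s] by (simp add: Gs'_def)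
        moreover have "S3 aY k g = counts Gs' (Suc s) k g" if "k < n" "g < H" for k g
        proof -
          have "S3 aY k g = counts Gs s k g + of_bool (S1 aG k 0 <= g)"
            using b2 that f3 e1 inv by (simp add: drift_inv_def)
          moreover have "(\<Sum>s'<s. of_bool (Gs' s' k <= g)) = counts Gs s k g"
            unfolding counts_def by (intro sum.cong) (auto simp: Gs'_def)
          ultimately show ?thesis by (simp add: counts_def Gs'_def)
        qed
        ultimately have "drift_inv (Suc s) Gs' S3" unfolding drift_inv_def by blast
        then show "EX Gs'. drift_inv (Suc s) Gs' S3" by blast
      qed
    qed
  qed
qed

lemma mods_run_drift [simp]: "mods run_drift = {i1, i2, i3, vg, vr, t2, i4, vacc, vcost, vfl2, vbst, aG, aY, aQ}"
  by (auto simp: run_drift_def)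

lemma wp_run_drift:
  assumes ok: "grid_ok S" and z: "S aQ = (%_ _. 0)" "S aY = (%_ _. 0)"
  shows "wp run_drift (%S'. EX Gs. (ALL s<dr.Sx. ALL k<n. dr.best (dr.queue Gs s) k (Gs s k)) &
     (ALL k<n. ALL g<H. S' aY k g = dr.y Gs k g)) S"
  unfolding run_drift_def
proof (rule wp_Loop[where I = "%s S'. EX Gs. drift_inv s Gs S'"])
  have vS: "S vSx 0 0 = dr.Sx" using ok by (simp add: grid_ok_def)
  show "S vSx 0 0 <= Lim" using vS lim_S by simp
  show "EX Gs. drift_inv 0 Gs (upd S i1 0 0 0)" using z by (simp add: drift_inv_def counts_def)
  fix s and S1 :: store
  assume s: "s < S vSx 0 0" and inv: "EX Gs. drift_inv s Gs S1"
    and fr: "!!r. r ~= i1 ==> r ~: mods (choose_points ;; count_points ;; update_queues) ==> S1 r = S r"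
  have ok1: "grid_ok S1" using ok unfolding grid_ok_def inst_ok_def params_def by (simp add: fr)
  obtain Gs where "drift_inv s Gs S1" using inv by blast
  then have "wp (choose_points ;; count_points ;; update_queues) (%S'. EX Gs'. drift_inv (Suc s) Gs' S') S1"
    using s vS by (intro wp_drift_step[OF ok1]) auto
  then show "wp (choose_points ;; count_points ;; update_queues) (%S'. EX Gs'. drift_inv (Suc s) Gs' (upd S' i1 0 0 (Suc s))) S1"
    by (rule wp_mono) (auto simp: drift_inv_def)
next
  fix S1 :: store
  assume "EX Gs. drift_inv (S vSx 0 0) Gs S1"
  then show "EX Gs. (ALL s<dr.Sx. ALL k<n. dr.best (dr.queue Gs s) k (Gs s k)) & (ALL k<n. ALL g<H. S1 aY k g = dr.y Gs k g)"
    using ok by (auto simp: grid_ok_def drift_inv_def counts_def dr.y_def)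
qed auto

end

section \<open>The program: edge colouring and preemptive transmission\<close>

abbreviation "aRem == 305::nat"
abbreviation "aA == 306::nat"
abbreviation "aR == 307::nat"
abbreviation "vsl == 308::nat"
abbreviation "vca == 309::nat"
abbreviation "vcb == 310::nat"
abbreviation "vact == 311::nat"
abbreviation "vpi == 312::nat"
abbreviation "vpl == 313::nat"
abbreviation "vpj == 314::nat"
abbreviation "vold == 315::nat"
abbreviation "vip == 316::nat"
abbreviation "vlab == 317::nat"
abbreviation "vamt == 318::nat"
abbreviation "vk2 == 319::nat"
abbreviation "vel == 322::nat"
abbreviation "vcc == 323::nat"
abbreviation "vKN == 324::nat"
abbreviation "vX == 325::nat"

definition modx :: "ex => ex => ex" where
  "modx a b = a .- (a \<oslash> b) .* b"

lemma ev_modx [simp]: "ev S (modx a b) = ev S a mod ev S b"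
  by (simp add: modx_def modulo_nat_def mult.commute minus_div_mult_eq_mod)

lemma reads_modx [simp]: "reads (modx a b) = reads a \<union> reads b"
  by (auto simp: modx_def)

lemma wfe_modx [simp]: "wfe (modx a b) \<longleftrightarrow> wfe a & wfe b"
  by (auto simp: modx_def)

definition chain_move :: pr where
  "chain_move =
    vpj :=: modx (V vpl) (V vN) ;;
    Test (Arr aR (V vpj) (V vca))
     (vip :=: Arr aR (V vpj) (V vca) .- Cn 1 ;;
      vold :=: Arr aA (V vip) (V vca) ;; vlab :=: Arr aA (V vip) (V vcb) ;;
      Put aA (V vpi) (V vca) (V vpl .+ Cn 1) ;; Put aA (V vip) (V vca) (Cn 0) ;; Put aA (V vip) (V vcb) (V vold) ;;
      Put aR (V vpj) (V vca) (V vpi .+ Cn 1) ;; Put aR (V vpj) (V vcb) (V vip .+ Cn 1) ;;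
      Test (V vlab)
       (vpl :=: V vlab .- Cn 1 ;; vpi :=: V vip ;; vpj :=: modx (V vpl) (V vN) ;; Put aR (V vpj) (V vcb) (Cn 0))
       (vact :=: Cn 0))
     (Put aA (V vpi) (V vca) (V vpl .+ Cn 1) ;; Put aR (V vpj) (V vca) (V vpi .+ Cn 1) ;; vact :=: Cn 0)"

text \<open>Both searches run through all colours and keep the last free one. The chain loop always
  makes \<open>N\<close> rounds; \<open>vact\<close> turns the rounds after its end into
  no-ops.\<close>

definition insert_edge :: pr where
  "insert_edge =
    Loop i5 vK (Test (Arr aA (V vi) (V i5)) Skp (vca :=: V i5)) ;;
    Loop i5 vK (Test (Arr aR (V vj) (V i5)) Skp (vcb :=: V i5)) ;;
    vpi :=: V vi ;; vpl :=: V vel ;; vact :=: Cn 1 ;; Loop i5 vN (Test (V vact) chain_move Skp)"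

text \<open>Flows are numbered \<open>k * N * N + i * N + j\<close>. The number of slots
  \<open>vsl\<close> is a quotient rounded up by adding the divisor less 1.\<close>

definition colour_edge :: pr where
  "colour_edge =
    vk2 :=: V i2 \<oslash> V vNN ;; vi :=: modx (V i2) (V vNN) \<oslash> V vN ;; vj :=: modx (modx (V i2) (V vNN)) (V vN) ;;
    vel :=: V vk2 .* V vN .+ V vj ;;
    vsl :=: (Cn 10 .* V vNn .* Arr aD (V vk2) (modx (V i2) (V vNN)) .* Arr aY (V vk2) (V i1) .* V vP10 .+
       (V vSx .* Ar1 aT (V i1) .- Cn 1)) \<oslash> (V vSx .* Ar1 aT (V i1)) ;;
    Loop i4 vsl insert_edge"

definition clear_slots :: pr where
  "clear_slots = Loop i2 vKN (Put aA (modx (V i2) (V vN)) (V i2 \<oslash> V vN) (Cn 0) ;; Put aR (modx (V i2) (V vN)) (V i2 \<oslash> V vN) (Cn 0))"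

text \<open>In scaled units, interval \<open>g\<close> lasts from \<open>10 * K * T g\<close> to
  \<open>11 * K * T g\<close>, which is \<open>10 * K * T (g + 1)\<close>. It consists of
  \<open>K\<close> slots of length \<open>T g\<close>, one for each colour.\<close>

definition send_amount :: pr where
  "send_amount = Test (V vamt)
       (emit (Cn 0) (V vi) (V vj) (V vk2) ((Cn 10 .* V vK .+ V vcc) .* Ar1 aT (V i1))
          ((Cn 10 .* V vK .+ V vcc) .* Ar1 aT (V i1) .+ V vamt) ;;
        Put aRem (V vk2) (V vi .* V vN .+ V vj) (Arr aRem (V vk2) (V vi .* V vN .+ V vj) .- V vamt)) Skp"

definition use_slot :: pr where
  "use_slot = vcc :=: V i2 \<oslash> V vN ;; vi :=: modx (V i2) (V vN) ;;
    Test (Arr aA (V vi) (V vcc))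
     (vpl :=: Arr aA (V vi) (V vcc) .- Cn 1 ;; vk2 :=: V vpl \<oslash> V vN ;; vj :=: modx (V vpl) (V vN) ;;
      vamt :=: Arr aRem (V vk2) (V vi .* V vN .+ V vj) ;;
      Test (V vamt .- Ar1 aT (V i1)) (vamt :=: Ar1 aT (V i1)) Skp ;;
      send_amount) Skp"

definition use_interval :: pr where
  "use_interval = clear_slots ;; Loop i2 vF colour_edge ;; Loop i2 vKN use_slot"

definition single_core :: pr where
  "single_core = prepare_grid ;; run_drift ;; vKN :=: V vK .* V vN ;; vX :=: Cn 10 .* V vK .* V vP10 ;;
    Loop i1 vn (Loop i2 vNN (Put aRem (V i1) (V i2) (Arr aD (V i1) (V i2) .* V vX))) ;;
    Loop i1 vH use_interval ;; vDen :=: V vD .* V vX"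

section \<open>Slots per flow and degrees of the resulting multigraph\<close>

lemma div_mod_unique_nat: "c < b ==> (a * b + c) div b = a" "c < b ==> (a * b + c) mod b = c" for a b c :: nat
  by auto

lemma sum_div_mod:
  fixes f :: "nat => nat => nat"
  assumes "0 < N"
  shows "(\<Sum>l<n * N. f (l div N) (l mod N)) = (\<Sum>k<n. \<Sum>j<N. f k j)"
proof -
  have "(\<Sum>l<n * N. f (l div N) (l mod N)) = (\<Sum>k<n. \<Sum>l\<in>{k * N..<k * N + N}. f (l div N) (l mod N))"
    by (rule sum.nat_group[symmetric])
  also have "... = (\<Sum>k<n. \<Sum>j<N. f k j)"
  proof (rule sum.cong[OF refl])
    fix k
    have "(\<Sum>l\<in>{k * N..<k * N + N}. f (l div N) (l mod N)) = (\<Sum>l\<in>{0 + k * N..<N + k * N}. f (l div N) (l mod N))"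
      by (simp add: add.commute)
    also have "... = (\<Sum>j\<in>{0..<N}. f ((j + k * N) div N) ((j + k * N) mod N))"
      by (rule sum.shift_bounds_nat_ivl)
    also have "... = (\<Sum>j<N. f k j)" using assms unfolding atLeast0LessThan by (intro sum.cong) auto
    finally show "(\<Sum>l\<in>{k * N..<k * N + N}. f (l div N) (l mod N)) = (\<Sum>j<N. f k j)" .
  qed
  finally show ?thesis .
qed

lemma sum_mod_class:
  fixes f :: "nat => nat"
  assumes "j < N"
  shows "(\<Sum>l | l < n * N & l mod N = j. f (l div N)) = (\<Sum>k<n. f k)"
proof (rule sum.reindex_bij_witness[of _ "%k. k * N + j" "%l. l div N"])
  show "k * N + j \<in> {l. l < n * N & l mod N = j}" if "k \<in> {..<n}" for k
  proof -
    have "Suc k * N <= n * N" using that by (intro mult_le_mono1) auto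
    then show ?thesis using assms by simp
  qed
  show "(k * N + j) div N = k" for k using assms by simp
  show "l div N * N + j = l" if "l \<in> {l. l < n * N & l mod N = j}" for l
    using that by (metis (mono_tags) div_mult_mod_eq mem_Collect_eq)
  show "l div N \<in> {..<n}" if "l \<in> {l. l < n * N & l mod N = j}" for l
    using that by (auto simp: less_mult_imp_div_less)
qed simp

text \<open>Rounding up adds at most one per element, which turns \<open>11 * c\<close> into
  \<open>12 * c\<close>.\<close>

lemma sum_ceil_le:
  fixes x :: "'b => nat"
  assumes s: "0 < s" and A: "finite A" "card A = c" and x: "(\<Sum>a\<in>A. x a) <= 11 * c * s"
  shows "(\<Sum>a\<in>A. (x a + (s - 1)) div s) <= 12 * c"
proof -
  have "s * (\<Sum>a\<in>A. (x a + (s - 1)) div s) <= (\<Sum>a\<in>A. x a + s)"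
    unfolding sum_distrib_left
  proof (rule sum_mono)
    fix a
    show "s * ((x a + (s - 1)) div s) <= x a + s"
      using times_div_less_eq_dividend[of s "x a + (s - 1)"] by linarith
  qed
  also have "... <= 11 * c * s + c * s" using x A by (simp add: sum.distrib)
  also have "... = s * (12 * c)" by simp
  finally show ?thesis using s by simp
qed

lemma ceil_ge: "0 < s ==> x <= s * ((x + (s - 1)) div s)" for s x :: nat
proof -
  assume s: "0 < s"
  have "x + (s - 1) = s * ((x + (s - 1)) div s) + (x + (s - 1)) mod s" by simp
  moreover have "(x + (s - 1)) mod s <= s - 1" using s by (simp add: Suc_leI less_Suc_eq_le[symmetric])
  ultimately show ?thesis by linarith
qed

context inst
begin

text \<open>The share \<open>y / (12 * Sx)\<close> of the scaled size \<open>X * dd i j k\<close>,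
  measured in slots of length \<open>T g\<close> and rounded up; the 12 cancels against the one in
  \<open>K\<close>.\<close>

definition slots :: "(nat => nat => nat) => nat => nat => nat => nat => nat" where
  "slots Gs g i j k = (10 * (N * n) * dd i j k * dr.y Gs k g * 10 ^ H + (dr.Sx * dr.T g - 1)) div (dr.Sx * dr.T g)"

text \<open>The label \<open>k * N + j\<close> tells parallel edges of different coflows apart and
  still determines the output of the edge.\<close>

definition mult where
  "mult Gs g i l = (if l < n * N then slots Gs g i (l mod N) (l div N) else 0)"

definition X :: nat where "X = 10 * K * 10 ^ H"

text \<open>The time reserved for a flow before interval \<open>g\<close>. Through rounding, and
  through intervals after its completion, it may exceed the size of the flow.\<close>

definition progress where
  "progress Gs g i j k = (\<Sum>g'<g. slots Gs g' i j k * dr.T g')"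

lemma ST_pos: "0 < dr.Sx * dr.T g"
  using dr.T_pos N_pos coflows_pos dr.H by (simp add: dr.Sx_def)

context
  fixes Gs :: "nat => nat => nat"
  assumes best: "!!s k. s < dr.Sx ==> k < n ==> dr.best (dr.queue Gs s) k (Gs s k)"
begin

text \<open>\<open>A\<close> enumerates the \<open>N * n\<close> flows at port \<open>p\<close>, so
  that inputs and outputs are treated alike. The bound on the fractional load leaves
  \<open>11 * (N * n)\<close> slots before rounding.\<close>

lemma port_slots:
  assumes p: "p < 2 * N" and g: "g < H" and A: "finite A" "card A = N * n"
    and x: "(\<Sum>a\<in>A. d a * dr.y Gs (\<kappa> a) g) = (\<Sum>k<n. L p k * dr.y Gs k g)"
  shows "(\<Sum>a\<in>A. (10 * (N * n) * d a * dr.y Gs (\<kappa> a) g * 10 ^ H + (dr.Sx * dr.T g - 1)) div (dr.Sx * dr.T g)) <= K"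
  unfolding K_def
proof (rule sum_ceil_le[OF ST_pos A])
  have "(\<Sum>a\<in>A. 10 * (N * n) * d a * dr.y Gs (\<kappa> a) g * 10 ^ H) = N * n * (10 * 10 ^ H * (\<Sum>a\<in>A. d a * dr.y Gs (\<kappa> a) g))"
    by (simp add: sum_distrib_left mult_ac)
  also have "... <= N * n * (11 * dr.Sx * dr.T g)"
    unfolding x using dr.fractional_load[of Gs p g, OF best p g] by (intro mult_le_mono2) simp
  also have "... = 11 * (N * n) * (dr.Sx * dr.T g)" by (simp only: mult_ac)
  finally show "(\<Sum>a\<in>A. 10 * (N * n) * d a * dr.y Gs (\<kappa> a) g * 10 ^ H) <= 11 * (N * n) * (dr.Sx * dr.T g)" .
qed

lemma input_degree:
  assumes g: "g < H" and i: "i < N"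
  shows "(\<Sum>l<n * N. mult Gs g i l) <= K"
proof -
  have "(\<Sum>l<n * N. mult Gs g i l) = (\<Sum>l<n * N. (10 * (N * n) * dd i (l mod N) (l div N) * dr.y Gs (l div N) g * 10 ^ H
      + (dr.Sx * dr.T g - 1)) div (dr.Sx * dr.T g))"
    unfolding mult_def slots_def by simp
  also have "... <= K"
  proof (rule port_slots[of i])
    show "(\<Sum>l<n * N. dd i (l mod N) (l div N) * dr.y Gs (l div N) g) = (\<Sum>k<n. L i k * dr.y Gs k g)"
      using sum_div_mod[where N = N and n = n and f = "%k j. dd i j k * dr.y Gs k g"] N_pos i by (simp add: L_def sum_distrib_right)
  qed (use g i in auto)
  finally show ?thesis .
qed

lemma output_degree:
  assumes g: "g < H" and j: "j < N"
  shows "(\<Sum>i<N. \<Sum>l | l < n * N & l mod N = j. mult Gs g i l) <= K"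
proof -
  let ?f = "%i k. (10 * (N * n) * dd i j k * dr.y Gs k g * 10 ^ H + (dr.Sx * dr.T g - 1)) div (dr.Sx * dr.T g)"
  have "(\<Sum>l | l < n * N & l mod N = j. mult Gs g i l) = (\<Sum>k<n. ?f i k)" for i
  proof -
    have "(\<Sum>l | l < n * N & l mod N = j. mult Gs g i l) = (\<Sum>l | l < n * N & l mod N = j. ?f i (l div N))"
      by (intro sum.cong) (auto simp: mult_def slots_def)
    also have "... = (\<Sum>k<n. ?f i k)" by (rule sum_mod_class[OF j])
    finally show ?thesis .
  qed
  then have "(\<Sum>i<N. \<Sum>l | l < n * N & l mod N = j. mult Gs g i l) = (\<Sum>i<N. \<Sum>k<n. ?f i k)" by simp
  also have "... = (\<Sum>a\<in>{..<N} \<times> {..<n}. ?f (fst a) (snd a))"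
    by (simp add: sum.cartesian_product case_prod_beta)
  also have "... <= K"
  proof (rule port_slots[of "N + j" g "{..<N} \<times> {..<n}" "%a. dd (fst a) j (snd a)" snd])
    have "(\<Sum>a\<in>{..<N} \<times> {..<n}. dd (fst a) j (snd a) * dr.y Gs (snd a) g) = (\<Sum>i<N. \<Sum>k<n. dd i j k * dr.y Gs k g)"
      by (simp add: sum.cartesian_product case_prod_beta)
    also have "... = (\<Sum>k<n. \<Sum>i<N. dd i j k * dr.y Gs k g)" by (rule sum.swap)
    finally show "(\<Sum>a\<in>{..<N} \<times> {..<n}. dd (fst a) j (snd a) * dr.y Gs (snd a) g) = (\<Sum>k<n. L (N + j) k * dr.y Gs k g)"
      by (simp add: L_def sum_distrib_right)
  qed (use g j in auto)
  finally show ?thesis .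
qed

text \<open>Up to the finish index the fractional completions add up to at least
  \<open>12 * Sx\<close>, so the shares \<open>y / (12 * Sx)\<close> add up to the whole flow;
  rounding up only helps.\<close>

lemma progress_enough:
  assumes k: "k < n" and g: "dr.finish_index Gs k <= g"
  shows "X * dd i j k <= progress Gs g i j k"
proof -
  let ?e = "dr.finish_index Gs k"
  have "dr.Sx * (X * dd i j k) = 10 * (N * n) * dd i j k * 10 ^ H * (12 * dr.Sx)"
    by (simp add: X_def K_def)
  also have "... <= 10 * (N * n) * dd i j k * 10 ^ H * (\<Sum>g<?e. dr.y Gs k g)"
    using dr.finish_index_enough[of Gs k, OF best] by (intro mult_le_mono2) simp
  also have "... = (\<Sum>g<?e. 10 * (N * n) * dd i j k * dr.y Gs k g * 10 ^ H)"
    by (simp add: sum_distrib_left mult_ac)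
  also have "... <= (\<Sum>g<?e. dr.Sx * dr.T g * slots Gs g i j k)"
    unfolding slots_def by (intro sum_mono ceil_ge ST_pos)
  also have "... = dr.Sx * progress Gs ?e i j k" by (simp add: progress_def sum_distrib_left mult_ac)
  also have "... <= dr.Sx * progress Gs g i j k"
    unfolding progress_def using g by (intro mult_le_mono2 sum_mono2) auto
  finally show ?thesis using ST_pos[of 0] by simp
qed

text \<open>A positive share means that some round chose a point not after \<open>g\<close>. That
  point was allowed, hence not before the lower bound of the coflow, which includes its
  release.\<close>

lemma slots_release:
  assumes k: "k < n" and g: "g < H" and s: "0 < slots Gs g i j k"
  shows "X * rho k <= 10 * K * dr.T g"
proof -
  have "dr.y Gs k g ~= 0"
  proof
    assume "dr.y Gs k g = 0"
    then have "slots Gs g i j k = (dr.Sx * dr.T g - 1) div (dr.Sx * dr.T g)" by (simp add: slots_def)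
    also have "... = 0" using ST_pos[of g] by (intro div_less) simp
    finally show False using s by simp
  qed
  then obtain s where s: "s < dr.Sx" "Gs s k <= g" unfolding dr.y_def by (auto split: if_splits)
  have "10 ^ H * Bk k <= dr.T (Gs s k)" using best[OF s(1) k] by (simp add: dr.best_def dr.allowed_def)
  also have "... <= dr.T g" using s g by (intro T_mono) auto
  finally have "10 ^ H * rho k <= dr.T g" by (simp add: Bk_def nat_mult_max_right)
  then have "10 * K * (10 ^ H * rho k) <= 10 * K * dr.T g" by (rule mult_le_mono2)
  then show ?thesis by (simp only: X_def mult.assoc)
qed

lemma Bk_le_finish:
  assumes k: "k < n"
  shows "Bk k <= dr.\<tau> (dr.finish_index Gs k)"
proof -
  have "0 < (\<Sum>g<dr.finish_index Gs k. dr.y Gs k g)"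
    using dr.finish_index_enough[of Gs k, OF best] ST_pos[of 0] by simp
  then have "\<not> (\<forall>g\<in>{..<dr.finish_index Gs k}. dr.y Gs k g = 0)" by (metis less_irrefl sum.neutral)
  then obtain g where g: "g < dr.finish_index Gs k" "0 < dr.y Gs k g" by auto
  then obtain s where s: "s < dr.Sx" "Gs s k <= g" unfolding dr.y_def by (auto simp: card_gt_0_iff)
  have "real (Bk k) <= dr.\<tau> (Gs s k)" using best[OF s(1) k] by (simp add: dr.best_def dr.allowed_iff)
  also have "... <= dr.\<tau> (dr.finish_index Gs k)" using s g by (intro dr.\<tau>_mono) simp
  finally show ?thesis .
qed

text \<open>Coflows without data have no weight in \<open>W2\<close>; their bound is the release
  time, which is at most \<open>C k\<close>. The others are covered by
  \<open>dr.finish_cost\<close>.\<close>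

lemma finish_bounds:
  fixes C U :: "nat => real"
  assumes m: "m = 1" and C: "lower_bounds C"
  defines "U == %k. if loads.max_load {k} = 0 then real (rho k) else dr.\<tau> (dr.finish_index Gs k)"
  shows "k < n ==> rho k <= U k" "(\<Sum>k<n. W k * U k) <= 4 * (\<Sum>k<n. W k * C k)"
proof -
  show "k < n ==> rho k <= U k" using Bk_le_finish[of k] by (auto simp: U_def Bk_def)
  have rC: "real (rho k) <= C k" if "k < n" for k
    using C that N_pos unfolding lower_bounds_def by (metis le_add1 of_nat_mono order_trans One_nat_def Suc_le_eq)
  have load: "real (\<Sum>k | k < n & C k <= t. L p k) <= t" if "0 <= t" "p < 2 * N" for t p
    using C that m unfolding lower_bounds_def by simp
  have BC: "Bk k <= C k" if k: "k < n" for k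
  proof -
    have "L p k <= C k" if p: "p < 2 * N" for p
    proof -
      have "L p k <= (\<Sum>k' | k' < n & C k' <= C k. L p k')" using k by (intro member_le_sum) auto
      then have "real (L p k) <= real (\<Sum>k' | k' < n & C k' <= C k. L p k')" by (simp only: of_nat_le_iff)
      also have "... <= C k" using rC[OF k] p by (intro load) auto
      finally show ?thesis .
    qed
    moreover obtain p where "loads.max_load {k} = 0 \<or> p < 2 * N & loads.max_load {k} = L p k"
      using Max_in[of "insert 0 ((%p. loads.total_load {k} p) ` {..<2*N})"]
      unfolding loads.max_load_def loads.total_load_def by auto
    ultimately have "real (loads.max_load {k}) <= C k" using rC[OF k] by (metis of_nat_0 of_nat_0_le_iff order_trans)
    then show ?thesis using rC[OF k] by (simp add: Bk_def)
  qed
  have "(\<Sum>k<n. W2 k * dr.\<tau> (dr.finish_index Gs k)) <= 4 * (\<Sum>k<n. W2 k * C k)"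
    by (rule dr.finish_cost[of Gs C]) (use best BC load in auto)
  \<comment> \<open>The difference vanishes for coflows with data and is
    \<open>4 * (W k * C k)\<close> for the others, so that summation restores the dropped
    weights.\<close>
  moreover have "W k * U k <= W2 k * dr.\<tau> (dr.finish_index Gs k) + (4 * (W k * C k) - 4 * (W2 k * C k))" if "k < n" for k
  proof (cases "loads.max_load {k} = 0")
    case True
    have "W k * real (rho k) <= W k * C k" using rC[OF that] by (intro mult_left_mono) auto
    moreover have "0 <= W k * C k" using rC[OF that] by (intro mult_nonneg_nonneg) (auto intro: order_trans)
    ultimately show ?thesis using True by (simp add: U_def W2_def)
  qed (simp add: U_def W2_def)
  then have "(\<Sum>k<n. W k * U k) <= (\<Sum>k<n. W2 k * dr.\<tau> (dr.finish_index Gs k) + (4 * (W k * C k) - 4 * (W2 k * C k)))"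
    by (intro sum_mono) simp
  ultimately show "(\<Sum>k<n. W k * U k) <= 4 * (\<Sum>k<n. W k * C k)"
    by (simp add: sum.distrib sum_subtractf sum_distrib_left)
qed

end

end

section \<open>Correctness of the colouring program\<close>

context alg2
begin

sublocale col: colouring N K
  by unfold_locales (rule N_pos)

text \<open>A table entry is a label plus one, hence at most \<open>n * N\<close>; this keeps labels
  in range and stored values below \<open>M\<close>.\<close>

definition "chaining a b A0 i0 l0 s S \<longleftrightarrow> (ALL i c. S aA i c <= n * N) &
   (if S vact 0 0 = 0 then col.inserted A0 i0 l0 (S aA) (S aR)
    else S vpl 0 0 < n * N & col.chain a b A0 i0 l0 s (S aA) (S aR) (S vpi 0 0) (S vpl 0 0))"

lemma chaining_done:
  assumes "S aA = A" "S aR = R" "S vact 0 0 = 0" "col.inserted A0 i0 l0 A R" "!!i c. A i c <= n * N"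
  shows "chaining a b A0 i0 l0 s S"
  using assms by (simp add: chaining_def)

lemma chaining_active:
  assumes "S aA = A" "S aR = R" "S vact 0 0 ~= 0" "S vpl 0 0 = l" "S vpi 0 0 = i" "l < n * N"
    "col.chain a b A0 i0 l0 s A R i l" "!!i c. A i c <= n * N"
  shows "chaining a b A0 i0 l0 s S"
  using assms by (simp add: chaining_def)

lemma mods_chain_move [simp]: "mods chain_move = {vpj, vip, vold, vlab, aA, aR, vpl, vpi, vact}"
  by (auto simp: chain_move_def)

lemma nN_le_M: "n * N <= M" "N <= M"
proof -
  show "n * N <= M" using limM(2) by (simp add: mult.commute)
  show "N <= M" using lim_N Lim_le_M by linarith
qed

lemma wp_chain_move:
  assumes ch: "chaining a b A0 i0 l0 s S" and act: "S vact 0 0 ~= 0" and v: "S vN 0 0 = N" "S vca 0 0 = a" "S vcb 0 0 = b"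
    and ab: "a < K" "b < K"
  shows "wp chain_move (chaining a b A0 i0 l0 (Suc s)) S"
proof -
  define i l where "i = S vpi 0 0" and "l = S vpl 0 0"
  let ?A = "S aA" and ?R = "S aR" and ?j = "l mod N"
  have bA: "!!i c. ?A i c <= n * N" and l: "l < n * N" and c: "col.chain a b A0 i0 l0 s ?A ?R i l"
    using ch act unfolding chaining_def i_def l_def by auto
  have i: "i < N" using c by (simp add: col.chain_def)
  have lM: "Suc l <= M" "Suc i <= M" "l <= M" using l i nN_le_M by linarith+
  have jM: "?j <= M" using mod_le_divisor[of N l] N_pos nN_le_M by linarith
  have AM: "?A i c <= M" for i c using bA[of i c] nN_le_M by linarith
  have nN1: "Suc l <= n * N" using l by simp
  let ?S0 = "upd S vpj 0 0 ?j"
  show ?thesis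
  proof (cases "?R ?j a = 0")
    case True
    let ?S1 = "upd (upd (upd ?S0 aA i a (Suc l)) aR ?j a (Suc i)) vact 0 0 0"
    have "?S1 aA = col.set2 ?A i a (Suc l)" "?S1 aR = col.set2 ?R ?j a (Suc i)" by (auto simp: upd_def fun_eq_iff)
    then have "chaining a b A0 i0 l0 (Suc s) ?S1"
    proof (rule chaining_done)
      show "col.inserted A0 i0 l0 (col.set2 ?A i a (Suc l)) (col.set2 ?R ?j a (Suc i))" by (rule col.chain_end_1[OF c ab True])
    qed (use bA nN1 in simp_all)
    then show ?thesis
      unfolding chain_move_def using True v lM jM by (simp add: i_def[symmetric] l_def[symmetric])
  next
    case False
    define i' where "i' = ?R ?j a - 1"
    have i's: "?R ?j a - Suc 0 = i'" by (simp add: i'_def)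
    note f = col.chain_step_facts[OF c ab False, folded i'_def]
    let ?S1 = "upd (upd (upd ?S0 vip 0 0 i') vold 0 0 (?A i' a)) vlab 0 0 (?A i' b)"
    let ?S2 = "upd (upd (upd (upd (upd ?S1 aA i a (Suc l)) aA i' a 0) aA i' b (?A i' a)) aR ?j a (Suc i)) aR ?j b (Suc i')"
    let ?A' = "col.set2 (col.set2 (col.set2 ?A i a (Suc l)) i' a 0) i' b (?A i' a)"
    let ?R' = "col.set2 (col.set2 ?R ?j a (Suc i)) ?j b (Suc i')"
    have i'M: "Suc i' <= M" "i' <= M" using f(2) nN_le_M by linarith+
    have bA': "?A' x y <= n * N" for x y using bA nN1 by simp
    show ?thesis
    proof (cases "?A i' b = 0")
      case True
      let ?S3 = "upd ?S2 vact 0 0 0"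
      have "?S3 aA = ?A'" "?S3 aR = ?R'" by (auto simp: upd_def fun_eq_iff)
      then have "chaining a b A0 i0 l0 (Suc s) ?S3"
      proof (rule chaining_done)
        show "col.inserted A0 i0 l0 ?A' ?R'" using col.chain_end_2[OF c ab False, folded i'_def, OF True] .
      qed (use bA' in simp_all)
      then show ?thesis
        unfolding chain_move_def using False True v lM jM i'M AM f(1,3) by (simp add: i_def[symmetric] l_def[symmetric] i's)
    next
      case F2: False
      define l' where "l' = ?A i' b - 1"
      have l's: "?A i' b - Suc 0 = l'" by (simp add: l'_def)
      let ?S3 = "upd (upd (upd (upd ?S2 vpl 0 0 l') vpi 0 0 i') vpj 0 0 (l' mod N)) aR (l' mod N) b 0"
      have A3: "?S3 aA = ?A'" and R3: "?S3 aR = col.set2 ?R' (l' mod N) b 0" by (auto simp: upd_def fun_eq_iff)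
      have l': "l' < n * N" using bA[of i' b] F2 unfolding l'_def by linarith
      have c': "col.chain a b A0 i0 l0 (Suc s) ?A' (col.set2 ?R' (l' mod N) b 0) i' l'"
        using col.chain_next[OF c ab False, folded i'_def, OF F2] unfolding l'_def .
      have g: "chaining a b A0 i0 l0 (Suc s) ?S3"
        by (rule chaining_active[OF A3 R3 _ _ _ l' c' bA']) (use act in simp_all)
      have l'M: "l' <= M" "l' mod N <= M" using AM[of i' b] mod_less_eq_dividend[of l' N] unfolding l'_def by linarith+
      show ?thesis
        unfolding chain_move_def using False F2 v lM jM i'M AM f(1,3) g l'M
        by (simp add: i_def[symmetric] l_def[symmetric] i's l's)
    qed
  qed
qed

lemma mods_insert_edge [simp]: "mods insert_edge = {i5, vca, vcb, vpj, vip, vold, vlab, aA, aR, vpl, vpi, vact}"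
  by (auto simp: insert_edge_def)

lemma wp_find_free:
  assumes free: "card {c. c < K & S r x c ~= 0} < K" and v: "S vK 0 0 = K" "S vv 0 0 = x"
    and d: "d ~: {i5, vK, vv, r}" "vv ~= i5" "r ~= i5"
  shows "wp (Loop i5 vK (Test (Arr r (V vv) (V i5)) Skp (d :=: V i5))) (%S'. S' d 0 0 < K & S r x (S' d 0 0) = 0) S"
proof (rule wp_Loop[where I = "%i S'. (EX c<i. S r x c = 0) --> S' d 0 0 < i & S r x (S' d 0 0) = 0"])
  show "S vK 0 0 <= Lim" using v lim_K by simp
  fix c and S1 :: store
  assume c: "c < S vK 0 0" and inv: "(EX c'<c. S r x c' = 0) --> S1 d 0 0 < c & S r x (S1 d 0 0) = 0"
    and v1: "S1 i5 0 0 = c" and fr: "!!r'. r' ~= i5 ==> r' ~: mods (Test (Arr r (V vv) (V i5)) Skp (d :=: V i5)) ==> S1 r' = S r'"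
  have e: "S1 r = S r" "S1 vv = S vv" using fr d by auto
  have "c <= M" using c v limM by simp
  then show "wp (Test (Arr r (V vv) (V i5)) Skp (d :=: V i5))
     (%S''. (EX c'<Suc c. S r x c' = 0) --> upd S'' i5 0 0 (Suc c) d 0 0 < Suc c & S r x (upd S'' i5 0 0 (Suc c) d 0 0) = 0) S1"
    using e v v1 inv d by (auto simp: less_Suc_eq)
next
  fix S1 :: store
  assume inv: "(EX c<S vK 0 0. S r x c = 0) --> S1 d 0 0 < S vK 0 0 & S r x (S1 d 0 0) = 0"
  have "EX c<K. S r x c = 0"
  proof (rule ccontr)
    assume "\<not> ?thesis"
    then have "{c. c < K & S r x c ~= 0} = {..<K}" by auto
    then show False using free by simp
  qed
  then show "S1 d 0 0 < K & S r x (S1 d 0 0) = 0" using inv v by simp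
qed (use d in auto)

lemma wp_insert_edge:
  assumes pr: "col.proper (S aA) (S aR)" and bA: "!!i c. S aA i c <= n * N"
    and v: "S vK 0 0 = K" "S vN 0 0 = N" "S vi 0 0 = i0" "S vj 0 0 = l0 mod N" "S vel 0 0 = l0" "i0 < N" "l0 < n * N"
    and free: "card {c. c < K & S aA i0 c ~= 0} < K" "card {c. c < K & S aR (l0 mod N) c ~= 0} < K"
  shows "wp insert_edge (%S'. (ALL i c. S' aA i c <= n * N) & col.inserted (S aA) i0 l0 (S' aA) (S' aR)) S"
proof -
  have M: "i0 <= M" "l0 <= M" "Suc 0 <= M" using v nN_le_M Lim_pos Lim_le_M by linarith+
  show ?thesis
    unfolding insert_edge_def
  proof (rule wp_seq[OF wp_find_free[where x = i0]])
    fix S1 :: store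
    assume a1: "S1 vca 0 0 < K & S aA i0 (S1 vca 0 0) = 0"
      and f1: "!!r. r ~: mods (Loop i5 vK (Test (Arr aA (V vi) (V i5)) Skp (vca :=: V i5))) ==> S1 r = S r"
    have e1: "S1 r = S r" if "r ~: {i5, vca}" for r using f1 that by simp
    show "wp (Loop i5 vK (Test (Arr aR (V vj) (V i5)) Skp (vcb :=: V i5)) ;;
      vpi :=: V vi ;; vpl :=: V vel ;; vact :=: Cn 1 ;; Loop i5 vN (Test (V vact) chain_move Skp))
      (%S'. (ALL i c. S' aA i c <= n * N) & col.inserted (S aA) i0 l0 (S' aA) (S' aR)) S1"
    proof (rule wp_seq[OF wp_find_free[where x = "l0 mod N"]])
      fix S2 :: store
      assume a2: "S2 vcb 0 0 < K & S1 aR (l0 mod N) (S2 vcb 0 0) = 0"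
        and f2: "!!r. r ~: mods (Loop i5 vK (Test (Arr aR (V vj) (V i5)) Skp (vcb :=: V i5))) ==> S2 r = S1 r"
      have e2: "S2 r = S1 r" if "r ~: {i5, vcb}" for r using f2 that by simp
      define a b where "a = S2 vca 0 0" and "b = S2 vcb 0 0"
      have ab: "a < K" "b < K" "S aA i0 a = 0" "S aR (l0 mod N) b = 0" using a1 a2 by (simp_all add: a_def b_def e1 e2)
      let ?S = "upd (upd (upd S2 vpi 0 0 i0) vpl 0 0 l0) vact 0 0 (Suc 0)"
      have "wp (Loop i5 vN (Test (V vact) chain_move Skp))
         (%S'. (ALL i c. S' aA i c <= n * N) & col.inserted (S aA) i0 l0 (S' aA) (S' aR)) ?S"
      proof (rule wp_Loop[where I = "chaining a b (S aA) i0 l0"])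
        have c: "col.chain a b (S aA) i0 l0 0 (S aA) (S aR) i0 l0"
          by (rule col.chain_start) (use pr v ab in auto)
        show "chaining a b (S aA) i0 l0 0 (upd ?S i5 0 0 0)"
          by (rule chaining_active[OF _ _ _ _ _ _ c]) (use bA v in \<open>simp_all add: e1 e2\<close>)
        show "?S vN 0 0 <= Lim" using v lim_N by (simp add: e1 e2)
        fix s and S3 :: store
        assume inv: "chaining a b (S aA) i0 l0 s S3"
          and f3: "!!r. r ~= i5 ==> r ~: mods (Test (V vact) chain_move Skp) ==> S3 r = ?S r"
        have w: "wp chain_move (chaining a b (S aA) i0 l0 (Suc s)) S3" if "S3 vact 0 0 ~= 0"
          by (rule wp_chain_move[OF inv that]) (use f3 v ab in \<open>simp_all add: a_def b_def e1 e2\<close>)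
        have st: "chaining a b (S aA) i0 l0 (Suc s) S3" if "S3 vact 0 0 = 0" using inv that by (simp add: chaining_def)
        have cn: "chaining a b (S aA) i0 l0 (Suc s) (upd S' i5 0 0 x)" if "chaining a b (S aA) i0 l0 (Suc s) S'" for S' x
          using that by (simp add: chaining_def)
        show "wp (Test (V vact) chain_move Skp) (%S''. chaining a b (S aA) i0 l0 (Suc s) (upd S'' i5 0 0 (Suc s))) S3"
        proof (cases "S3 vact 0 0 = 0")
          case True
          then show ?thesis using cn[OF st] by simp
        next
          case False
          have "wp chain_move (%S''. chaining a b (S aA) i0 l0 (Suc s) (upd S'' i5 0 0 (Suc s))) S3"
            using w[OF False] by (rule wp_mono) (rule cn)
          then show ?thesis using False by simp
        qed
      next
        fix S3 :: store
        assume "chaining a b (S aA) i0 l0 (?S vN 0 0) S3"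
        moreover have "?S vN 0 0 = N" using v by (simp add: e1 e2)
        ultimately have c: "chaining a b (S aA) i0 l0 N S3" by simp
        \<comment> \<open>A chain still active after \<open>N\<close> rounds would contradict
          \<open>col.chain_less\<close>.\<close>
        then have "S3 vact 0 0 = 0" using col.chain_less unfolding chaining_def by (metis less_irrefl)
        then show "(ALL i c. S3 aA i c <= n * N) & col.inserted (S aA) i0 l0 (S3 aA) (S3 aR)"
          using c by (simp add: chaining_def)
      qed auto
      then show "wp (vpi :=: V vi ;; vpl :=: V vel ;; vact :=: Cn 1 ;; Loop i5 vN (Test (V vact) chain_move Skp))
        (%S'. (ALL i c. S' aA i c <= n * N) & col.inserted (S aA) i0 l0 (S' aA) (S' aR)) S2"
        using v M by (simp add: e1 e2)
    qed (use v free in \<open>simp_all add: e1\<close>)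
  qed (use v free in simp_all)
qed

definition "coloured w S \<longleftrightarrow> col.proper (S aA) (S aR) & (ALL i c. S aA i c <= n * N) &
   (ALL i<N. ALL l. col.colours (S aA) i l = w i l)"

lemma colours_out: "(!!i c. A i c <= n * N) ==> n * N <= l ==> col.colours A i l = 0"
proof -
  assume "!!i c. A i c <= n * N" "n * N <= l"
  then have "A i c ~= Suc l" for c by (metis Suc_n_not_le_n order_trans)
  then show ?thesis by (simp add: col.colours_def)
qed

text \<open>The target multigraph \<open>w'\<close> has degree at most \<open>K\<close>, and at
  least one copy of the new edge is missing in \<open>w\<close>. So both ends have degree below
  \<open>K\<close> and a free colour each.\<close>

lemma wp_insert_coloured:
  assumes co: "coloured w S" and le: "!!i l. i < N ==> w i l <= w' i l" and less: "w i0 l0 < w' i0 l0"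
    and v: "S vK 0 0 = K" "S vN 0 0 = N" "S vi 0 0 = i0" "S vj 0 0 = l0 mod N" "S vel 0 0 = l0" "i0 < N" "l0 < n * N"
    and deg: "(\<Sum>l<n * N. w' i0 l) <= K" "(\<Sum>i<N. \<Sum>l | l < n * N & l mod N = l0 mod N. w' i l) <= K"
  shows "wp insert_edge (coloured (%i l. w i l + of_bool (i = i0 & l = l0))) S"
proof -
  have pr: "col.proper (S aA) (S aR)" and bA: "!!i c. S aA i c <= n * N" and c: "!!i l. i < N ==> col.colours (S aA) i l = w i l"
    using co by (auto simp: coloured_def)
  have "(\<Sum>l<n * N. w i0 l) < (\<Sum>l<n * N. w' i0 l)"
    using v le less by (intro sum_strict_mono_ex1) auto
  then have "card {c. c < K & S aA i0 c ~= 0} < K"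
    using deg(1) col.used_at_input[of "n * N" "S aA" i0, OF colours_out[OF bA]] c v by simp
  moreover have "(\<Sum>l | l < n * N & l mod N = l0 mod N. w i0 l) < (\<Sum>l | l < n * N & l mod N = l0 mod N. w' i0 l)"
    using v le less by (intro sum_strict_mono_ex1) auto
  then have "(\<Sum>i<N. \<Sum>l | l < n * N & l mod N = l0 mod N. w i l) < (\<Sum>i<N. \<Sum>l | l < n * N & l mod N = l0 mod N. w' i l)"
    using v le by (intro sum_strict_mono_ex1) (auto intro!: sum_mono)
  then have "card {c. c < K & S aR (l0 mod N) c ~= 0} < K"
    using deg(2) col.used_at_output[of "S aA" "S aR" "l0 mod N" "n * N", OF pr _ colours_out[OF bA]] c N_pos by simp
  ultimately have "wp insert_edge (%S'. (ALL i c. S' aA i c <= n * N) & col.inserted (S aA) i0 l0 (S' aA) (S' aR)) S"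
    by (intro wp_insert_edge[OF pr bA v]) auto
  then show ?thesis
    by (rule wp_mono) (use c in \<open>auto simp: coloured_def col.inserted_def\<close>)
qed

lemma coloured_counter: "r ~: {aA, aR} ==> coloured w (upd S r x y z) = coloured w S"
  by (simp add: coloured_def)

text \<open>The position of an edge in the traversal by \<open>colour_edge\<close>; the edges below
  the current position are those already coloured.\<close>

definition ord :: "nat => nat => nat" where
  "ord i l = l div N * (N * N) + (i * N + l mod N)"

lemma ord_inj:
  assumes "i < N" "ord i l = x"
  shows "l div N = x div (N * N)" "i = x mod (N * N) div N" "l mod N = x mod (N * N) mod N"
proof -
  have l: "l mod N < N" using N_pos by simp
  have "Suc i * N <= N * N" using assms by (intro mult_le_mono1) simp
  then have e: "i * N + l mod N < N * N" using l by simp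
  note d = div_mod_unique_nat[OF e, of "l div N"] div_mod_unique_nat[OF l, of i]
  show "l div N = x div (N * N)" unfolding assms(2)[symmetric] ord_def by (simp only: d)
  have m: "x mod (N * N) = i * N + l mod N" unfolding assms(2)[symmetric] ord_def by (simp only: d)
  show "i = x mod (N * N) div N" "l mod N = x mod (N * N) mod N" unfolding m by (simp_all only: d)
qed

lemma ord_less: "i < N ==> l < n * N ==> ord i l < N * N * n"
proof -
  assume i: "i < N" and l: "l < n * N"
  have "Suc i * N <= N * N" using i by (intro mult_le_mono1) simp
  moreover have "l mod N < N" using N_pos by simp
  ultimately have "i * N + l mod N < N * N" by simp
  moreover have "Suc (l div N) * (N * N) <= n * (N * N)" using less_mult_imp_div_less[OF l] by (intro mult_le_mono1) simp
  ultimately show ?thesis unfolding ord_def by (simp add: mult.commute)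
qed

lemma ord_inverse:
  assumes "x < N * N * n"
  defines "k == x div (N * N)" and "i == x mod (N * N) div N" and "j == x mod (N * N) mod N"
  shows "k < n" "i < N" "j < N" "ord i (k * N + j) = x" "k * N + j < n * N" "x mod (N * N) = i * N + j"
proof -
  have N: "0 < N * N" using N_pos by simp
  show k: "k < n" unfolding k_def using assms(1) by (simp add: less_mult_imp_div_less mult.commute)
  have m: "x mod (N * N) < N * N" using N by simp
  then show i: "i < N" unfolding i_def by (rule div_mod_N)
  show j: "j < N" unfolding j_def using N_pos by simp
  show e: "x mod (N * N) = i * N + j" unfolding i_def j_def by simp
  have "x = k * (N * N) + x mod (N * N)" unfolding k_def by (rule div_mult_mod_eq[symmetric])
  then show "ord i (k * N + j) = x" unfolding ord_def e using j by simp
  have "Suc k * N <= n * N" using k by (intro mult_le_mono1) simp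
  then show "k * N + j < n * N" using j by simp
qed

lemma mods_colour_edge [simp]: "mods colour_edge = {vk2, vi, vj, vel, vsl, i4, i5, vca, vcb, vpj, vip, vold, vlab, aA, aR, vpl, vpi, vact}"
  by (auto simp: colour_edge_def)

lemma grid_ok_frame:
  assumes "grid_ok S" "!!r. r ~: Z ==> S' r = S r"
    "Z \<inter> {vm, vN, vn, vNN, vRow, vD, vDw, v2N, vF, aRho, aD, aL, vNn, vK, vG, vH, vP10, vP110, vSx, vc1, vc2, aT, aB, aW} = {}"
  shows "grid_ok S'"
proof -
  have "S' r = S r" if "r \<in> {vm, vN, vn, vNN, vRow, vD, vDw, v2N, vF, aRho, aD, aL, vNn, vK, vG, vH, vP10, vP110, vSx, vc1, vc2, aT, aB, aW}" for r
    using assms that by blast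
  then show ?thesis using assms(1) unfolding grid_ok_def inst_ok_def params_def by simp
qed

definition "drifted Gs S \<longleftrightarrow> grid_ok S & (ALL k<n. ALL g<H. S aY k g = dr.y Gs k g) & S vKN 0 0 = K * N"

lemma drifted_frame:
  assumes "drifted Gs S" "!!r. r ~: Z ==> S' r = S r"
    "Z \<inter> {vm, vN, vn, vNN, vRow, vD, vDw, v2N, vF, aRho, aD, aL, vNn, vK, vG, vH, vP10, vP110, vSx, vc1, vc2, aT, aB, aW, aY, vKN} = {}"
  shows "drifted Gs S'"
proof -
  have "S' aY = S aY" "S' vKN = S vKN" using assms(2,3) by blast+
  moreover have "grid_ok S'" by (rule grid_ok_frame[of S Z]) (use assms in \<open>auto simp: drifted_def\<close>)
  ultimately show ?thesis using assms(1) by (simp add: drifted_def)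
qed

lemma KN_le: "K * N <= Lim" "K * N <= M"
proof -
  have "1 * (K * N) <= H * (K * N)" using dr.H by (intro mult_le_mono1) simp
  then show "K * N <= Lim" unfolding mult_1 using lim_HKN by (rule order_trans)
  then show "K * N <= M" using Lim_le_M by simp
qed

lemma mods_clear_slots [simp]: "mods clear_slots = {i2, aA, aR}"
  by (auto simp: clear_slots_def)

lemma slot_index: "i < N ==> (c * N + i = x) = (c = x div N & i = x mod N)"
proof
  assume "i < N" "c * N + i = x"
  then show "c = x div N & i = x mod N" by auto
next
  assume "c = x div N & i = x mod N"
  then show "c * N + i = x" by simp
qed

lemma slot_less: "i < N ==> c < K ==> c * N + i < K * N"
proof -
  assume "i < N" "c < K"
  then have "Suc c * N <= K * N" by (intro mult_le_mono1) simp
  then show ?thesis using \<open>i < N\<close> by simp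
qed

lemma wp_clear_slots:
  assumes dr: "drifted Gs S" and bA: "!!i c. S aA i c <= n * N"
  shows "wp clear_slots (coloured (%_ _. 0)) S"
  unfolding clear_slots_def
proof (rule wp_Loop[where I = "%x S'. (ALL i c. S' aA i c <= n * N) & (ALL i<N. ALL c<K. c * N + i < x --> S' aA i c = 0 & S' aR i c = 0)"])
  have v: "S vKN 0 0 = K * N" "S vN 0 0 = N" using dr by (auto simp: drifted_def grid_ok_def inst_ok_def params_def)
  show "S vKN 0 0 <= Lim" using v KN_le by simp
  fix x and S1 :: store
  let ?b = "Put aA (modx (V i2) (V vN)) (V i2 \<oslash> V vN) (Cn 0) ;; Put aR (modx (V i2) (V vN)) (V i2 \<oslash> V vN) (Cn 0)"
  assume inv: "(ALL i c. S1 aA i c <= n * N) & (ALL i<N. ALL c<K. c * N + i < x --> S1 aA i c = 0 & S1 aR i c = 0)"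
    and v1: "S1 i2 0 0 = x" and fr: "!!r. r ~= i2 ==> r ~: mods ?b ==> S1 r = S r"
  have N1: "S1 vN 0 0 = N" using fr v by simp
  show "wp ?b (%S'. (ALL i c. upd S' i2 0 0 (Suc x) aA i c <= n * N) &
      (ALL i<N. ALL c<K. c * N + i < Suc x --> upd S' i2 0 0 (Suc x) aA i c = 0 & upd S' i2 0 0 (Suc x) aR i c = 0)) S1"
    using inv v1 N1 by (auto simp: less_Suc_eq slot_index)
next
  fix S1 :: store
  assume inv: "(ALL i c. S1 aA i c <= n * N) & (ALL i<N. ALL c<K. c * N + i < S vKN 0 0 --> S1 aA i c = 0 & S1 aR i c = 0)"
  have "S vKN 0 0 = K * N" using dr by (simp add: drifted_def)
  then have z: "S1 aA i c = 0 & S1 aR i c = 0" if "i < N" "c < K" for i c using inv that slot_less by simp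
  have "col.proper (S1 aA) (S1 aR)" unfolding col.proper_def using z by auto
  moreover have "col.colours (S1 aA) i l = 0" if "i < N" for i l unfolding col.colours_def using z that by (simp add: card_eq_0_iff)
  ultimately show "coloured (%_ _. 0) S1" using inv by (simp add: coloured_def)
qed (use bA in auto)

lemma coloured_cong: "coloured w S ==> (!!i l. i < N ==> w i l = w' i l) ==> coloured w' S"
  by (simp add: coloured_def)

text \<open>Slots are traversed in the order \<open>c * N + i\<close>. This counts the slots of the
  current interval that belong to an edge and lie before position \<open>x\<close>.\<close>

definition dn :: "(nat => nat => nat) => nat => nat => nat => nat" where
  "dn A x i l = card {c. c < K & c * N + i < x & A i c = Suc l}"

lemma dn_Suc:
  assumes "i < N" "x < K * N"
  shows "dn A (Suc x) i l = dn A x i l + of_bool (i = x mod N & A i (x div N) = Suc l)"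
proof -
  have c: "x div N < K" using assms by (simp add: less_mult_imp_div_less)
  have "{c. c < K & c * N + i < Suc x & A i c = Suc l} =
     {c. c < K & c * N + i < x & A i c = Suc l} \<union> (if i = x mod N & A i (x div N) = Suc l then {x div N} else {})"
    using c slot_index[OF assms(1)] by (auto simp: less_Suc_eq)
  moreover have "x div N ~: {c. c < K & c * N + i < x & A i c = Suc l}" if "i = x mod N" using that by simp
  ultimately show ?thesis unfolding dn_def by (auto simp: card_Un_disjoint)
qed

lemma dn_0: "dn A 0 i l = 0"
  by (simp add: dn_def)

lemma dn_all: "i < N ==> dn A (K * N) i l = col.colours A i l"
  unfolding dn_def col.colours_def using slot_less by (metis (no_types, lifting))

text \<open>When interval \<open>g'\<close> began, not enough time had been reserved for the flow,
  so \<open>g'\<close> is below its finish index. This turns the end of the interval into a bound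
  for the period.\<close>

definition "old_ok Gs g S q \<longleftrightarrow> (EX g'<g. bS S q <= 10 * K * dr.T (Suc g') &
   progress Gs g' (S pI q 0) (S pJ q 0) (S pK q 0) < X * dd (S pI q 0) (S pJ q 0) (S pK q 0))"

definition "cur_ok Gs g x S q \<longleftrightarrow> progress Gs g (S pI q 0) (S pJ q 0) (S pK q 0) < X * dd (S pI q 0) (S pJ q 0) (S pK q 0) &
   (EX c<K. c * N + S pI q 0 < x & S aA (S pI q 0) c = Suc (S pK q 0 * N + S pJ q 0) & bS S q <= (10 * K + Suc c) * dr.T g)"

text \<open>The remaining amount is tied both to the data sent and to the time reserved. The second
  equation relies on truncated subtraction, as the reserved time may exceed the size.\<close>

definition "sending Gs g x S \<longleftrightarrow> psched X S & kS S <= g * (K * N) + x &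
   (ALL i<N. ALL j<N. ALL k<n. S aRem k (i * N + j) + snt S (i, j, k) = X * dd i j k &
      S aRem k (i * N + j) = X * dd i j k - (progress Gs g i j k + dn (S aA) x i (k * N + j) * dr.T g)) &
   (ALL q<kS S. old_ok Gs g S q \<or> cur_ok Gs g x S q)"

lemma sending_cong:
  assumes "sending Gs g x S" "!!r. r \<in> {pC, pI, pJ, pK, pA, pB, cnt, aRem, aA} ==> S' r = S r"
  shows "sending Gs g x S'"
proof -
  have e: "S' pC = S pC" "S' pI = S pI" "S' pJ = S pJ" "S' pK = S pK" "S' pA = S pA" "S' pB = S pB" "S' cnt = S cnt"
    "S' aRem = S aRem" "S' aA = S aA" by (rule assms(2), simp)+
  show ?thesis using assms(1) unfolding sending_def old_ok_def cur_ok_def psched_def snt_def e .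
qed

text \<open>At \<open>x = 0\<close> no slot of the current interval is referred to, so the colouring
  tables may be cleared and refilled.\<close>

lemma sending_0_cong:
  assumes "sending Gs g 0 S" "!!r. r \<in> {pC, pI, pJ, pK, pA, pB, cnt, aRem} ==> S' r = S r"
  shows "sending Gs g 0 S'"
proof -
  have e: "S' pC = S pC" "S' pI = S pI" "S' pJ = S pJ" "S' pK = S pK" "S' pA = S pA" "S' pB = S pB" "S' cnt = S cnt"
    "S' aRem = S aRem" by (rule assms(2), simp)+
  have c: "cur_ok Gs g 0 S q = False" for S q by (simp add: cur_ok_def)
  show ?thesis using assms(1) unfolding sending_def old_ok_def c dn_0 psched_def snt_def e .
qed

text \<open>The last slot of interval \<open>g\<close> ends by \<open>11 * K * T g\<close>, the
  start of the next interval, and a full traversal has met each edge as often as its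
  multiplicity.\<close>

lemma sending_next:
  assumes se: "sending Gs g (K * N) S" and co: "coloured (mult Gs g) S" and g: "g < H"
  shows "sending Gs (Suc g) 0 S"
proof -
  have T11: "10 * K * dr.T (Suc g) = 11 * K * dr.T g" using T_Suc[OF g] by simp
  have o1: "old_ok Gs (Suc g) S q" if "cur_ok Gs g (K * N) S q" for q
  proof -
    from that obtain c where p: "progress Gs g (S pI q 0) (S pJ q 0) (S pK q 0) < X * dd (S pI q 0) (S pJ q 0) (S pK q 0)"
      and c: "c < K" "bS S q <= (10 * K + Suc c) * dr.T g" unfolding cur_ok_def by blast
    have "(10 * K + Suc c) * dr.T g <= 11 * K * dr.T g" using c(1) by (intro mult_le_mono1) simp
    then have "bS S q <= 10 * K * dr.T (Suc g)" unfolding T11 using c(2) by (rule order_trans[rotated])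
    then show ?thesis unfolding old_ok_def using p by blast
  qed
  have o2: "old_ok Gs (Suc g) S q" if "old_ok Gs g S q" for q
    using that unfolding old_ok_def by (meson less_SucI)
  have pr: "progress Gs g i j k + dn (S aA) (K * N) i (k * N + j) * dr.T g = progress Gs (Suc g) i j k + dn (S aA) 0 i (k * N + j) * dr.T (Suc g)"
    if "i < N" "j < N" "k < n" for i j k
  proof -
    have "Suc k * N <= n * N" using that by (intro mult_le_mono1) simp
    then have "k * N + j < n * N" using that by simp
    then have "mult Gs g i (k * N + j) = slots Gs g i j k" using that by (simp add: mult_def)
    then have "dn (S aA) (K * N) i (k * N + j) = slots Gs g i j k" using co that by (simp add: dn_all coloured_def)
    then show ?thesis by (simp add: progress_def dn_0)
  qed
  have "sending Gs g (K * N) S" by (rule se)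
  then have "psched X S" "kS S <= Suc g * (K * N) + 0" and R: "!!i j k. i < N ==> j < N ==> k < n ==>
      S aRem k (i * N + j) + snt S (i, j, k) = X * dd i j k &
      S aRem k (i * N + j) = X * dd i j k - (progress Gs g i j k + dn (S aA) (K * N) i (k * N + j) * dr.T g)"
    and ok: "!!q. q < kS S ==> old_ok Gs g S q \<or> cur_ok Gs g (K * N) S q"
    unfolding sending_def by (blast, simp, blast, blast)
  then show ?thesis unfolding sending_def using o1 o2 pr by metis
qed

lemma mods_use_slot [simp]: "mods use_slot = {vcc, vi, vpl, vk2, vj, vamt, pC, pI, pJ, pK, pA, pB, cnt, aRem}"
  by (auto simp: use_slot_def send_amount_def)

lemma sending_start:
  assumes "psched X S" "kS S = 0" "!!i j k. i < N ==> j < N ==> k < n ==> S aRem k (i * N + j) = X * dd i j k"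
  shows "sending Gs 0 0 S"
  using assms unfolding sending_def by (simp add: snt_def sent_0 progress_def dn_0)

lemma period_bounds:
  assumes g: "g < H" and c: "c < K" and am: "am <= dr.T g"
  shows "(10 * K + c) * dr.T g + am <= (10 * K + Suc c) * dr.T g" "(10 * K + c) * dr.T g + am <= M" "(10 * K + c) * dr.T g <= M"
proof -
  show 1: "(10 * K + c) * dr.T g + am <= (10 * K + Suc c) * dr.T g" using am by simp
  have "(10 * K + Suc c) * dr.T g <= 22 * K * 11 ^ H" using c g by (intro mult_le_mono T_le) auto
  also have "... <= M" using bd2 by linarith
  finally show "(10 * K + c) * dr.T g + am <= M" using 1 by (rule order_trans[rotated])
  then show "(10 * K + c) * dr.T g <= M" by (rule add_leD1)
qed

lemma mods_use_interval [simp]: "mods use_interval = {i2, aA, aR} \<union> mods colour_edge \<union> mods use_slot"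
  by (auto simp: use_interval_def)

context
  fixes Gs :: "nat => nat => nat"
  assumes best: "!!s k. s < dr.Sx ==> k < n ==> dr.best (dr.queue Gs s) k (Gs s k)"
begin

lemma mult_le_K: "g < H ==> i < N ==> l < n * N ==> mult Gs g i l <= K"
  using input_degree[of Gs g i, OF best] member_le_sum[of l "{..<n * N}" "mult Gs g i"] by (simp add: order_trans)

lemma wp_colour_edge:
  assumes dr: "drifted Gs S" and g: "S i1 0 0 = g" "g < H" and x: "S i2 0 0 = x" "x < N * N * n"
    and co: "coloured (%i l. if ord i l < x then mult Gs g i l else 0) S"
  shows "wp colour_edge (coloured (%i l. if ord i l < Suc x then mult Gs g i l else 0)) S"
proof -
  define k i j where "k = x div (N * N)" and "i = x mod (N * N) div N" and "j = x mod (N * N) mod N"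
  define l where "l = k * N + j"
  note o = ord_inverse[OF x(2), folded k_def i_def j_def, folded l_def]
  have v: "S vN 0 0 = N" "S vNN 0 0 = N * N" "S vNn 0 0 = N * n" "S vP10 0 0 = 10 ^ H" "S vSx 0 0 = dr.Sx" "S vK 0 0 = K"
      "S aT g 0 = dr.T g" "S aY k g = dr.y Gs k g" "S aD k (x mod (N * N)) = dd i j k"
    using dr g o by (auto simp: drifted_def grid_ok_def inst_ok_def params_def)
  have lm: "l mod N = j" "l div N = k" using o(3) unfolding l_def by auto
  have w: "mult Gs g i l = slots Gs g i j k" using o lm by (simp add: mult_def)
  have sl: "slots Gs g i j k <= K" using mult_le_K[OF g(2) o(2,5)] w by simp
  have M: "k <= M" "i <= M" "j <= M" "l <= M" "slots Gs g i j k <= M" using o nN_le_M lim_n Lim_le_M sl limM(1) by linarith+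
  let ?S = "upd (upd (upd (upd (upd S vk2 0 0 k) vi 0 0 i) vj 0 0 j) vel 0 0 l) vsl 0 0 (slots Gs g i j k)"
  let ?w = "%c i' l'. (if ord i' l' < x then mult Gs g i' l' else 0) + (if i' = i & l' = l then c else 0)"
  have eq: "ord i' l' = x \<longleftrightarrow> i' = i & l' = l" if "i' < N" for i' l'
  proof
    assume "ord i' l' = x"
    then have "l' div N = k" "i' = i" "l' mod N = j" using ord_inj[OF that] unfolding k_def i_def j_def by auto
    then show "i' = i & l' = l" unfolding l_def using div_mult_mod_eq[of l' N] by simp
  qed (use o in simp)
  have "wp (Loop i4 vsl insert_edge) (coloured (%i l. if ord i l < Suc x then mult Gs g i l else 0)) ?S"
  proof (rule wp_Loop[where I = "%c. coloured (?w c)"])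
    show "?S vsl 0 0 <= Lim" using sl lim_K by simp
    show "coloured (?w 0) (upd ?S i4 0 0 0)" using co by (simp add: coloured_counter cong: if_cong)
    fix c and S1 :: store
    assume c: "c < ?S vsl 0 0" and inv: "coloured (?w c) S1" and fr: "!!r. r ~= i4 ==> r ~: mods insert_edge ==> S1 r = ?S r"
    have c': "c < slots Gs g i j k" using c by simp
    have le: "?w c i' l' <= mult Gs g i' l'" if "i' < N" for i' l'
      using c' w o(4) by auto
    have less: "?w c i l < mult Gs g i l" using c' w o(4) by simp
    have vs: "S1 vK 0 0 = K" "S1 vN 0 0 = N" "S1 vi 0 0 = i" "S1 vj 0 0 = l mod N" "S1 vel 0 0 = l"
      using v lm by (simp_all add: fr)
    have "wp insert_edge (coloured (%i' l'. ?w c i' l' + of_bool (i' = i & l' = l))) S1"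
      by (rule wp_insert_coloured[OF inv le less vs o(2,5)])
        (use input_degree[of Gs g i, OF best] output_degree[of Gs g j, OF best] g o lm in auto)
    then show "wp insert_edge (%S'. coloured (?w (Suc c)) (upd S' i4 0 0 (Suc c))) S1"
    proof (rule wp_mono)
      fix S' :: store
      assume "coloured (%i' l'. ?w c i' l' + of_bool (i' = i & l' = l)) S'"
      then have "coloured (?w (Suc c)) S'" by (rule coloured_cong) simp
      then show "coloured (?w (Suc c)) (upd S' i4 0 0 (Suc c))" by (simp add: coloured_counter)
    qed
  next
    fix S1 :: store
    assume "coloured (?w (?S vsl 0 0)) S1"
    then show "coloured (%i l. if ord i l < Suc x then mult Gs g i l else 0) S1"
    proof (rule coloured_cong)
      fix i' l' assume "i' < N"
      from eq[OF this, of l'] show "?w (?S vsl 0 0) i' l' = (if ord i' l' < Suc x then mult Gs g i' l' else 0)"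
        using w o(4) by (cases "i' = i & l' = l") (auto simp: less_Suc_eq)
    qed
  qed auto
  moreover have "(10 * (N * n) * dd i j k * dr.y Gs k g * 10 ^ H + (dr.Sx * dr.T g - Suc 0)) div (dr.Sx * dr.T g) = slots Gs g i j k"
    by (simp add: slots_def)
  ultimately show ?thesis
    unfolding colour_edge_def using v g x M
    by (simp add: k_def[symmetric] i_def[symmetric] j_def[symmetric] l_def[symmetric])
qed

lemma wp_colour_all:
  assumes dr: "drifted Gs S" and g: "S i1 0 0 = g" "g < H" and co: "coloured (%_ _. 0) S"
  shows "wp (Loop i2 vF colour_edge) (coloured (mult Gs g)) S"
proof (rule wp_Loop[where I = "%x. coloured (%i l. if ord i l < x then mult Gs g i l else 0)"])
  have vF: "S vF 0 0 = N * N * n" using dr by (simp add: drifted_def grid_ok_def inst_ok_def)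
  show "S vF 0 0 <= Lim" using vF lim_F by simp
  show "coloured (%i l. if ord i l < 0 then mult Gs g i l else 0) (upd S i2 0 0 0)" using co by (simp add: coloured_counter)
  fix x and S1 :: store
  assume x: "x < S vF 0 0" and inv: "coloured (%i l. if ord i l < x then mult Gs g i l else 0) S1" and v: "S1 i2 0 0 = x"
    and fr: "!!r. r ~= i2 ==> r ~: mods colour_edge ==> S1 r = S r"
  have dr1: "drifted Gs S1" by (rule drifted_frame[OF dr, of "insert i2 (mods colour_edge)"]) (use fr in auto)
  have "wp colour_edge (coloured (%i l. if ord i l < Suc x then mult Gs g i l else 0)) S1"
    using g x vF fr by (intro wp_colour_edge[OF dr1 _ g(2) v _ inv]) auto
  then show "wp colour_edge (%S'. coloured (%i l. if ord i l < Suc x then mult Gs g i l else 0) (upd S' i2 0 0 (Suc x))) S1"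
    by (rule wp_mono) (simp add: coloured_counter)
next
  fix S1 :: store
  assume a: "coloured (%i l. if ord i l < S vF 0 0 then mult Gs g i l else 0) S1"
  have vF: "S vF 0 0 = N * N * n" using dr by (simp add: drifted_def grid_ok_def inst_ok_def)
  from a show "coloured (mult Gs g) S1"
    by (rule coloured_cong) (use ord_less vF in \<open>auto simp: mult_def\<close>)
qed auto

text \<open>Every conflicting earlier period ends by the start of the current slot: periods of
  former intervals and slots do by time, and within a slot the edges form a matching.\<close>

lemma sending_emitted:
  assumes m: "m = 1" and se: "sending Gs g x S" and co: "coloured (mult Gs g) S" and g: "g < H" and x: "x < K * N"
    and ix: "c = x div N" "i = x mod N" "S aA i c = Suc l" "k = l div N" "j = l mod N"
    and am: "am = min (S aRem k (i * N + j)) (dr.T g)" "0 < am"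
    and S': "S' = upd (emitted S 0 i j k ((10 * K + c) * dr.T g) ((10 * K + c) * dr.T g + am)) aRem k (i * N + j) (S aRem k (i * N + j) - am)"
  shows "sending Gs g (Suc x) S'"
proof -
  let ?a = "(10 * K + c) * dr.T g" and ?b = "(10 * K + c) * dr.T g + am"
  let ?E = "emitted S 0 i j k ?a ?b"
  have pr: "col.proper (S aA) (S aR)" and bA: "!!i c. S aA i c <= n * N" and cl: "!!i l. i < N ==> col.colours (S aA) i l = mult Gs g i l"
    using co by (auto simp: coloured_def)
  have i: "i < N" using ix N_pos by simp
  have j: "j < N" using ix N_pos by simp
  have c: "c < K" using x unfolding ix by (simp add: less_mult_imp_div_less)
  have cx: "c * N + i = x" using slot_index[OF i] ix by simp
  have l: "l < n * N" using bA[of i c] ix by simp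
  have k: "k < n" using less_mult_imp_div_less[OF l] ix by simp
  have lkj: "k * N + j = l" using ix by simp
  have P: "psched X S" "kS S <= g * (K * N) + x" and R: "!!i j k. i < N ==> j < N ==> k < n ==>
      S aRem k (i * N + j) + snt S (i, j, k) = X * dd i j k &
      S aRem k (i * N + j) = X * dd i j k - (progress Gs g i j k + dn (S aA) x i (k * N + j) * dr.T g)"
    and ok: "!!q. q < kS S ==> old_ok Gs g S q \<or> cur_ok Gs g x S q"
    using se unfolding sending_def by blast+
  have rem: "0 < S aRem k (i * N + j)" "am <= S aRem k (i * N + j)" "am <= dr.T g" using am by auto
  have pg: "progress Gs g i j k < X * dd i j k" using R[OF i j k] rem(1) by linarith
  note pb = period_bounds[OF g c rem(3)]
  have "0 < slots Gs g i j k"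
  proof -
    have "{c. c < K & S aA i c = Suc l} ~= {}" using c ix by blast
    then have "0 < col.colours (S aA) i l" unfolding col.colours_def by (simp add: card_gt_0_iff)
    then show ?thesis using cl[OF i] l ix by (simp add: mult_def)
  qed
  then have rel: "X * rho k <= ?a" using slots_release[of Gs k g i j, OF best k g] by (simp add: add_mult_distrib)
  have disj: "bS S q <= ?a" if q: "q < kS S" and p: "S pI q 0 = i \<or> S pJ q 0 = j" for q
    using ok[OF q]
  proof
    assume "old_ok Gs g S q"
    then obtain g' where g': "g' < g" "bS S q <= 10 * K * dr.T (Suc g')" by (auto simp: old_ok_def)
    have "10 * K * dr.T (Suc g') <= (10 * K + c) * dr.T g" using g' g by (intro mult_le_mono T_mono) auto
    then show ?thesis using g' by simp
  next
    assume "cur_ok Gs g x S q"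
    then obtain c' where c': "c' < K" "c' * N + S pI q 0 < x" "S aA (S pI q 0) c' = Suc (S pK q 0 * N + S pJ q 0)"
      "bS S q <= (10 * K + Suc c') * dr.T g" by (auto simp: cur_ok_def)
    have pI: "S pI q 0 < N" "S pJ q 0 < N" using pschedD[OF P(1) q] by auto
    \<comment> \<open>Inputs vary fastest in the traversal, so otherwise the period would lie in the
      same slot at a smaller input. Sharing a port would then mean the same output, which a matching
      excludes.\<close>
    have "c' < c"
    proof (rule ccontr)
      assume "\<not> c' < c"
      then have cc: "c <= c'" by simp
      then have "c * N <= c' * N" by (rule mult_le_mono1)
      moreover have "c' * N + S pI q 0 < c * N + i" using c'(2) cx by simp
      ultimately have "S pI q 0 < i" by linarith
      have "c' = c"
      proof (rule ccontr)
        assume "c' ~= c"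
        then have "Suc c * N <= c' * N" using cc by (intro mult_le_mono1) simp
        then show False using \<open>c' * N + S pI q 0 < c * N + i\<close> i by simp
      qed
      have "S pJ q 0 = j" using p \<open>S pI q 0 < i\<close> by auto
      then have "S aR j c = Suc (S pI q 0)"
        using pr pI c'(1,3) \<open>c' = c\<close> unfolding col.proper_def by fastforce
      moreover have "S aR j c = Suc i" using pr i c ix unfolding col.proper_def by fastforce
      ultimately show False using \<open>S pI q 0 < i\<close> by simp
    qed
    then have "(10 * K + Suc c') * dr.T g <= (10 * K + c) * dr.T g" by (intro mult_le_mono1) simp
    then show ?thesis using c'(4) by simp
  qed
  have "psched X ?E"
  proof (rule psched_emitted[OF P(1)])
    show "0 < m" using m by simp
    show "?a < ?b" using am by simp
    show "cS S q = 0" if "q < kS S" for q using pschedD(1)[OF P(1) that] m by simp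
  qed (use i j k rel disj in auto)
  then have P': "psched X S'" unfolding S' psched_def by simp
  have k': "kS S' = Suc (kS S)" unfolding S' by (simp add: emitted_fields(1))
  have R': "S' aRem k' (i' * N + j') + snt S' (i', j', k') = X * dd i' j' k' &
      S' aRem k' (i' * N + j') = X * dd i' j' k' - (progress Gs g i' j' k' + dn (S' aA) (Suc x) i' (k' * N + j') * dr.T g)"
    if ij: "i' < N" "j' < N" "k' < n" for i' j' k'
  proof -
    have sn: "snt S' f = snt S f + (if f = (i, j, k) then am else 0)" for f
    proof -
      have "snt S' f = snt ?E f" unfolding S' snt_def by simp
      then show ?thesis by (simp add: snt_emitted)
    qed
    have aA': "S' aA = S aA" unfolding S' by simp
    have dnS: "dn (S' aA) (Suc x) i' (k' * N + j') = dn (S aA) x i' (k' * N + j') + of_bool (i' = i & Suc l = Suc (k' * N + j'))"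
      unfolding aA' dn_Suc[OF ij(1) x] using ix by auto
    show ?thesis
    proof (cases "i' = i & j' = j & k' = k")
      case True
      then have e: "i' = i" "j' = j" "k' = k" by simp_all
      have rm: "S' aRem k (i * N + j) = S aRem k (i * N + j) - am" unfolding S' by simp
      have d1: "dn (S' aA) (Suc x) i (k * N + j) = dn (S aA) x i (k * N + j) + 1" using dnS lkj e by simp
      define z where "z = progress Gs g i j k + dn (S aA) x i (k * N + j) * dr.T g"
      have Rz: "S aRem k (i * N + j) + snt S (i, j, k) = X * dd i j k" "S aRem k (i * N + j) = X * dd i j k - z"
        using R[OF i j k] by (simp_all add: z_def)
      have zz: "progress Gs g i j k + (dn (S aA) x i (k * N + j) + 1) * dr.T g = z + dr.T g" by (simp add: z_def)
      have rr: "S aRem k (i * N + j) - am = X * dd i j k - (z + dr.T g)" using Rz am(1) by linarith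
      have "S aRem k (i * N + j) - am + (snt S (i, j, k) + am) = X * dd i j k" using Rz(1) rem(2) by linarith
      then show ?thesis unfolding e rm d1 zz sn using rr by simp
    next
      case False
      have "i' * N + j' ~= i * N + j" if "k' = k"
      proof
        assume "i' * N + j' = i * N + j"
        then have "i' = i & j' = j" using ij(2) j slot_index[OF ij(2)] slot_index[OF j] by metis
        then show False using False that by simp
      qed
      then have rm: "S' aRem k' (i' * N + j') = S aRem k' (i' * N + j')" unfolding S' by auto
      have "\<not> (i' = i & Suc l = Suc (k' * N + j'))"
      proof
        assume a: "i' = i & Suc l = Suc (k' * N + j')"
        then have "k' * N + j' = k * N + j" using lkj by simp
        then have "k' = k & j' = j" using ij(2) j slot_index[OF ij(2)] slot_index[OF j] by metis
        then show False using False a by simp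
      qed
      then have "dn (S' aA) (Suc x) i' (k' * N + j') = dn (S aA) x i' (k' * N + j')" using dnS by simp
      moreover have "snt S' (i', j', k') = snt S (i', j', k')" using False unfolding sn by auto
      ultimately show ?thesis using R[OF ij] rm by simp
    qed
  qed
  have fl: "fS S' q = (if q = kS S then (i, j, k) else fS S q)" "bS S' q = (if q = kS S then ?b else bS S q)" "S' aA = S aA" for q
    unfolding S' by (simp_all add: emitted_fields[simplified])
  have "old_ok Gs g S' q \<or> cur_ok Gs g (Suc x) S' q" if q: "q < kS S'" for q
  proof (cases "q = kS S")
    case True
    have "S aA i c = Suc (k * N + j)" "c * N + i < Suc x" using lkj ix cx by simp_all
    then have "cur_ok Gs g (Suc x) S' q" unfolding cur_ok_def using fl(1,2)[of q] fl(3) True pg pb(1) c by auto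
    then show ?thesis ..
  next
    case False
    then have "q < kS S" using q k' by simp
    from ok[OF this] show ?thesis
    proof
      assume "old_ok Gs g S q"
      then have "old_ok Gs g S' q" unfolding old_ok_def using fl(1,2)[of q] False by simp
      then show ?thesis ..
    next
      assume "cur_ok Gs g x S q"
      then have "cur_ok Gs g (Suc x) S' q" unfolding cur_ok_def using fl(1,2)[of q] fl(3) False by (auto intro: less_SucI)
      then show ?thesis ..
    qed
  qed
  moreover have "kS S' <= g * (K * N) + Suc x" using P(2) k' by simp
  ultimately show ?thesis unfolding sending_def using P' R' by blast
qed

lemma sending_skip:
  assumes se: "sending Gs g x S" and x: "x < K * N" and bA: "!!i c. S aA i c <= n * N"
    and z: "!!l. S aA (x mod N) (x div N) = Suc l ==> S aRem (l div N) (x mod N * N + l mod N) = 0"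
  shows "sending Gs g (Suc x) S"
proof -
  have R: "S aRem k (i * N + j) = X * dd i j k - (progress Gs g i j k + dn (S aA) (Suc x) i (k * N + j) * dr.T g)"
    if ij: "i < N" "j < N" "k < n" for i j k
  proof -
    have R0: "S aRem k (i * N + j) = X * dd i j k - (progress Gs g i j k + dn (S aA) x i (k * N + j) * dr.T g)"
      using se ij by (simp add: sending_def)
    show ?thesis
    proof (cases "i = x mod N & S aA i (x div N) = Suc (k * N + j)")
      case True
      then have t: "i = x mod N" and u: "S aA i (x div N) = Suc (k * N + j)" by blast+
      have "S aRem k (i * N + j) = 0" using z[OF u[unfolded t]] ij(2) unfolding t by simp
      then show ?thesis using R0 dn_Suc[OF ij(1) x, of "S aA" "k * N + j"] True by (simp add: algebra_simps)
    next
      case False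
      have z0: "(of_bool (i = x mod N & S aA i (x div N) = Suc (k * N + j)) :: nat) = 0"
        unfolding of_bool_def if_not_P[OF False] ..
      show ?thesis using R0 unfolding dn_Suc[OF ij(1) x] z0 add_0_right .
    qed
  qed
  have "cur_ok Gs g (Suc x) S q" if "cur_ok Gs g x S q" for q using that unfolding cur_ok_def by (meson less_SucI)
  then show ?thesis using se R unfolding sending_def by (metis le_SucI add_Suc_right)
qed

lemma wp_use_slot:
  assumes m: "m = 1" and dr: "drifted Gs S" and g: "S i1 0 0 = g" "g < H" and x: "S i2 0 0 = x" "x < K * N"
    and se: "sending Gs g x S" and co: "coloured (mult Gs g) S"
  shows "wp use_slot (sending Gs g (Suc x)) S"
proof -
  define c i where "c = x div N" and "i = x mod N"
  have v: "S vN 0 0 = N" "S aT g 0 = dr.T g" "S vK 0 0 = K" using dr g by (auto simp: drifted_def grid_ok_def inst_ok_def params_def)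
  have bA: "!!i c. S aA i c <= n * N" using co by (simp add: coloured_def)
  have i: "i < N" unfolding i_def using N_pos by simp
  have c: "c < K" unfolding c_def using x by (simp add: less_mult_imp_div_less)
  have M: "i <= M" "c <= M" using i c nN_le_M limM(1) by linarith+
  show ?thesis
  proof (cases "S aA i c")
    case 0
    have "sending Gs g (Suc x) S" by (rule sending_skip[OF se x(2) bA]) (use 0 in \<open>simp add: c_def i_def\<close>)
    then have "sending Gs g (Suc x) (upd (upd S vcc 0 0 c) vi 0 0 i)" by (rule sending_cong) auto
    then show ?thesis unfolding use_slot_def using 0 v x M by (simp add: c_def[symmetric] i_def[symmetric])
  next
    case (Suc l)
    define k j where "k = l div N" and "j = l mod N"
    have l: "l < n * N" using bA[of i c] Suc by simp
    have k: "k < n" unfolding k_def using less_mult_imp_div_less[OF l] .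
    have j: "j < N" unfolding j_def using N_pos by simp
    have M2: "l <= M" "k <= M" "j <= M" using l k j nN_le_M lim_n Lim_le_M by linarith+
    let ?r = "S aRem k (i * N + j)"
    define am where "am = min ?r (dr.T g)"
    have rM: "?r <= M"
    proof -
      have "?r <= X * dd i j k" using se i j k unfolding sending_def by (metis diff_le_self)
      also have "... <= X * TL" using dd_le_TL[OF i j k] by (rule mult_le_mono2)
      also have "... <= M" using bd2 unfolding X_def by (simp only: mult.commute[of _ TL])
      finally show ?thesis .
    qed
    have TM: "dr.T g <= M" using bd_T(1) g by simp
    have kl: "kS S < Lim"
    proof -
      have "kS S < Suc g * (K * N)" using se x unfolding sending_def by simp
      also have "... <= H * (K * N)" using g by (intro mult_le_mono1) simp
      also have "... <= Lim" by (rule lim_HKN)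
      finally show ?thesis .
    qed
    let ?S1 = "upd (upd (upd (upd (upd S vcc 0 0 c) vi 0 0 i) vpl 0 0 l) vk2 0 0 k) vj 0 0 j"
    let ?S2 = "upd ?S1 vamt 0 0 ?r"
    let ?S3 = "if dr.T g < ?r then upd ?S2 vamt 0 0 (dr.T g) else ?S2"
    have core: "wp send_amount (sending Gs g (Suc x)) S3"
      if S3: "S3 vamt 0 0 = am" "S3 vi 0 0 = i" "S3 vj 0 0 = j" "S3 vk2 0 0 = k" "S3 vcc 0 0 = c"
        and fr: "!!r. r ~: {vcc, vi, vpl, vk2, vj, vamt} ==> S3 r = S r" for S3 :: store
    proof -
      have se3: "sending Gs g x S3" by (rule sending_cong[OF se]) (use fr in auto)
      have co3: "coloured (mult Gs g) S3" using co fr[of aA] fr[of aR] by (simp add: coloured_def)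
      have bA3: "S3 aA i c <= n * N" for i c using bA fr[of aA] by simp
      have A3: "S3 aA i c = Suc l" "S3 aRem = S aRem" "S3 vN 0 0 = N" "S3 vK 0 0 = K" "S3 aT g 0 = dr.T g" "S3 i1 0 0 = g" "kS S3 = kS S"
        using Suc v g by (simp_all add: fr)
      show ?thesis
      proof (cases "am = 0")
        case True
        then have "?r = 0" using dr.T_pos[of g] by (auto simp: am_def min_def split: if_splits)
        have "sending Gs g (Suc x) S3"
          by (rule sending_skip[OF se3 x(2) bA3]) (use A3 \<open>?r = 0\<close> in \<open>simp add: c_def[symmetric] i_def[symmetric] k_def j_def\<close>)
        then show ?thesis unfolding send_amount_def using True S3 by simp
      next
        case False
        have amT: "am <= dr.T g" by (simp add: am_def)
        note pb = period_bounds[OF g(2) c amT]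
        have fin: "sending Gs g (Suc x) (upd (emitted S3 0 i j k ((10 * K + c) * dr.T g) ((10 * K + c) * dr.T g + am)) aRem k (i * N + j) (S3 aRem k (i * N + j) - am))"
          by (rule sending_emitted[OF m se3 co3 g(2) x(2) c_def i_def A3(1) k_def j_def _ _ refl]) (use False A3 in \<open>simp_all add: am_def\<close>)
        show ?thesis unfolding send_amount_def wp_Test wp_Sq
          using False S3 by (simp del: wp_Put) (rule wp_emit, use S3 A3 M M2 pb kl rM fin in simp_all)
      qed
    qed
    have "wp send_amount (sending Gs g (Suc x)) ?S3"
      by (rule core) (auto simp: am_def min_def)
    then show ?thesis
      unfolding use_slot_def using Suc v x g M M2 rM TM
      by (cases "dr.T g < ?r") (simp_all add: c_def[symmetric] i_def[symmetric] k_def[symmetric] j_def[symmetric])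
  qed
qed

lemma wp_use_interval:
  assumes m: "m = 1" and dr: "drifted Gs S" and g: "S i1 0 0 = g" "g < H"
    and se: "sending Gs g 0 S" and bA: "!!i c. S aA i c <= n * N"
  shows "wp use_interval (%S'. sending Gs (Suc g) 0 S' & (ALL i c. S' aA i c <= n * N)) S"
  unfolding use_interval_def
proof (rule wp_seq[OF wp_clear_slots[OF dr bA]])
  fix S1 :: store
  assume co1: "coloured (%_ _. 0) S1" and f1: "!!r. r ~: mods clear_slots ==> S1 r = S r"
  have dr1: "drifted Gs S1" by (rule drifted_frame[OF dr, of "mods clear_slots"]) (use f1 in auto)
  have g1: "S1 i1 0 0 = g" using g f1 by simp
  show "wp (Loop i2 vF colour_edge ;; Loop i2 vKN use_slot) (%S'. sending Gs (Suc g) 0 S' & (ALL i c. S' aA i c <= n * N)) S1"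
  proof (rule wp_seq[OF wp_colour_all[OF dr1 g1 g(2) co1]])
    fix S2 :: store
    assume co2: "coloured (mult Gs g) S2" and f2: "!!r. r ~: mods (Loop i2 vF colour_edge) ==> S2 r = S1 r"
    have f2': "S2 r = S1 r" if "r ~: insert i2 (mods colour_edge)" for r using that by (intro f2) simp
    have dr2: "drifted Gs S2" by (rule drifted_frame[OF dr1, of "insert i2 (mods colour_edge)"]) (use f2' in auto)
    have se2: "sending Gs g 0 S2" by (rule sending_0_cong[OF se]) (use f1 f2' in auto)
    have v2: "S2 vKN 0 0 = K * N" using dr2 by (simp add: drifted_def)
    show "wp (Loop i2 vKN use_slot) (%S'. sending Gs (Suc g) 0 S' & (ALL i c. S' aA i c <= n * N)) S2"
    proof (rule wp_Loop[where I = "sending Gs g"])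
      show "S2 vKN 0 0 <= Lim" using v2 KN_le by simp
      show "sending Gs g 0 (upd S2 i2 0 0 0)" by (rule sending_cong[OF se2]) auto
      fix x and S3 :: store
      assume x: "x < S2 vKN 0 0" and inv: "sending Gs g x S3" and v3: "S3 i2 0 0 = x"
        and f3: "!!r. r ~= i2 ==> r ~: mods use_slot ==> S3 r = S2 r"
      have dr3: "drifted Gs S3" by (rule drifted_frame[OF dr2, of "insert i2 (mods use_slot)"]) (use f3 in auto)
      have g3: "S3 i1 0 0 = g" using g1 f2' f3 by simp
      have "S3 aA = S2 aA" "S3 aR = S2 aR" using f3 by simp_all
      then have co3: "coloured (mult Gs g) S3" using co2 by (simp add: coloured_def)
      have x': "x < K * N" using x v2 by simp
      have "wp use_slot (sending Gs g (Suc x)) S3"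
        by (rule wp_use_slot[OF m dr3 g3 g(2) v3 x' inv co3])
      then show "wp use_slot (%S'. sending Gs g (Suc x) (upd S' i2 0 0 (Suc x))) S3"
      proof (rule wp_mono)
        fix S' :: store
        assume "sending Gs g (Suc x) S'"
        then show "sending Gs g (Suc x) (upd S' i2 0 0 (Suc x))" by (rule sending_cong) auto
      qed
    next
      fix S3 :: store
      assume inv: "sending Gs g (S2 vKN 0 0) S3" and f3: "!!r. r ~= i2 ==> r ~: mods use_slot ==> S3 r = S2 r"
      have "S3 aA = S2 aA" "S3 aR = S2 aR" using f3 by simp_all
      then have co3: "coloured (mult Gs g) S3" using co2 by (simp add: coloured_def)
      have "sending Gs (Suc g) 0 S3" by (rule sending_next[OF _ co3 g(2)]) (use inv v2 in simp)
      then show "sending Gs (Suc g) 0 S3 & (ALL i c. S3 aA i c <= n * N)" using co3 by (simp add: coloured_def)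
    qed auto
  qed
qed

text \<open>A period of a flow lies in an interval below the finish index of its coflow, because
  from that index on enough time has been reserved. Its end is thus at most the finish time.\<close>

lemma sending_good:
  assumes m: "m = 1" and se: "sending Gs H 0 S"
  shows "good_schedule X 4 S"
proof -
  have fi: "dr.finish_index Gs k <= H" if "k < n" for k using dr.finish_index_le[of Gs k, OF best that] .
  have c0: "cur_ok Gs H 0 S q = False" for q by (simp add: cur_ok_def)
  have P: "psched X S" and R: "!!i j k. i < N ==> j < N ==> k < n ==>
      S aRem k (i * N + j) + snt S (i, j, k) = X * dd i j k &
      S aRem k (i * N + j) = X * dd i j k - progress Gs H i j k"
    and ok: "!!q. q < kS S ==> old_ok Gs H S q"
    using se unfolding sending_def dn_0 c0 mult_0 add_0_right by blast+
  have sn: "snt S (i, j, k) = X * dd i j k" if "i < N" "j < N" "k < n" for i j k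
    using R[OF that] progress_enough[of Gs k H i j, OF best that(3) fi[OF that(3)]] by simp
  have "EX U::nat => real. (ALL k<n. rho k <= U k) & (ALL q<kS S. bS S q <= X * U (S pK q 0)) &
      (\<Sum>k<n. W k * U k) <= 4 * (\<Sum>k<n. W k * C k)" if C: "lower_bounds C" for C :: "nat => real"
  proof -
    define U where "U k = (if loads.max_load {k} = 0 then real (rho k) else dr.\<tau> (dr.finish_index Gs k))" for k
    have "bS S q <= X * U (S pK q 0)" if q: "q < kS S" for q
    proof -
      let ?i = "S pI q 0" and ?j = "S pJ q 0" and ?k = "S pK q 0"
      have ijk: "?i < N" "?j < N" "?k < n" using pschedD[OF P q] by auto
      obtain g' where g': "g' < H" "bS S q <= 10 * K * dr.T (Suc g')" "progress Gs g' ?i ?j ?k < X * dd ?i ?j ?k"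
        using ok[OF q] by (auto simp: old_ok_def)
      have "g' < dr.finish_index Gs ?k"
      proof (rule ccontr)
        assume "\<not> ?thesis"
        then have "X * dd ?i ?j ?k <= progress Gs g' ?i ?j ?k" using ijk by (intro progress_enough[of Gs, OF best]) auto
        then show False using g'(3) by simp
      qed
      then have "dr.T (Suc g') <= dr.T (dr.finish_index Gs ?k)" using fi[OF ijk(3)] by (intro T_mono) auto
      then have "10 * K * dr.T (Suc g') <= 10 * K * dr.T (dr.finish_index Gs ?k)" by (rule mult_le_mono2)
      then have "bS S q <= 10 * K * dr.T (dr.finish_index Gs ?k)" using g'(2) by (rule order_trans[rotated])
      then have "real (bS S q) <= real (10 * K * dr.T (dr.finish_index Gs ?k))" by (simp only: of_nat_le_iff)
      also have "... = X * dr.\<tau> (dr.finish_index Gs ?k)" using fi[OF ijk(3)] by (simp add: dr.T_eq X_def)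
      \<comment> \<open>A flow that is actually transmitted has positive size, so its coflow has
        data and \<open>U\<close> is the finish time.\<close>
      also have "dr.\<tau> (dr.finish_index Gs ?k) = U ?k"
      proof -
        have "0 < dd ?i ?j ?k" using g'(3) by (cases "dd ?i ?j ?k") auto
        also have "... <= L ?i ?k" using ijk by (intro dd_le_L)
        also have "... <= loads.max_load {?k}" using loads.total_load_le_max[of ?i "{?k}"] ijk by (simp add: loads.total_load_def)
        finally show ?thesis by (simp add: U_def)
      qed
      finally show ?thesis .
    qed
    then show ?thesis
      using finish_bounds[of Gs C, OF best m C] unfolding U_def[symmetric] by (intro exI[of _ U]) blast
  qed
  then show ?thesis unfolding good_schedule_def using P sn by blast
qed

end

lemma mods_prepare_grid [simp]: "mods prepare_grid = {vNn, vK, i1, vbb, i2, aW, aB, vbm, vlen, vtmp, vG, vH, vP10, vP110, aT, vlam, vBc, vSx, vc1, vc2}"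
  by (auto simp: prepare_grid_def prepare_constants_def SumTo_def)

lemma X_bounds: "X <= M" "d <= TL ==> d * X <= M" "D * X <= M"
proof -
  show 1: "D * X <= M" using bd2 unfolding X_def by linarith
  have "1 * X <= D * X" using D_pos by (intro mult_le_mono1) simp
  then show "X <= M" unfolding mult_1 using 1 by (rule order_trans)
  assume "d <= TL"
  then have "d * X <= TL * X" by (rule mult_le_mono1)
  also have "... <= M" using bd2 unfolding X_def by linarith
  finally show "d * X <= M" .
qed

lemma wp_single_core:
  assumes m: "m = 1" and ok: "inst_ok S" and W0: "!!k. k < n ==> S aW k 0 = W k"
    and zero: "kS S = 0" "S aQ = (%_ _. 0)" "S aY = (%_ _. 0)" "S aA = (%_ _. 0)"
  shows "wp single_core (%S'. good_schedule X 4 S' & S' vDen 0 0 = D * X & kS S' <= Lim) S"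
  unfolding single_core_def
proof (rule wp_seq[OF wp_prepare_grid[OF ok W0]], assumption)
  let ?Q = "%S'. good_schedule X 4 S' & S' vDen 0 0 = D * X & kS S' <= Lim"
  let ?init = "Loop i1 vn (Loop i2 vNN (Put aRem (V i1) (V i2) (Arr aD (V i1) (V i2) .* V vX)))"
  fix S1 :: store
  assume ok1: "grid_ok S1" and f1: "!!r. r ~: mods prepare_grid ==> S1 r = S r"
  have z1: "S1 aQ = (%_ _. 0)" "S1 aY = (%_ _. 0)" using zero f1 by simp_all
  show "wp (run_drift ;; vKN :=: V vK .* V vN ;; vX :=: Cn 10 .* V vK .* V vP10 ;; ?init ;; Loop i1 vH use_interval ;; vDen :=: V vD .* V vX) ?Q S1"
  proof (rule wp_seq[OF wp_run_drift[OF ok1 z1]])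
    fix S2 :: store
    assume "EX Gs. (ALL s<dr.Sx. ALL k<n. dr.best (dr.queue Gs s) k (Gs s k)) & (ALL k<n. ALL g<H. S2 aY k g = dr.y Gs k g)"
      and f2: "!!r. r ~: mods run_drift ==> S2 r = S1 r"
    then obtain Gs where best: "!!s k. s < dr.Sx ==> k < n ==> dr.best (dr.queue Gs s) k (Gs s k)"
      and Y: "!!k g. k < n ==> g < H ==> S2 aY k g = dr.y Gs k g" by blast
    have ok2: "grid_ok S2" by (rule grid_ok_frame[OF ok1, of "mods run_drift"]) (use f2 in auto)
    let ?S = "upd (upd S2 vKN 0 0 (K * N)) vX 0 0 X"
    have dr: "drifted Gs ?S" unfolding drifted_def
    proof (intro conjI)
      show "grid_ok ?S" by (rule grid_ok_frame[OF ok2, of "{vKN, vX}"]) auto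
    qed (use Y in simp_all)
    have v: "S2 vK 0 0 = K" "S2 vN 0 0 = N" "S2 vP10 0 0 = 10 ^ H" "S2 vn 0 0 = n" "S2 vNN 0 0 = N * N"
      using ok2 by (auto simp: grid_ok_def inst_ok_def params_def)
    have aD: "S2 aD k e = dd (e div N) (e mod N) k" if "k < n" "e < N * N" for k e
    proof -
      have "S2 aD k (e div N * N + e mod N) = dd (e div N) (e mod N) k"
        using ok2 that div_mod_N[of e] unfolding grid_ok_def inst_ok_def by blast
      then show ?thesis by simp
    qed
    have ddX: "dd (e div N) (e mod N) k * X <= M" if "k < n" "e < N * N" for k e
      using that div_mod_N[of e] by (intro X_bounds(2) dd_le_TL)
    have "wp ?init (%S'. ALL k<?S vn 0 0. ALL e<?S vNN 0 0. S' aRem k e = dd (e div N) (e mod N) k * X) ?S"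
    proof (rule wp_fill)
      fix k e and S3 :: store
      let ?b = "Put aRem (V i1) (V i2) (Arr aD (V i1) (V i2) .* V vX)"
      assume "k < ?S vn 0 0" "e < ?S vNN 0 0" "S3 i1 0 0 = k" "S3 i2 0 0 = e"
        "!!r. r ~: insert i1 (insert i2 (mods ?b)) ==> S3 r = ?S r"
      then show "wp ?b (%S'. S' aRem k e = dd (e div N) (e mod N) k * X &
          (ALL k' e'. \<not> (k' = k & e' = e) --> S' aRem k' e' = S3 aRem k' e')) S3"
        using aD[of k e] ddX[of k e] v by auto
    qed (use v lim_n lim_NN in auto)
    then have "wp ?init (%S'. ALL k<n. ALL e<N*N. S' aRem k e = dd (e div N) (e mod N) k * X) ?S" by (simp add: v)
    then have "wp (?init ;; Loop i1 vH use_interval ;; vDen :=: V vD .* V vX) ?Q ?S"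
    proof (rule wp_seq)
      fix S3 :: store
      assume rem: "ALL k<n. ALL e<N*N. S3 aRem k e = dd (e div N) (e mod N) k * X"
        and f3: "!!r. r ~: mods ?init ==> S3 r = ?S r"
      have dr3: "drifted Gs S3" by (rule drifted_frame[OF dr, of "mods ?init"]) (use f3 in auto)
      have k3: "kS S3 = 0" "S3 aA = (%_ _. 0)" "S3 vX 0 0 = X" using zero f1 f2 f3 by simp_all
      have "S3 aRem k (i * N + j) = X * dd i j k" if "i < N" "j < N" "k < n" for i j k
      proof -
        have "Suc i * N <= N * N" using that by (intro mult_le_mono1) simp
        then have "i * N + j < N * N" using that by simp
        then show ?thesis using rem that by (simp add: mult.commute)
      qed
      then have se3: "sending Gs 0 0 S3"
        using k3 by (intro sending_start) (simp_all add: psched_def partial_schedule_0)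
      have vH: "S3 vH 0 0 = H" "S3 vD 0 0 = D" using dr3 by (auto simp: drifted_def grid_ok_def inst_ok_def)
      have "wp (Loop i1 vH use_interval) (sending Gs H 0) S3"
      proof (rule wp_Loop[where I = "%g S'. sending Gs g 0 S' & (ALL i c. S' aA i c <= n * N)"])
        show "S3 vH 0 0 <= Lim" using vH lim_Nn by simp
        show "sending Gs 0 0 (upd S3 i1 0 0 0) & (ALL i c. upd S3 i1 0 0 0 aA i c <= n * N)"
          using k3 by (auto intro: sending_cong[OF se3])
        fix g and S4 :: store
        assume g: "g < S3 vH 0 0" and inv: "sending Gs g 0 S4 & (ALL i c. S4 aA i c <= n * N)" and v4: "S4 i1 0 0 = g"
          and f4: "!!r. r ~= i1 ==> r ~: mods use_interval ==> S4 r = S3 r"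
        have dr4: "drifted Gs S4" by (rule drifted_frame[OF dr3, of "insert i1 (mods use_interval)"]) (use f4 in auto)
        have "wp use_interval (%S'. sending Gs (Suc g) 0 S' & (ALL i c. S' aA i c <= n * N)) S4"
          by (rule wp_use_interval[of Gs, OF best m dr4 v4]) (use inv g vH in auto)
        then show "wp use_interval (%S'. sending Gs (Suc g) 0 (upd S' i1 0 0 (Suc g)) & (ALL i c. upd S' i1 0 0 (Suc g) aA i c <= n * N)) S4"
        proof (rule wp_mono)
          fix S' :: store
          assume a: "sending Gs (Suc g) 0 S' & (ALL i c. S' aA i c <= n * N)"
          have "sending Gs (Suc g) 0 (upd S' i1 0 0 (Suc g))" by (rule sending_cong[of _ _ _ S']) (use a in auto)
          then show "sending Gs (Suc g) 0 (upd S' i1 0 0 (Suc g)) & (ALL i c. upd S' i1 0 0 (Suc g) aA i c <= n * N)"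
            using a by simp
        qed
      next
        fix S4 :: store
        assume "sending Gs (S3 vH 0 0) 0 S4 & (ALL i c. S4 aA i c <= n * N)"
        then show "sending Gs H 0 S4" using vH by simp
      qed auto
      then show "wp (Loop i1 vH use_interval ;; vDen :=: V vD .* V vX) ?Q S3"
      proof (rule wp_seq)
        fix S5 :: store
        assume se5: "sending Gs H 0 S5" and f5: "!!r. r ~: mods (Loop i1 vH use_interval) ==> S5 r = S3 r"
        have v5: "S5 vD 0 0 = D" "S5 vX 0 0 = X" using vH k3 f5 by simp_all
        have "sending Gs H 0 (upd S5 vDen 0 0 (D * X))" by (rule sending_cong[OF se5]) auto
        then have "good_schedule X 4 (upd S5 vDen 0 0 (D * X))" by (rule sending_good[of Gs, rotated 2]) (use best m in auto)
        moreover have "kS S5 <= Lim" using se5 lim_HKN unfolding sending_def by linarith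
        ultimately show "wp (vDen :=: V vD .* V vX) ?Q S5" using v5 X_bounds(3) by simp
      qed
    qed
    then show "wp (vKN :=: V vK .* V vN ;; vX :=: Cn 10 .* V vK .* V vP10 ;; ?init ;; Loop i1 vH use_interval ;; vDen :=: V vD .* V vX) ?Q S2"
      using v KN_le(2) X_bounds(1) by (simp add: X_def)
  qed
qed

end

section \<open>Input and output\<close>

abbreviation "vin == 326::nat"
abbreviation "vq == 327::nat"

text \<open>Written directly for the machine, since the array language has no input.
  \<open>vq\<close> counts the numbers read so far, \<open>vin\<close> is their total.\<close>

definition read_loop :: com where
  "read_loop = While (cex (V vin .- V vq))
     (Seq (Read (addr raw (cex (V vq)) (Const 0))) (Assign (scalar_addr vq) (cex (V vq .+ Cn 1))))"

definition read_cost :: nat where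
  "read_cost = fac (cex (V vin .- V vq)) + fac (addr raw (cex (V vq)) (Const 0)) + 1 + fac (scalar_addr vq) + fac (cex (V vq .+ Cn 1))"

lemma exec_read:
  assumes "bounded_store M S" "r < names" "wfe e" "v <= M"
  shows "EX t. exec (Read (addr r (cex e) (Const 0))) (enc S, v # inp, out) t (enc (upd S r (ev S e) 0 v), inp, out) &
    t <= (fac (addr r (cex e) (Const 0)) + 1) * bits M" "bounded_store M (upd S r (ev S e) 0 v)"
proof -
  let ?a = "addr r (cex e) (Const 0)"
  have "exec (Read ?a) (enc S, v # inp, out) (acost (enc S) ?a + bits (aval (enc S) ?a) + bits v)
      ((enc S)(aval (enc S) ?a := v), inp, out)" by (rule exec.Read)
  moreover have "(enc S)(aval (enc S) ?a := v) = enc (upd S r (ev S e) 0 v)"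
    using assms by (simp add: aval_addr aval_cex enc_upd)
  moreover have "acost (enc S) ?a + bits (aval (enc S) ?a) <= fac ?a * bits M"
    using assms by (intro acost_bits_le bounded_storeD)
  then have "acost (enc S) ?a + bits (aval (enc S) ?a) + bits v <= (fac ?a + 1) * bits M"
    using bits_mono[OF assms(4)] by simp
  ultimately show "EX t. exec (Read ?a) (enc S, v # inp, out) t (enc (upd S r (ev S e) 0 v), inp, out) &
    t <= (fac ?a + 1) * bits M" by metis
  show "bounded_store M (upd S r (ev S e) 0 v)" using assms by (simp add: bounded_store_upd)
qed

lemma exec_read_loop:
  assumes "bounded_store M S" "S vin 0 0 = S vq 0 0 + length xs" "!!v. v \<in> set xs ==> v <= M"
  shows "EX t S'. exec read_loop (enc S, xs @ rest, out) t (enc S', rest, out) & t <= (length xs + 1) * read_cost * bits M &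
    bounded_store M S' & (ALL q<length xs. S' raw (S vq 0 0 + q) 0 = xs ! q) &
    (ALL q<S vq 0 0. S' raw q 0 = S raw q 0) & (ALL r. r ~= raw --> r ~= vq --> S' r = S r)"
  using assms
proof (induction xs arbitrary: S)
  case Nil
  let ?c = "cex (V vin .- V vq)"
  have z: "aval (enc S) ?c = 0" using Nil by (subst aval_cex) (auto simp: names_def)
  define t0 where "t0 = acost (enc S) ?c + bits (aval (enc S) ?c)"
  have e: "exec read_loop (enc S, rest, out) t0 (enc S, rest, out)"
    unfolding read_loop_def t0_def by (rule exec.WhileFalse[OF z])
  have "t0 <= fac ?c * bits M" unfolding t0_def using Nil by (intro acost_bits_le bounded_storeD)
  also have "... <= read_cost * bits M" unfolding read_cost_def by (intro mult_le_mono1) simp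
  finally have "t0 <= read_cost * bits M" .
  then show ?case using e Nil by (intro exI[of _ t0] exI[of _ "S"]) auto
next
  case (Cons v xs)
  let ?c = "cex (V vin .- V vq)" and ?a = "addr raw (cex (V vq)) (Const 0)"
  let ?i = "S vq 0 0"
  let ?S1 = "upd S raw ?i 0 v"
  let ?S2 = "upd ?S1 vq 0 0 (Suc ?i)"
  have z: "aval (enc S) ?c ~= 0" using Cons.prems by (subst aval_cex) (auto simp: names_def)
  have w: "acost (enc S) ?c + bits (aval (enc S) ?c) <= fac ?c * bits M"
    using Cons.prems by (intro acost_bits_le bounded_storeD)
  have vM: "v <= M" using Cons.prems by simp
  have r: "EX t. exec (Read ?a) (enc S, v # xs @ rest, out) t (enc ?S1, xs @ rest, out) & t <= (fac ?a + 1) * bits M"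
    "bounded_store M ?S1"
    using exec_read[of M S raw "V vq" v, OF Cons.prems(1) _ _ vM] by (auto simp: names_def)
  then obtain t1 where t1: "exec (Read ?a) (enc S, v # xs @ rest, out) t1 (enc ?S1, xs @ rest, out)" "t1 <= (fac ?a + 1) * bits M" by blast
  have "Suc ?i <= S vin 0 0" using Cons.prems(2) by simp
  also have "... <= M" using Cons.prems(1) by (simp add: bounded_store_def)
  finally have iM: "Suc ?i <= M" .
  obtain t2 where t2: "exec (Assign (scalar_addr vq) (cex (V vq .+ Cn 1))) (enc ?S1, xs @ rest, out) t2 (enc ?S2, xs @ rest, out)"
      "t2 <= (fac (scalar_addr vq) + fac (cex (V vq .+ Cn 1))) * bits M" and b2: "bounded_store M ?S2"
    using exec_set[of M ?S1 vq "V vq .+ Cn 1" "xs @ rest" out] r(2) iM by (auto simp: names_def)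
  obtain t3 S' where t3: "exec read_loop (enc ?S2, xs @ rest, out) t3 (enc S', rest, out)" "t3 <= (length xs + 1) * read_cost * bits M"
    and S': "bounded_store M S'" "!!q. q < length xs ==> S' raw (Suc ?i + q) 0 = xs ! q"
      "!!q. q < Suc ?i ==> S' raw q 0 = ?S2 raw q 0" "!!r. r ~= raw ==> r ~= vq ==> S' r = ?S2 r"
    using Cons.IH[OF b2] Cons.prems by auto
  have "exec read_loop (enc S, (v # xs) @ rest, out) (acost (enc S) ?c + bits (aval (enc S) ?c) + (t1 + t2) + t3) (enc S', rest, out)"
    unfolding read_loop_def using t3(1) exec.Seq[OF t1(1) t2(1)] by (intro exec.WhileTrue[OF z]) (auto simp: read_loop_def)
  moreover have "acost (enc S) ?c + bits (aval (enc S) ?c) + (t1 + t2) + t3 <= (length (v # xs) + 1) * read_cost * bits M"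
  proof -
    have "acost (enc S) ?c + bits (aval (enc S) ?c) + (t1 + t2) <= read_cost * bits M"
      using w t1(2) t2(2) unfolding read_cost_def by (simp add: algebra_simps)
    then show ?thesis using t3(2) by (simp add: algebra_simps)
  qed
  moreover have "S' raw (?i + q) 0 = (v # xs) ! q" if "q < length (v # xs)" for q
    using S'(2)[of "q - 1"] S'(3)[of ?i] that by (cases q) auto
  moreover have "S' raw q 0 = S raw q 0" if "q < ?i" for q using S'(3)[of q] that by simp
  moreover have "S' r = S r" if "r ~= raw" "r ~= vq" for r using S'(4)[OF that] that by simp
  ultimately show ?case using S'(1) by blast
qed

section \<open>Output of the periods\<close>

primrec writes :: "ex list => com" where
  "writes [] = Skip"
| "writes (e # es) = Seq (Write (cex e)) (writes es)"

definition period_exprs :: "ex list" where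
  "period_exprs = [Ar1 pC (V vq), Ar1 pI (V vq), Ar1 pJ (V vq), Ar1 pK (V vq), Ar1 pA (V vq), V vDen, Ar1 pB (V vq), V vDen]"

lemma wfe_period_exprs: "e \<in> set period_exprs ==> wfe e"
  by (auto simp: period_exprs_def names_def)

definition write_loop :: com where
  "write_loop = While (cex (V cnt .- V vq)) (Seq (writes period_exprs) (Assign (scalar_addr vq) (cex (V vq .+ Cn 1))))"

definition write_cost :: nat where
  "write_cost = fac (cex (V cnt .- V vq)) + (1 + (\<Sum>e\<leftarrow>period_exprs. fac (cex e))) + fac (scalar_addr vq) + fac (cex (V vq .+ Cn 1))"

lemma exec_writes:
  assumes "bounded_store M S" "!!e. e \<in> set es ==> wfe e"
  shows "EX t. exec (writes es) (enc S, inp, out) t (enc S, inp, out @ map (ev S) es) & t <= (1 + (\<Sum>e\<leftarrow>es. fac (cex e))) * bits M"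
  using assms(2)
proof (induction es arbitrary: out)
  case Nil
  then show ?case using exec.Skip bits_pos[of M] by (auto intro!: exI[of _ 1])
next
  case (Cons e es)
  obtain t where t: "exec (writes es) (enc S, inp, out @ [ev S e]) t (enc S, inp, (out @ [ev S e]) @ map (ev S) es)"
      "t <= (1 + (\<Sum>e\<leftarrow>es. fac (cex e))) * bits M"
    using Cons.IH[of "out @ [ev S e]"] Cons.prems by auto
  have "exec (Write (cex e)) (enc S, inp, out) (acost (enc S) (cex e) + bits (aval (enc S) (cex e))) (enc S, inp, out @ [ev S e])"
    using exec.Write[of "cex e" "enc S" inp out] Cons.prems by (simp add: aval_cex)
  from exec.Seq[OF this t(1)]
  have "exec (writes (e # es)) (enc S, inp, out) (acost (enc S) (cex e) + bits (aval (enc S) (cex e)) + t) (enc S, inp, out @ map (ev S) (e # es))"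
    by simp
  moreover have "acost (enc S) (cex e) + bits (aval (enc S) (cex e)) <= fac (cex e) * bits M"
    using assms(1) by (intro acost_bits_le bounded_storeD)
  then have "acost (enc S) (cex e) + bits (aval (enc S) (cex e)) + t <= (1 + (\<Sum>e\<leftarrow>e # es. fac (cex e))) * bits M"
    using t(2) by (simp add: algebra_simps)
  ultimately show ?case by blast
qed

definition period_numbers :: "store => nat => nat list" where
  "period_numbers S q = (case fS S q of (i, j, k) => [cS S q, i, j, k, aS S q, S vDen 0 0, bS S q, S vDen 0 0])"

lemma exec_write_loop:
  assumes "bounded_store M S" "S vq 0 0 + d = kS S"
  shows "EX t s. exec write_loop (enc S, inp, out) t (s, inp, out @ concat (map (period_numbers S) [S vq 0 0..<kS S])) &
    t <= (d + 1) * write_cost * bits M"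
  using assms
proof (induction d arbitrary: S out)
  case 0
  let ?c = "cex (V cnt .- V vq)"
  have z: "aval (enc S) ?c = 0" using 0 by (subst aval_cex) (auto simp: names_def)
  define t0 where "t0 = acost (enc S) ?c + bits (aval (enc S) ?c)"
  have e: "exec write_loop (enc S, inp, out) t0 (enc S, inp, out)"
    unfolding write_loop_def t0_def by (rule exec.WhileFalse[OF z])
  have "t0 <= fac ?c * bits M" unfolding t0_def using 0 by (intro acost_bits_le bounded_storeD)
  also have "... <= write_cost * bits M" unfolding write_cost_def by (intro mult_le_mono1) simp
  finally have "t0 <= write_cost * bits M" .
  then show ?case using e 0 by (intro exI[of _ t0] exI[of _ "enc S"]) auto
next
  case (Suc d)
  let ?c = "cex (V cnt .- V vq)" and ?i = "S vq 0 0"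
  let ?S2 = "upd S vq 0 0 (Suc ?i)"
  have z: "aval (enc S) ?c ~= 0" using Suc.prems by (subst aval_cex) (auto simp: names_def)
  have w: "acost (enc S) ?c + bits (aval (enc S) ?c) <= fac ?c * bits M"
    using Suc.prems by (intro acost_bits_le bounded_storeD)
  have "map (ev S) period_exprs = period_numbers S ?i" by (simp add: period_exprs_def period_numbers_def)
  then obtain t1 where t1: "exec (writes period_exprs) (enc S, inp, out) t1 (enc S, inp, out @ period_numbers S ?i)"
      "t1 <= (1 + (\<Sum>e\<leftarrow>period_exprs. fac (cex e))) * bits M"
    using exec_writes[of M S period_exprs inp out, OF Suc.prems(1) wfe_period_exprs] by metis
  have "Suc ?i <= S cnt 0 0" using Suc.prems(2) by simp
  also have "... <= M" using Suc.prems(1) by (simp add: bounded_store_def)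
  finally have iM: "Suc ?i <= M" .
  obtain t2 where t2: "exec (Assign (scalar_addr vq) (cex (V vq .+ Cn 1))) (enc S, inp, out @ period_numbers S ?i) t2 (enc ?S2, inp, out @ period_numbers S ?i)"
      "t2 <= (fac (scalar_addr vq) + fac (cex (V vq .+ Cn 1))) * bits M" and b2: "bounded_store M ?S2"
    using exec_set[of M S vq "V vq .+ Cn 1" inp "out @ period_numbers S ?i"] Suc.prems(1) iM by (auto simp: names_def)
  have pn: "period_numbers ?S2 = period_numbers S" by (simp add: period_numbers_def fun_eq_iff)
  obtain t3 s where t3: "exec write_loop (enc ?S2, inp, out @ period_numbers S ?i) t3
      (s, inp, (out @ period_numbers S ?i) @ concat (map (period_numbers S) [Suc ?i..<kS S]))" "t3 <= (d + 1) * write_cost * bits M"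
    using Suc.IH[OF b2, of "out @ period_numbers S ?i"] Suc.prems(2) unfolding pn by auto
  have "[?i..<kS S] = ?i # [Suc ?i..<kS S]" using Suc.prems(2) by (intro upt_conv_Cons) simp
  then have "exec write_loop (enc S, inp, out) (acost (enc S) ?c + bits (aval (enc S) ?c) + (t1 + t2) + t3)
      (s, inp, out @ concat (map (period_numbers S) [?i..<kS S]))"
    unfolding write_loop_def using t3(1) exec.Seq[OF t1(1) t2(1)] by (intro exec.WhileTrue[OF z]) (auto simp: write_loop_def)
  moreover have "acost (enc S) ?c + bits (aval (enc S) ?c) + (t1 + t2) + t3 <= (Suc d + 1) * write_cost * bits M"
  proof -
    have "acost (enc S) ?c + bits (aval (enc S) ?c) + (t1 + t2) <= write_cost * bits M"
      using w t1(2) t2(2) unfolding write_cost_def by (simp add: algebra_simps)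
    then show ?thesis using t3(2) by (simp add: algebra_simps)
  qed
  ultimately show ?case by blast
qed

lemma power_mult_mono: "x <= B ^ a ==> y <= B ^ b ==> x * y <= B ^ (a + b)" for x y B :: nat
  unfolding power_add by (rule mult_le_mono)

lemma concat_nth_rows:
  assumes "!!x. x \<in> set xss ==> length x = r" "k < length xss" "e < r"
  shows "concat xss ! (k * r + e) = xss ! k ! e"
  using assms
proof (induction xss arbitrary: k)
  case (Cons x xss)
  then show ?case by (cases k) (auto simp: nth_append)
qed simp

lemma length_rows: "(!!x. x \<in> set xss ==> length x = r) ==> length (concat xss) = length xss * r"
  by (induction xss) auto

section \<open>Polynomial bounds\<close>

context inst
begin

abbreviation "sz == input_size I"
abbreviation "input_rows == concat (map (encode_coflow I) [0..<n])"
abbreviation "demands k == [demand I i j k. i \<leftarrow> [0..<N], j \<leftarrow> [0..<N]]"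

lemma encode_rats: "encode_rat (release I k) = [rn k, rd k]" "encode_rat (weight I k) = [wn k, wd k]"
  by (simp_all add: encode_rat_def rn_def rd_def wn_def wd_def split: prod.split)

lemma length_demands: "length (demands k) = N * N"
  by (subst length_rows[where r = N]) auto

lemma demands_nth: "e < N * N ==> demands k ! e = demand I (e div N) (e mod N) k"
proof -
  assume e: "e < N * N"
  have N: "0 < N" using N_pos by simp
  have d: "e div N < N" "e mod N < N" using e N by (auto simp: less_mult_imp_div_less)
  have "demands k ! (e div N * N + e mod N) = map (%i. map (%j. demand I i j k) [0..<N]) [0..<N] ! (e div N) ! (e mod N)"
    by (rule concat_nth_rows) (use d in auto)
  then show ?thesis using d by simp
qed

lemma length_coflow: "length (encode_coflow I k) = N * N + 4"
  unfolding encode_coflow_def length_append length_demands encode_rats by simp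

lemma rows_nth: "k < n ==> e < N * N + 4 ==> input_rows ! (k * (N * N + 4) + e) = encode_coflow I k ! e"
  by (subst concat_nth_rows[where r = "N * N + 4"]) (auto simp: length_coflow)

lemma length_rows_eq: "length input_rows = n * (N * N + 4)"
  by (subst length_rows[where r = "N * N + 4"]) (auto simp: length_coflow)

lemma coflow_nth:
  "e < N * N ==> encode_coflow I k ! e = demand I (e div N) (e mod N) k"
  "encode_coflow I k ! (N * N) = rn k" "encode_coflow I k ! (N * N + 1) = rd k"
  "encode_coflow I k ! (N * N + 2) = wn k" "encode_coflow I k ! (N * N + 3) = wd k"
  unfolding encode_coflow_def encode_rats
  by (simp_all add: nth_append length_demands demands_nth del: length_concat)

lemma entry_le: "v \<in> set (encode_instance I) ==> v < 2 ^ sz"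
proof -
  assume "v \<in> set (encode_instance I)"
  then have "bits v <= sz" unfolding input_size_def by (intro member_le_sum_list) auto
  then have "(2::nat) ^ bits v <= 2 ^ sz" by (intro power_increasing) auto
  then show ?thesis using less_two_power_bits[of v] by linarith
qed

lemma length_le_size: "length (encode_instance I) <= sz"
proof -
  have "length xs <= sum_list (map bits xs)" for xs
  proof (induction xs)
    case (Cons x xs)
    then show ?case using bits_pos[of x] by simp
  qed simp
  then show ?thesis by (simp add: input_size_def)
qed

lemma input_le: "n * (N * N + 4) + 3 <= sz"
  using length_le_size by (simp add: encode_instance_def length_rows_eq[simplified])

lemma small: "N * N * n <= sz" "N * N <= sz" "N <= sz" "n <= sz" "3 <= sz"
proof -
  show F: "N * N * n <= sz" using input_le by (simp add: algebra_simps)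
  have "N * N * 1 <= N * N * n" using coflows_pos by (rule mult_le_mono2)
  then show NN: "N * N <= sz" using F by linarith
  have "N * 1 <= N * N" using N_pos by (rule mult_le_mono2)
  then show "N <= sz" using NN by linarith
  have "n * 1 <= n * (N * N + 4)" by (rule mult_le_mono2) simp
  then show "n <= sz" using input_le by linarith
  show "3 <= sz" using input_le by linarith
qed

lemma row_mem: "k < n ==> e < N * N + 4 ==> encode_coflow I k ! e < 2 ^ sz"
proof (rule entry_le)
  assume k: "k < n" and e: "e < N * N + 4"
  then have "encode_coflow I k ! e \<in> set (encode_coflow I k)" by (intro nth_mem) (simp add: length_coflow)
  then show "encode_coflow I k ! e \<in> set (encode_instance I)" using k by (auto simp: encode_instance_def)
qed

lemma entries: "k < n ==> rn k < 2 ^ sz" "k < n ==> rd k < 2 ^ sz" "k < n ==> wn k < 2 ^ sz" "k < n ==> wd k < 2 ^ sz"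
  "i < N ==> j < N ==> k < n ==> demand I i j k < 2 ^ sz"
proof -
  show "k < n ==> rn k < 2 ^ sz" "k < n ==> rd k < 2 ^ sz" "k < n ==> wn k < 2 ^ sz" "k < n ==> wd k < 2 ^ sz"
    using row_mem[of k "N * N"] row_mem[of k "N * N + 1"] row_mem[of k "N * N + 2"] row_mem[of k "N * N + 3"]
    unfolding coflow_nth by simp_all
  assume ij: "i < N" "j < N" and k: "k < n"
  have "Suc i * N <= N * N" using ij by (intro mult_le_mono1) simp
  then have "i * N + j < N * N" using ij by simp
  then show "demand I i j k < 2 ^ sz" using row_mem[OF k, of "i * N + j"] coflow_nth(1)[of "i * N + j" k] ij by simp
qed

text \<open>At most \<open>sz\<close> factors with at most \<open>sz\<close> bits each.\<close>

lemma prod_le_power: "(!!k. k < n ==> f k < 2 ^ sz) ==> (\<Prod>k<n. f k) <= (2::nat) ^ (sz * sz)"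
proof -
  assume "!!k. k < n ==> f k < 2 ^ sz"
  then have "(\<Prod>k<n. f k) <= (\<Prod>k<n. 2 ^ sz)" by (intro prod_mono) (auto intro: less_imp_le)
  also have "... = 2 ^ (sz * n)" by (simp add: power_mult)
  also have "... <= 2 ^ (sz * sz)" using small(4) by (intro power_increasing mult_le_mono2) auto
  finally show ?thesis .
qed

definition "ez = sz * sz + 6 * sz + 6"
definition "hz = 16 * ez + 20"
definition "uz = hz + 9000"
definition "Lx = uz ^ 6"
definition "lx = Lx + ez + 7 * hz"
definition "Ax = (2::nat) ^ lx"
definition "Mx = Ax ^ (18 + sz)"

lemma le_Ax: "e <= lx ==> x <= 2 ^ e ==> x <= Ax" for x :: nat
  unfolding Ax_def by (rule order_trans[of _ "2 ^ e"]) (auto intro: power_increasing)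

lemma power_le_two_power: "b <= 2 ^ c ==> h <= d ==> b ^ h <= 2 ^ (c * d)" for b :: nat
proof -
  assume b: "b <= 2 ^ c" and h: "h <= d"
  have "b ^ h <= (2 ^ c) ^ h" using b by (intro power_mono) auto
  also have "... = 2 ^ (c * h)" by (simp add: power_mult)
  also have "... <= 2 ^ (c * d)" using h by (intro power_increasing mult_le_mono2) auto
  finally show ?thesis .
qed

lemma sz_power: "sz <= 2 ^ sz"
  using less_exp[of sz] by simp

lemma small_power: "N <= 2 ^ sz" "n <= 2 ^ sz"
  using small sz_power by (auto intro: order_trans)

lemma magnitudes:
  "D <= 2 ^ ez" "Dw <= 2 ^ ez" "k < n ==> rho k <= 2 ^ ez" "(\<Sum>k<n. W k) + n + 1 <= 2 ^ ez"
  "k < n ==> p < 2 * N ==> L p k <= 2 ^ ez" "(\<Sum>p<2*N. \<Sum>k<n. L p k) <= 2 ^ ez"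
proof -
  have D: "D <= 2 ^ (sz * sz)" unfolding D_def by (rule prod_le_power) (rule entries)
  have Dw: "Dw <= 2 ^ (sz * sz)" unfolding Dw_def by (rule prod_le_power) (rule entries)
  have le: "x <= 2 ^ ez" if "x <= 2 ^ e" "e <= ez" for x e :: nat
    using that by (rule order_trans[OF _ power_increasing]) simp
  show "D <= 2 ^ ez" "Dw <= 2 ^ ez" by (rule le[OF D] le[OF Dw], simp add: ez_def)+
  have scaled: "a * (P div b) <= 2 ^ (sz + sz * sz)" if "a < 2 ^ sz" "P <= 2 ^ (sz * sz)" for a b P :: nat
  proof -
    have "P div b <= 2 ^ (sz * sz)" using div_le_dividend[of P b] that(2) by linarith
    then have "a * (P div b) <= 2 ^ sz * 2 ^ (sz * sz)" using that(1) by (intro mult_le_mono) auto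
    then show ?thesis by (simp add: power_add)
  qed
  show "rho k <= 2 ^ ez" if "k < n"
    using scaled[OF entries(1)[OF that] D] unfolding rho_def by (rule le) (simp add: ez_def)
  have W: "W k <= 2 ^ (sz + sz * sz)" if "k < n" for k
    using scaled[OF entries(3)[OF that] Dw] unfolding W_def .
  have "(\<Sum>k<n. W k) <= n * 2 ^ (sz + sz * sz)" using sum_bounded_above[of "{..<n}" W] W by simp
  also have "... <= 2 ^ sz * 2 ^ (sz + sz * sz)" using small_power by (intro mult_le_mono1)
  also have "... = 2 ^ (sz + (sz + sz * sz))" by (simp only: power_add)
  finally have "(\<Sum>k<n. W k) <= 2 ^ (sz + (sz + sz * sz))" .
  moreover have "n <= 2 ^ (sz + (sz + sz * sz))"
    by (rule order_trans[OF small_power(2)]) (rule power_increasing, auto)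
  moreover have "1 <= (2::nat) ^ (sz + (sz + sz * sz))" by simp
  ultimately have "(\<Sum>k<n. W k) + n + 1 <= 4 * 2 ^ (sz + (sz + sz * sz))" by linarith
  also have "... = 2 ^ (2 + (sz + (sz + sz * sz)))" by (simp add: power_add)
  finally show "(\<Sum>k<n. W k) + n + 1 <= 2 ^ ez" by (rule le) (simp add: ez_def)
  have dd: "dd i j k <= 2 ^ (sz * sz + sz)" if "i < N" "j < N" "k < n" for i j k
    unfolding dd_def power_add using D entries(5)[OF that] by (intro mult_le_mono) auto
  have L: "L p k <= 2 ^ (sz + (sz * sz + sz))" if "k < n" "p < 2 * N" for p k
  proof -
    have "L p k <= N * 2 ^ (sz * sz + sz)"
    proof (cases "p < N")
      case True
      then have "L p k = (\<Sum>j<N. dd p j k)" by (simp add: L_def)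
      also have "... <= of_nat (card {..<N}) * 2 ^ (sz * sz + sz)" using dd True that by (intro sum_bounded_above) auto
      finally show ?thesis by simp
    next
      case False
      then have "L p k = (\<Sum>i<N. dd i (p - N) k)" by (simp add: L_def)
      also have "... <= of_nat (card {..<N}) * 2 ^ (sz * sz + sz)" using dd False that by (intro sum_bounded_above) auto
      finally show ?thesis by simp
    qed
    also have "... <= 2 ^ sz * 2 ^ (sz * sz + sz)" using small_power by (intro mult_le_mono1)
    finally show ?thesis by (simp only: power_add)
  qed
  show "L p k <= 2 ^ ez" if "k < n" "p < 2 * N" for k p using L[OF that] by (rule le) (simp add: ez_def)
  have "(\<Sum>k<n. L p k) <= of_nat (card {..<n}) * 2 ^ (sz + (sz * sz + sz))" if "p < 2 * N" for p
    using L that by (intro sum_bounded_above) auto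
  then have "(\<Sum>p<2*N. \<Sum>k<n. L p k) <= of_nat (card {..<2*N}) * (n * 2 ^ (sz + (sz * sz + sz)))"
    by (intro sum_bounded_above) auto
  also have "... = 2 * (N * (n * 2 ^ (sz + (sz * sz + sz))))" by simp
  also have "... <= 2 * (2 ^ sz * (2 ^ sz * 2 ^ (sz + (sz * sz + sz))))"
    using small_power by (intro mult_le_mono) auto
  also have "... = 2 ^ (1 + (sz + (sz + (sz + (sz * sz + sz)))))" by (simp only: power_add power_one_right)
  finally show "(\<Sum>p<2*N. \<Sum>k<n. L p k) <= 2 ^ ez" by (rule le) (simp add: ez_def)
qed

lemma Bm_le: "Bm <= 2 ^ ez"
proof -
  have "Bk k <= 2 ^ ez" if "k < n" for k
    using magnitudes(3)[OF that] magnitudes(5)[OF that]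
    by (simp add: Bk_def loads.max_load_le_iff loads.total_load_def)
  then show ?thesis unfolding Bm_def by (subst Max_le_iff) auto
qed

lemma H_le: "H <= hz"
proof -
  have "n <= 2 ^ ez"
  proof -
    have "n <= 2 ^ sz" by (rule small_power)
    also have "... <= (2::nat) ^ ez" by (intro power_increasing) (auto simp: ez_def)
    finally show ?thesis .
  qed
  then have "n * Bm <= 2 ^ ez * 2 ^ ez" using Bm_le by (rule mult_le_mono)
  also have "... < 2 ^ (2 * ez + 1)" by (simp add: power_add[symmetric] mult_2)
  finally have "floorlog 2 (n * Bm) <= 2 * ez + 1" by (simp add: floorlog_le_iff)
  then show ?thesis by (simp add: H_def hz_def)
qed

lemma small_uz: "sz <= uz" "N <= uz" "n <= uz" "H <= uz" "H + 1 <= uz" "2 * sz + 1 <= uz"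
  using small H_le by (simp_all add: uz_def hz_def ez_def)

lemma le_Lx: "c <= 6 ==> x <= uz ^ c ==> x <= Lx"
  unfolding Lx_def by (erule order_trans, rule power_increasing) (auto simp: uz_def)

lemma Lx_ge: "uz <= Lx" "1 <= Lx" "sz <= Lx"
  using le_Lx[of 1 uz] small_uz by (simp_all add: uz_def)

lemma limits:
  "n * (N * N + 4) <= Lx" "2 * N <= Lx" "N * N * n * (2 * (N * N * n) + 1) <= Lx" "H + 1 <= Lx" "dr.Sx <= Lx"
  "K <= Lx" "H * (K * N) <= Lx" "dr.Bc <= Lx"
proof -
  have one: "x <= uz ==> x <= uz ^ 1" for x by simp
  have c: "12 <= uz" "9000 <= uz" by (simp_all add: uz_def)
  note u = one[OF small_uz(2)] one[OF small_uz(3)] one[OF small_uz(4)] one[OF c(1)] one[OF c(2)]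
  show "n * (N * N + 4) <= Lx" using input_le Lx_ge(3) by linarith
  show "2 * N <= Lx" using small(3) small_uz(6) Lx_ge(1) by linarith
  show "H + 1 <= Lx" using small_uz(5) Lx_ge(1) by linarith
  have "N * N * n <= uz" "2 * (N * N * n) + 1 <= uz" using small(1) small_uz by linarith+
  then have "N * N * n * (2 * (N * N * n) + 1) <= uz ^ (1 + 1)" by (intro power_mult_mono one)
  then show "N * N * n * (2 * (N * N * n) + 1) <= Lx" by (rule le_Lx[rotated]) simp
  have "dr.Sx <= uz ^ (1 + 1 + 1 + 1 + 1 + 1)" unfolding dr.Sx_def by (intro power_mult_mono u)
  then show "dr.Sx <= Lx" by (rule le_Lx[rotated]) simp
  have "dr.Bc <= uz ^ (1 + 1 + 1 + 1)" unfolding dr.Bc_def by (intro power_mult_mono u)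
  then show "dr.Bc <= Lx" by (rule le_Lx[rotated]) simp
  have "K <= uz ^ (1 + (1 + 1))" unfolding K_def by (intro power_mult_mono u)
  then show "K <= Lx" by (rule le_Lx[rotated]) simp
  have "H * (K * N) <= uz ^ (1 + (1 + (1 + 1) + 1))" unfolding K_def by (intro power_mult_mono u)
  then show "H * (K * N) <= Lx" by (rule le_Lx[rotated]) simp
qed

lemma Lx_lx: "Lx <= lx" "ez <= lx" "7 * hz <= lx" "9000 <= lx"
  using Lx_ge(1) by (simp_all add: lx_def uz_def)

lemma sizes_Ax:
  "x <= Lx ==> x <= Ax" "x <= 2 ^ ez ==> x <= Ax" "10 ^ H <= Ax" "11 ^ H <= Ax" "110 ^ H <= Ax" "x <= 1000 ==> x <= Ax"
proof -
  have "Lx <= 2 ^ Lx" using less_exp[of Lx] by simp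
  then show "x <= Lx ==> x <= Ax" using Lx_lx(1) order_trans by (intro le_Ax[of Lx]) blast+
  show "x <= 2 ^ ez ==> x <= Ax" using Lx_lx(2) by (intro le_Ax[of ez])
  show "10 ^ H <= Ax" "11 ^ H <= Ax" "110 ^ H <= Ax"
    using power_le_two_power[of _ 7 H hz] H_le Lx_lx(3) by (intro le_Ax[of "7 * hz"]; simp)+
  have "(2::nat) ^ 10 <= Ax" unfolding Ax_def using Lx_lx(4) by (intro power_increasing) auto
  then show "x <= 1000 ==> x <= Ax" by simp
qed

lemma Ax_power: "c <= 18 + sz ==> x <= Ax ^ c ==> x <= Mx"
proof -
  assume "c <= 18 + sz" "x <= Ax ^ c"
  moreover have "1 <= Ax" by (simp add: Ax_def)
  ultimately show ?thesis unfolding Mx_def using power_increasing[of c "18 + sz" Ax] by linarith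
qed

lemma Ax_Suc: "x <= Ax ^ a ==> x + 1 <= Ax ^ (a + 1)"
proof -
  assume x: "x <= Ax ^ a"
  have "2 <= Ax" by (rule sizes_Ax(6)) simp
  then have "Ax ^ a * 2 <= Ax ^ (a + 1)" by simp
  moreover have "1 <= Ax ^ a" by (simp add: Ax_def)
  ultimately show ?thesis using x by linarith
qed

lemma lam_Ax: "dr.lam <= Ax ^ 4"
proof -
  have "(\<Sum>k<n. W2 k * Bk k) <= (\<Sum>k<n. W k * 2 ^ ez)"
  proof (rule sum_mono)
    fix k assume "k \<in> {..<n}"
    then have "Bk k <= 2 ^ ez" using Bk_le_Bm[of k] Bm_le by simp
    moreover have "W2 k <= W k" by (simp add: W2_def)
    ultimately show "W2 k * Bk k <= W k * 2 ^ ez" by (intro mult_le_mono)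
  qed
  also have "... = (\<Sum>k<n. W k) * 2 ^ ez" by (simp add: sum_distrib_right)
  also have "... <= Ax ^ 1 * Ax ^ 1" using magnitudes(4) sizes_Ax(2) by (intro mult_le_mono) (auto intro: sizes_Ax(2))
  finally have "(\<Sum>k<n. W2 k * Bk k) * 10 ^ H <= Ax ^ (1 + 1) * Ax ^ 1"
    unfolding power_add using sizes_Ax(3) by (intro mult_le_mono) auto
  then have "(\<Sum>k<n. W2 k * Bk k) * 10 ^ H <= Ax ^ 3" by (simp add: power3_eq_cube mult.assoc)
  from Ax_Suc[OF this] show ?thesis by (simp add: dr.lam_def)
qed

lemma big_bound:
  defines "tot == (\<Sum>p<2*N. \<Sum>k<n. L p k)"
  shows "40 * dr.Bc * 110 ^ H * 110 ^ H * ((\<Sum>k<n. W k) + 1) * 11 ^ H +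
       dr.lam * 10 ^ H * (H * (2 * N * (dr.Sx * 10 ^ H * tot * tot) * 110 ^ H * 110 ^ H) + 1) +
       dr.Sx * 10 ^ H * tot + tot * (10 * K * 10 ^ H) + 22 * K * 11 ^ H + D * (10 * K * 10 ^ H) + n * Bm <= Mx"
proof -
  have one: "x <= Ax ==> x <= Ax ^ 1" for x by simp
  have N: "2 * N <= Ax ^ 1" and Bc: "dr.Bc <= Ax ^ 1" and Sx: "dr.Sx <= Ax ^ 1" and K: "K <= Ax ^ 1" and H: "H <= Ax ^ 1"
    using limits sizes_Ax(1) by (intro one; simp)+
  have tot: "tot <= Ax ^ 1" and D: "D <= Ax ^ 1" and W: "(\<Sum>k<n. W k) + 1 <= Ax ^ 1" and Bm: "Bm <= Ax ^ 1"
    using magnitudes(1,4,6) Bm_le unfolding tot_def by (intro one sizes_Ax(2); linarith)+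
  have n: "n <= Ax ^ 1" using small(4) Lx_ge(3) by (intro one sizes_Ax(1)) linarith
  have c40: "40 <= Ax ^ 1" and c10: "10 <= Ax ^ 1" and c22: "22 <= Ax ^ 1" by (intro one sizes_Ax(6); simp)+
  note P = one[OF sizes_Ax(3)] one[OF sizes_Ax(4)] one[OF sizes_Ax(5)]
  note M = power_mult_mono
  have t1: "40 * dr.Bc * 110 ^ H * 110 ^ H * ((\<Sum>k<n. W k) + 1) * 11 ^ H <= Ax ^ (1 + 1 + 1 + 1 + 1 + 1)"
    by (intro M c40 Bc P W)
  have t2: "dr.lam * 10 ^ H * (H * (2 * N * (dr.Sx * 10 ^ H * tot * tot) * 110 ^ H * 110 ^ H) + 1)
      <= Ax ^ (4 + 1 + (1 + (1 + (1 + 1 + 1 + 1) + 1 + 1) + 1))"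
    by (intro M lam_Ax P Ax_Suc H N Sx tot)
  have t3: "dr.Sx * 10 ^ H * tot <= Ax ^ (1 + 1 + 1)" by (intro M Sx P tot)
  have t4: "tot * (10 * K * 10 ^ H) <= Ax ^ (1 + (1 + 1 + 1))" by (intro M c10 K P tot)
  have t5: "22 * K * 11 ^ H <= Ax ^ (1 + 1 + 1)" by (intro M c22 K P)
  have t6: "D * (10 * K * 10 ^ H) <= Ax ^ (1 + (1 + 1 + 1))" by (intro M c10 K P D)
  have t7: "n * Bm <= Ax ^ (1 + 1)" by (intro M n Bm)
  have up: "x <= Ax ^ 16" if "x <= Ax ^ c" "c <= 16" for x c
    using that power_increasing[of c 16 Ax] by (simp add: Ax_def)
  note u = up[OF t1] up[OF t2] up[OF t3] up[OF t4] up[OF t5] up[OF t6] up[OF t7]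
  have "40 * dr.Bc * 110 ^ H * 110 ^ H * ((\<Sum>k<n. W k) + 1) * 11 ^ H +
       dr.lam * 10 ^ H * (H * (2 * N * (dr.Sx * 10 ^ H * tot * tot) * 110 ^ H * 110 ^ H) + 1) +
       dr.Sx * 10 ^ H * tot + tot * (10 * K * 10 ^ H) + 22 * K * 11 ^ H + D * (10 * K * 10 ^ H) + n * Bm
     <= Ax ^ 16 + Ax ^ 16 + Ax ^ 16 + Ax ^ 16 + Ax ^ 16 + Ax ^ 16 + Ax ^ 16"
    by (intro add_mono u) auto
  also have "... = 7 * Ax ^ 16" by simp
  also have "... <= Ax ^ (1 + 16)" by (intro M one sizes_Ax(6)) auto
  finally show ?thesis by (rule Ax_power[rotated]) simp
qed

lemma one_plus_total: "1 + (\<Sum>p<2*N. \<Sum>k<n. L p k) <= Ax"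
proof (rule le_Ax)
  show "ez + 1 <= lx" using Lx_ge(2) by (simp add: lx_def)
  have "1 <= (2::nat) ^ ez" by simp
  then have "1 + (\<Sum>p<2*N. \<Sum>k<n. L p k) <= 2 * 2 ^ ez" using magnitudes(6) by linarith
  then show "1 + (\<Sum>p<2*N. \<Sum>k<n. L p k) <= 2 ^ (ez + 1)" by simp
qed

lemma Ax_le_Mx: "x <= Ax ==> x <= Mx"
  by (rule Ax_power[of 1]) auto

lemma alg_holds: "alg I Mx Lx"
proof unfold_locales
  show "Lx <= Mx" by (intro Ax_le_Mx sizes_Ax(1)) simp
  show "1 <= Lx" by (rule Lx_ge)
  show "n * (N * N + 4) <= Lx" "2 * N <= Lx" by (rule limits)+
  show "D <= Mx" "Dw <= Mx" by (intro Ax_le_Mx sizes_Ax(2) magnitudes)+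
  let ?tot = "\<Sum>p<2*N. \<Sum>k<n. L p k"
  show "rho k + 4 * ?tot <= Mx" if "k < n" for k
  proof -
    have r: "rho k <= Ax" "?tot <= Ax" using magnitudes(3)[OF that] magnitudes(6) by (auto intro: sizes_Ax(2))
    have "5 * Ax <= Ax * Ax" by (intro mult_le_mono1 sizes_Ax(6)) simp
    then have "rho k + 4 * ?tot <= Ax * Ax" using r by linarith
    then have "rho k + 4 * ?tot <= Ax ^ 2" unfolding power2_eq_square .
    then show ?thesis by (rule Ax_power[rotated]) simp
  qed
  have "(\<Sum>k<n. W k + 1) = (\<Sum>k<n. W k) + n" by (simp only: sum.distrib) simp
  also have "... <= Ax" using magnitudes(4) by (intro sizes_Ax(2)) linarith
  finally have w: "(\<Sum>k<n. W k + 1) <= Ax ^ 1" by simp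
  have "(1 + ?tot) ^ n <= Ax ^ n" using one_plus_total by (intro power_mono) auto
  then have "(\<Sum>k<n. W k + 1) * (1 + ?tot) ^ n <= Ax ^ (1 + n)" by (rule power_mult_mono[OF w])
  then show "(\<Sum>k<n. W k + 1) * (1 + ?tot) ^ n <= Mx" using small(4) by (intro Ax_power[of "1 + n"]) auto
qed

lemma alg2_holds: "alg2 I Mx Lx"
proof -
  interpret alg I Mx Lx by (rule alg_holds)
  show ?thesis
  proof unfold_locales
    show "N * N * n * (2 * (N * N * n) + 1) <= Lx" "H + 1 <= Lx" "dr.Sx <= Lx"
      "K <= Lx" "H * (K * N) <= Lx" by (rule limits)+
    show "40 * dr.Bc * 110 ^ H * 110 ^ H * ((\<Sum>k<n. W k) + 1) * 11 ^ H +
       dr.lam * 10 ^ H * (H * (2 * N * (dr.Sx * 10 ^ H * TL * TL) * 110 ^ H * 110 ^ H) + 1) +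
       dr.Sx * 10 ^ H * TL + TL * (10 * K * 10 ^ H) + 22 * K * 11 ^ H + D * (10 * K * 10 ^ H) + n * Bm <= Mx"
      unfolding TL_def by (rule big_bound)
  qed
qed

end

section \<open>The algorithm\<close>

definition prologue :: pr where
  "prologue = vNN :=: V vN .* V vN ;; vRow :=: V vNN .+ Cn 4 ;; vin :=: V vn .* V vRow"

definition main_part :: pr where
  "main_part = setup_scale ;; setup_copy ;; setup_loads ;; Test (V vm .- Cn 1) list_scheduling single_core ;; vq :=: Cn 0"

definition algorithm_body :: com where
  "algorithm_body = Seq (comp prologue) (Seq read_loop (Seq (comp main_part) write_loop))"

text \<open>The three header numbers are read first. Without coflows nothing more is read, and the
  empty output already is a schedule.\<close>

definition algorithm :: com where
  "algorithm = Seq (Read (scalar_addr vm)) (Seq (Read (scalar_addr vN)) (Seq (Read (scalar_addr vn))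
     (Cond (cex (V vn)) algorithm_body Skip)))"

lemma wfp_main_part: "wfp main_part"
  unfolding main_part_def setup_scale_def setup_copy_def setup_loads_def list_scheduling_def single_core_def
    compute_order_def place_all_def place_flow_def prepare_grid_def prepare_bounds_def coflow_bound_def prepare_powers_def prepare_times_def
    prepare_constants_def run_drift_def choose_points_def choose_point_def count_points_def update_queues_def
    use_interval_def clear_slots_def compare_point_def largest_load_def record_bound_def send_amount_def colour_edge_def insert_edge_def chain_move_def use_slot_def
    choose_core_def place_step_def scan_def scan_step_def select_port_def select_coflow_def select_coflow_step_def reduce_weights_def
  by (simp add: names_def)

context alg2
begin

lemma good_schedule_mono:
  assumes "good_schedule Y \<rho> S" "\<rho> <= \<rho>'"
  shows "good_schedule Y \<rho>' S"
proof -
  have "\<rho> * (\<Sum>k<n. W k * C k) <= \<rho>' * (\<Sum>k<n. W k * C k)" if C: "lower_bounds C" for C :: "nat => real"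
  proof -
    have "0 <= C k" if "k < n" for k
    proof -
      have "real (rho k + dd 0 0 k) <= C k" using C that N_pos unfolding lower_bounds_def by simp
      then show ?thesis by (rule order_trans[rotated]) simp
    qed
    then have "0 <= (\<Sum>k<n. W k * C k)" by (intro sum_nonneg mult_nonneg_nonneg) auto
    then show ?thesis using assms(2) by (intro mult_right_mono)
  qed
  then show ?thesis using assms(1) unfolding good_schedule_def by (meson order_trans)
qed

text \<open>For one core \<open>6 - 2 / m\<close> equals 4, the ratio of \<open>single_core\<close>;
  for at least two cores it is at least 5, the ratio of \<open>list_scheduling\<close>.\<close>

lemma wp_main_part:
  assumes par: "params S" and raw: "raw_ok S" and zero: "!!r. r ~: {vm, vN, vn, vNN, vRow, vin, raw, vq} ==> S r = (%_ _. 0)"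
  shows "wp main_part (%S'. EX Y>0. good_schedule Y (6 - 2 / real m) S' & S' vDen 0 0 = D * Y & kS S' <= Lim & S' vq 0 0 = 0) S"
  unfolding main_part_def
proof (rule wp_seq[OF wp_setup_scale[OF par raw]])
  let ?Q = "%S'. EX Y>0. good_schedule Y (6 - 2 / real m) S' & S' vDen 0 0 = D * Y & kS S' <= Lim & S' vq 0 0 = 0"
  fix S1 :: store
  assume a1: "S1 vD 0 0 = D & S1 vDw 0 0 = Dw" and f1: "!!r. r ~: mods setup_scale ==> S1 r = S r"
  have f1': "S1 r = S r" if "r ~: {vD, vDw, i1}" for r using that by (intro f1) (auto simp: setup_scale_def)
  have par1: "params S1" "raw_ok S1" using par raw by (simp_all add: params_def raw_ok_def f1')
  show "wp (setup_copy ;; setup_loads ;; Test (V vm .- Cn 1) list_scheduling single_core ;; vq :=: Cn 0) ?Q S1"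
  proof (rule wp_seq[OF wp_setup_copy[OF par1]])
    show "S1 vD 0 0 = D" "S1 vDw 0 0 = Dw" using a1 by auto
    fix S2 :: store
    assume a2: "ALL k<n. S2 aRho k 0 = rho k & S2 aW k 0 = W k & (ALL e<N*N. S2 aD k e = dd (e div N) (e mod N) k)"
      and f2: "!!r. r ~: mods setup_copy ==> S2 r = S1 r"
    have f2': "S2 r = S1 r" if "r ~: {aRho, aW, aD, i1, i2}" for r using that by (intro f2) (auto simp: setup_copy_def)
    have par2: "params S2" "S2 vD 0 0 = D" using par1 a1 by (simp_all add: params_def f2')
    show "wp (setup_loads ;; Test (V vm .- Cn 1) list_scheduling single_core ;; vq :=: Cn 0) ?Q S2"
    proof (rule wp_seq[OF wp_setup_loads[OF par2]])
      show "S2 aRho k 0 = rho k & (ALL e<N*N. S2 aD k e = dd (e div N) (e mod N) k)" if "k < n" for k using a2 that by blast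
      fix S3 :: store
      assume ok: "inst_ok S3" and f3: "!!r. r ~: mods setup_loads ==> S3 r = S2 r"
      have f3': "S3 r = S2 r" if "r ~: {v2N, vF, aL, t1, i1, i2, i3}" for r using that by (intro f3) (auto simp: setup_loads_def)
      have W3: "S3 aW k 0 = W k" if "k < n" for k using a2 that by (simp add: f3')
      have z3: "S3 r = (%_ _. 0)" if "r \<in> {cnt, aLd, aX, aQ, aY, aA}" for r
        using that zero[of r] by (auto simp: f3' f2' f1')
      have z: "S3 cnt = (%_ _. 0)" "S3 aLd = (%_ _. 0)" "S3 aX = (%_ _. 0)" "S3 aQ = (%_ _. 0)" "S3 aY = (%_ _. 0)" "S3 aA = (%_ _. 0)"
        by (rule z3, simp)+
      have vm3: "S3 vm 0 0 = m" using ok by (simp add: inst_ok_def params_def)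
      let ?R = "%S'. EX Y>0. good_schedule Y (6 - 2 / real m) S' & S' vDen 0 0 = D * Y & kS S' <= Lim"
      have "wp (Test (V vm .- Cn 1) list_scheduling single_core) ?R S3"
      proof (cases "m = 1")
        case True
        have "wp single_core (%S'. good_schedule X 4 S' & S' vDen 0 0 = D * X & kS S' <= Lim) S3"
          by (rule wp_single_core[OF True ok W3]) (use z in simp_all)
        then have "wp single_core ?R S3"
        proof (rule wp_mono)
          fix S' :: store
          assume "good_schedule X 4 S' & S' vDen 0 0 = D * X & kS S' <= Lim"
          moreover have "0 < X" using N_pos coflows_pos by (simp add: X_def K_def)
          ultimately show "?R S'" using True by (intro exI[of _ X]) simp
        qed
        then show ?thesis using True vm3 by simp
      next
        case False
        then have m2: "2 <= m" using m_pos by simp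
        have "wp list_scheduling (%S'. good_schedule 1 5 S' & S' vDen 0 0 = D * 1 & kS S' <= Lim) S3"
          by (rule wp_list_scheduling[OF ok W3]) (use z in simp_all)
        then have "wp list_scheduling ?R S3"
        proof (rule wp_mono)
          fix S' :: store
          assume a: "good_schedule 1 5 S' & S' vDen 0 0 = D * 1 & kS S' <= Lim"
          have "5 <= 6 - 2 / real m" using m2 by (simp add: field_simps)
          then have "good_schedule 1 (6 - 2 / real m) S'" using a good_schedule_mono by blast
          then show "?R S'" using a by (intro exI[of _ 1]) simp
        qed
        moreover have "m - 1 ~= 0" using m2 by simp
        ultimately show ?thesis using vm3 by simp
      qed
      then show "wp (Test (V vm .- Cn 1) list_scheduling single_core ;; vq :=: Cn 0) ?Q S3"
      proof (rule wp_seq)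
        fix S4 :: store
        assume "?R S4"
        then have "?Q (upd S4 vq 0 0 0)" by (auto simp: good_schedule_def psched_def snt_def)
        then show "wp (vq :=: Cn 0) ?Q S4" by simp
      qed
    qed
  qed
qed

lemma exec_main_part:
  assumes bS: "bounded_store M S" and par: "params S" and raw: "raw_ok S"
    and zero: "!!r. r ~: {vm, vN, vn, vNN, vRow, vin, raw, vq} ==> S r = (%_ _. 0)"
  shows "EX t s out. exec (Seq (comp main_part) write_loop) (enc S, [], []) t (s, [], out) &
     t <= (poly (time_poly main_part) Lim + (Lim + 1) * write_cost) * bits M &
     feasible I (schedule_of (decode_periods out)) &
     objective I (schedule_of (decode_periods out)) <= (6 - 2 / real m) * optimum I"
proof -
  define S' where "S' = sem main_part S"
  have w: "safe main_part S" "EX Y>0. good_schedule Y (6 - 2 / real m) S' & S' vDen 0 0 = D * Y & kS S' <= Lim & S' vq 0 0 = 0"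
    using wp_main_part[OF par raw zero] unfolding wp_def S'_def by blast+
  obtain t1 where t1: "exec (comp main_part) (enc S, [], []) t1 (enc S', [], [])" "t1 <= poly (time_poly main_part) Lim * bits M"
    and b: "bounded_store M S'"
    using comp_exec[OF wfp_main_part w(1) bS] unfolding S'_def by blast
  obtain Y where Y: "0 < Y" "good_schedule Y (6 - 2 / real m) S'" "S' vDen 0 0 = D * Y" "kS S' <= Lim" "S' vq 0 0 = 0"
    using w(2) by blast
  let ?out = "concat (map (period_numbers S') [0..<kS S'])"
  obtain t2 s where t2: "exec write_loop (enc S', [], []) t2 (s, [], ?out)" "t2 <= (kS S' + 1) * write_cost * bits M"
    using exec_write_loop[OF b, of "kS S'" "[]" "[]"] Y(5) by auto
  have "exec (Seq (comp main_part) write_loop) (enc S, [], []) (t1 + t2) (s, [], ?out)"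
    by (rule exec.Seq[OF t1(1) t2(1)])
  moreover have "t1 + t2 <= (poly (time_poly main_part) Lim + (Lim + 1) * write_cost) * bits M"
  proof -
    have le: "(kS S' + 1) * write_cost * bits M <= (Lim + 1) * write_cost * bits M" using Y(4) by (intro mult_le_mono1) simp
    show ?thesis unfolding distrib_right[of "poly _ _"] by (rule add_mono[OF t1(2) order_trans[OF t2(2) le]])
  qed
  moreover define x where "x = schedule_of (decode_periods ?out)"
  have "x = schedule_of (map (%q. (cS S' q, fS S' q, real (aS S' q) / real (D * Y), real (bS S' q) / real (D * Y))) [0..<kS S'])"
    unfolding x_def period_numbers_def Y(3) decode_periods_map ..
  moreover have ps: "partial_schedule Y (kS S') (cS S') (fS S') (aS S') (bS S')"
    "!!i j k. i < N ==> j < N ==> k < n ==> sent (kS S') (fS S') (aS S') (bS S') (i, j, k) = Y * dd i j k"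
    "!!C::nat => real. lower_bounds C ==> EX U::nat => real. (ALL k<n. rho k <= U k) &
        (ALL q<kS S'. bS S' q <= Y * U (coflow_of (fS S' q))) & (\<Sum>k<n. W k * U k) <= (6 - 2 / real m) * (\<Sum>k<n. W k * C k)"
    using Y(2) unfolding good_schedule_def psched_def snt_def by simp_all
  moreover have "0 <= 6 - 2 / real m" using m_pos by (simp add: field_simps)
  ultimately have "feasible I x" "objective I x <= (6 - 2 / real m) * optimum I"
    using complete_schedule[OF Y(1) ps] by simp_all
  then show ?thesis
    using \<open>exec (Seq (comp main_part) write_loop) (enc S, [], []) (t1 + t2) (s, [], ?out)\<close>
      \<open>t1 + t2 <= (poly (time_poly main_part) Lim + (Lim + 1) * write_cost) * bits M\<close> unfolding x_def by blast
qed

end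

lemma exec_scalar_read:
  assumes "bounded_store M S" "r < names" "v <= M"
  shows "EX t. exec (Read (scalar_addr r)) (enc S, v # inp, out) t (enc (upd S r 0 0 v), inp, out) &
    t <= (fac (scalar_addr r) + 1) * bits M" "bounded_store M (upd S r 0 0 v)"
  using exec_read(1)[of M S r "Cn 0" v inp out] exec_read(2)[of M S r "Cn 0" v] assms by simp_all

definition head_cost :: nat where
  "head_cost = (fac (scalar_addr vm) + 1) + (fac (scalar_addr vN) + 1) + (fac (scalar_addr vn) + 1) + fac (cex (V vn)) + 1"

lemma exec_head:
  assumes M: "a <= M" "b <= M" "c <= M"
  defines "S == upd (upd (upd (%_ _ _. 0) vm 0 0 a) vN 0 0 b) vn 0 0 c"
  assumes rest: "exec (if c ~= 0 then algorithm_body else Skip)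
     (enc S, inp, []) t \<tau>"
  shows "EX t'. exec algorithm (%_. 0, a # b # c # inp, []) t' \<tau> & t' <= head_cost * bits M + t" "bounded_store M S"
proof -
  let ?S0 = "%_ _ _. 0::nat"
  have b0: "bounded_store M ?S0" by (simp add: bounded_store_def)
  have b1: "bounded_store M (upd ?S0 vm 0 0 a)" using b0 M(1) by (rule bounded_store_upd)
  have b2: "bounded_store M (upd (upd ?S0 vm 0 0 a) vN 0 0 b)" using b1 M(2) by (rule bounded_store_upd)
  show bS: "bounded_store M S" unfolding S_def using b2 M(3) by (rule bounded_store_upd)
  obtain u1 where u1: "exec (Read (scalar_addr vm)) (%_. 0, a # b # c # inp, []) u1 (enc (upd ?S0 vm 0 0 a), b # c # inp, [])"
      "u1 <= (fac (scalar_addr vm) + 1) * bits M"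
    using exec_scalar_read(1)[OF b0 _ M(1), of vm "b # c # inp" "[]"] by (auto simp: names_def enc_zero)
  obtain u2 where u2: "exec (Read (scalar_addr vN)) (enc (upd ?S0 vm 0 0 a), b # c # inp, []) u2 (enc (upd (upd ?S0 vm 0 0 a) vN 0 0 b), c # inp, [])"
      "u2 <= (fac (scalar_addr vN) + 1) * bits M"
    using exec_scalar_read(1)[OF b1 _ M(2), of vN "c # inp" "[]"] by (auto simp: names_def)
  obtain u3 where u3: "exec (Read (scalar_addr vn)) (enc (upd (upd ?S0 vm 0 0 a) vN 0 0 b), c # inp, []) u3 (enc S, inp, [])"
      "u3 <= (fac (scalar_addr vn) + 1) * bits M"
    using exec_scalar_read(1)[OF b2 _ M(3), of vn inp "[]"] unfolding S_def by (auto simp: names_def)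
  let ?c = "cex (V vn)"
  have cv: "aval (enc S) ?c = c" by (subst aval_cex) (auto simp: names_def S_def)
  define u4 where "u4 = acost (enc S) ?c + bits (aval (enc S) ?c)"
  have u4: "u4 <= fac ?c * bits M" unfolding u4_def using bS by (intro acost_bits_le bounded_storeD)
  have "exec (Cond ?c algorithm_body Skip) (enc S, inp, []) (u4 + t) \<tau>"
  proof (cases "c = 0")
    case True
    then show ?thesis unfolding u4_def using rest cv by (intro exec.CondFalse) auto
  next
    case False
    then show ?thesis unfolding u4_def using rest cv by (intro exec.CondTrue) auto
  qed
  then have "exec algorithm (%_. 0, a # b # c # inp, []) (u1 + (u2 + (u3 + (u4 + t)))) \<tau>"
    unfolding algorithm_def by (intro exec.Seq[OF u1(1)] exec.Seq[OF u2(1)] exec.Seq[OF u3(1)])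
  moreover have "u1 + (u2 + (u3 + (u4 + t))) <= head_cost * bits M + t"
  proof -
    define B where "B = bits M"
    have "head_cost * B = (fac (scalar_addr vm) + 1) * B + (fac (scalar_addr vN) + 1) * B + (fac (scalar_addr vn) + 1) * B + fac ?c * B + B"
      unfolding head_cost_def by (simp add: add_mult_distrib)
    then show ?thesis using u1(2) u2(2) u3(2) u4 unfolding B_def by linarith
  qed
  ultimately show "EX t'. exec algorithm (%_. 0, a # b # c # inp, []) t' \<tau> & t' <= head_cost * bits M + t" by blast
qed

definition total_poly :: "nat poly" where
  "total_poly = [:head_cost:] + time_poly prologue + [:read_cost, read_cost:] + time_poly main_part + [:write_cost, write_cost:]"

lemma (in inst) run_algorithm:
  "EX t s out. exec algorithm (start I) t (s, [], out) & t <= poly total_poly Lx * bits Mx &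
     feasible I (schedule_of (decode_periods out)) &
     objective I (schedule_of (decode_periods out)) <= (6 - 2 / real m) * optimum I"
proof -
  interpret alg2 I Mx Lx by (rule alg2_holds)
  have vM: "v <= Mx" if "v < 2 ^ sz" for v
  proof -
    have "sz <= ez" by (simp add: ez_def)
    then have "(2::nat) ^ sz <= 2 ^ ez" by (intro power_increasing) auto
    then show ?thesis using that by (intro Ax_le_Mx sizes_Ax(2)) linarith
  qed
  have mem: "v <= Mx" if "v \<in> set (encode_instance I)" for v using entry_le[OF that] by (rule vM)
  have hd: "m <= Mx" "N <= Mx" "n <= Mx" by (rule mem, simp add: encode_instance_def)+
  define S where "S = upd (upd (upd (%_ _ _. 0) vm 0 0 m) vN 0 0 N) vn 0 0 n"
  define S1 where "S1 = upd (upd (upd S vNN 0 0 (N * N)) vRow 0 0 (N * N + 4)) vin 0 0 (n * (N * N + 4))"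
  have bS: "bounded_store Mx S" unfolding S_def using hd by (intro bounded_store_upd) (auto simp: bounded_store_def)
  have NN: "N * N <= Mx" "N * N + 4 <= Mx" "n * (N * N + 4) <= Mx"
  proof -
    show 1: "n * (N * N + 4) <= Mx" using lim_input Lim_le_M by linarith
    have "1 * (N * N + 4) <= n * (N * N + 4)" using coflows_pos by (rule mult_le_mono1)
    then show "N * N + 4 <= Mx" unfolding mult_1 using 1 by (rule order_trans)
    then show "N * N <= Mx" by linarith
  qed
  have "wp prologue (%S'. S' = S1) S" unfolding prologue_def S1_def using NN by (simp add: S_def)
  then have sp: "safe prologue S" "sem prologue S = S1" by (simp_all add: wp_def)
  have wfpr: "wfp prologue" by (simp add: prologue_def names_def)
  obtain t1 where t1: "exec (comp prologue) (enc S, input_rows, []) t1 (enc S1, input_rows, [])" "t1 <= poly (time_poly prologue) Lx * bits Mx"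
    and b1: "bounded_store Mx S1"
    using comp_exec[OF wfpr sp(1) bS] unfolding sp(2) by blast
  have len: "S1 vin 0 0 = S1 vq 0 0 + length input_rows" unfolding length_rows_eq S1_def S_def by simp
  have rM: "v <= Mx" if "v \<in> set input_rows" for v using that by (intro mem) (simp add: encode_instance_def)
  obtain t2 S2 where t2: "exec read_loop (enc S1, input_rows @ [], []) t2 (enc S2, [], [])" "t2 <= (length input_rows + 1) * read_cost * bits Mx"
    and b2: "bounded_store Mx S2" and raw2: "!!q. q < length input_rows ==> S2 raw (S1 vq 0 0 + q) 0 = input_rows ! q"
    and f2: "!!r. r ~= raw ==> r ~= vq ==> S2 r = S1 r"
    using exec_read_loop[OF b1 len rM, where rest = "[]" and out = "[]"] by blast
  have raw3: "S2 raw (k * (N * N + 4) + e) 0 = encode_coflow I k ! e" if "k < n" "e < N * N + 4" for k e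
  proof -
    have "Suc k * (N * N + 4) <= n * (N * N + 4)" using that by (intro mult_le_mono1) simp
    then have "k * (N * N + 4) + e < length input_rows" unfolding length_rows_eq using that by simp
    moreover have "S1 vq 0 0 = 0" by (simp add: S1_def S_def)
    ultimately show ?thesis using raw2[of "k * (N * N + 4) + e"] rows_nth[OF that] by simp
  qed
  have "raw_ok S2" unfolding raw_ok_def
  proof (intro allI impI conjI)
    fix k assume k: "k < n"
    show "S2 raw (k * (N * N + 4) + e) 0 = demand I (e div N) (e mod N) k" if "e < N * N" for e
      using raw3[OF k, of e] coflow_nth(1)[OF that, of k] that by simp
    show "S2 raw (k * (N * N + 4) + N * N) 0 = rn k" "S2 raw (k * (N * N + 4) + (N * N + 1)) 0 = rd k"
      "S2 raw (k * (N * N + 4) + (N * N + 2)) 0 = wn k" "S2 raw (k * (N * N + 4) + (N * N + 3)) 0 = wd k"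
      unfolding coflow_nth(2-5)[symmetric, of k] by (rule raw3[OF k], simp)+
  qed
  moreover have "params S2" unfolding params_def by (simp add: f2 S1_def S_def)
  moreover have "S2 r = (%_ _. 0)" if "r ~: {vm, vN, vn, vNN, vRow, vin, raw, vq}" for r
    using that by (simp add: f2 S1_def S_def)
  ultimately obtain t3 s out where t3: "exec (Seq (comp main_part) write_loop) (enc S2, [], []) t3 (s, [], out)"
      "t3 <= (poly (time_poly main_part) Lx + (Lx + 1) * write_cost) * bits Mx"
    and good: "feasible I (schedule_of (decode_periods out))"
     "objective I (schedule_of (decode_periods out)) <= (6 - 2 / real m) * optimum I"
    using exec_main_part[OF b2] by blast
  have e: "exec (if n ~= 0 then algorithm_body else Skip)
     (enc S, input_rows, []) (t1 + (t2 + t3)) (s, [], out)"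
    using exec.Seq[OF t1(1) exec.Seq[OF t2(1)[unfolded append_Nil2] t3(1)]] coflows_pos by (simp add: algorithm_body_def)
  obtain t where t: "exec algorithm (%_. 0, m # N # n # input_rows, []) t (s, [], out)" "t <= head_cost * bits Mx + (t1 + (t2 + t3))"
    using exec_head(1)[OF hd e[unfolded S_def]] by blast
  have "t <= poly total_poly Lx * bits Mx"
  proof -
    define B where "B = bits Mx"
    have "(length input_rows + 1) * read_cost * B <= (Lx + 1) * read_cost * B"
      unfolding length_rows_eq using lim_input by (intro mult_le_mono1) simp
    then have "t2 <= (Lx + 1) * read_cost * B" using t2(2) unfolding B_def by linarith
    moreover have "poly total_poly Lx * B = head_cost * B + poly (time_poly prologue) Lx * B + (Lx + 1) * read_cost * B
        + (poly (time_poly main_part) Lx + (Lx + 1) * write_cost) * B"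
      by (simp add: total_poly_def algebra_simps)
    ultimately show ?thesis using t(2) t1(2) t3(2) unfolding B_def by linarith
  qed
  moreover have "start I = (%_. 0, m # N # n # input_rows, [])" by (simp add: start_def encode_instance_def)
  ultimately show ?thesis using t(1) good by auto
qed

text \<open>Without flows feasibility is vacuous and the objective is an empty sum, so any schedule
  attains the optimum 0.\<close>

lemma empty_instance:
  assumes "coflows I = 0"
  shows "feasible I x" "objective I x = 0" "optimum I = 0"
proof -
  have f: "flows I = {}" using assms by (simp add: flows_def)
  show F: "feasible I x" for x unfolding feasible_def f by simp
  show o: "objective I x = 0" for x using assms by (simp add: objective_def)
  show "optimum I = 0" unfolding optimum_def using F o by (simp add: image_constant_conv)
qed

lemma run_empty:
  assumes "coflows I = 0"
  shows "EX t s. exec algorithm (start I) t (s, [], []) & t <= head_cost * input_size I + 1"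
proof -
  have enc: "encode_instance I = [cores I, ports I, 0]" using assms by (simp add: encode_instance_def)
  define M where "M = max (cores I) (ports I)"
  let ?S = "enc (upd (upd (upd (%_ _ _. 0) vm 0 0 (cores I)) vN 0 0 (ports I)) vn 0 0 0)"
  have "exec (if (0::nat) ~= 0 then algorithm_body else Skip) (?S, [], []) 1 (?S, [], [])"
    unfolding not_not if_False simp_thms by (rule exec.Skip)
  then have "EX t'. exec algorithm (%_. 0, [cores I, ports I, 0], []) t' (?S, [], []) & t' <= head_cost * bits M + 1"
    by (intro exec_head(1)) (auto simp: M_def)
  then obtain t s where t: "exec algorithm (%_. 0, [cores I, ports I, 0], []) t (s, [], [])" "t <= head_cost * bits M + 1" by blast
  have "bits M <= input_size I" unfolding M_def input_size_def enc by (simp add: max_def)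
  then have "head_cost * bits M + 1 <= head_cost * input_size I + 1" by simp
  then show ?thesis using t unfolding start_def enc by (meson order_trans)
qed

definition size_poly :: "nat poly" where "size_poly = [:6, 6, 1:]"
definition height_poly :: "nat poly" where "height_poly = [:16:] * size_poly + [:20:]"
definition limit_poly :: "nat poly" where "limit_poly = (height_poly + [:9000:]) ^ 6"
definition magnitude_poly :: "nat poly" where
  "magnitude_poly = (limit_poly + size_poly + [:7:] * height_poly) * [:18, 1:] + [:1:]"
text \<open>The cost in units of \<open>bits Mx\<close> is a polynomial in the loop bound, which is
  itself a polynomial in the input size; the second factor bounds \<open>bits Mx\<close>. The last
  summand covers instances without coflows.\<close>

definition running_time :: "nat poly" where
  "running_time = pcompose total_poly limit_poly * magnitude_poly + [:1, head_cost:]"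

lemma (in inst) running_time: "poly total_poly Lx * bits Mx <= poly running_time sz"
proof -
  have e: "poly size_poly sz = ez" by (simp add: size_poly_def ez_def algebra_simps)
  have h: "poly height_poly sz = hz" by (simp add: height_poly_def hz_def e)
  have l: "poly limit_poly sz = Lx" by (simp add: limit_poly_def Lx_def uz_def h)
  have "poly magnitude_poly sz = lx * (18 + sz) + 1" by (simp add: magnitude_poly_def lx_def e h l algebra_simps)
  moreover have "bits Mx <= lx * (18 + sz) + 1"
  proof -
    have "Mx = 2 ^ (lx * (18 + sz))" unfolding Mx_def Ax_def by (simp only: power_mult)
    then show ?thesis by (simp add: bits_le_iff)
  qed
  ultimately have "bits Mx <= poly magnitude_poly sz" by simp
  then have "poly total_poly Lx * bits Mx <= poly total_poly Lx * poly magnitude_poly sz" by (rule mult_le_mono2)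
  also have "... <= poly running_time sz" by (simp add: running_time_def poly_pcompose l)
  finally show ?thesis .
qed

lemma algorithm_correct:
  assumes "valid_instance I"
  shows "EX t s out. exec algorithm (start I) t (s, [], out) & t <= poly running_time (input_size I) &
     feasible I (schedule_of (decode_periods out)) &
     objective I (schedule_of (decode_periods out)) <= (6 - 2 / real (cores I)) * optimum I"
proof (cases "coflows I = 0")
  case True
  obtain t s where t: "exec algorithm (start I) t (s, [], [])" "t <= head_cost * input_size I + 1"
    using run_empty[OF True] by blast
  have "head_cost * input_size I + 1 <= poly running_time (input_size I)" by (simp add: running_time_def)
  then show ?thesis using t empty_instance[OF True] by (metis mult_zero_right order_refl order_trans)
next
  case False
  then interpret inst I using assms by unfold_locales auto
  show ?thesis using run_algorithm running_time by (meson order_trans)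
qed

theorem theorem1:
  "\<exists>c :: com. polynomial_time c \<and>
     has_approximation_ratio c (\<lambda>I. 6 - 2 / real (cores I))"
proof (intro exI conjI)
  show "polynomial_time algorithm"
    unfolding polynomial_time_def using algorithm_correct by blast
  show "has_approximation_ratio algorithm (\<lambda>I. 6 - 2 / real (cores I))"
    unfolding has_approximation_ratio_def computes_schedule_def using algorithm_correct by metis
qed

end
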